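(* Let $K=\mathrm{SU}(2)$, $K^{\mathbb C}=\mathrm{SL}(2,\mathbb C)$, $\hbar>0$, $\beta>0$, and let $\mathcal H=\mathcal HL^2(K^{\mathbb C},\mathrm e^{-\kappa/\hbar}\eta\varepsilon)^K$ be the Hilbert space of holomorphic functions on $K^{\mathbb C}$ which are invariant under conjugation by $K$ and square-integrable relative to $\mathrm e^{-\kappa/\hbar}\eta\varepsilon$, with its distinguished orthonormal basis $\{|n\rangle : n=0,1,2,\dots\}$. Let $\mathcal V_\pm=\{\psi\in\mathcal H : \psi(\pm\mathbf 1)=0\}$, where $\mathbf 1$ is the identity matrix, and let $\mathcal H_\pm$ be the orthogonal complement of $\mathcal V_\pm$ in $\mathcal H$. Then the subspaces $\mathcal H_+$ and $\mathcal H_-$ have dimension $1$. They are spanned by the normalized vectors $$\psi_+ := \frac1N\sum_{n=0}^\infty (n+1)\,\mathrm e^{-\hbar\beta^2(n+1)^2/2}\,|n\rangle,$$ $$\psi_- := \frac1N\sum_{n=0}^\infty (-1)^n(n+1)\,\mathrm e^{-\hbar\beta^2(n+1)^2/2}\,|n\rangle,$$ respectively, where the normalization factor $N$ is determined by the identity $$N^2=\sum_{n=1}^\infty n^2\,\mathrm e^{-\hbar\beta^2n^2}.$$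
   Context: $K=\mathrm{SU}(2)$ has Lie algebra $\mathfrak k=\mathfrak{su}(2)$, endowed with the invariant inner product $\langle Y_1,Y_2\rangle=-\frac{1}{2\beta^2}\mathrm{tr}(Y_1Y_2)$, where $\beta>0$ is a fixed scaling factor; $|\cdot|$ denotes the associated norm. By the polar decomposition, $(x,Y)\mapsto x\,\mathrm e^{iY}$ is a diffeomorphism $K\times\mathfrak k\to K^{\mathbb C}=\mathrm{SL}(2,\mathbb C)$. The function $\kappa$ on $K^{\mathbb C}$ is $\kappa(x\,\mathrm e^{iY})=|Y|^2$; the symplectic form on $K^{\mathbb C}\cong \mathrm T^*K$ is $i\partial\overline\partial\kappa$ and $\varepsilon$ is its Liouville volume form (the symplectic form $\omega$ raised to the top exterior power $3$ and divided by $3!$, regarded as a positive measure). The function $\eta$ on $K^{\mathbb C}$ is $$\eta(x\,\mathrm e^{iY})=\sqrt{\left|\det\frac{\sin(\mathrm{ad}(Y))}{\mathrm{ad}(Y)}\right|},\quad x\in K,\ Y\in\mathfrak k.$$ The scalar product on $\mathcal H$ is $$\langle\psi_1,\psi_2\rangle=\frac{1}{\mathrm{vol}(K)}\int_{K^{\mathbb C}}\overline{\psi_1}\,\psi_2\,\mathrm e^{-\kappa/\hbar}\,\eta\,\varepsilon,$$ where $\mathrm{vol}(K)$ is the Riemannian volume of $K$ for the bi-invariant metric determined by the inner product on $\mathfrak k$. For $n\ge 0$, $\chi_n^{\mathbb C}$ denotes the irreducible (holomorphic) character of $\mathrm{SL}(2,\mathbb C)$ of highest weight $\lambda_n=\frac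 n2\alpha$ ($\alpha$ the positive root), i.e. $\chi^{\mathbb C}_n(\mathrm{diag}(z,z^{-1}))=z^n+z^{n-2}+\cdots+z^{-n}$ for $z\in\mathbb C\setminus\{0\}$. Put $C_n=(\hbar\pi)^{3/2}\mathrm e^{\hbar\beta^2(n+1)^2}$. The distinguished orthonormal basis of $\mathcal H$ is given by $|n\rangle:=C_n^{-1/2}\chi^{\mathbb C}_n$, $n=0,1,2,\dots$ (it is a known fact, a consequence of the holomorphic Peter-Weyl theorem, that these vectors form an orthonormal basis of $\mathcal H$). The points $\pm\mathbf 1\in K^{\mathbb C}$ represent the two singular (one-point) strata of the reduced phase space $\mathrm T^*K/\!/K\cong K^{\mathbb C}/\!/K^{\mathbb C}\cong\mathbb C$, corresponding to $\pm2\in\mathbb C$. *)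

theory Defs
  imports
    "HOL-Analysis.Analysis"
    "HOL-Computational_Algebra.Polynomial"
    "HOL-Library.Function_Algebras"
begin

definition cadjoint :: "complex^2^2 \<Rightarrow> complex^2^2" where
  "cadjoint A = (\<chi> i j. cnj (A $ j $ i))"

definition SL2C :: "(complex^2^2) set" where
  "SL2C = {g. det g = 1}"

definition SU2 :: "(complex^2^2) set" where
  "SU2 = {x. det x = 1 \<and> cadjoint x ** x = mat 1}"

definition su2 :: "(complex^2^2) set" where
  "su2 = {Y. cadjoint Y = - Y \<and> trace Y = 0}"

definition matpow :: "'a::semiring_1^'n^'n \<Rightarrow> nat \<Rightarrow> 'a^'n^'n" where
  "matpow A m = (((**) A) ^^ m) (mat 1)"

definition mexp :: "complex^2^2 \<Rightarrow> complex^2^2" where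
  "mexp A = (\<Sum>m. (1 / fact m) *\<^sub>R matpow A m)"

text \<open>The trace form is real on \<open>su2\<close>, so taking the real part only adjusts the type.\<close>

definition su2_inner :: "real \<Rightarrow> complex^2^2 \<Rightarrow> complex^2^2 \<Rightarrow> real" where
  "su2_inner \<beta> Y1 Y2 = - (1 / (2 * \<beta>\<^sup>2)) * Re (trace (Y1 ** Y2))"

text \<open>The Lie algebra component \<open>Y\<close> of \<open>g = x exp(iY)\<close>; note that \<open>mat c ** A\<close> is the
  scalar multiple \<open>c A\<close>.\<close>

definition polar_Y :: "complex^2^2 \<Rightarrow> complex^2^2" where
  "polar_Y g = (THE Y. Y \<in> su2 \<and> (\<exists>x\<in>SU2. g = x ** mexp (mat \<i> ** Y)))"

definition kappa :: "real \<Rightarrow> complex^2^2 \<Rightarrow> real" where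
  "kappa \<beta> g = su2_inner \<beta> (polar_Y g) (polar_Y g)"

text \<open>A linear isomorphism between \<open>real^3\<close> and \<open>su2\<close>, used to regard \<open>ad Y\<close>, an endomorphism
  of the three-dimensional real vector space \<open>su2\<close>, as a matrix; determinants do not depend on
  the choice of this isomorphism.\<close>

definition su2_of_vec :: "real^3 \<Rightarrow> complex^2^2" where
  "su2_of_vec v = vector [vector [Complex 0 (v$1), Complex (v$2) (v$3)],
                          vector [Complex (- v$2) (v$3), Complex 0 (- v$1)]]"

definition vec_of_su2 :: "complex^2^2 \<Rightarrow> real^3" where
  "vec_of_su2 Y = vector [Im (Y$1$1), Re (Y$1$2), Im (Y$1$2)]"

definition ad :: "complex^2^2 \<Rightarrow> complex^2^2 \<Rightarrow> complex^2^2" where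
  "ad Y X = Y ** X - X ** Y"

definition ad_matrix :: "complex^2^2 \<Rightarrow> real^3^3" where
  "ad_matrix Y = matrix (\<lambda>v. vec_of_su2 (ad Y (su2_of_vec v)))"

text \<open>\<open>sin(A)/A\<close> is the value at \<open>A\<close> of the everywhere convergent power series of \<open>sin(z)/z\<close>.\<close>

definition sinc_matrix :: "real^3^3 \<Rightarrow> real^3^3" where
  "sinc_matrix A = (\<Sum>m. ((- 1) ^ m / fact (2 * m + 1)) *\<^sub>R matpow A (2 * m))"

definition eta :: "complex^2^2 \<Rightarrow> real" where
  "eta g = sqrt \<bar>det (sinc_matrix (ad_matrix (polar_Y g)))\<bar>"

definition wirtinger :: "3 \<Rightarrow> (complex^3 \<Rightarrow> complex) \<Rightarrow> complex^3 \<Rightarrow> complex" where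
  "wirtinger j f z =
     (frechet_derivative f (at z) (axis j 1) - \<i> * frechet_derivative f (at z) (axis j \<i>)) / 2"

definition wirtinger_bar :: "3 \<Rightarrow> (complex^3 \<Rightarrow> complex) \<Rightarrow> complex^3 \<Rightarrow> complex" where
  "wirtinger_bar j f z =
     (frechet_derivative f (at z) (axis j 1) + \<i> * frechet_derivative f (at z) (axis j \<i>)) / 2"

text \<open>The form \<open>i \<partial> \<partial>bar f = i \<Sum> f_jk dz_j \<and> dzbar_k\<close>, where \<open>f_jk\<close> is the second derivative of \<open>f\<close> in
  \<open>z_j\<close> and \<open>zbar_k\<close>, evaluated at \<open>z\<close> on real tangent vectors \<open>u\<close> and \<open>v\<close>. It is real for real \<open>f\<close>,
  so taking the real part only adjusts the type.\<close>

definition i_ddbar :: "(complex^3 \<Rightarrow> real) \<Rightarrow> complex^3 \<Rightarrow> complex^3 \<Rightarrow> complex^3 \<Rightarrow> real" where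
  "i_ddbar f z u v =
     Re (\<i> * (\<Sum>j\<in>UNIV. \<Sum>k\<in>UNIV.
           wirtinger j (wirtinger_bar k (\<lambda>w. complex_of_real (f w))) z
             * (u$j * cnj (v$k) - v$j * cnj (u$k))))"

text \<open>The value \<open>(\<omega> \<and> \<omega> \<and> \<omega>)(v 0, \<dots>, v 5)\<close> for a two-form \<open>\<omega>\<close>, with the wedge product
  normalized as in \<open>(\<alpha> \<and> \<beta>)(u, v) = \<alpha>(u) \<beta>(v) - \<alpha>(v) \<beta>(u)\<close> for one-forms.\<close>

definition wedge_cube :: "('a \<Rightarrow> 'a \<Rightarrow> real) \<Rightarrow> (nat \<Rightarrow> 'a) \<Rightarrow> real" where
  "wedge_cube \<omega> v = (1 / 2 ^ 3) *
     (\<Sum>p | p permutes {..<6}. of_int (sign p) * (\<Prod>i<3. \<omega> (v (p (2 * i))) (v (p (2 * i + 1)))))"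

text \<open>The coordinate vectors \<open>\<partial>/\<partial>x_1, \<partial>/\<partial>y_1, \<partial>/\<partial>x_2, \<partial>/\<partial>y_2, \<partial>/\<partial>x_3, \<partial>/\<partial>y_3\<close> for \<open>z_j = x_j + i y_j\<close>.\<close>

definition real_frame :: "nat \<Rightarrow> complex^3" where
  "real_frame = (!) [axis 1 1, axis 1 \<i>, axis 2 1, axis 2 \<i>, axis 3 1, axis 3 \<i>]"

text \<open>A holomorphic chart of \<open>SL2C\<close> onto the open subset where the upper left entry does not
  vanish. The complement of its image is a complex hypersurface, hence a null set for every volume
  form, so integrals of volume forms over \<open>SL2C\<close> can be computed in this chart.\<close>

definition chart_dom :: "(complex^3) set" where
  "chart_dom = {z. z$1 \<noteq> 0}"

definition sl2_chart :: "complex^3 \<Rightarrow> complex^2^2" where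
  "sl2_chart z = vector [vector [z$1, z$2], vector [z$3, (1 + z$2 * z$3) / z$1]]"

lemma sl2_chart_image: "sl2_chart ` chart_dom = {g \<in> SL2C. g$1$1 \<noteq> 0}"
proof (intro equalityI subsetI)
  fix g assume "g \<in> sl2_chart ` chart_dom"
  then show "g \<in> {g \<in> SL2C. g$1$1 \<noteq> 0}"
    by (auto simp: SL2C_def sl2_chart_def chart_dom_def det_2)
next
  fix g assume g: "g \<in> {g \<in> SL2C. g$1$1 \<noteq> 0}"
  then have d: "(1 + g$1$2 * g$2$1) / g$1$1 = g$2$2"
    by (auto simp: SL2C_def det_2 field_simps)
  let ?z = "vector [g$1$1, g$1$2, g$2$1] :: complex^3"
  have "g = sl2_chart ?z"
    using d by (simp add: sl2_chart_def vec_eq_iff forall_2)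
  moreover have "?z \<in> chart_dom"
    using g by (simp add: chart_dom_def)
  ultimately show "g \<in> sl2_chart ` chart_dom" by blast
qed

lemma inj_on_sl2_chart: "inj_on sl2_chart chart_dom"
  by (auto simp: inj_on_def sl2_chart_def vec_eq_iff forall_2 forall_3)

text \<open>The coordinate expression, in this holomorphic chart, of the symplectic form
  \<open>\<omega> = i \<partial> \<partial>bar \<kappa>\<close>, and of the Liouville volume form \<open>\<omega>\<^sup>3 / 3!\<close> with respect to Lebesgue
  measure; the absolute value makes it a positive measure.\<close>

definition omega :: "real \<Rightarrow> complex^3 \<Rightarrow> complex^3 \<Rightarrow> complex^3 \<Rightarrow> real" where
  "omega \<beta> = i_ddbar (\<lambda>w. kappa \<beta> (sl2_chart w))"

definition liouville_density :: "real \<Rightarrow> complex^3 \<Rightarrow> real" where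
  "liouville_density \<beta> z = \<bar>wedge_cube (omega \<beta> z) real_frame / fact 3\<bar>"

definition liouville :: "real \<Rightarrow> (complex^2^2) measure" where
  "liouville \<beta> =
     distr (density (restrict_space lborel chart_dom) (\<lambda>z. ennreal (liouville_density \<beta> z)))
       (restrict_space borel SL2C) sl2_chart"

text \<open>Hopf coordinates parametrize \<open>SU2\<close> up to a null set, injectively. The Gram matrix is that of
  the bi-invariant metric: tangent vectors at \<open>x\<close> are moved to \<open>su2\<close> by left translation.\<close>

definition hopf_dom :: "(real^3) set" where
  "hopf_dom = {t. 0 < t$1 \<and> t$1 < pi / 2 \<and> 0 < t$2 \<and> t$2 < 2 * pi \<and> 0 < t$3 \<and> t$3 < 2 * pi}"

definition hopf_chart :: "real^3 \<Rightarrow> complex^2^2" where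
  "hopf_chart t = vector [vector [cos (t$1) * cis (t$2), - (sin (t$1) * cis (- t$3))],
                          vector [sin (t$1) * cis (t$3), cos (t$1) * cis (- t$2)]]"

definition su2_gram :: "real \<Rightarrow> real^3 \<Rightarrow> real^3^3" where
  "su2_gram \<beta> t = (\<chi> j k.
     su2_inner \<beta>
       (matrix_inv (hopf_chart t) ** frechet_derivative hopf_chart (at t) (axis j 1))
       (matrix_inv (hopf_chart t) ** frechet_derivative hopf_chart (at t) (axis k 1)))"

definition vol_SU2 :: "real \<Rightarrow> real" where
  "vol_SU2 \<beta> = (LINT t:hopf_dom|lborel. sqrt (det (su2_gram \<beta> t)))"

text \<open>Holomorphy on the complex submanifold \<open>SL2C\<close>: locally the restriction of a holomorphic
  function on an open subset of the space of all matrices.\<close>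

definition holomorphic_on_SL2C :: "(complex^2^2 \<Rightarrow> complex) \<Rightarrow> bool" where
  "holomorphic_on_SL2C \<psi> \<longleftrightarrow>
     (\<forall>g\<in>SL2C. \<exists>V F. open V \<and> g \<in> V \<and> (\<forall>A \<in> V \<inter> SL2C. \<psi> A = F A) \<and>
        (\<forall>A\<in>V. \<exists>D. (F has_derivative D) (at A) \<and> (\<forall>c X. D (mat c ** X) = c * D X)))"

definition weight :: "real \<Rightarrow> real \<Rightarrow> complex^2^2 \<Rightarrow> real" where
  "weight hbar \<beta> g = exp (- kappa \<beta> g / hbar) * eta g"

text \<open>A holomorphic function is determined by its class modulo null functions, so elements of the
  Hilbert space are functions rather than classes. Functions on \<open>SL2C\<close> are represented by functions
  on all matrices that vanish outside \<open>SL2C\<close>.\<close>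

definition HL2 :: "real \<Rightarrow> real \<Rightarrow> (complex^2^2 \<Rightarrow> complex) set" where
  "HL2 hbar \<beta> = {\<psi>.
     (\<forall>g. g \<notin> SL2C \<longrightarrow> \<psi> g = 0) \<and>
     holomorphic_on_SL2C \<psi> \<and>
     (\<forall>k\<in>SU2. \<forall>g\<in>SL2C. \<psi> (k ** g ** matrix_inv k) = \<psi> g) \<and>
     integrable (liouville \<beta>) (\<lambda>g. (cmod (\<psi> g))\<^sup>2 * weight hbar \<beta> g)}"

definition hinner ::
  "real \<Rightarrow> real \<Rightarrow> (complex^2^2 \<Rightarrow> complex) \<Rightarrow> (complex^2^2 \<Rightarrow> complex) \<Rightarrow> complex" where
  "hinner hbar \<beta> \<psi>1 \<psi>2 =
     (1 / vol_SU2 \<beta>) * (LINT g|liouville \<beta>. cnj (\<psi>1 g) * \<psi>2 g * weight hbar \<beta> g)"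

definition hnorm :: "real \<Rightarrow> real \<Rightarrow> (complex^2^2 \<Rightarrow> complex) \<Rightarrow> real" where
  "hnorm hbar \<beta> \<psi> = sqrt (Re (hinner hbar \<beta> \<psi> \<psi>))"

definition fscale :: "complex \<Rightarrow> (complex^2^2 \<Rightarrow> complex) \<Rightarrow> complex^2^2 \<Rightarrow> complex" where
  "fscale c \<psi> = (\<lambda>g. c * \<psi> g)"

global_interpretation cfun: vector_space fscale
  by unfold_locales (auto simp: fscale_def fun_eq_iff algebra_simps)

definition hsums ::
  "real \<Rightarrow> real \<Rightarrow> (nat \<Rightarrow> complex^2^2 \<Rightarrow> complex) \<Rightarrow> (complex^2^2 \<Rightarrow> complex) \<Rightarrow> bool" where
  "hsums hbar \<beta> f \<psi> \<longleftrightarrow>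
     (\<forall>n. f n \<in> HL2 hbar \<beta>) \<and> \<psi> \<in> HL2 hbar \<beta> \<and>
     (\<lambda>m. hnorm hbar \<beta> ((\<Sum>n<m. f n) - \<psi>)) \<longlonglongrightarrow> 0"

definition hsuminf ::
  "real \<Rightarrow> real \<Rightarrow> (nat \<Rightarrow> complex^2^2 \<Rightarrow> complex) \<Rightarrow> complex^2^2 \<Rightarrow> complex" where
  "hsuminf hbar \<beta> f = (THE \<psi>. hsums hbar \<beta> f \<psi>)"

text \<open>The irreducible representation of highest weight \<open>n\<close> acts on the binary forms of degree \<open>n\<close>;
  \<open>g\<close> with rows \<open>(a, b)\<close> and \<open>(c, d)\<close> sends the monomial \<open>X^(n-k) Y^k\<close> to
  \<open>(a X + c Y)^(n-k) (b X + d Y)^k\<close>. The character is the trace of this action, with forms written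
  as polynomials in \<open>Y\<close> by setting \<open>X = 1\<close>.\<close>

definition sym_character :: "nat \<Rightarrow> complex^2^2 \<Rightarrow> complex" where
  "sym_character n g =
     (\<Sum>k\<le>n. coeff ([:g$1$1, g$2$1:] ^ (n - k) * [:g$1$2, g$2$2:] ^ k) k)"

lemma sym_character_diag:
  assumes "z \<noteq> 0"
  shows "sym_character n (vector [vector [z, 0], vector [0, 1 / z]])
    = (\<Sum>k\<le>n. z powi (int n - 2 * int k))"
proof -
  have "coeff ([:z:] ^ (n - k) * [:0, 1 / z:] ^ k) k = z powi (int n - 2 * int k)"
    if "k \<le> n" for k
  proof -
    have "[:0, 1 / z:] ^ k = monom ((1 / z) ^ k) k"
      by (metis monom_0 monom_Suc One_nat_def monom_power mult_1)
    moreover have "[:z:] ^ (n - k) = [:z ^ (n - k):]"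
      by (simp add: poly_const_pow)
    ultimately have "coeff ([:z:] ^ (n - k) * [:0, 1 / z:] ^ k) k = z ^ (n - k) * (1 / z) ^ k"
      by simp
    also have "\<dots> = z powi (int (n - k) - int k)"
      using assms by (simp add: power_int_diff power_divide)
    finally show ?thesis
      using that by (simp add: of_nat_diff)
  qed
  then show ?thesis
    by (simp add: sym_character_def)
qed

definition chi :: "nat \<Rightarrow> complex^2^2 \<Rightarrow> complex" where
  "chi n g = (if g \<in> SL2C then sym_character n g else 0)"

definition C_norm :: "real \<Rightarrow> real \<Rightarrow> nat \<Rightarrow> real" where
  "C_norm hbar \<beta> n = (hbar * pi) powr (3 / 2) * exp (hbar * \<beta>\<^sup>2 * (real n + 1)\<^sup>2)"

definition ket :: "real \<Rightarrow> real \<Rightarrow> nat \<Rightarrow> complex^2^2 \<Rightarrow> complex" where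
  "ket hbar \<beta> n = fscale (complex_of_real (C_norm hbar \<beta> n powr (- 1 / 2))) (chi n)"

definition orth_compl ::
  "real \<Rightarrow> real \<Rightarrow> (complex^2^2 \<Rightarrow> complex) set \<Rightarrow> (complex^2^2 \<Rightarrow> complex) set" where
  "orth_compl hbar \<beta> V = {\<psi> \<in> HL2 hbar \<beta>. \<forall>\<phi>\<in>V. hinner hbar \<beta> \<phi> \<psi> = 0}"

definition V_plus :: "real \<Rightarrow> real \<Rightarrow> (complex^2^2 \<Rightarrow> complex) set" where
  "V_plus hbar \<beta> = {\<psi> \<in> HL2 hbar \<beta>. \<psi> (mat 1) = 0}"

definition V_minus :: "real \<Rightarrow> real \<Rightarrow> (complex^2^2 \<Rightarrow> complex) set" where
  "V_minus hbar \<beta> = {\<psi> \<in> HL2 hbar \<beta>. \<psi> (- mat 1) = 0}"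

definition H_plus :: "real \<Rightarrow> real \<Rightarrow> (complex^2^2 \<Rightarrow> complex) set" where
  "H_plus hbar \<beta> = orth_compl hbar \<beta> (V_plus hbar \<beta>)"

definition H_minus :: "real \<Rightarrow> real \<Rightarrow> (complex^2^2 \<Rightarrow> complex) set" where
  "H_minus hbar \<beta> = orth_compl hbar \<beta> (V_minus hbar \<beta>)"

definition plus_term :: "real \<Rightarrow> real \<Rightarrow> nat \<Rightarrow> complex^2^2 \<Rightarrow> complex" where
  "plus_term hbar \<beta> n =
     fscale (complex_of_real ((real n + 1) * exp (- hbar * \<beta>\<^sup>2 * (real n + 1)\<^sup>2 / 2)))
       (ket hbar \<beta> n)"

definition minus_term :: "real \<Rightarrow> real \<Rightarrow> nat \<Rightarrow> complex^2^2 \<Rightarrow> complex" where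
  "minus_term hbar \<beta> n =
     fscale (complex_of_real ((- 1) ^ n * (real n + 1) * exp (- hbar * \<beta>\<^sup>2 * (real n + 1)\<^sup>2 / 2)))
       (ket hbar \<beta> n)"

definition psi_plus :: "real \<Rightarrow> real \<Rightarrow> real \<Rightarrow> complex^2^2 \<Rightarrow> complex" where
  "psi_plus hbar \<beta> N = fscale (complex_of_real (1 / N)) (hsuminf hbar \<beta> (plus_term hbar \<beta>))"

definition psi_minus :: "real \<Rightarrow> real \<Rightarrow> real \<Rightarrow> complex^2^2 \<Rightarrow> complex" where
  "psi_minus hbar \<beta> N = fscale (complex_of_real (1 / N)) (hsuminf hbar \<beta> (minus_term hbar \<beta>))"

end

theory Submission
  imports Defs "HOL-Complex_Analysis.Complex_Analysis" "HOL-Real_Asymp.Real_Asymp"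
begin

text \<open>Every conjugation-invariant holomorphic function on \<open>SL(2,\<complex>)\<close> is an entire function of the
  trace. In the coordinates used to define the Liouville form, \<open>\<kappa>\<close> depends only on the Frobenius norm,
  so the density can be computed explicitly; integrating over conjugacy classes shows that the trace
  pushes \<open>e\<^bsup>-\<kappa>/\<hbar>\<^esup> \<eta> \<epsilon>\<close> forward to a multiple of the measure with density \<open>exp (- x\<^sup>2 / (\<hbar> \<beta>\<^sup>2))\<close> at
  \<open>w = 2 cosh (x + \<i> y)\<close> on the complex plane. Thus \<open>\<H>\<close> is a weighted Bergman space of entire functions in \<open>w\<close>.
  The characters become Chebyshev polynomials, which are orthogonal on every confocal elliptic region
  \<open>\<bar>x\<bar> < T\<close>. Comparing the Chebyshev expansion with the values at \<open>\<plusminus>2\<close> shows that the series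
  defining \<open>\<psi>\<^sub>\<plusminus>\<close> is, up to a factor, the reproducing kernel at \<open>\<plusminus>2\<close>, and the orthogonal complement of
  the kernel of a point evaluation is the line spanned by its reproducing kernel.\<close>

text \<open>The factor \<open>eta\<close> makes the integral over a conjugacy class elementary. If 2
  cosh (2 r) is the squared Frobenius norm, the Liouville density contributes r^2 / sinh^2 (2 r) and
  \<open>eta\<close> contributes sinh (2 r) / (2 r). Together with the Gaussian in r this is an
  exact derivative, so a class contributes only the boundary value at its least norm.

  The obstacle is that membership in H is an integral condition while the subspaces are defined by
  values at points, and that an element of H is not known beforehand to be a series of characters.
  Bounded elliptic regions bridge the gap: there the Taylor series converges uniformly, so
  orthogonality expresses each Chebyshev coefficient by Taylor coefficients, independently of the
  region. Enlarging the region identifies the coefficients with inner products in H, and summing the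
  same double series in the other order gives the value at 2 or -2.

  The complement is then found directly: subtracting from one of its elements the multiple of the
  kernel with the same value at the point leaves a vector orthogonal to itself.\<close>

no_notation fps_nth (infixl "$" 75)

section \<open>Lebesgue measure on complex coordinate spaces\<close>

lemma prod_UNIV_3: "(\<Prod>i\<in>UNIV. f i) = f 1 * f 2 * f (3::3)"
  unfolding UNIV_3 by (simp add: mult.assoc)

lemma prod_Basis_vec:
  fixes h :: "'a::euclidean_space^'n \<Rightarrow> real"
  shows "(\<Prod>b\<in>Basis. h b) = (\<Prod>i\<in>UNIV. \<Prod>u\<in>Basis. h (axis i u))"
proof -
  have "(\<Prod>b\<in>Basis. h b) = (\<Prod>b\<in>(\<lambda>(i,u). axis i u) ` (UNIV \<times> (Basis::'a set)). h b)"
    by (rule prod.cong) (auto simp: Basis_vec_def)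
  also have "\<dots> = (\<Prod>(i,u)\<in>UNIV \<times> (Basis::'a set). h (axis i u))"
  proof (subst prod.reindex)
    show "inj_on (\<lambda>(i, u). axis i u) (UNIV \<times> (Basis::'a set))"
      by (auto simp: inj_on_def axis_eq_axis)
  qed (auto simp: case_prod_unfold)
  also have "\<dots> = (\<Prod>i\<in>UNIV. \<Prod>u\<in>Basis. h (axis i u))"
    by (simp add: prod.cartesian_product)
  finally show ?thesis .
qed

lemma borel_measurable_vector_3 [measurable]:
  "(\<lambda>(a, b, c). vector [a, b, c] :: 'a::euclidean_space^3) \<in> borel_measurable (borel \<Otimes>\<^sub>M (borel \<Otimes>\<^sub>M borel))"
proof -
  have "(\<lambda>p. vector [fst p, fst (snd p), snd (snd p)] :: 'a^3)
      = (\<lambda>p. axis 1 (fst p) + axis 2 (fst (snd p)) + axis 3 (snd (snd p)))"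
    by (auto simp: fun_eq_iff vec_eq_iff forall_3 axis_def)
  moreover have "continuous_on UNIV (axis i :: 'a \<Rightarrow> 'a^3)" for i
    by (intro linear_continuous_on linear_conv_bounded_linear[THEN iffD1] linearI)
       (auto simp: axis_def vec_eq_iff)
  then have "(axis i :: 'a \<Rightarrow> 'a^3) \<in> borel_measurable borel" for i
    by (rule borel_measurable_continuous_onI)
  note this[measurable]
  ultimately show ?thesis
    by (simp add: case_prod_unfold)
qed

lemma borel_measurable_vector_3_lborel:
  "(\<lambda>(a, b, c). vector [a, b, c] :: 'a::euclidean_space^3)
    \<in> borel_measurable (lborel \<Otimes>\<^sub>M (lborel \<Otimes>\<^sub>M lborel))"
proof -
  have "sets (lborel \<Otimes>\<^sub>M (lborel \<Otimes>\<^sub>M lborel)) = sets (borel \<Otimes>\<^sub>M (borel \<Otimes>\<^sub>M borel) :: ('a \<times> 'a \<times> 'a) measure)"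
    by (intro sets_pair_measure_cong sets_lborel)
  from measurable_cong_sets[OF this refl] show ?thesis
    using borel_measurable_vector_3 by simp
qed

text \<open>Lebesgue measure is determined by its values on boxes, and the coordinate map pulls a
  box back to a product of three boxes.\<close>

lemma lborel_vector_3:
  "(lborel :: ('a::euclidean_space^3) measure)
    = distr (lborel \<Otimes>\<^sub>M (lborel \<Otimes>\<^sub>M lborel)) borel (\<lambda>(a, b, c). vector [a, b, c])"
proof (rule lborel_eqI)
  fix l u :: "'a^3"
  assume le: "\<And>b. b \<in> Basis \<Longrightarrow> l \<bullet> b \<le> u \<bullet> b"
  have le': "l $ i \<bullet> b \<le> u $ i \<bullet> b" if "b \<in> Basis" for i b
    using le[of "axis i b"] that by (simp add: inner_axis)
  have s2: "sigma_finite_measure (lborel \<Otimes>\<^sub>M lborel :: ('a \<times> 'a) measure)"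
    by (simp add: lborel_prod lborel.sigma_finite_measure_axioms)
  have eq: "(\<lambda>(a, b, c). vector [a, b, c] :: 'a^3) -` box l u \<inter> space (lborel \<Otimes>\<^sub>M (lborel \<Otimes>\<^sub>M lborel))
      = box (l$1) (u$1) \<times> (box (l$2) (u$2) \<times> box (l$3) (u$3))"
    by (auto simp: space_pair_measure mem_box Basis_vec_def inner_axis forall_3 ball_Un)
  have "emeasure (distr (lborel \<Otimes>\<^sub>M (lborel \<Otimes>\<^sub>M lborel)) borel (\<lambda>(a, b, c). vector [a, b, c])) (box l u)
      = emeasure lborel (box (l$1) (u$1)) * (emeasure lborel (box (l$2) (u$2)) * emeasure lborel (box (l$3) (u$3)))"
  proof -
    have 1: "emeasure (lborel \<Otimes>\<^sub>M lborel) (box (l$2) (u$2) \<times> box (l$3) (u$3))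
        = emeasure lborel (box (l$2) (u$2)) * emeasure lborel (box (l$3) (u$3))"
      by (rule lborel.emeasure_pair_measure_Times) simp_all
    have 2: "emeasure (lborel \<Otimes>\<^sub>M (lborel \<Otimes>\<^sub>M lborel)) (box (l$1) (u$1) \<times> (box (l$2) (u$2) \<times> box (l$3) (u$3)))
        = emeasure lborel (box (l$1) (u$1)) * emeasure (lborel \<Otimes>\<^sub>M lborel) (box (l$2) (u$2) \<times> box (l$3) (u$3))"
      by (rule sigma_finite_measure.emeasure_pair_measure_Times[OF s2]) (simp, rule pair_measureI, simp_all)
    show ?thesis
      unfolding emeasure_distr[OF borel_measurable_vector_3_lborel box_borel] eq 2 1 ..
  qed
  also have "\<dots> = ennreal (\<Prod>i\<in>UNIV. \<Prod>b\<in>Basis. (u$i - l$i) \<bullet> b)"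
  proof -
    have 1: "emeasure lborel (box (l$i) (u$i)) = ennreal (\<Prod>b\<in>Basis. (u$i - l$i) \<bullet> b)" for i
      using le' by (intro emeasure_lborel_box) auto
    have 2: "0 \<le> (\<Prod>b\<in>Basis. (u$i - l$i) \<bullet> b)" for i
      using le' by (intro prod_nonneg) (auto simp: inner_diff_left)
    show ?thesis
      unfolding 1 using 2[of 1] 2[of 2] 2[of 3]
      by (simp only: prod_UNIV_3 ennreal_mult'[symmetric] mult_nonneg_nonneg mult.assoc)
  qed
  also have "(\<Prod>i\<in>UNIV. \<Prod>b\<in>Basis. (u$i - l$i) \<bullet> b) = (\<Prod>b\<in>Basis. (u - l) \<bullet> b)"
    unfolding prod_Basis_vec inner_axis by simp
  finally show "emeasure (distr (lborel \<Otimes>\<^sub>M (lborel \<Otimes>\<^sub>M lborel)) borel (\<lambda>(a, b, c). vector [a, b, c])) (box l u)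
      = ennreal (\<Prod>b\<in>Basis. (u - l) \<bullet> b)" .
qed auto

text \<open>Tonelli's theorem after \<open>lborel_vector_3\<close>. It serves with complex entries
  for the chart of SL(2,C) and with real entries for the Hopf coordinates on SU(2).\<close>

lemma nn_integral_lborel_vector_3:
  fixes f :: "'a::euclidean_space^3 \<Rightarrow> ennreal"
  assumes [measurable]: "f \<in> borel_measurable borel"
  shows "(\<integral>\<^sup>+z. f z \<partial>lborel) = (\<integral>\<^sup>+a. \<integral>\<^sup>+b. \<integral>\<^sup>+c. f (vector [a, b, c]) \<partial>lborel \<partial>lborel \<partial>lborel)"
proof -
  have s2: "sigma_finite_measure (lborel \<Otimes>\<^sub>M lborel :: ('a \<times> 'a) measure)"
    by (simp add: lborel_prod lborel.sigma_finite_measure_axioms)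
  have m[measurable]: "(\<lambda>p. f (vector [fst p, fst (snd p), snd (snd p)])) \<in> borel_measurable (lborel \<Otimes>\<^sub>M (lborel \<Otimes>\<^sub>M lborel))"
    using measurable_compose[OF borel_measurable_vector_3 assms] by (simp add: case_prod_unfold)
  have [measurable]: "(\<lambda>p. f (vector [a, fst p, snd p])) \<in> borel_measurable (lborel \<Otimes>\<^sub>M lborel)" for a
  proof -
    have "(\<lambda>p. (a, p)) \<in> lborel \<Otimes>\<^sub>M lborel \<rightarrow>\<^sub>M lborel \<Otimes>\<^sub>M (lborel \<Otimes>\<^sub>M lborel)"
      by measurable
    from measurable_compose[OF this m] show ?thesis
      by simp
  qed
  have "(\<integral>\<^sup>+z. f z \<partial>lborel) = (\<integral>\<^sup>+p. f (vector [fst p, fst (snd p), snd (snd p)]) \<partial>(lborel \<Otimes>\<^sub>M (lborel \<Otimes>\<^sub>M lborel)))"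
    by (subst lborel_vector_3, subst nn_integral_distr[OF borel_measurable_vector_3_lborel])
       (simp_all add: assms case_prod_unfold)
  also have "\<dots> = (\<integral>\<^sup>+a. \<integral>\<^sup>+q. f (vector [a, fst q, snd q]) \<partial>(lborel \<Otimes>\<^sub>M lborel) \<partial>lborel)"
    by (subst sigma_finite_measure.nn_integral_fst[OF s2, symmetric, OF m]) simp
  also have "\<dots> = (\<integral>\<^sup>+a. \<integral>\<^sup>+b. \<integral>\<^sup>+c. f (vector [a, b, c]) \<partial>lborel \<partial>lborel \<partial>lborel)"
    by (subst lborel.nn_integral_fst[symmetric]) simp_all
  finally show ?thesis .
qed

section \<open>Holomorphic change of variables in the plane\<close>

lemma borel_measurable_Complex [measurable (raw)]:
  assumes [measurable]: "f \<in> borel_measurable M" "g \<in> borel_measurable M"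
  shows "(\<lambda>x. Complex (f x) (g x)) \<in> borel_measurable M"
  unfolding Complex_eq by measurable

lemma lborel_complex:
  "(lborel :: complex measure) = distr (lborel \<Otimes>\<^sub>M lborel) borel (\<lambda>(x, y). Complex x y)"
proof (rule lborel_eqI)
  fix l u :: complex
  assume "\<And>b. b \<in> Basis \<Longrightarrow> l \<bullet> b \<le> u \<bullet> b"
  from this[of 1] this[of \<i>] have le: "Re l \<le> Re u" "Im l \<le> Im u"
    by (auto simp: Basis_complex_def)
  have eq: "(\<lambda>(x, y). Complex x y) -` box l u \<inter> space (lborel \<Otimes>\<^sub>M lborel)
      = {Re l<..<Re u} \<times> {Im l<..<Im u}"
    by (auto simp: space_pair_measure mem_box Basis_complex_def)
  show "emeasure (distr (lborel \<Otimes>\<^sub>M lborel) borel (\<lambda>(x, y). Complex x y)) (box l u)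
      = ennreal (\<Prod>b\<in>Basis. (u - l) \<bullet> b)"
    using le by (subst emeasure_distr)
      (auto simp: eq[unfolded case_prod_unfold] lborel.emeasure_pair_measure_Times ennreal_mult' Basis_complex_def case_prod_unfold)
qed auto

text \<open>\<open>has_measure_differentiable_image\<close> equates a finite measure of the image
  with a convergent integral. If the integral diverges, the same equivalence rules out a finite
  measure, so both sides are infinite.\<close>

lemma emeasure_differentiable_image:
  fixes g :: "real^'n::{finite,wellorder} \<Rightarrow> real^'n::_"
  assumes S: "S \<in> sets borel"
    and der: "\<And>x. x \<in> S \<Longrightarrow> (g has_derivative g' x) (at x within S)"
    and inj: "inj_on g S"
    and img: "g ` S \<in> sets borel"
    and meas: "(\<lambda>x. \<bar>det (matrix (g' x))\<bar> * indicator S x) \<in> borel_measurable borel"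
  shows "emeasure lborel (g ` S) = (\<integral>\<^sup>+x. ennreal (\<bar>det (matrix (g' x))\<bar> * indicator S x) \<partial>lborel)"
    (is "_ = ?I")
proof -
  have SL: "S \<in> sets lebesgue"
    using S by simp
  have ind: "(\<lambda>x. \<bar>det (matrix (g' x))\<bar> * indicator S x) = (\<lambda>x. if x \<in> S then \<bar>det (matrix (g' x))\<bar> else 0)"
    by (auto simp: indicator_def)
  note iff = has_measure_differentiable_image[OF SL der inj]
  show ?thesis
  proof (cases "?I = \<infinity>")
    case False
    then obtain m where m: "0 \<le> m" "?I = ennreal m"
      by (cases ?I) auto
    have "((\<lambda>x. \<bar>det (matrix (g' x))\<bar> * indicator S x) has_integral m) UNIV"
      by (rule nn_integral_has_integral) (use meas m in auto)
    then have "((\<lambda>x. \<bar>det (matrix (g' x))\<bar>) has_integral m) S"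
      unfolding ind by (simp add: has_integral_restrict_UNIV)
    with iff have "g ` S \<in> lmeasurable" "measure lebesgue (g ` S) = m"
      by auto
    then have "emeasure lebesgue (g ` S) = m"
      by (simp add: emeasure_eq_measure2 fmeasurableD2)
    with m img show ?thesis
      by simp
  next
    case True
    have "g ` S \<notin> lmeasurable"
    proof
      assume "g ` S \<in> lmeasurable"
      with iff[of "measure lebesgue (g ` S)"]
      have "((\<lambda>x. \<bar>det (matrix (g' x))\<bar>) has_integral measure lebesgue (g ` S)) S"
        by simp
      then have "((\<lambda>x. \<bar>det (matrix (g' x))\<bar> * indicator S x) has_integral measure lebesgue (g ` S)) UNIV"
        unfolding ind by (simp add: has_integral_restrict_UNIV)
      then have "?I = measure lebesgue (g ` S)"
        by (intro nn_integral_has_integral_lborel) (use meas in auto)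
      with True show False
        by simp
    qed
    moreover have "g ` S \<in> sets lebesgue"
      using img by simp
    ultimately have "emeasure lebesgue (g ` S) = \<infinity>"
      by (metis fmeasurableI infinity_ennreal_def top.not_eq_extremum)
    with True img show ?thesis
      by simp
  qed
qed

text \<open>Carries Lebesgue measure of the plane to \<open>real^2\<close>, where the Jacobian is a
  matrix determinant.\<close>

lemma lborel_complex_vec:
  "(lborel :: complex measure) = distr (lborel :: (real^2) measure) borel (\<lambda>v. Complex (v$1) (v$2))"
proof (rule lborel_eqI)
  fix l u :: complex
  assume "\<And>b. b \<in> Basis \<Longrightarrow> l \<bullet> b \<le> u \<bullet> b"
  from this[of 1] this[of \<i>] have le: "Re l \<le> Re u" "Im l \<le> Im u"
    by (auto simp: Basis_complex_def)
  define R where "R = (\<lambda>z. vector [Re z, Im z] :: real^2)"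
  have eq: "(\<lambda>v. Complex (v$1) (v$2)) -` box l u \<inter> space lborel = box (R l) (R u)"
    by (auto simp: R_def mem_box Basis_complex_def Basis_vec_def inner_axis forall_2)
  have [measurable]: "(\<lambda>v::real^2. Complex (v$1) (v$2)) \<in> borel_measurable lborel"
    unfolding Complex_eq by simp
  have "emeasure (distr (lborel :: (real^2) measure) borel (\<lambda>v. Complex (v$1) (v$2))) (box l u)
      = emeasure lborel (box (R l) (R u))"
    by (subst emeasure_distr) (simp_all only: eq, simp_all)
  also have "\<dots> = ennreal (\<Prod>b\<in>Basis. (R u - R l) \<bullet> b)"
  proof (intro emeasure_lborel_box)
    have "\<forall>i. R l $ i \<le> R u $ i"
      using le by (simp add: R_def forall_2)
    then show "R l \<bullet> b \<le> R u \<bullet> b" if "b \<in> Basis" for b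
      using that by (auto simp: Basis_vec_def inner_axis)
  qed
  also have "(\<Prod>b\<in>Basis. (R u - R l) \<bullet> b) = (\<Prod>b\<in>Basis. (u - l) \<bullet> b)"
    unfolding prod_Basis_vec inner_axis UNIV_2 by (simp add: R_def Basis_complex_def)
  finally show "emeasure (distr (lborel :: (real^2) measure) borel (\<lambda>v. Complex (v$1) (v$2))) (box l u)
      = ennreal (\<Prod>b\<in>Basis. (u - l) \<bullet> b)" .
qed auto

text \<open>By the Cauchy-Riemann equations the real derivative is multiplication by f'(z), whose
  determinant as a real 2 by 2 matrix is |f'(z)|^2.\<close>

lemma emeasure_holomorphic_image:
  assumes hol: "f holomorphic_on UNIV" and S: "S \<in> sets borel" and inj: "inj_on f S"
    and img: "f ` S \<in> sets borel"
  shows "emeasure lborel (f ` S) = (\<integral>\<^sup>+z. ennreal ((cmod (deriv f z))\<^sup>2 * indicator S z) \<partial>lborel)"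
proof -
  define T where "T = (\<lambda>v::real^2. Complex (v$1) (v$2))"
  define R where "R = (\<lambda>z. vector [Re z, Im z] :: real^2)"
  have TR [simp]: "T (R z) = z" and RT [simp]: "R (T v) = v" for z v
    by (auto simp: T_def R_def vec_eq_iff forall_2)
  have lR: "bounded_linear R"
    unfolding linear_conv_bounded_linear[symmetric]
    by (rule linearI) (auto simp: R_def vec_eq_iff forall_2)
  have lT: "bounded_linear T"
    unfolding linear_conv_bounded_linear[symmetric]
    by (rule linearI) (auto simp: T_def complex_eq_iff)
  have T_meas [measurable]: "T \<in> borel_measurable borel" and [measurable]: "R \<in> borel_measurable borel"
    using lT lR by (auto intro!: borel_measurable_continuous_onI linear_continuous_on)
  have [measurable]: "deriv f \<in> borel_measurable borel"
    using hol by (intro borel_measurable_continuous_onI holomorphic_on_imp_continuous_on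
        holomorphic_deriv[where S=UNIV]) auto
  note [measurable] = S img
  define g where "g = (\<lambda>v. R (f (T v)))"
  define g' where "g' = (\<lambda>v h. R (deriv f (T v) * T h))"
  \<comment> \<open>R and T are mutually inverse, so images under R are preimages under the
    measurable map T.\<close>
  have vim: "R ` A = T -` A" for A
    by (auto simp: image_iff) (metis RT)
  have RS: "R ` S \<in> sets borel" "R ` (f ` S) \<in> sets borel"
    unfolding vim by (rule measurable_sets_borel[of T borel]; simp)+
  have det: "det (matrix (g' v)) = (cmod (deriv f (T v)))\<^sup>2" for v
    unfolding cmod_power2 by (simp add: det_2 matrix_def g'_def R_def T_def axis_def power2_eq_square)
  have gim: "g ` (R ` S) = R ` (f ` S)"
    by (auto simp: g_def image_iff)
  have "emeasure lborel (f ` S) = emeasure lborel (g ` (R ` S))"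
    unfolding gim unfolding vim by (subst (1) lborel_complex_vec, subst emeasure_distr)
      (auto simp: T_def[symmetric])
  also have "\<dots> = (\<integral>\<^sup>+v. ennreal (\<bar>det (matrix (g' v))\<bar> * indicator (R ` S) v) \<partial>lborel)"
  proof (rule emeasure_differentiable_image)
    show "inj_on g (R ` S)"
      using inj by (auto simp: inj_on_def g_def) (metis TR)
    show "(g has_derivative g' x) (at x within R ` S)" for x
    proof -
      have "(f has_field_derivative deriv f (T x)) (at (T x))"
        using hol holomorphic_derivI[of f UNIV "T x"] by simp
      then have 1: "(f has_derivative (\<lambda>h. deriv f (T x) * h)) (at (T x))"
        by (simp add: has_field_derivative_def)
      have 2: "(T has_derivative T) (at x)"
        by (rule bounded_linear.has_derivative[OF lT has_derivative_ident])
      from diff_chain_at[OF 2 1] have "((\<lambda>v. f (T v)) has_derivative (\<lambda>h. deriv f (T x) * T h)) (at x)"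
        by (simp add: o_def)
      from bounded_linear.has_derivative[OF lR this] show ?thesis
        unfolding g_def g'_def by (rule has_derivative_at_withinI)
    qed
    show "R ` S \<in> sets borel" "g ` (R ` S) \<in> sets borel"
      unfolding gim using RS by auto
    show "(\<lambda>v. \<bar>det (matrix (g' v))\<bar> * indicator (R ` S) v) \<in> borel_measurable borel"
      unfolding det using RS by measurable
  qed
  also have "\<dots> = (\<integral>\<^sup>+v. ennreal ((cmod (deriv f (T v)))\<^sup>2 * indicator S (T v)) \<partial>lborel)"
    unfolding det vim by (intro nn_integral_cong) (simp add: indicator_def)
  also have "\<dots> = (\<integral>\<^sup>+z. ennreal ((cmod (deriv f z))\<^sup>2 * indicator S z) \<partial>lborel)"
    using T_meas unfolding T_def by (subst lborel_complex_vec, subst nn_integral_distr) simp_all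
  finally show ?thesis .
qed

text \<open>The image formula is applied to the part of S that f maps into A; injectivity on S
  passes to this subset, and the image of S is open, hence Borel, by the open mapping
  theorem.\<close>

lemma distr_holomorphic:
  assumes hol: "f holomorphic_on UNIV" and S: "open S" and inj: "inj_on f S"
  shows "distr (density lborel (\<lambda>z. ennreal ((cmod (deriv f z))\<^sup>2 * indicator S z))) borel f
    = density lborel (indicator (f ` S))" (is "?L = ?R")
proof (rule measure_eqI)
  fix A assume "A \<in> sets ?L"
  then have A [measurable]: "A \<in> sets borel"
    by simp
  have [measurable]: "f \<in> borel_measurable borel"
    using hol by (intro borel_measurable_continuous_onI holomorphic_on_imp_continuous_on)
  have [measurable]: "deriv f \<in> borel_measurable borel"
    using hol by (intro borel_measurable_continuous_onI holomorphic_on_imp_continuous_on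
        holomorphic_deriv[where S=UNIV]) auto
  have [measurable]: "S \<in> sets borel"
    using S by simp
  have "open (f ` S)"
    using open_mapping_thm3[OF holomorphic_on_subset[OF hol] S inj] by simp
  then have [measurable]: "f ` S \<in> sets borel"
    by simp
  have [measurable]: "f -` A \<in> sets borel"
    by (rule measurable_sets_borel[of f borel]) auto
  have vS: "S \<inter> f -` A \<in> sets borel"
    by measurable
  have im: "f ` (S \<inter> f -` A) = f ` S \<inter> A"
    by auto
  have "emeasure ?L A = (\<integral>\<^sup>+z. ennreal ((cmod (deriv f z))\<^sup>2 * indicator (S \<inter> f -` A) z) \<partial>lborel)"
    by (subst emeasure_distr, simp, simp, subst emeasure_density, simp)
      (auto intro!: nn_integral_cong simp: indicator_def)
  also have "\<dots> = emeasure lborel (f ` (S \<inter> f -` A))"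
    using inj_on_subset[OF inj] by (intro emeasure_holomorphic_image[OF hol vS, symmetric]) (auto simp: im)
  also have "\<dots> = emeasure ?R A"
    unfolding im by (subst emeasure_density) (auto simp flip: indicator_inter_arith)
  finally show "emeasure ?L A = emeasure ?R A" .
qed simp

text \<open>The complement of the image may be null instead of empty because the substitutions by
  exp and \<open>two_cosh\<close> miss part of the real axis.\<close>

lemma nn_integral_holomorphic:
  assumes hol: "f holomorphic_on UNIV" and S: "open S" and inj: "inj_on f S"
    and null: "- f ` S \<in> null_sets lborel" and [measurable]: "F \<in> borel_measurable borel"
  shows "(\<integral>\<^sup>+w. F w \<partial>lborel) = (\<integral>\<^sup>+z. ennreal ((cmod (deriv f z))\<^sup>2 * indicator S z) * F (f z) \<partial>lborel)"
proof -
  have [measurable]: "f \<in> borel_measurable borel"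
    using hol by (intro borel_measurable_continuous_onI holomorphic_on_imp_continuous_on)
  have [measurable]: "deriv f \<in> borel_measurable borel"
    using hol by (intro borel_measurable_continuous_onI holomorphic_on_imp_continuous_on
        holomorphic_deriv[where S=UNIV]) auto
  have [measurable]: "S \<in> sets borel"
    using S by simp
  have "open (f ` S)"
    using open_mapping_thm3[OF holomorphic_on_subset[OF hol] S inj] by simp
  then have [measurable]: "f ` S \<in> sets borel"
    by simp
  have "(\<integral>\<^sup>+w. F w \<partial>lborel) = (\<integral>\<^sup>+w. indicator (f ` S) w * F w \<partial>lborel)"
    using AE_not_in[OF null] by (intro nn_integral_cong_AE) (auto simp: indicator_def)
  also have "\<dots> = (\<integral>\<^sup>+w. F w \<partial>density lborel (indicator (f ` S)))"
    by (subst nn_integral_density) auto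
  also have "\<dots> = (\<integral>\<^sup>+z. F (f z) \<partial>density lborel (\<lambda>z. ennreal ((cmod (deriv f z))\<^sup>2 * indicator S z)))"
    by (subst distr_holomorphic[OF hol S inj, symmetric], subst nn_integral_distr) auto
  also have "\<dots> = (\<integral>\<^sup>+z. ennreal ((cmod (deriv f z))\<^sup>2 * indicator S z) * F (f z) \<partial>lborel)"
    by (subst nn_integral_density) auto
  finally show ?thesis .
qed

lemma nn_integral_lborel_complex:
  assumes [measurable]: "F \<in> borel_measurable borel"
  shows "(\<integral>\<^sup>+z. F z \<partial>lborel) = (\<integral>\<^sup>+x. \<integral>\<^sup>+y. F (Complex x y) \<partial>lborel \<partial>lborel)"
proof -
  have "(\<integral>\<^sup>+z. F z \<partial>lborel) = (\<integral>\<^sup>+p. F (Complex (fst p) (snd p)) \<partial>(lborel \<Otimes>\<^sub>M lborel))"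
    by (subst lborel_complex, subst nn_integral_distr) (simp_all add: case_prod_unfold)
  also have "\<dots> = (\<integral>\<^sup>+x. \<integral>\<^sup>+y. F (Complex x y) \<partial>lborel \<partial>lborel)"
    by (subst lborel.nn_integral_fst[symmetric]) simp_all
  finally show ?thesis .
qed

lemma nn_integral_affine_complex:
  assumes c: "c \<noteq> 0" and [measurable]: "F \<in> borel_measurable borel"
  shows "(\<integral>\<^sup>+w. F w \<partial>lborel) = ennreal ((cmod c)\<^sup>2) * (\<integral>\<^sup>+z. F (c * z + d) \<partial>lborel)"
proof -
  have "w \<in> range (\<lambda>z. c * z + d)" for w
    using c by (intro image_eqI[where x="(w - d) / c"]) auto
  then have im: "range (\<lambda>z. c * z + d) = UNIV"
    by auto
  have inj: "inj (\<lambda>z. c * z + d)"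
    using c by (auto simp: inj_on_def)
  have der: "deriv (\<lambda>z. c * z + d) z = c" for z
    by (rule DERIV_imp_deriv) (auto intro!: derivative_eq_intros)
  show ?thesis
    by (subst nn_integral_holomorphic[where f="\<lambda>z. c * z + d" and S=UNIV])
       (use inj in \<open>auto simp: im der nn_integral_cmult intro!: holomorphic_intros\<close>)
qed

lemma real_line_null: "{w::complex. Im w = 0} \<in> null_sets lborel"
proof -
  have "negligible {w. \<i> \<bullet> w = 0}"
    by (rule negligible_hyperplane) simp
  then have "{w::complex. Im w = 0} \<in> null_sets lebesgue"
    by (simp add: negligible_iff_null_sets)
  moreover have "closed {w::complex. Im w = 0}"
    by (intro closed_Collect_eq continuous_intros)
  ultimately show ?thesis
    by (simp add: null_sets_def)
qed

section \<open>Polar coordinates through the exponential map\<close>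

definition period_strip :: "complex set" where
  "period_strip = {z. 0 < Im z \<and> Im z < 2 * pi}"

lemma open_period_strip: "open period_strip"
  unfolding period_strip_def by (intro open_Collect_conj open_Collect_less continuous_intros)

lemma inj_on_exp_period_strip: "inj_on exp period_strip"
  by (auto simp: inj_on_def period_strip_def intro!: exp_complex_eqI)

lemma exp_period_strip:
  assumes "Im w \<noteq> 0"
  obtains z where "z \<in> period_strip" "exp z = w"
proof
  have w: "w \<noteq> 0"
    using assms by auto
  have "Arg2pi w \<noteq> 0"
    using assms by (metis Arg2pi_eq_0 complex_is_Real_iff)
  then show "Complex (ln (cmod w)) (Arg2pi w) \<in> period_strip"
    using Arg2pi[of w] by (auto simp: period_strip_def)
  have "exp (Complex (ln (cmod w)) (Arg2pi w)) = of_real (cmod w) * exp (\<i> * of_real (Arg2pi w))"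
    using w by (simp add: Complex_eq exp_add exp_of_real)
  also have "\<dots> = w"
    using Arg2pi[of w] by (simp add: is_Arg_def)
  finally show "exp (Complex (ln (cmod w)) (Arg2pi w)) = w" .
qed

text \<open>The substitution m = exp (2 x) on compact intervals, extended by continuity from below
  as the intervals exhaust the line on one side and the positive half-line on the other.\<close>

lemma nn_integral_exp_substitution:
  fixes G :: "real \<Rightarrow> ennreal"
  assumes [measurable]: "G \<in> borel_measurable borel"
  shows "(\<integral>\<^sup>+x. ennreal (2 * exp (2 * x)) * G (exp (2 * x)) \<partial>lborel) = (\<integral>\<^sup>+m. G m * indicator {0<..} m \<partial>lborel)"
proof -
  let ?f = "\<lambda>x. ennreal (2 * exp (2 * x)) * G (exp (2 * x))"
  define A where "A n = {exp (2 * - real (Suc n))..exp (2 * real (Suc n))}" for n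
  define B where "B n = {- real (Suc n)..real (Suc n)}" for n
  have incA: "incseq A" and incB: "incseq B"
    by (auto simp: incseq_def A_def B_def intro: order_trans)
  have UA: "(\<Union>n. A n) = {0<..}"
  proof (intro equalityI subsetI)
    fix m :: real assume m: "m \<in> {0<..}"
    obtain n where n: "\<bar>ln m\<bar> < real n"
      using reals_Archimedean2 by blast
    have "exp (2 * - real (Suc n)) \<le> exp (ln m)" "exp (ln m) \<le> exp (2 * real (Suc n))"
      using n by (auto simp del: exp_ln_iff exp_ln)
    moreover have "exp (ln m) = m"
      using m by simp
    ultimately have "m \<in> A n"
      unfolding A_def by (simp only: atLeastAtMost_iff simp_thms)
    then show "m \<in> (\<Union>n. A n)"
      by blast
  next
    fix m assume "m \<in> (\<Union>n. A n)"
    then show "m \<in> {0<..}"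
      by (auto simp: A_def intro: less_le_trans[OF exp_gt_zero])
  qed
  have UB: "(\<Union>n. B n) = UNIV"
  proof (intro equalityI subsetI)
    fix x :: real
    obtain n where n: "\<bar>x\<bar> < real n"
      using reals_Archimedean2 by blast
    then show "x \<in> (\<Union>n. B n)"
      by (intro UN_I[of n]) (auto simp: B_def)
  qed auto
  have "(\<integral>\<^sup>+m. G m * indicator (A n) m \<partial>lborel) = (\<integral>\<^sup>+x. G (exp (2 * x)) * ennreal (2 * exp (2 * x)) * indicator (B n) x \<partial>lborel)" for n
    unfolding A_def B_def
    by (rule nn_integral_substitution_aux) (auto intro!: derivative_eq_intros continuous_intros)
  then have eq: "emeasure (density lborel G) (A n) = emeasure (density lborel ?f) (B n)" for n
    by (subst (1 2) emeasure_density) (simp_all add: A_def B_def mult.commute)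
  have "(\<lambda>n. emeasure (density lborel G) (A n)) \<longlonglongrightarrow> emeasure (density lborel G) (\<Union>n. A n)"
    by (rule Lim_emeasure_incseq[OF _ incA]) (auto simp: A_def)
  moreover have "(\<lambda>n. emeasure (density lborel ?f) (B n)) \<longlonglongrightarrow> emeasure (density lborel ?f) (\<Union>n. B n)"
    by (rule Lim_emeasure_incseq[OF _ incB]) (auto simp: B_def)
  ultimately have "emeasure (density lborel G) (\<Union>n. A n) = emeasure (density lborel ?f) (\<Union>n. B n)"
    unfolding eq by (rule LIMSEQ_unique)
  then have "emeasure (density lborel G) {0<..} = emeasure (density lborel ?f) UNIV"
    unfolding UA UB .
  then show ?thesis
    by (simp add: emeasure_density)
qed

text \<open>Polar coordinates in the form n = exp (x + i y). The Jacobian is exp (2 x), the angle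
  contributes 2 pi, and m = exp (2 x) has dm = 2 exp (2 x) dx, which leaves the factor pi.\<close>

lemma nn_integral_norm_sq:
  assumes [measurable]: "G \<in> borel_measurable borel"
  shows "(\<integral>\<^sup>+n. G ((cmod n)\<^sup>2) \<partial>lborel) = ennreal pi * (\<integral>\<^sup>+m. G m * indicator {0<..} m \<partial>lborel)"
proof -
  have sub: "- exp ` period_strip \<subseteq> {w. Im w = 0}"
    using exp_period_strip by (auto simp: image_iff)
  have "open (exp ` period_strip)"
    by (rule open_mapping_thm3[OF _ open_period_strip inj_on_exp_period_strip]) (intro holomorphic_intros)
  then have null: "- exp ` period_strip \<in> null_sets lborel"
    by (intro null_sets_subset[OF real_line_null _ sub]) auto
  have [measurable]: "period_strip \<in> sets borel"
    using open_period_strip by simp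
  have ind: "indicator period_strip (Complex x y) = (indicator {0<..<2 * pi} y :: real)" for x y
    by (auto simp: indicator_def period_strip_def)
  have norm: "(cmod (exp (Complex x y)))\<^sup>2 = exp (2 * x)" for x y
    by (simp add: power2_eq_square flip: exp_add)
  have der: "deriv exp z = exp z" for z :: complex
    by (rule DERIV_imp_deriv) (rule DERIV_exp)
  have "(\<integral>\<^sup>+n. G ((cmod n)\<^sup>2) \<partial>lborel)
      = (\<integral>\<^sup>+z. ennreal ((cmod (exp z))\<^sup>2 * indicator period_strip z) * G ((cmod (exp z))\<^sup>2) \<partial>lborel)"
    by (subst nn_integral_holomorphic[OF _ open_period_strip inj_on_exp_period_strip null])
       (simp_all add: der holomorphic_on_exp del: norm_exp_eq_Re)
  also have "\<dots> = (\<integral>\<^sup>+x. \<integral>\<^sup>+y. (ennreal (exp (2 * x)) * G (exp (2 * x))) * indicator {0<..<2 * pi} y \<partial>lborel \<partial>lborel)"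
    by (subst nn_integral_lborel_complex, simp, intro nn_integral_cong)
       (simp add: norm ind del: norm_exp_eq_Re split: split_indicator)
  also have "\<dots> = (\<integral>\<^sup>+x. ennreal pi * (ennreal (2 * exp (2 * x)) * G (exp (2 * x))) \<partial>lborel)"
  proof (intro nn_integral_cong)
    fix x :: real
    have e: "ennreal (exp (2 * x)) * ennreal (2 * pi) = ennreal pi * ennreal (2 * exp (2 * x))"
      by (simp flip: ennreal_mult)
    have "(\<integral>\<^sup>+y. (ennreal (exp (2 * x)) * G (exp (2 * x))) * indicator {0<..<2 * pi} y \<partial>lborel)
        = ennreal (exp (2 * x)) * G (exp (2 * x)) * ennreal (2 * pi)"
      by (subst nn_integral_cmult_indicator) simp_all
    also have "\<dots> = ennreal (exp (2 * x)) * ennreal (2 * pi) * G (exp (2 * x))"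
      by (simp only: mult_ac)
    also have "\<dots> = ennreal pi * (ennreal (2 * exp (2 * x)) * G (exp (2 * x)))"
      unfolding e by (simp only: mult_ac)
    finally show "(\<integral>\<^sup>+y. (ennreal (exp (2 * x)) * G (exp (2 * x))) * indicator {0<..<2 * pi} y \<partial>lborel)
        = ennreal pi * (ennreal (2 * exp (2 * x)) * G (exp (2 * x)))" .
  qed
  also have "\<dots> = ennreal pi * (\<integral>\<^sup>+m. G m * indicator {0<..} m \<partial>lborel)"
    by (subst nn_integral_cmult) (auto simp: nn_integral_exp_substitution)
  finally show ?thesis .
qed

text \<open>The area of the projective line in an affine coordinate. In the integral over a
  conjugacy class it is the volume of the space of eigenlines.\<close>

lemma nn_integral_Riemann_sphere:
  "(\<integral>\<^sup>+\<xi>. ennreal (1 / (1 + (cmod \<xi>)\<^sup>2)\<^sup>2) \<partial>lborel) = ennreal pi"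
proof -
  have "(\<integral>\<^sup>+m. ennreal (1 / (1 + m)\<^sup>2) * indicator {0<..} m \<partial>lborel)
      = (\<integral>\<^sup>+m. ennreal (1 / (1 + m)\<^sup>2) * indicator {0..} m \<partial>lborel)"
    using AE_lborel_singleton[of "0::real"]
    by (intro nn_integral_cong_AE) (auto simp: indicator_def elim!: eventually_mono)
  also have "\<dots> = ennreal (0 - (- 1 / (1 + 0)))"
  proof (rule nn_integral_FTC_atLeast)
    show "((\<lambda>m::real. - 1 / (1 + m)) \<longlongrightarrow> 0) at_top"
      by real_asymp
    show "((\<lambda>m. - 1 / (1 + m)) has_real_derivative 1 / (1 + x)\<^sup>2) (at x)" if "0 \<le> x" for x :: real
      using that by (auto intro!: derivative_eq_intros simp: power2_eq_square)
  qed simp_all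
  finally have "(\<integral>\<^sup>+m. ennreal (1 / (1 + m)\<^sup>2) * indicator {0<..} m \<partial>lborel) = 1"
    by simp
  then show ?thesis
    by (subst nn_integral_norm_sq[where G="\<lambda>m. ennreal (1 / (1 + m)\<^sup>2)"]) simp_all
qed

section \<open>Integration over conjugacy classes\<close>

text \<open>The minimum of the squared Frobenius norm over the matrices with determinant \<open>1\<close> and trace \<open>w\<close>.\<close>

definition min_frob :: "complex \<Rightarrow> real" where
  "min_frob w = ((cmod w)\<^sup>2 + cmod (w\<^sup>2 - 4)) / 2"

text \<open>The parallelogram law for \<zeta> and 1/\<zeta>, since (\<zeta> + 1/\<zeta>)^2 - 4 =
  (\<zeta> - 1/\<zeta>)^2. The value is the squared norm of the diagonal matrix with these
  eigenvalues.\<close>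

lemma min_frob_eigenvalue:
  assumes "\<zeta> \<noteq> 0"
  shows "min_frob (\<zeta> + 1 / \<zeta>) = (cmod \<zeta>)\<^sup>2 + (cmod (1 / \<zeta>))\<^sup>2"
proof -
  have "(\<zeta> + 1 / \<zeta>)\<^sup>2 - 4 = (\<zeta> - 1 / \<zeta>)\<^sup>2"
    using assms by (simp add: power2_eq_square field_simps)
  then have "cmod ((\<zeta> + 1 / \<zeta>)\<^sup>2 - 4) = (cmod (\<zeta> - 1 / \<zeta>))\<^sup>2"
    by (simp add: norm_power)
  moreover have "(cmod (x + y))\<^sup>2 + (cmod (x - y))\<^sup>2 = 2 * ((cmod x)\<^sup>2 + (cmod y)\<^sup>2)" for x y
    unfolding cmod_power2 by (simp add: power2_eq_square algebra_simps)
  ultimately show ?thesis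
    unfolding min_frob_def by (metis nonzero_mult_div_cancel_left zero_neq_numeral)
qed

lemma eigenvalue_exists:
  obtains \<zeta> :: complex where "\<zeta> \<noteq> 0" "w = \<zeta> + 1 / \<zeta>"
proof
  define r where "r = csqrt (w\<^sup>2 - 4)"
  have r: "r\<^sup>2 = w\<^sup>2 - 4"
    by (simp add: r_def)
  have p: "(w + r) / 2 * ((w - r) / 2) = 1"
    using r by (simp add: power2_eq_square algebra_simps)
  then show nz: "(w + r) / 2 \<noteq> 0"
    by auto
  have "1 / ((w + r) / 2) = (w - r) / 2"
    using p nz by (metis nonzero_mult_div_cancel_left)
  then show "w = (w + r) / 2 + 1 / ((w + r) / 2)"
    by (simp add: field_simps)
qed

text \<open>On a conjugacy class with eigenvalues \<open>\<zeta>\<close> and \<open>1/\<zeta>\<close>, use as coordinates the eigenvector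
  \<open>(1, \<xi>)\<close> and the off-diagonal entry \<open>n\<close> of the Schur form. Both substitutions are affine.\<close>

lemma nn_integral_conjugacy_class:
  fixes W :: "real \<Rightarrow> ennreal"
  assumes [measurable]: "W \<in> borel_measurable borel"
  shows "(\<integral>\<^sup>+b. \<integral>\<^sup>+d. ennreal (1 / (cmod b)\<^sup>2) * W ((cmod (w - d))\<^sup>2 + (cmod b)\<^sup>2 + (cmod (((w - d) * d - 1) / b))\<^sup>2
      + (cmod d)\<^sup>2) \<partial>lborel \<partial>lborel)
    = ennreal (pi\<^sup>2) * (\<integral>\<^sup>+s. W s * indicator {min_frob w<..} s \<partial>lborel)"
proof -
  obtain \<zeta> where \<zeta>: "\<zeta> \<noteq> 0" and w: "w = \<zeta> + 1 / \<zeta>"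
    using eigenvalue_exists .
  define \<Delta> where "\<Delta> = \<zeta> - 1 / \<zeta>"
  define Q where "Q = (\<lambda>\<xi> b. (cmod (\<zeta> - b * \<xi>))\<^sup>2 + (cmod b)\<^sup>2 + (cmod (\<xi> * (\<Delta> - b * \<xi>)))\<^sup>2 + (cmod (b * \<xi> + 1 / \<zeta>))\<^sup>2)"
  have [measurable]: "(\<lambda>(\<xi>, b). Q \<xi> b) \<in> borel_measurable (borel \<Otimes>\<^sub>M borel)"
    unfolding Q_def by measurable
  \<comment> \<open>The lower right entry is d = b \<xi> + 1/\<zeta>, which makes (1, \<xi>) an
    eigenvector for \<zeta>. The Jacobian |b|^2 cancels the density 1 / |b|^2.\<close>
  have inner: "(\<integral>\<^sup>+d. ennreal (1 / (cmod b)\<^sup>2) * W ((cmod (w - d))\<^sup>2 + (cmod b)\<^sup>2 + (cmod (((w - d) * d - 1) / b))\<^sup>2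
      + (cmod d)\<^sup>2) \<partial>lborel) = (\<integral>\<^sup>+\<xi>. W (Q \<xi> b) \<partial>lborel)" if b: "b \<noteq> 0" for b
  proof -
    have eq: "w - (b * \<xi> + 1 / \<zeta>) = \<zeta> - b * \<xi>"
      "((\<zeta> - b * \<xi>) * (b * \<xi> + 1 / \<zeta>) - 1) / b = \<xi> * (\<Delta> - b * \<xi>)" for \<xi>
      using b \<zeta> by (auto simp: w \<Delta>_def field_simps)
    have "(\<integral>\<^sup>+d. ennreal (1 / (cmod b)\<^sup>2) * W ((cmod (w - d))\<^sup>2 + (cmod b)\<^sup>2 + (cmod (((w - d) * d - 1) / b))\<^sup>2
      + (cmod d)\<^sup>2) \<partial>lborel)
      = ennreal ((cmod b)\<^sup>2) * (\<integral>\<^sup>+\<xi>. ennreal (1 / (cmod b)\<^sup>2) * W (Q \<xi> b) \<partial>lborel)"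
      by (subst nn_integral_affine_complex[OF b, where d="1 / \<zeta>"], measurable) (simp only: eq Q_def)
    also have "\<dots> = ennreal ((cmod b)\<^sup>2) * (ennreal (1 / (cmod b)\<^sup>2) * (\<integral>\<^sup>+\<xi>. W (Q \<xi> b) \<partial>lborel))"
      by (subst nn_integral_cmult) measurable
    also have "\<dots> = (\<integral>\<^sup>+\<xi>. W (Q \<xi> b) \<partial>lborel)"
      using b by (simp flip: mult.assoc ennreal_mult)
    finally show ?thesis .
  qed
  have schur: "(\<integral>\<^sup>+b. W (Q \<xi> b) \<partial>lborel) = ennreal (1 / (1 + (cmod \<xi>)\<^sup>2)\<^sup>2) * (\<integral>\<^sup>+n. W (min_frob w + (cmod n)\<^sup>2) \<partial>lborel)" for \<xi>
  proof -
    define L where "L = 1 + (cmod \<xi>)\<^sup>2"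
    have L: "L > 0"
      by (simp add: L_def add_pos_nonneg)
    \<comment> \<open>Completing the square in b. Unitary invariance of the Frobenius norm explains
      the result: the Schur form has diagonal entries \<zeta> and 1/\<zeta>, and its off-diagonal
      entry has the modulus that appears here.\<close>
    have Q: "Q \<xi> b = min_frob w + (cmod (of_real L * b - cnj \<xi> * \<Delta>))\<^sup>2" for b
    proof -
      have "(cmod (z - u))\<^sup>2 + (cmod b)\<^sup>2 + (cmod (\<xi> * (z - z' - u)))\<^sup>2 + (cmod (u + z'))\<^sup>2
        = (cmod z)\<^sup>2 + (cmod z')\<^sup>2 + (cmod (of_real L * b - cnj \<xi> * (z - z')))\<^sup>2" if "u = b * \<xi>" for z z' u
        unfolding that L_def norm_mult power_mult_distrib cmod_power2
        by (simp add: power2_eq_square algebra_simps)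
      from this[of "b * \<xi>" \<zeta> "1 / \<zeta>"] show ?thesis
        unfolding Q_def w min_frob_eigenvalue[OF \<zeta>] \<Delta>_def by simp
    qed
    have "(\<integral>\<^sup>+b. W (Q \<xi> b) \<partial>lborel) = ennreal ((cmod (1 / of_real L))\<^sup>2) *
        (\<integral>\<^sup>+n. W (Q \<xi> (1 / of_real L * n + cnj \<xi> * \<Delta> / of_real L)) \<partial>lborel)"
      by (rule nn_integral_affine_complex) (use L in \<open>auto\<close>)
    also have "(cmod (1 / of_real L))\<^sup>2 = 1 / (1 + (cmod \<xi>)\<^sup>2)\<^sup>2"
      unfolding L_def[symmetric] norm_divide power_divide using L by simp
    also have "(\<lambda>n. W (Q \<xi> (1 / of_real L * n + cnj \<xi> * \<Delta> / of_real L))) = (\<lambda>n. W (min_frob w + (cmod n)\<^sup>2))"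
      unfolding Q using L by (simp add: field_simps)
    finally show ?thesis .
  qed
  have "(\<integral>\<^sup>+b. \<integral>\<^sup>+d. ennreal (1 / (cmod b)\<^sup>2) * W ((cmod (w - d))\<^sup>2 + (cmod b)\<^sup>2 + (cmod (((w - d) * d - 1) / b))\<^sup>2
      + (cmod d)\<^sup>2) \<partial>lborel \<partial>lborel) = (\<integral>\<^sup>+b. \<integral>\<^sup>+\<xi>. W (Q \<xi> b) \<partial>lborel \<partial>lborel)"
    using AE_lborel_singleton[of "0::complex"]
    by (intro nn_integral_cong_AE) (auto elim!: eventually_mono simp: inner)
  also have "\<dots> = (\<integral>\<^sup>+\<xi>. \<integral>\<^sup>+b. W (Q \<xi> b) \<partial>lborel \<partial>lborel)"
    by (rule lborel_pair.Fubini') measurable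
  also have "\<dots> = (\<integral>\<^sup>+\<xi>. ennreal (1 / (1 + (cmod \<xi>)\<^sup>2)\<^sup>2) * (\<integral>\<^sup>+n. W (min_frob w + (cmod n)\<^sup>2) \<partial>lborel) \<partial>lborel)"
    by (simp only: schur)
  also have "\<dots> = ennreal pi * (\<integral>\<^sup>+n. W (min_frob w + (cmod n)\<^sup>2) \<partial>lborel)"
    by (subst nn_integral_multc, measurable) (simp only: nn_integral_Riemann_sphere)
  also have "(\<integral>\<^sup>+n. W (min_frob w + (cmod n)\<^sup>2) \<partial>lborel)
      = ennreal pi * (\<integral>\<^sup>+m. W (min_frob w + m) * indicator {0<..} m \<partial>lborel)"
    by (rule nn_integral_norm_sq[where G="\<lambda>m. W (min_frob w + m)"]) measurable
  also have "(\<integral>\<^sup>+m. W (min_frob w + m) * indicator {0<..} m \<partial>lborel)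
      = (\<integral>\<^sup>+s. W s * indicator {min_frob w<..} s \<partial>lborel)"
    by (subst (2) nn_integral_real_affine[where c=1 and t="min_frob w"], measurable)
      (auto intro!: nn_integral_cong simp: indicator_def)
  finally show ?thesis
    by (simp add: power2_eq_square ennreal_mult mult.assoc)
qed

text \<open>The entry c is replaced by d = (1 + b c) / a for fixed a and b, and then a by the trace
  w = a + d. The first Jacobian |a / b|^2 turns the density 1 / |a|^2 into 1 / |b|^2, the form in
  which \<open>nn_integral_conjugacy_class\<close> expects it.\<close>

lemma nn_integral_trace_frob:
  fixes F :: "complex \<Rightarrow> ennreal" and W :: "real \<Rightarrow> ennreal"
  assumes [measurable]: "F \<in> borel_measurable borel" "W \<in> borel_measurable borel"
  shows "(\<integral>\<^sup>+a. \<integral>\<^sup>+b. \<integral>\<^sup>+c. ennreal (1 / (cmod a)\<^sup>2) * (F (a + (1 + b * c) / a) *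
      W ((cmod a)\<^sup>2 + (cmod b)\<^sup>2 + (cmod c)\<^sup>2 + (cmod ((1 + b * c) / a))\<^sup>2)) \<partial>lborel \<partial>lborel \<partial>lborel)
    = ennreal (pi\<^sup>2) * (\<integral>\<^sup>+w. F w * (\<integral>\<^sup>+s. W s * indicator {min_frob w<..} s \<partial>lborel) \<partial>lborel)"
proof -
  define Q where "Q = (\<lambda>a b d. ennreal (1 / (cmod b)\<^sup>2) * W ((cmod a)\<^sup>2 + (cmod b)\<^sup>2 + (cmod ((a * d - 1) / b))\<^sup>2 + (cmod d)\<^sup>2))"
  have [measurable (raw)]: "(\<lambda>x. Q (f x) (g x) (h x)) \<in> borel_measurable M"
    if [measurable]: "f \<in> borel_measurable M" "g \<in> borel_measurable M" "h \<in> borel_measurable M"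
    for f g h and M :: "'z measure"
    unfolding Q_def by measurable
  have [measurable]: "min_frob \<in> borel_measurable borel"
    unfolding min_frob_def by measurable
  have inner: "(\<integral>\<^sup>+c. ennreal (1 / (cmod a)\<^sup>2) * (F (a + (1 + b * c) / a) *
      W ((cmod a)\<^sup>2 + (cmod b)\<^sup>2 + (cmod c)\<^sup>2 + (cmod ((1 + b * c) / a))\<^sup>2)) \<partial>lborel)
      = (\<integral>\<^sup>+d. F (a + d) * Q a b d \<partial>lborel)" if ab: "a \<noteq> 0" "b \<noteq> 0" for a b
  proof -
    have eq: "(1 + b * ((a * d - 1) / b)) / a = d" "a / b * d + - 1 / b = (a * d - 1) / b" for d
      using ab by (simp_all add: field_simps)
    have k: "ennreal ((cmod (a / b))\<^sup>2) * (ennreal (1 / (cmod a)\<^sup>2) * (x * y)) = x * (ennreal (1 / (cmod b)\<^sup>2) * y)" for x y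
    proof -
      have "ennreal ((cmod (a / b))\<^sup>2) * ennreal (1 / (cmod a)\<^sup>2) = ennreal (1 / (cmod b)\<^sup>2)"
        using ab by (simp add: norm_divide power_divide flip: ennreal_mult)
      then show ?thesis
        by (metis mult.assoc mult.left_commute)
    qed
    have ab0: "a / b \<noteq> 0"
      using ab by simp
    have "(\<integral>\<^sup>+c. ennreal (1 / (cmod a)\<^sup>2) * (F (a + (1 + b * c) / a) *
      W ((cmod a)\<^sup>2 + (cmod b)\<^sup>2 + (cmod c)\<^sup>2 + (cmod ((1 + b * c) / a))\<^sup>2)) \<partial>lborel)
      = ennreal ((cmod (a / b))\<^sup>2) * (\<integral>\<^sup>+d. ennreal (1 / (cmod a)\<^sup>2) * (F (a + d) *
      W ((cmod a)\<^sup>2 + (cmod b)\<^sup>2 + (cmod ((a * d - 1) / b))\<^sup>2 + (cmod d)\<^sup>2)) \<partial>lborel)"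
      by (subst nn_integral_affine_complex[OF ab0, where d="- 1 / b"], measurable) (simp only: eq)
    also have "\<dots> = (\<integral>\<^sup>+d. ennreal ((cmod (a / b))\<^sup>2) * (ennreal (1 / (cmod a)\<^sup>2) * (F (a + d) *
      W ((cmod a)\<^sup>2 + (cmod b)\<^sup>2 + (cmod ((a * d - 1) / b))\<^sup>2 + (cmod d)\<^sup>2))) \<partial>lborel)"
      by (rule nn_integral_cmult[symmetric]) measurable
    also have "\<dots> = (\<integral>\<^sup>+d. F (a + d) * Q a b d \<partial>lborel)"
      by (simp only: k Q_def)
    finally show ?thesis .
  qed
  have "(\<integral>\<^sup>+a. \<integral>\<^sup>+b. \<integral>\<^sup>+c. ennreal (1 / (cmod a)\<^sup>2) * (F (a + (1 + b * c) / a) *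
      W ((cmod a)\<^sup>2 + (cmod b)\<^sup>2 + (cmod c)\<^sup>2 + (cmod ((1 + b * c) / a))\<^sup>2)) \<partial>lborel \<partial>lborel \<partial>lborel)
    = (\<integral>\<^sup>+a. \<integral>\<^sup>+b. \<integral>\<^sup>+d. F (a + d) * Q a b d \<partial>lborel \<partial>lborel \<partial>lborel)"
  proof (rule nn_integral_cong_AE)
    have "(\<integral>\<^sup>+b. \<integral>\<^sup>+c. ennreal (1 / (cmod a)\<^sup>2) * (F (a + (1 + b * c) / a) *
        W ((cmod a)\<^sup>2 + (cmod b)\<^sup>2 + (cmod c)\<^sup>2 + (cmod ((1 + b * c) / a))\<^sup>2)) \<partial>lborel \<partial>lborel)
      = (\<integral>\<^sup>+b. \<integral>\<^sup>+d. F (a + d) * Q a b d \<partial>lborel \<partial>lborel)" if "a \<noteq> 0" for a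
      using AE_lborel_singleton[of "0::complex"]
      by (intro nn_integral_cong_AE) (auto elim!: eventually_mono simp: inner that)
    then show "AE a in lborel. (\<integral>\<^sup>+b. \<integral>\<^sup>+c. ennreal (1 / (cmod a)\<^sup>2) * (F (a + (1 + b * c) / a) *
        W ((cmod a)\<^sup>2 + (cmod b)\<^sup>2 + (cmod c)\<^sup>2 + (cmod ((1 + b * c) / a))\<^sup>2)) \<partial>lborel \<partial>lborel)
      = (\<integral>\<^sup>+b. \<integral>\<^sup>+d. F (a + d) * Q a b d \<partial>lborel \<partial>lborel)"
      using AE_lborel_singleton[of "0::complex"] by (auto elim!: eventually_mono)
  qed
  also have "\<dots> = (\<integral>\<^sup>+b. \<integral>\<^sup>+a. \<integral>\<^sup>+d. F (a + d) * Q a b d \<partial>lborel \<partial>lborel \<partial>lborel)"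
    by (rule lborel_pair.Fubini') measurable
  also have "\<dots> = (\<integral>\<^sup>+b. \<integral>\<^sup>+d. \<integral>\<^sup>+a. F (a + d) * Q a b d \<partial>lborel \<partial>lborel \<partial>lborel)"
    by (intro nn_integral_cong lborel_pair.Fubini') measurable
  also have "\<dots> = (\<integral>\<^sup>+b. \<integral>\<^sup>+d. \<integral>\<^sup>+w. F w * Q (w - d) b d \<partial>lborel \<partial>lborel \<partial>lborel)"
  proof (rule nn_integral_cong, rule nn_integral_cong)
    fix b d :: complex
    show "(\<integral>\<^sup>+a. F (a + d) * Q a b d \<partial>lborel) = (\<integral>\<^sup>+w. F w * Q (w - d) b d \<partial>lborel)"
      by (subst nn_integral_affine_complex[where c=1 and d="- d"]) simp_all
  qed
  also have "\<dots> = (\<integral>\<^sup>+b. \<integral>\<^sup>+w. \<integral>\<^sup>+d. F w * Q (w - d) b d \<partial>lborel \<partial>lborel \<partial>lborel)"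
    by (intro nn_integral_cong lborel_pair.Fubini') measurable
  also have "\<dots> = (\<integral>\<^sup>+w. \<integral>\<^sup>+b. \<integral>\<^sup>+d. F w * Q (w - d) b d \<partial>lborel \<partial>lborel \<partial>lborel)"
    by (rule lborel_pair.Fubini') measurable
  also have "\<dots> = (\<integral>\<^sup>+w. F w * (\<integral>\<^sup>+b. \<integral>\<^sup>+d. Q (w - d) b d \<partial>lborel \<partial>lborel) \<partial>lborel)"
    by (simp add: nn_integral_cmult)
  also have "\<dots> = (\<integral>\<^sup>+w. F w * (ennreal (pi\<^sup>2) * (\<integral>\<^sup>+s. W s * indicator {min_frob w<..} s \<partial>lborel)) \<partial>lborel)"
    unfolding Q_def by (simp only: nn_integral_conjugacy_class[OF \<open>W \<in> borel_measurable borel\<close>])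
  also have "\<dots> = ennreal (pi\<^sup>2) * (\<integral>\<^sup>+w. F w * (\<integral>\<^sup>+s. W s * indicator {min_frob w<..} s \<partial>lborel) \<partial>lborel)"
    unfolding mult.left_commute[of "F _" "ennreal (pi\<^sup>2)"] by (rule nn_integral_cmult, measurable, simp)
  finally show ?thesis .
qed

section \<open>Polar decomposition and the weight\<close>

definition sinhc :: "real \<Rightarrow> real" where
  "sinhc y = (if y = 0 then 1 else sinh y / y)"

lemma sinhc_pos: "sinhc y > 0"
  by (cases y "0::real" rule: linorder_cases) (auto simp: sinhc_def divide_neg_neg)

lemma borel_measurable_sinhc [measurable]: "sinhc \<in> borel_measurable borel"
proof -
  have "sinh \<in> borel_measurable (borel :: real measure)"
    by (intro borel_measurable_continuous_onI continuous_intros)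
  note [measurable] = this
  show ?thesis
    unfolding sinhc_def by measurable
qed

lemma mult_sinhc: "y * sinhc y = sinh y"
  by (simp add: sinhc_def)

lemma sinhc_sums: "(\<lambda>m. y ^ (2 * m) / fact (2 * m + 1)) sums sinhc y"
proof (cases "y = 0")
  case True
  have "(\<lambda>m. y ^ (2 * m) / fact (2 * m + 1)) = (\<lambda>m. if m = 0 then 1 else 0 :: real)"
    using True by (auto simp: fun_eq_iff)
  then show ?thesis
    using sums_single[of 0 "\<lambda>_. 1 :: real"] True by (simp add: sinhc_def)
next
  case False
  let ?f = "\<lambda>n. if even n then 0 else y ^ n /\<^sub>R fact n"
  have "(\<lambda>m. ?f (2 * m + 1)) sums sinh y"
    using sinh_converges[of y]
    by (subst sums_mono_reindex) (auto simp: strict_mono_def elim!: oddE)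
  from sums_divide[OF this, of y] have "(\<lambda>m. ?f (2 * m + 1) / y) sums sinhc y"
    using False by (simp only: sinhc_def if_False)
  moreover have "?f (2 * m + 1) / y = y ^ (2 * m) / fact (2 * m + 1)" for m
    using False by (simp add: field_simps del: fact_Suc)
  ultimately show ?thesis
    by (simp only: )
qed

section \<open>Exponentials of 2 by 2 matrices with scalar square\<close>

lemma mat_mult_mat_left: "mat c ** A = (\<chi> i j. c * A $ i $ j)"
  for A :: "'a::comm_semiring_1^'n^'m::finite"
  by (simp add: vec_eq_iff matrix_matrix_mult_def mat_def if_distrib[where f="\<lambda>x. x * _"] cong: if_cong)

lemma mat_mult_mat: "mat a ** mat b = (mat (a * b) :: 'a::comm_semiring_1^'n^'n)"
  unfolding mat_mult_mat_left by (simp add: vec_eq_iff mat_def)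

lemma scaleR_mat: "r *\<^sub>R (mat c :: complex^'n^'n) = mat (of_real r * c)"
  by (simp add: vec_eq_iff mat_def scaleR_conv_of_real[where 'a=complex])

lemma of_real_cmod_sq: "(of_real (cmod z))\<^sup>2 = z * cnj z"
  by (metis complex_norm_square of_real_power)

lemma matpow_Suc: "matpow A (Suc m) = A ** matpow A m"
  by (simp add: matpow_def)

lemma matpow_0: "matpow A 0 = mat 1"
  by (simp add: matpow_def)

text \<open>Even powers of \<open>H\<close> are scalar and odd powers are multiples of
  \<open>H\<close>, so the exponential series splits into those of cosh y and sinh y / y. Writing
  the latter as \<open>sinhc\<close> includes y = 0.\<close>

lemma mexp_eq:
  assumes H: "H ** H = mat (of_real (y\<^sup>2))"
  shows "mexp H = cosh y *\<^sub>R mat 1 + sinhc y *\<^sub>R H"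
proof -
  have even: "matpow H (2 * m) = (y ^ (2 * m)) *\<^sub>R mat 1" for m
  proof (induction m)
    case (Suc m)
    have "matpow H (2 * Suc m) = (H ** H) ** matpow H (2 * m)"
      by (simp add: matpow_Suc matrix_mul_assoc)
    then show ?case
      by (simp add: H Suc scaleR_mat mat_mult_mat power2_eq_square mult.assoc)
  qed (simp add: matpow_0)
  have odd: "matpow H (2 * m + 1) = (y ^ (2 * m)) *\<^sub>R H" for m
    by (simp add: matpow_Suc even matrix_matrix_mult_def vec_eq_iff mat_def sum_2 forall_2)
  let ?a = "\<lambda>m. if even m then y ^ m /\<^sub>R fact m else 0"
  let ?b = "\<lambda>m. if even m then 0 else y ^ (m - 1) / fact m"
  have "(\<lambda>m. ?b (2 * m + 1)) sums sinhc y"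
    using sinhc_sums[of y] by simp
  then have b: "?b sums sinhc y"
    by (subst (asm) sums_mono_reindex) (auto simp: strict_mono_def elim!: oddE)
  have "(\<lambda>m. ?a m *\<^sub>R mat 1 + ?b m *\<^sub>R H) sums (cosh y *\<^sub>R mat 1 + sinhc y *\<^sub>R H)"
    by (intro sums_add bounded_linear.sums[OF bounded_linear_scaleR_left] cosh_converges b)
  moreover have "?a m *\<^sub>R mat 1 + ?b m *\<^sub>R H = (1 / fact m) *\<^sub>R matpow H m" for m
  proof (cases "even m")
    case True
    then obtain k where "m = 2 * k"
      by (elim evenE)
    then show ?thesis
      by (simp add: even divide_inverse)
  next
    case False
    then obtain k where "m = 2 * k + 1"
      by (elim oddE)
    then show ?thesis
      using odd[of k] by (simp add: divide_inverse)
  qed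
  ultimately show ?thesis
    unfolding mexp_def by (simp add: sums_iff)
qed

section \<open>Polar decomposition of SL(2,C)\<close>

definition frob :: "complex^2^2 \<Rightarrow> real" where
  "frob g = (\<Sum>i\<in>UNIV. \<Sum>j\<in>UNIV. (cmod (g $ i $ j))\<^sup>2)"

text \<open>If \<open>s\<close> is the squared Frobenius norm of g in SL(2,C), the singular values
  of g are exp r and exp (- r) with r = \<open>radius s\<close>, since s = 2 cosh (2 r).\<close>

definition radius :: "real \<Rightarrow> real" where
  "radius s = arcosh (s / 2) / 2"

lemma cosh_radius: "s \<ge> 2 \<Longrightarrow> 2 * cosh (2 * radius s) = s"
  by (simp add: radius_def)

lemma radius_nonneg: "s \<ge> 2 \<Longrightarrow> radius s \<ge> 0"
  by (simp add: radius_def)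

lemma radius_cosh: "y \<ge> 0 \<Longrightarrow> radius (2 * cosh (2 * y)) = y"
  by (simp add: radius_def arcosh_cosh_real)

lemma cadjoint_mult: "cadjoint (A ** B) = cadjoint B ** cadjoint A"
  by (simp add: cadjoint_def matrix_matrix_mult_def vec_eq_iff sum_2 mult.commute)

lemma cadjoint_nth: "cadjoint A $ i $ j = cnj (A $ j $ i)"
  by (simp add: cadjoint_def)

text \<open>The matrix iY is Hermitian and traceless, so by Cayley-Hamilton its square is the scalar
  - det (iY), a sum of two squared moduli.\<close>

lemma su2_iY_sq:
  assumes "Y \<in> su2"
  shows "(mat \<i> ** Y) ** (mat \<i> ** Y) = mat (of_real ((cmod (Y$1$1))\<^sup>2 + (cmod (Y$1$2))\<^sup>2))"
    "cadjoint (mat \<i> ** Y) = mat \<i> ** Y" "trace (mat \<i> ** Y) = 0"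
    "trace (Y ** Y) = - of_real (2 * ((cmod (Y$1$1))\<^sup>2 + (cmod (Y$1$2))\<^sup>2))"
proof -
  have h: "cnj (Y$1$1) = - Y$1$1" "cnj (Y$1$2) = - Y$2$1" "cnj (Y$2$1) = - Y$1$2" "Y$2$2 = - Y$1$1"
    using assms by (auto simp: su2_def vec_eq_iff forall_2 cadjoint_nth trace_def sum_2 add_eq_0_iff)
  have h': "Y$2$1 = - cnj (Y$1$2)"
    using h by (metis complex_cnj_minus complex_cnj_cnj)
  have n: "of_real ((cmod (Y$1$1))\<^sup>2 + (cmod (Y$1$2))\<^sup>2) = - (Y$1$1 * Y$1$1) + Y$1$2 * cnj (Y$1$2)"
    by (simp add: of_real_cmod_sq h)
  show "(mat \<i> ** Y) ** (mat \<i> ** Y) = mat (of_real ((cmod (Y$1$1))\<^sup>2 + (cmod (Y$1$2))\<^sup>2))"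
    unfolding n mat_mult_mat_left
    by (simp add: vec_eq_iff forall_2 matrix_matrix_mult_def sum_2 mat_def h(4) h' algebra_simps)
  show "cadjoint (mat \<i> ** Y) = mat \<i> ** Y" "trace (mat \<i> ** Y) = 0"
    unfolding mat_mult_mat_left
    by (simp_all add: vec_eq_iff forall_2 cadjoint_nth trace_def sum_2 h)
  have "trace (Y ** Y) = - 2 * of_real ((cmod (Y$1$1))\<^sup>2 + (cmod (Y$1$2))\<^sup>2)"
    unfolding n by (simp add: trace_def matrix_matrix_mult_def sum_2 h(4) h' algebra_simps)
  then show "trace (Y ** Y) = - of_real (2 * ((cmod (Y$1$1))\<^sup>2 + (cmod (Y$1$2))\<^sup>2))"
    by simp
qed

lemma trace_cadjoint: "trace (cadjoint g ** g) = of_real (frob g)"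
  by (simp add: trace_def matrix_matrix_mult_def sum_2 cadjoint_nth frob_def of_real_cmod_sq mult.commute)

text \<open>Multiplication in the commutative algebra generated by a matrix with scalar square. It
  is used with q = y^2 for the polar part and with q = -1 for one-parameter subgroups of
  SU(2).\<close>

lemma mat_linear_mult:
  fixes H :: "complex^2^2"
  assumes H: "H ** H = mat (of_real q)"
  shows "(a *\<^sub>R mat 1 + b *\<^sub>R H) ** (c *\<^sub>R mat 1 + d *\<^sub>R H)
    = (a * c + b * d * q) *\<^sub>R mat 1 + (a * d + b * c) *\<^sub>R H"
proof -
  have "(a *\<^sub>R mat 1 + b *\<^sub>R H) ** (c *\<^sub>R mat 1 + d *\<^sub>R H)
      = (a * c) *\<^sub>R mat 1 + (b * d) *\<^sub>R (H ** H) + (a * d + b * c) *\<^sub>R H"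
    by (simp add: vec_eq_iff forall_2 matrix_matrix_mult_def sum_2 mat_def scaleR_conv_of_real[where 'a=complex] algebra_simps)
  also have "\<dots> = (a * c + b * d * q) *\<^sub>R mat 1 + (a * d + b * c) *\<^sub>R H"
    unfolding H by (simp add: vec_eq_iff mat_def scaleR_conv_of_real[where 'a=complex] algebra_simps)
  finally show ?thesis .
qed

text \<open>Read through \<open>mexp_eq\<close>, these are exp H exp H = exp (2 H) and exp H exp (-
  H) = 1 in both orders; they reduce to the duplication formula and cosh^2 - sinh^2 = 1.\<close>

lemma polar_square:
  fixes H :: "complex^2^2"
  assumes H: "H ** H = mat (of_real (y\<^sup>2))"
  shows "(cosh y *\<^sub>R mat 1 + sinhc y *\<^sub>R H) ** (cosh y *\<^sub>R mat 1 + sinhc y *\<^sub>R H)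
    = cosh (2 * y) *\<^sub>R mat 1 + (2 * cosh y * sinhc y) *\<^sub>R H" (is ?A)
    and "(cosh y *\<^sub>R mat 1 + sinhc y *\<^sub>R H) ** (cosh y *\<^sub>R mat 1 + (- sinhc y) *\<^sub>R H) = mat 1" (is ?B)
    and "(cosh y *\<^sub>R mat 1 + (- sinhc y) *\<^sub>R H) ** (cosh y *\<^sub>R mat 1 + sinhc y *\<^sub>R H) = mat 1" (is ?C)
proof -
  have s: "sinhc y * sinhc y * y\<^sup>2 = (sinh y)\<^sup>2"
    by (simp add: mult_sinhc[of y, symmetric] power2_eq_square mult_ac)
  have 1: "cosh y * cosh y + sinhc y * sinhc y * y\<^sup>2 = cosh (2 * y)"
    unfolding s by (simp add: cosh_double power2_eq_square)
  have 2: "cosh y * cosh y + sinhc y * - sinhc y * y\<^sup>2 = 1" "cosh y * cosh y + - sinhc y * sinhc y * y\<^sup>2 = 1"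
    using s hyperbolic_pythagoras[of y] by (simp_all add: power2_eq_square)
  show ?A
    unfolding mat_linear_mult[OF H] 1 by (simp add: algebra_simps)
  show ?B ?C
    unfolding mat_linear_mult[OF H] 2 by (simp_all add: algebra_simps)
qed

text \<open>From 1 = |det g| and the inequality of arithmetic and geometric means. It keeps
  \<open>radius\<close> in the range where arcosh inverts cosh.\<close>

lemma frob_ge_2:
  assumes "g \<in> SL2C"
  shows "frob g \<ge> 2"
proof -
  have "g$1$1 * g$2$2 = 1 + g$1$2 * g$2$1"
    using assms by (simp add: SL2C_def det_2 algebra_simps)
  then have "1 = cmod (g$1$1 * g$2$2 - g$1$2 * g$2$1)"
    by simp
  also have "\<dots> \<le> cmod (g$1$1) * cmod (g$2$2) + cmod (g$1$2) * cmod (g$2$1)"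
    by (rule order_trans[OF norm_triangle_ineq4]) (simp add: norm_mult)
  also have "\<dots> \<le> frob g / 2"
    using sum_squares_bound[of "cmod (g$1$1)" "cmod (g$2$2)"] sum_squares_bound[of "cmod (g$1$2)" "cmod (g$2$1)"]
    by (simp add: frob_def sum_2)
  finally show ?thesis
    by simp
qed

lemma cadjoint_linear: "cadjoint (a *\<^sub>R mat 1 + b *\<^sub>R H) = a *\<^sub>R mat 1 + b *\<^sub>R cadjoint H"
  by (simp add: vec_eq_iff cadjoint_nth mat_def)

text \<open>Because x is unitary, the adjoint of g times g is exp (2 i Y). Its trace determines the
  length of Y, and its traceless part then determines Y.\<close>

lemma polar_unique:
  assumes Y: "Y \<in> su2" and x: "x \<in> SU2" and g: "g = x ** mexp (mat \<i> ** Y)"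
  shows "cadjoint g ** g = (frob g / 2) *\<^sub>R mat 1
      + (2 * cosh (radius (frob g)) * sinhc (radius (frob g))) *\<^sub>R (mat \<i> ** Y)"
    and "(cmod (Y$1$1))\<^sup>2 + (cmod (Y$1$2))\<^sup>2 = (radius (frob g))\<^sup>2"
proof -
  define H where "H = mat \<i> ** Y"
  define y where "y = sqrt ((cmod (Y$1$1))\<^sup>2 + (cmod (Y$1$2))\<^sup>2)"
  have y: "y\<^sup>2 = (cmod (Y$1$1))\<^sup>2 + (cmod (Y$1$2))\<^sup>2" "y \<ge> 0"
    by (simp_all add: y_def)
  have H: "H ** H = mat (of_real (y\<^sup>2))" "cadjoint H = H" "trace H = 0"
    using su2_iY_sq[OF Y] by (simp_all add: H_def y)
  have "cadjoint g ** g = cadjoint (mexp H) ** (cadjoint x ** x) ** mexp H"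
    by (simp add: g H_def cadjoint_mult matrix_mul_assoc)
  also have "\<dots> = cosh (2 * y) *\<^sub>R mat 1 + (2 * cosh y * sinhc y) *\<^sub>R H"
    using x by (simp add: SU2_def mexp_eq[OF H(1)] cadjoint_linear H(2) polar_square(1)[OF H(1)])
  finally have P: "cadjoint g ** g = cosh (2 * y) *\<^sub>R mat 1 + (2 * cosh y * sinhc y) *\<^sub>R H" .
  have "trace (cosh (2 * y) *\<^sub>R mat 1 + (2 * cosh y * sinhc y) *\<^sub>R H) = of_real (2 * cosh (2 * y)) + of_real (2 * cosh y * sinhc y) * trace H"
    by (simp add: trace_def sum_2 mat_def scaleR_conv_of_real[where 'a=complex] algebra_simps)
  then have "complex_of_real (frob g) = of_real (2 * cosh (2 * y))"
    unfolding P[symmetric] trace_cadjoint H(3) by simp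
  then have f: "frob g = 2 * cosh (2 * y)"
    using of_real_eq_iff by blast
  have r: "radius (frob g) = y"
    unfolding f by (rule radius_cosh) (rule y)
  show "cadjoint g ** g = (frob g / 2) *\<^sub>R mat 1
      + (2 * cosh (radius (frob g)) * sinhc (radius (frob g))) *\<^sub>R (mat \<i> ** Y)"
    unfolding r P H_def[symmetric] by (simp add: f)
  show "(cmod (Y$1$1))\<^sup>2 + (cmod (Y$1$2))\<^sup>2 = (radius (frob g))\<^sup>2"
    by (simp add: r y)
qed

text \<open>Take the square root of P, the adjoint of g times g, in the form exp H, and set x = g
  exp (- H).\<close>

lemma polar_exists:
  assumes g: "g \<in> SL2C"
  shows "\<exists>Y\<in>su2. \<exists>x\<in>SU2. g = x ** mexp (mat \<i> ** Y)"
proof -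
  define y where "y = radius (frob g)"
  have y: "2 * cosh (2 * y) = frob g" "y \<ge> 0"
    using frob_ge_2[OF g] by (simp_all add: y_def cosh_radius radius_nonneg)
  define k where "k = 2 * cosh y * sinhc y"
  have k: "k > 0"
    by (simp add: k_def sinhc_pos)
  define P where "P = cadjoint g ** g"
  have Pa: "cadjoint P = P"
    by (simp add: P_def vec_eq_iff cadjoint_nth matrix_matrix_mult_def sum_2 mult.commute)
  then have P12: "cnj (P$1$2) = P$2$1" "cnj (P$2$1) = P$1$2" "cnj (P$1$1) = P$1$1" "cnj (P$2$2) = P$2$2"
    by (auto simp: vec_eq_iff forall_2 cadjoint_nth)
  have "det (cadjoint g) = cnj (det g)"
    by (simp add: det_2 cadjoint_nth)
  then have dP: "P$1$1 * P$2$2 - P$1$2 * P$2$1 = 1"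
    using g by (simp add: P_def SL2C_def det_mul flip: det_2)
  have tP: "P$1$1 + P$2$2 = of_real (2 * cosh (2 * y))"
    using trace_cadjoint[of g] unfolding y by (simp add: P_def trace_def sum_2)
  \<comment> \<open>The only possible choice: the formula of \<open>polar_unique\<close> solved for
    iY.\<close>
  define H where "H = (1 / k) *\<^sub>R (P - cosh (2 * y) *\<^sub>R mat 1)"
  define Y where "Y = mat (- \<i>) ** H"
  have iY: "mat \<i> ** Y = H"
    by (simp add: Y_def matrix_mul_assoc mat_mult_mat)
  have H': "H$1$1 = (P$1$1 - of_real (cosh (2 * y))) / of_real k" "H$1$2 = P$1$2 / of_real k"
    "H$2$1 = P$2$1 / of_real k" "H$2$2 = (P$2$2 - of_real (cosh (2 * y))) / of_real k"
    by (simp_all add: H_def mat_def scaleR_conv_of_real[where 'a=complex] divide_inverse mult_ac)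
  have "P$2$2 - of_real (cosh (2 * y)) = - (P$1$1 - of_real (cosh (2 * y)))"
    using tP by (simp add: algebra_simps)
  then have H22: "H$2$2 = - H$1$1"
    unfolding H' by (simp add: minus_divide_left)
  have Hc: "cnj (H$1$1) = H$1$1" "cnj (H$1$2) = H$2$1" "cnj (H$2$1) = H$1$2"
    unfolding H' by (simp_all add: P12)
  have Y: "Y \<in> su2"
    by (simp add: su2_def Y_def mat_mult_mat_left vec_eq_iff forall_2 cadjoint_nth H22 Hc trace_def sum_2)
  have HH: "H ** H = mat (of_real (y\<^sup>2))"
  proof -
    have "k\<^sup>2 * y\<^sup>2 = (2 * cosh y * sinh y)\<^sup>2"
      by (simp add: k_def mult_sinhc[of y, symmetric] power_mult_distrib)
    also have "\<dots> = (sinh (2 * y))\<^sup>2"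
      unfolding sinh_double by (simp add: mult_ac)
    also have "\<dots> = (cosh (2 * y))\<^sup>2 - 1"
      using hyperbolic_pythagoras[of "2 * y"] by simp
    finally have "y\<^sup>2 = ((cosh (2 * y))\<^sup>2 - 1) / k\<^sup>2"
      using k by (simp add: field_simps)
    then have "of_real (y\<^sup>2) = (of_real (((cosh (2 * y))\<^sup>2 - 1) / k\<^sup>2) :: complex)"
      by (rule arg_cong)
    then have y2: "of_real (y\<^sup>2) = ((complex_of_real (cosh (2 * y)))\<^sup>2 - 1) / (of_real k)\<^sup>2"
      by simp
    \<comment> \<open>Cayley-Hamilton for P, which has trace 2 C and determinant 1: the square of P
      - C is the scalar C^2 - 1. The four equations are its entries.\<close>
    have e: "(P$1$1 - C) * (P$1$1 - C) + P$1$2 * P$2$1 = C\<^sup>2 - 1" "P$2$1 * P$1$2 + (P$2$2 - C) * (P$2$2 - C) = C\<^sup>2 - 1"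
      "(P$1$1 - C) * P$1$2 + P$1$2 * (P$2$2 - C) = 0" "P$2$1 * (P$1$1 - C) + (P$2$2 - C) * P$2$1 = 0"
      if "C = of_real (cosh (2 * y))" for C
    proof -
      have "P$2$2 = 2 * C - P$1$1"
        using tP that by (simp add: algebra_simps)
      with dP show "(P$1$1 - C) * (P$1$1 - C) + P$1$2 * P$2$1 = C\<^sup>2 - 1" "P$2$1 * P$1$2 + (P$2$2 - C) * (P$2$2 - C) = C\<^sup>2 - 1"
        "(P$1$1 - C) * P$1$2 + P$1$2 * (P$2$2 - C) = 0" "P$2$1 * (P$1$1 - C) + (P$2$2 - C) * P$2$1 = 0"
        by algebra+
    qed
    show ?thesis
      unfolding y2 using e[OF refl]
      by (simp add: vec_eq_iff forall_2 matrix_matrix_mult_def sum_2 mat_def H' power2_eq_square add_divide_distrib[symmetric])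
  qed
  define E where "E = mexp (mat \<i> ** Y)"
  \<comment> \<open>This is exp (- H), the inverse of E.\<close>
  define E' where "E' = cosh y *\<^sub>R mat 1 + (- sinhc y) *\<^sub>R H"
  have Eq: "E = cosh y *\<^sub>R mat 1 + sinhc y *\<^sub>R H"
    by (simp add: E_def iY mexp_eq[OF HH])
  have EE: "E ** E = P"
    unfolding Eq polar_square(1)[OF HH] k_def[symmetric] using k by (simp add: H_def)
  have inv: "E ** E' = mat 1" "E' ** E = mat 1"
    unfolding Eq E'_def using polar_square[OF HH] by auto
  have "cadjoint H = H"
    by (simp add: vec_eq_iff forall_2 cadjoint_nth H' P12)
  then have "cadjoint E' = E'"
    by (simp add: E'_def cadjoint_linear del: scaleR_minus_left)
  have "cadjoint (g ** E') ** (g ** E') = E' ** P ** E'"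
    by (simp add: cadjoint_mult P_def matrix_mul_assoc \<open>cadjoint E' = E'\<close>)
  also have "\<dots> = (E' ** E) ** (E ** E')"
    unfolding EE[symmetric] by (simp only: matrix_mul_assoc)
  finally have U: "cadjoint (g ** E') ** (g ** E') = mat 1"
    by (simp add: inv)
  have "det E' = 1"
  proof -
    have "det H = - of_real (y\<^sup>2)"
    proof -
      have "H$1$1 * H$1$1 + H$1$2 * H$2$1 = of_real (y\<^sup>2)"
        using HH by (auto simp: vec_eq_iff forall_2 matrix_matrix_mult_def sum_2 mat_def)
      then show ?thesis
        by (simp add: det_2 H22 algebra_simps)
    qed
    moreover have "trace H = 0"
      by (simp add: trace_def sum_2 H22)
    moreover have "det E' = (of_real (cosh y))\<^sup>2 - of_real (cosh y) * of_real (sinhc y) * trace H + (of_real (sinhc y))\<^sup>2 * det H"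
      by (simp add: E'_def det_2 trace_def sum_2 mat_def scaleR_conv_of_real[where 'a=complex] power2_eq_square algebra_simps)
    ultimately have "det E' = of_real ((cosh y)\<^sup>2 - (y * sinhc y)\<^sup>2)"
      by (simp add: power_mult_distrib mult.commute)
    then show ?thesis
      using hyperbolic_pythagoras[of y] by (simp add: mult_sinhc)
  qed
  then have "g ** E' \<in> SU2"
    using U g by (simp add: SU2_def det_mul SL2C_def)
  moreover have "g = g ** E' ** E"
    by (simp add: matrix_mul_assoc[symmetric] inv)
  ultimately show ?thesis
    using Y unfolding E_def by blast
qed

text \<open>The description \<open>polar_Y\<close> denotes because \<open>polar_unique\<close>
  recovers Y from g: the coefficient k is positive and multiplication by \<i> is invertible.\<close>

lemma polar_Y:
  assumes g: "g \<in> SL2C"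
  shows "polar_Y g \<in> su2"
    and "(cmod (polar_Y g$1$1))\<^sup>2 + (cmod (polar_Y g$1$2))\<^sup>2 = (radius (frob g))\<^sup>2"
proof -
  define k where "k = 2 * cosh (radius (frob g)) * sinhc (radius (frob g))"
  have k: "k > 0"
    by (simp add: k_def sinhc_pos)
  have "\<exists>!Y. Y \<in> su2 \<and> (\<exists>x\<in>SU2. g = x ** mexp (mat \<i> ** Y))"
  proof (rule ex_ex1I)
    show "\<exists>Y. Y \<in> su2 \<and> (\<exists>x\<in>SU2. g = x ** mexp (mat \<i> ** Y))"
      using polar_exists[OF g] by blast
  next
    fix Y Y'
    assume "Y \<in> su2 \<and> (\<exists>x\<in>SU2. g = x ** mexp (mat \<i> ** Y))" "Y' \<in> su2 \<and> (\<exists>x\<in>SU2. g = x ** mexp (mat \<i> ** Y'))"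
    then have "k *\<^sub>R (mat \<i> ** Y) = k *\<^sub>R (mat \<i> ** Y')"
      using polar_unique(1)[of _ _ g] unfolding k_def by (metis add_left_cancel)
    then have "mat (- \<i>) ** (mat \<i> ** Y) = mat (- \<i>) ** (mat \<i> ** Y')"
      using k by simp
    then show "Y = Y'"
      by (simp add: matrix_mul_assoc mat_mult_mat)
  qed
  from theI'[OF this] have "polar_Y g \<in> su2 \<and> (\<exists>x\<in>SU2. g = x ** mexp (mat \<i> ** polar_Y g))"
    unfolding polar_Y_def .
  then show "polar_Y g \<in> su2" "(cmod (polar_Y g$1$1))\<^sup>2 + (cmod (polar_Y g$1$2))\<^sup>2 = (radius (frob g))\<^sup>2"
    using polar_unique(2) by blast+
qed

lemma kappa_eq:
  assumes "g \<in> SL2C"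
  shows "kappa \<beta> g = (radius (frob g))\<^sup>2 / \<beta>\<^sup>2"
  unfolding kappa_def su2_inner_def su2_iY_sq(4)[OF polar_Y(1)[OF assms]] polar_Y(2)[OF assms]
  by simp

section \<open>The determinant of sin (ad Y) / ad Y\<close>

lemma ad_matrix_su2_of_vec:
  "ad_matrix (su2_of_vec v) = vector [vector [0, - 2 * v$3, 2 * v$2], vector [2 * v$3, 0, - 2 * v$1],
    vector [- 2 * v$2, 2 * v$1, 0]]"
  unfolding ad_matrix_def matrix_def
  by (simp add: vec_eq_iff forall_3 vec_of_su2_def ad_def su2_of_vec_def matrix_matrix_mult_def sum_2 axis_def)

lemma su2_of_vec_of_su2:
  assumes "Y \<in> su2"
  shows "su2_of_vec (vec_of_su2 Y) = Y"
proof -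
  have "cnj (Y$1$1) = - Y$1$1" "cnj (Y$1$2) = - Y$2$1" "Y$2$2 = - Y$1$1"
    using assms by (auto simp: su2_def vec_eq_iff forall_2 cadjoint_def trace_def sum_2 add_eq_0_iff)
  then show ?thesis
    by (simp add: vec_eq_iff forall_2 su2_of_vec_def vec_of_su2_def complex_eq_iff)
qed

lemma matrix_mult_scaleR_right: "A ** (c *\<^sub>R B) = c *\<^sub>R (A ** B)"
  for A :: "'a::real_algebra_1^'n^'m"
  by (simp add: vec_eq_iff matrix_matrix_mult_def scaleR_sum_right)

text \<open>The matrix \<open>A\<close> of \<open>ad Y\<close> is that of \<open>2 v \<times> -\<close>, hence \<open>A\<^sup>3 = -4 |v|\<^sup>2 A\<close> and the series for
  \<open>sin A / A\<close> collapses to a combination of \<open>1\<close> and \<open>A\<^sup>2\<close>.\<close>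

lemma det_sinc_ad:
  "det (sinc_matrix (ad_matrix (su2_of_vec v))) = (sinhc (2 * sqrt ((v$1)\<^sup>2 + (v$2)\<^sup>2 + (v$3)\<^sup>2)))\<^sup>2"
proof -
  define r where "r = (v$1)\<^sup>2 + (v$2)\<^sup>2 + (v$3)\<^sup>2"
  define y where "y = sqrt r"
  define A where "A = ad_matrix (su2_of_vec v)"
  have r0: "r \<ge> 0"
    by (simp add: r_def)
  have y2: "y\<^sup>2 = r"
    using r0 by (simp add: y_def)
  have AA: "A ** A = vector [vector [4 * ((v$1)\<^sup>2 - r), 4 * (v$1 * v$2), 4 * (v$1 * v$3)],
      vector [4 * (v$1 * v$2), 4 * ((v$2)\<^sup>2 - r), 4 * (v$2 * v$3)],
      vector [4 * (v$1 * v$3), 4 * (v$2 * v$3), 4 * ((v$3)\<^sup>2 - r)]]"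
    unfolding A_def ad_matrix_su2_of_vec r_def
    by (simp add: vec_eq_iff forall_3 matrix_matrix_mult_def sum_3 power2_eq_square)
  have "A ** (A ** A) = (- 4 * r) *\<^sub>R A"
    unfolding AA unfolding A_def ad_matrix_su2_of_vec
    by (simp add: vec_eq_iff forall_3 matrix_matrix_mult_def sum_3 power2_eq_square algebra_simps)
  then have AAA: "A ** (A ** (A ** A)) = (- 4 * r) *\<^sub>R (A ** A)"
    by (simp only: matrix_mult_scaleR_right)
  have pow: "matpow A (2 * Suc m) = ((- 4 * r) ^ m) *\<^sub>R (A ** A)" for m
  proof (induction m)
    case 0
    then show ?case
      by (simp add: matpow_Suc matpow_0 numeral_2_eq_2)
  next
    case (Suc m)
    have "matpow A (2 * Suc (Suc m)) = A ** (A ** matpow A (2 * Suc m))"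
      by (simp add: matpow_Suc)
    also have "\<dots> = (- 4 * r) ^ m *\<^sub>R (A ** (A ** (A ** A)))"
      unfolding Suc by (simp add: matrix_mult_scaleR_right)
    finally show ?case
      by (simp add: AAA)
  qed
  \<comment> \<open>The coefficient of A^2 in the term of index m. The term m = 0 is the identity
    matrix and is kept apart.\<close>
  define c where "c m = (if m = 0 then 0 else (- 1) ^ m * (- 4 * r) ^ (m - 1) / fact (2 * m + 1))" for m :: nat
  \<comment> \<open>Fixing the value of -4 r C instead of C covers r = 0 as well.\<close>
  obtain C where C: "c sums C" "- 4 * r * C = sinhc (2 * y) - 1"
  proof (cases "r = 0")
    case True
    \<comment> \<open>With r = 0 the term m = 1 survives because 0 ^ 0 = 1.\<close>
    have "c m = 0" if "m \<notin> {1}" for m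
      using that True by (auto simp: c_def)
    from sums_finite[of "{1}" c] this have "c sums (\<Sum>m\<in>{1}. c m)"
      by simp
    then show thesis
      using True by (intro that) (auto simp: y_def sinhc_def)
  next
    case False
    have "(\<lambda>m. (2 * y) ^ (2 * m) / fact (2 * m + 1) - (if m = 0 then 1 else 0)) sums (sinhc (2 * y) - 1)"
      by (intro sums_diff sinhc_sums sums_single[of 0 "\<lambda>_. 1 :: real", simplified])
    from sums_divide[OF this, of "- 4 * r"]
    have "(\<lambda>m. ((2 * y) ^ (2 * m) / fact (2 * m + 1) - (if m = 0 then 1 else 0)) / (- 4 * r)) sums ((sinhc (2 * y) - 1) / (- 4 * r))" .
    moreover have "((2 * y) ^ (2 * m) / fact (2 * m + 1) - (if m = 0 then 1 else 0)) / (- 4 * r) = c m" for m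
    proof (cases m)
      case (Suc k)
      have "(2 * y) ^ (2 * m) = (4 * r) ^ m"
        by (simp add: power_mult power_mult_distrib y2)
      also have "\<dots> = (- 1) ^ m * (- 4 * r) ^ m"
        unfolding power_mult_distrib[symmetric] by simp
      also have "(- 4 * r) ^ m = (- 4 * r) ^ k * (- 4 * r)"
        by (simp only: Suc power_Suc2)
      finally have "(2 * y) ^ (2 * m) = (- 1) ^ m * ((- 4 * r) ^ k * (- 4 * r))" .
      then show ?thesis
        using False by (simp add: c_def Suc del: fact_Suc power_Suc)
    qed (simp add: c_def)
    ultimately have "c sums ((sinhc (2 * y) - 1) / (- 4 * r))"
      by (simp only:)
    then show thesis
      using False by (intro that) auto
  qed
  have trm: "((- 1) ^ m / fact (2 * m + 1)) *\<^sub>R matpow A (2 * m) = (if m = 0 then mat 1 else 0) + c m *\<^sub>R (A ** A)" for m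
  proof (cases m)
    case (Suc k)
    show ?thesis
      using pow[of k] by (simp add: c_def Suc del: fact_Suc power_Suc)
  qed (simp add: c_def matpow_0)
  have "(\<lambda>m. (if m = 0 then mat 1 else 0) + c m *\<^sub>R (A ** A)) sums (mat 1 + C *\<^sub>R (A ** A))"
    by (intro sums_add bounded_linear.sums[OF bounded_linear_scaleR_left] C sums_single[of 0 "\<lambda>_. mat 1", simplified])
  then have "sinc_matrix A = mat 1 + C *\<^sub>R (A ** A)"
    unfolding sinc_matrix_def trm by (simp add: sums_iff)
  \<comment> \<open>Since A^2 = 4 (v v^T - r), the matrix has eigenvalue 1 on v and the double
    eigenvalue 1 - 4 r C on the plane orthogonal to v.\<close>
  moreover have "det (mat 1 + C *\<^sub>R (A ** A)) = (1 - 4 * r * C)\<^sup>2"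
  proof -
    have "det (vector [vector [p + a * x\<^sup>2, a * (x * y), a * (x * z)], vector [a * (x * y), p + a * y\<^sup>2, a * (y * z)],
        vector [a * (x * z), a * (y * z), p + a * z\<^sup>2]] :: real^3^3) = p\<^sup>2 * (p + a * (x\<^sup>2 + y\<^sup>2 + z\<^sup>2))" for p a x y z :: real
      by (simp add: det_3 power2_eq_square algebra_simps)
    from this[of "1 - 4 * r * C" "4 * C" "v$1" "v$2" "v$3"]
    have "det (vector [vector [1 - 4 * r * C + 4 * C * (v$1)\<^sup>2, 4 * C * (v$1 * v$2), 4 * C * (v$1 * v$3)],
        vector [4 * C * (v$1 * v$2), 1 - 4 * r * C + 4 * C * (v$2)\<^sup>2, 4 * C * (v$2 * v$3)],
        vector [4 * C * (v$1 * v$3), 4 * C * (v$2 * v$3), 1 - 4 * r * C + 4 * C * (v$3)\<^sup>2]] :: real^3^3) = (1 - 4 * r * C)\<^sup>2"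
      by (simp add: r_def[symmetric])
    moreover have "mat 1 + C *\<^sub>R (A ** A) = vector [vector [1 - 4 * r * C + 4 * C * (v$1)\<^sup>2, 4 * C * (v$1 * v$2), 4 * C * (v$1 * v$3)],
        vector [4 * C * (v$1 * v$2), 1 - 4 * r * C + 4 * C * (v$2)\<^sup>2, 4 * C * (v$2 * v$3)],
        vector [4 * C * (v$1 * v$3), 4 * C * (v$2 * v$3), 1 - 4 * r * C + 4 * C * (v$3)\<^sup>2]]"
      unfolding AA by (simp add: vec_eq_iff forall_3 mat_def algebra_simps)
    ultimately show ?thesis
      by simp
  qed
  moreover have "1 - 4 * r * C = sinhc (2 * y)"
    using C(2) by simp
  ultimately show ?thesis
    by (simp add: A_def y_def r_def)
qed

lemma eta_eq:
  assumes "g \<in> SL2C"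
  shows "eta g = sinhc (2 * radius (frob g))"
proof -
  define v where "v = vec_of_su2 (polar_Y g)"
  have Y: "polar_Y g = su2_of_vec v"
    using su2_of_vec_of_su2[OF polar_Y(1)[OF assms]] by (simp add: v_def)
  have "(v$1)\<^sup>2 + (v$2)\<^sup>2 + (v$3)\<^sup>2 = (radius (frob g))\<^sup>2"
    unfolding polar_Y(2)[OF assms, symmetric] Y by (simp add: su2_of_vec_def cmod_power2)
  moreover have "radius (frob g) \<ge> 0"
    using frob_ge_2[OF assms] by (simp add: radius_def)
  ultimately have "eta g = sqrt ((sinhc (2 * radius (frob g)))\<^sup>2)"
    by (simp add: eta_def Y det_sinc_ad)
  then show ?thesis
    using sinhc_pos[of "2 * radius (frob g)"] by simp
qed

lemma weight_eq:
  assumes "g \<in> SL2C"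
  shows "weight hbar \<beta> g = exp (- (radius (frob g))\<^sup>2 / (hbar * \<beta>\<^sup>2)) * sinhc (2 * radius (frob g))"
  by (simp add: weight_def kappa_eq[OF assms] eta_eq[OF assms] divide_divide_eq_left mult.commute)

section \<open>The Liouville density\<close>

text \<open>Each perfect matching of six points occurs 2^3 3! = 48 times. Instead of expanding 720
  terms, a permutation is factored into transpositions (0 b0) (1 b1) (2 b2) (3 b3) (4 b4) with b_i
  at least i, and the sums are evaluated from the innermost outwards.\<close>

lemma sum_permutations_pfaffian_6:
  fixes B :: "nat \<Rightarrow> nat \<Rightarrow> real"
  assumes skew: "\<And>i j. B j i = - B i j"
  defines "Pf \<equiv> B 0 1 * (B 2 3 * B 4 5 - B 2 4 * B 3 5 + B 2 5 * B 3 4)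
      - B 0 2 * (B 1 3 * B 4 5 - B 1 4 * B 3 5 + B 1 5 * B 3 4)
      + B 0 3 * (B 1 2 * B 4 5 - B 1 4 * B 2 5 + B 1 5 * B 2 4)
      - B 0 4 * (B 1 2 * B 3 5 - B 1 3 * B 2 5 + B 1 5 * B 2 3)
      + B 0 5 * (B 1 2 * B 3 4 - B 1 3 * B 2 4 + B 1 4 * B 2 3)"
  shows "(\<Sum>p | p permutes {..<6}. of_int (sign p) * (\<Prod>i<3. B (p (2 * i)) (p (2 * i + 1)))) = 48 * Pf"
proof -
  define h where "h p = of_int (sign p) * (\<Prod>i<3. B (p (2 * i)) (p (2 * i + 1)))" for p
  define t where "t a b = (Transposition.transpose a b :: nat \<Rightarrow> nat)" for a b
  define \<sigma> where "\<sigma> a b = (if a = b then 1 else - 1 :: real)" for a b :: nat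
  define m where "m x0 x1 x2 x3 x4 x5 = B x0 x1 * B x2 x3 * B x4 x5" for x0 x1 x2 x3 x4 x5
  have sg: "real_of_int (sign (t a b \<circ> q)) = \<sigma> a b * of_int (sign q)" if "permutation q" for a b q
    using that by (simp add: t_def \<sigma>_def sign_compose permutation_swap_id sign_swap_id)
  have perm: "permutation (t a b \<circ> q)" if "permutation q" for a b q
    using that by (simp add: t_def permutation_compose permutation_swap_id)
  have prod3: "(\<Prod>i<3. f i) = f 0 * (f (1::nat) * f 2)" for f :: "nat \<Rightarrow> real"
    by (simp add: numeral_3_eq_3 numeral_2_eq_2 lessThan_Suc mult_ac)
  define Q where "Q a b c d = B a b * B c d - B a c * B b d + B a d * B b c" for a b c d
  define P where "P x0 x1 x2 x3 x4 x5 = B x0 x1 * Q x2 x3 x4 x5 - B x0 x2 * Q x1 x3 x4 x5 + B x0 x3 * Q x1 x2 x4 x5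
      - B x0 x4 * Q x1 x2 x3 x5 + B x0 x5 * Q x1 x2 x3 x4" for x0 x1 x2 x3 x4 x5
  have tev: "t a b a = b" "t a b b = a" "c \<noteq> a \<Longrightarrow> c \<noteq> b \<Longrightarrow> t a b c = c" for a b c
    by (simp_all add: t_def)
  have h: "h (t 0 b0 \<circ> (t 1 b1 \<circ> (t 2 b2 \<circ> (t 3 b3 \<circ> (t 4 b4 \<circ> id)))))
      = \<sigma> 0 b0 * (\<sigma> 1 b1 * (\<sigma> 2 b2 * (\<sigma> 3 b3 * (\<sigma> 4 b4 *
        m (t 0 b0 (t 1 b1 (t 2 b2 (t 3 b3 (t 4 b4 0))))) (t 0 b0 (t 1 b1 (t 2 b2 (t 3 b3 (t 4 b4 1)))))
          (t 0 b0 (t 1 b1 (t 2 b2 (t 3 b3 (t 4 b4 2))))) (t 0 b0 (t 1 b1 (t 2 b2 (t 3 b3 (t 4 b4 3)))))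
          (t 0 b0 (t 1 b1 (t 2 b2 (t 3 b3 (t 4 b4 4))))) (t 0 b0 (t 1 b1 (t 2 b2 (t 3 b3 (t 4 b4 5)))))))))" for b0 b1 b2 b3 b4
    by (simp only: h_def m_def sg perm permutation_id sign_id prod3 o_apply id_apply mult_1_right of_int_1
        mult_zero_right mult_2_right one_add_one numeral_plus_one mult_numeral_1_right numeral_times_numeral semiring_norm
        add_0 mult_1 mult.assoc)
  \<comment> \<open>The sums at 4, 2 and 0 antisymmetrize an expression that is already alternating
    and contribute the factors 2, 4 and 6. Those at 3 and 1 assemble the Pfaffians \<open>Q\<close>
    of size 4 and \<open>P\<close> of size 6 by expansion along a row. The relabelling p allows each
    to be used under the outer transpositions.\<close>
  have A4: "(\<Sum>b\<in>{4,5}. \<sigma> 4 b * m (p (t 4 b 0)) (p (t 4 b 1)) (p (t 4 b 2)) (p (t 4 b 3)) (p (t 4 b 4)) (p (t 4 b 5)))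
      = 2 * m (p 0) (p 1) (p 2) (p 3) (p 4) (p 5)" for p
    using skew[of "p 4" "p 5"] by (simp add: tev \<sigma>_def m_def)
  have A3: "(\<Sum>b\<in>{3,4,5}. \<sigma> 3 b * (2 * m (p (t 3 b 0)) (p (t 3 b 1)) (p (t 3 b 2)) (p (t 3 b 3)) (p (t 3 b 4)) (p (t 3 b 5))))
      = 2 * (B (p 0) (p 1) * Q (p 2) (p 3) (p 4) (p 5))" for p
    using skew[of "p 3" "p 4"] by (simp add: tev \<sigma>_def m_def Q_def algebra_simps)
  have A2: "(\<Sum>b\<in>{2,3,4,5}. \<sigma> 2 b * (2 * (B (p (t 2 b 0)) (p (t 2 b 1)) * Q (p (t 2 b 2)) (p (t 2 b 3)) (p (t 2 b 4)) (p (t 2 b 5)))))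
      = 8 * (B (p 0) (p 1) * Q (p 2) (p 3) (p 4) (p 5))" for p
    using skew[of "p 2" "p 3"] skew[of "p 2" "p 4"] skew[of "p 2" "p 5"] skew[of "p 3" "p 4"] skew[of "p 3" "p 5"] skew[of "p 4" "p 5"]
    by (simp add: tev \<sigma>_def Q_def algebra_simps)
  have A1: "(\<Sum>b\<in>{1,2,3,4,5}. \<sigma> 1 b * (8 * (B (p (t 1 b 0)) (p (t 1 b 1)) * Q (p (t 1 b 2)) (p (t 1 b 3)) (p (t 1 b 4)) (p (t 1 b 5)))))
      = 8 * P (p 0) (p 1) (p 2) (p 3) (p 4) (p 5)" for p
    using skew[of "p 1" "p 2"] skew[of "p 1" "p 3"] skew[of "p 1" "p 4"] skew[of "p 2" "p 3"] skew[of "p 2" "p 4"] skew[of "p 3" "p 4"]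
      skew[of "p 1" "p 5"] skew[of "p 2" "p 5"] skew[of "p 3" "p 5"] skew[of "p 4" "p 5"]
    by (simp add: tev \<sigma>_def Q_def P_def algebra_simps)
  have A0: "(\<Sum>b\<in>{0,1,2,3,4,5}. \<sigma> 0 b * (8 * P (t 0 b 0) (t 0 b 1) (t 0 b 2) (t 0 b 3) (t 0 b 4) (t 0 b 5)))
      = 48 * P 0 1 2 3 4 5"
  proof -
    have "P x1 x0 x2 x3 x4 x5 = - P x0 x1 x2 x3 x4 x5" "P x2 x1 x0 x3 x4 x5 = - P x0 x1 x2 x3 x4 x5"
      "P x3 x1 x2 x0 x4 x5 = - P x0 x1 x2 x3 x4 x5" "P x4 x1 x2 x3 x0 x5 = - P x0 x1 x2 x3 x4 x5"
      "P x5 x1 x2 x3 x4 x0 = - P x0 x1 x2 x3 x4 x5" for x0 x1 x2 x3 x4 x5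
      using skew[of x0 x1] skew[of x0 x2] skew[of x0 x3] skew[of x0 x4] skew[of x0 x5]
        skew[of x1 x2] skew[of x1 x3] skew[of x1 x4] skew[of x1 x5] skew[of x2 x3] skew[of x2 x4] skew[of x2 x5]
        skew[of x3 x4] skew[of x3 x5] skew[of x4 x5]
      by (simp_all add: P_def Q_def algebra_simps)
    note this[of 1 0 2 3 4 5] this[of 2 1 0 3 4 5] this[of 3 1 2 0 4 5] this[of 4 1 2 3 0 5] this[of 5 1 2 3 4 0]
    then show ?thesis
      by (simp add: tev \<sigma>_def)
  qed
  define T where "T = {5::nat}"
  have S: "{..<6} = insert 0 (insert 1 (insert 2 (insert 3 (insert 4 T))))" and T: "finite T" "4 \<notin> T"
    "0 \<notin> T" "1 \<notin> T" "2 \<notin> T" "3 \<notin> T" "Suc 0 \<notin> T"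
    by (auto simp: T_def)
  have id: "(\<Sum>q | q permutes T. f q) = f id" for f :: "(nat \<Rightarrow> nat) \<Rightarrow> real"
    by (simp add: T_def)
  have "(\<Sum>p | p permutes {..<6}. h p) = (\<Sum>b0\<in>{0,1,2,3,4,5}. \<Sum>b1\<in>{1,2,3,4,5}. \<Sum>b2\<in>{2,3,4,5}. \<Sum>b3\<in>{3,4,5}. \<Sum>b4\<in>{4,5}.
      h (t 0 b0 \<circ> (t 1 b1 \<circ> (t 2 b2 \<circ> (t 3 b3 \<circ> (t 4 b4 \<circ> id))))))"
    unfolding S t_def
    by (subst sum_over_permutations_insert, simp add: T, simp add: T)+ (simp only: id, simp only: T_def)
  also have "\<dots> = 48 * P 0 1 2 3 4 5"
    unfolding h sum_distrib_left[symmetric]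
      A4[of "\<lambda>i. t 0 b0 (t 1 b1 (t 2 b2 (t 3 b3 i)))" for b0 b1 b2 b3]
      A3[of "\<lambda>i. t 0 b0 (t 1 b1 (t 2 b2 i))" for b0 b1 b2]
      A2[of "\<lambda>i. t 0 b0 (t 1 b1 i)" for b0 b1]
      A1[of "\<lambda>i. t 0 b0 i" for b0] A0 ..
  finally show ?thesis
    unfolding h_def P_def Q_def Pf_def .
qed

text \<open>A real differential written as A dz + B d(cnj z) displays both Wirtinger derivatives as
  its coefficients.\<close>

lemma wirtinger_linear:
  assumes "(f has_derivative (\<lambda>h. \<Sum>j\<in>UNIV. A j * h $ j + B j * cnj (h $ j))) (at z)"
  shows "wirtinger j f z = A j" "wirtinger_bar j f z = B j"
proof -
  have e: "axis i c $ j = (if j = i then c else 0)" for i j :: 3 and c :: complex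
    by (simp add: axis_def)
  have "(\<Sum>i\<in>UNIV. A i * axis j c $ i + B i * cnj (axis j c $ i)) = A j * c + B j * cnj c" for c
    by (simp add: e sum.distrib if_distrib[where f="\<lambda>x. _ * x"] if_distrib[where f=cnj] sum.delta cong: if_cong)
  then have "frechet_derivative f (at z) (axis j c) = A j * c + B j * cnj c" for c
    unfolding frechet_derivative_at[OF assms, symmetric] by simp
  then show "wirtinger j f z = A j" "wirtinger_bar j f z = B j"
    unfolding wirtinger_def wirtinger_bar_def by (simp_all add: algebra_simps)
qed

lemma wirtinger_bar_of_real:
  assumes "(f has_derivative (\<lambda>h. 2 * c * Re (\<Sum>j\<in>UNIV. q j * h $ j))) (at z)"
  shows "wirtinger_bar k (\<lambda>w. complex_of_real (f w)) z = of_real c * cnj (q k)"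
proof (rule wirtinger_linear)
  have "((\<lambda>w. complex_of_real (f w)) has_derivative (\<lambda>h. of_real (2 * c * Re (\<Sum>j\<in>UNIV. q j * h $ j)))) (at z)"
    by (rule bounded_linear.has_derivative[OF bounded_linear_of_real assms])
  moreover have "of_real (2 * c * Re u) = of_real c * u + of_real c * cnj u" for u
    by (simp add: complex_eq_iff)
  ultimately show "((\<lambda>w. complex_of_real (f w)) has_derivative
      (\<lambda>h. \<Sum>j\<in>UNIV. (of_real c * q j) * h $ j + (of_real c * cnj (q j)) * cnj (h $ j))) (at z)"
    by (simp only: cnj_sum sum_distrib_left sum.distrib complex_cnj_mult mult.assoc)
qed

section \<open>The complex Hessian of a function of the Frobenius norm\<close>

definition chart_d :: "complex^3 \<Rightarrow> complex" where
  "chart_d z = (1 + z$2 * z$3) / z$1"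

text \<open>The holomorphic gradient of the lower right entry \<open>chart_d\<close>.\<close>

definition chart_p :: "complex^3 \<Rightarrow> complex^3" where
  "chart_p z = vector [- chart_d z / z$1, z$3 / z$1, z$2 / z$1]"

text \<open>The vector of z-derivatives of \<open>chart_frob\<close>.\<close>

definition chart_q :: "complex^3 \<Rightarrow> complex^3" where
  "chart_q z = (\<chi> j. cnj (z$j) + cnj (chart_d z) * chart_p z $ j)"

definition chart_frob :: "complex^3 \<Rightarrow> real" where
  "chart_frob z = (cmod (z$1))\<^sup>2 + (cmod (z$2))\<^sup>2 + (cmod (z$3))\<^sup>2 + (cmod (chart_d z))\<^sup>2"

lemma frob_chart: "frob (sl2_chart z) = chart_frob z"
  by (simp add: frob_def chart_frob_def sl2_chart_def chart_d_def sum_2)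

lemma has_derivative_nth: "((\<lambda>z. z $ i) has_derivative (\<lambda>h. h $ i)) (at (z :: complex^3))"
  by (rule bounded_linear.has_derivative[OF bounded_linear_vec_nth has_derivative_ident])

lemma has_derivative_chart_d:
  assumes "z$1 \<noteq> 0"
  shows "(chart_d has_derivative (\<lambda>h. \<Sum>j\<in>UNIV. chart_p z $ j * h $ j)) (at z)"
proof -
  have "((\<lambda>z. (1 + z$2 * z$3) / z$1) has_derivative
      (\<lambda>h. - (1 + z$2 * z$3) * (inverse (z$1) * h$1 * inverse (z$1)) + (z$2 * h$3 + h$2 * z$3) / z$1)) (at z)"
    by (rule derivative_eq_intros has_derivative_nth assms refl)+ simp
  moreover have "chart_d = (\<lambda>z. (1 + z$2 * z$3) / z$1)"
    by (simp add: chart_d_def fun_eq_iff)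
  moreover have "(\<Sum>j\<in>UNIV. chart_p z $ j * h $ j)
      = - (1 + z$2 * z$3) * (inverse (z$1) * h$1 * inverse (z$1)) + (z$2 * h$3 + h$2 * z$3) / z$1" for h
    by (simp add: sum_3 chart_p_def chart_d_def divide_inverse algebra_simps)
  ultimately show ?thesis
    by simp
qed

lemma has_derivative_cmod_sq:
  assumes "(f has_derivative f') (at z)"
  shows "((\<lambda>z. (cmod (f z))\<^sup>2) has_derivative (\<lambda>h. 2 * Re (cnj (f z) * f' h))) (at z)"
  unfolding power2_norm_eq_inner using has_derivative_inner[OF assms assms]
  by (rule has_derivative_eq_rhs) (auto simp: fun_eq_iff inner_complex_def)

lemma has_derivative_chart_frob:
  assumes "z$1 \<noteq> 0"
  shows "(chart_frob has_derivative (\<lambda>h. 2 * Re (\<Sum>j\<in>UNIV. chart_q z $ j * h $ j))) (at z)"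
proof -
  have "((\<lambda>z. (cmod (z$1))\<^sup>2 + (cmod (z$2))\<^sup>2 + (cmod (z$3))\<^sup>2 + (cmod (chart_d z))\<^sup>2) has_derivative
      (\<lambda>h. 2 * Re (cnj (z$1) * h$1) + 2 * Re (cnj (z$2) * h$2) + 2 * Re (cnj (z$3) * h$3)
        + 2 * Re (cnj (chart_d z) * (\<Sum>j\<in>UNIV. chart_p z $ j * h $ j)))) (at z)"
    by (intro has_derivative_add has_derivative_cmod_sq has_derivative_nth has_derivative_chart_d assms)
  then have "(chart_frob has_derivative
      (\<lambda>h. 2 * Re (cnj (z$1) * h$1) + 2 * Re (cnj (z$2) * h$2) + 2 * Re (cnj (z$3) * h$3)
        + 2 * Re (cnj (chart_d z) * (\<Sum>j\<in>UNIV. chart_p z $ j * h $ j)))) (at z)"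
    by (simp add: chart_frob_def[abs_def])
  then show ?thesis
    by (rule has_derivative_eq_rhs) (simp add: fun_eq_iff sum_3 chart_q_def algebra_simps)
qed

text \<open>The gradient is left unspecified: of \<open>chart_p\<close> it only matters that its
  conjugate has no dz part.\<close>

definition complex_diff :: "(complex^3 \<Rightarrow> complex) \<Rightarrow> complex^3 \<Rightarrow> bool" where
  "complex_diff f z \<longleftrightarrow> (\<exists>r. (f has_derivative (\<lambda>h. \<Sum>j\<in>UNIV. r j * h $ j)) (at z))"

lemma complex_diff_nth: "complex_diff (\<lambda>z. z $ i) z"
  unfolding complex_diff_def
  by (rule exI[of _ "\<lambda>j. if j = i then 1 else 0"])
     (auto intro!: has_derivative_eq_rhs[OF has_derivative_nth] simp: fun_eq_iff if_distrib[where f="\<lambda>x. x * _"] sum.delta cong: if_cong)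

lemma complex_diff_divide:
  assumes "complex_diff f z" "complex_diff g z" "g z \<noteq> 0"
  shows "complex_diff (\<lambda>z. f z / g z) z"
proof -
  from assms obtain r t where "(f has_derivative (\<lambda>h. \<Sum>j\<in>UNIV. r j * h $ j)) (at z)"
    "(g has_derivative (\<lambda>h. \<Sum>j\<in>UNIV. t j * h $ j)) (at z)"
    unfolding complex_diff_def by blast
  from has_derivative_divide'[OF this \<open>g z \<noteq> 0\<close>]
  show ?thesis
    unfolding complex_diff_def
    by (intro exI[of _ "\<lambda>j. (r j * g z - f z * t j) / (g z * g z)"])
       (erule has_derivative_eq_rhs, use \<open>g z \<noteq> 0\<close> in \<open>simp add: fun_eq_iff sum_3 field_simps\<close>)
qed

lemma complex_diff_uminus: "complex_diff f z \<Longrightarrow> complex_diff (\<lambda>z. - f z) z"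
  unfolding complex_diff_def
  by (elim exE, rule_tac x="\<lambda>j. - r j" in exI, drule has_derivative_minus) (simp add: sum_3)

lemma complex_diff_chart_p:
  assumes "z$1 \<noteq> 0"
  shows "complex_diff (\<lambda>z. chart_p z $ k) z"
proof -
  have d: "complex_diff chart_d z"
    unfolding complex_diff_def using has_derivative_chart_d[OF assms] by blast
  have "complex_diff (\<lambda>z. - chart_d z / z$1) z" "complex_diff (\<lambda>z. z$3 / z$1) z" "complex_diff (\<lambda>z. z$2 / z$1) z"
    by (intro complex_diff_divide complex_diff_uminus complex_diff_nth d assms)+
  then show ?thesis
    using exhaust_3[of k] by (auto simp: chart_p_def)
qed

text \<open>Here \<open>\<phi>\<close> stands for the first derivative of a potential in s =
  \<open>chart_frob\<close> and \<open>\<psi>\<close> for the second, so this is the mixed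
  derivative of the potential. The last bracket is the mixed derivative of s itself; the conjugate
  of the holomorphic \<open>chart_p\<close> contributes nothing.\<close>

lemma wirtinger_potential:
  assumes z: "z$1 \<noteq> 0"
    and \<phi>: "(\<phi> has_real_derivative \<psi>) (at (chart_frob z))"
  shows "wirtinger j (\<lambda>w. of_real (\<phi> (chart_frob w)) * cnj (chart_q w $ k)) z
    = of_real \<psi> * (chart_q z $ j * cnj (chart_q z $ k))
      + of_real (\<phi> (chart_frob z)) * ((if j = k then 1 else 0) + chart_p z $ j * cnj (chart_p z $ k))"
proof -
  obtain r where r: "((\<lambda>z. chart_p z $ k) has_derivative (\<lambda>h. \<Sum>j\<in>UNIV. r j * h $ j)) (at z)"
    using complex_diff_chart_p[OF z] unfolding complex_diff_def by blast
  have 1: "((\<lambda>w. of_real (\<phi> (chart_frob w))) has_derivative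
      (\<lambda>h. complex_of_real (\<psi> * (2 * Re (\<Sum>j\<in>UNIV. chart_q z $ j * h $ j))))) (at z)"
    using has_derivative_compose[OF has_derivative_chart_frob[OF z], of \<phi> "(*) \<psi>"] \<phi>
    by (intro bounded_linear.has_derivative[OF bounded_linear_of_real]) (simp add: has_field_derivative_def)
  have q: "cnj (chart_q w $ k) = w$k + chart_d w * cnj (chart_p w $ k)" for w
    by (simp add: chart_q_def)
  have 2: "((\<lambda>w. cnj (chart_q w $ k)) has_derivative
      (\<lambda>h. h$k + (chart_d z * cnj (\<Sum>j\<in>UNIV. r j * h $ j) + (\<Sum>j\<in>UNIV. chart_p z $ j * h $ j) * cnj (chart_p z $ k)))) (at z)"
    unfolding q
    by (intro has_derivative_add has_derivative_nth has_derivative_mult has_derivative_chart_d z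
        bounded_linear.has_derivative[OF bounded_linear_cnj] r)
  let ?F = "\<lambda>j. of_real \<psi> * (chart_q z $ j * cnj (chart_q z $ k))
      + of_real (\<phi> (chart_frob z)) * ((if j = k then 1 else 0) + chart_p z $ j * cnj (chart_p z $ k))"
  let ?G = "\<lambda>j. of_real \<psi> * (cnj (chart_q z $ j) * cnj (chart_q z $ k)) + of_real (\<phi> (chart_frob z)) * (chart_d z * cnj (r j))"
  have re: "complex_of_real (\<psi> * (2 * Re u)) = of_real \<psi> * u + of_real \<psi> * cnj u" for u
    by (simp add: complex_eq_iff)
  have hk: "h $ k = (\<Sum>j\<in>UNIV. (if j = k then 1 else 0) * h $ j)" for h :: "complex^3"
    by (simp add: if_distrib[where f="\<lambda>x. x * _"] sum.delta cong: if_cong)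
  have "((\<lambda>w. of_real (\<phi> (chart_frob w)) * cnj (chart_q w $ k)) has_derivative
      (\<lambda>h. \<Sum>j\<in>UNIV. ?F j * h $ j + ?G j * cnj (h $ j))) (at z)"
  proof (rule has_derivative_eq_rhs[OF has_derivative_mult[OF 1 2]], rule ext)
    fix h :: "complex^3"
    show "of_real (\<phi> (chart_frob z)) *
       (h $ k + (chart_d z * cnj (\<Sum>j\<in>UNIV. r j * h $ j) + (\<Sum>j\<in>UNIV. chart_p z $ j * h $ j) * cnj (chart_p z $ k))) +
       complex_of_real (\<psi> * (2 * Re (\<Sum>j\<in>UNIV. chart_q z $ j * h $ j))) * cnj (chart_q z $ k)
       = (\<Sum>j\<in>UNIV. ?F j * h $ j + ?G j * cnj (h $ j))"
      unfolding re hk[of h]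
      by (simp add: cnj_sum sum_distrib_left sum_distrib_right sum.distrib algebra_simps)
  qed
  then show ?thesis
    by (rule wirtinger_linear)
qed

text \<open>The matrix determinant lemma applied twice to \<phi> (1 + p p'^T) + \<psi> q q'^T.
  Independent vectors in place of conjugates make this a polynomial identity.\<close>

lemma det_rank_two_update:
  fixes p p' q q' :: "'a::comm_ring_1^3"
  shows "det (\<chi> j k. \<psi> * (q$j * q'$k) + \<phi> * ((if j = k then 1 else 0) + p$j * p'$k) :: 'a^3^3)
    = \<phi> ^ 3 * (1 + (\<Sum>j\<in>UNIV. p$j * p'$j))
      + \<phi>\<^sup>2 * \<psi> * ((1 + (\<Sum>j\<in>UNIV. p$j * p'$j)) * (\<Sum>j\<in>UNIV. q$j * q'$j)
        - (\<Sum>j\<in>UNIV. p$j * q'$j) * (\<Sum>j\<in>UNIV. q$j * p'$j))"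
  by (simp add: det_3 sum_3 power2_eq_square power3_eq_cube algebra_simps)

text \<open>With P = 1 + |p|^2 and X the sum of p_j times the conjugate of q_j, the determinant
  involves only P and P |q|^2 - |X|^2. The relation a d - b c = 1 turns these into s / |a|^2 and
  (s^2 - 4) / |a|^2. The common factor 1 / |a|^2 is the density of Haar measure in this
  chart.\<close>

lemma det_chart_hessian:
  assumes "z$1 \<noteq> 0"
  defines "s \<equiv> chart_frob z"
  shows "det (\<chi> j k. of_real \<psi> * (chart_q z $ j * cnj (chart_q z $ k))
      + of_real \<phi> * ((if j = k then 1 else 0) + chart_p z $ j * cnj (chart_p z $ k)) :: complex^3^3)
    = of_real (\<phi>\<^sup>2 * (s * \<phi> + \<psi> * (s\<^sup>2 - 4)) / (cmod (z$1))\<^sup>2)"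
proof -
  define a b c d where "a = z$1" and "b = z$2" and "c = z$3" and "d = chart_d z"
  have a0: "a \<noteq> 0" "cnj a \<noteq> 0"
    using assms by (auto simp: a_def)
  have ad: "a * d = 1 + b * c"
    using a0 by (simp add: a_def b_def c_def d_def chart_d_def)
  then have ad': "cnj a * cnj d = 1 + cnj b * cnj c"
    by (metis complex_cnj_add complex_cnj_mult complex_cnj_one)
  have s: "of_real s = a * cnj a + b * cnj b + c * cnj c + d * cnj d"
    by (simp add: s_def chart_frob_def a_def b_def c_def d_def of_real_cmod_sq)
  have n: "of_real ((cmod a)\<^sup>2) = a * cnj a"
    by (simp add: of_real_cmod_sq)
  define P where "P = 1 + (\<Sum>j\<in>UNIV. chart_p z $ j * cnj (chart_p z $ j))"
  have P: "P * (a * cnj a) = of_real s"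
    using a0 by (simp add: P_def sum_3 chart_p_def s a_def[symmetric] b_def[symmetric] c_def[symmetric] d_def[symmetric] field_simps)
  define X where "X = (\<Sum>j\<in>UNIV. chart_p z $ j * cnj (chart_q z $ j))"
  have X': "(\<Sum>j\<in>UNIV. chart_q z $ j * cnj (chart_p z $ j)) = cnj X"
    by (simp add: X_def mult.commute)
  \<comment> \<open>The relation a d = 1 + b c rewrites the numerator - d a + 2 b c as d a -
    2.\<close>
  have X: "X = P * d - 2 / a"
  proof -
    have "X = (- d * a + c * b + b * c) / a + d * (P - 1)"
      using a0 by (simp add: X_def P_def chart_q_def sum_3 chart_p_def a_def[symmetric] b_def[symmetric] c_def[symmetric] d_def[symmetric]
          add_divide_distrib algebra_simps, simp add: field_simps)
    also have "- d * a + c * b + b * c = d * a - 2"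
      using ad by (simp add: algebra_simps)
    finally show ?thesis
      using a0 by (simp add: field_simps)
  qed
  have Q: "(\<Sum>j\<in>UNIV. chart_q z $ j * cnj (chart_q z $ j)) = of_real s - d * cnj d + (d * cnj d * (P - 1)) + (cnj d * (X - d * (P - 1)) + d * (cnj X - cnj d * (P - 1)))"
    by (simp add: X_def P_def s chart_q_def sum_3 chart_p_def a_def[symmetric] b_def[symmetric] c_def[symmetric] d_def[symmetric] algebra_simps)
  have cP: "cnj P = P"
    by (simp add: P_def mult.commute)
  have QX: "P * (\<Sum>j\<in>UNIV. chart_q z $ j * cnj (chart_q z $ j)) - X * cnj X = P * of_real s - 4 / (a * cnj a)"
    unfolding Q X by (simp add: cP algebra_simps)
  have Pd: "P = of_real s / (a * cnj a)"
    using P a0 by (simp add: field_simps)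
  have R: "complex_of_real (\<phi>\<^sup>2 * (s * \<phi> + \<psi> * (s\<^sup>2 - 4)) / (cmod a)\<^sup>2)
      = (of_real \<phi>)\<^sup>2 * (of_real s * of_real \<phi> + of_real \<psi> * ((of_real s)\<^sup>2 - 4)) / (a * cnj a)"
    unfolding of_real_divide n by simp
  show ?thesis
    unfolding a_def[symmetric] R
    by (simp add: det_rank_two_update[where q'="\<chi> j. cnj (chart_q z $ j)" and p'="\<chi> j. cnj (chart_p z $ j)", simplified]
        P_def[symmetric] X_def[symmetric] X' QX)
       (simp add: Pd power2_eq_square power3_eq_cube field_simps a0)
qed

text \<open>Since i dz \<and> d(cnj z) = 2 dx \<and> dy, the Pfaffian of the form in the real frame
  is 2^3 det F. The normalization 1 / 2^3 of \<open>wedge_cube\<close> cancels this power, and the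
  48 repetitions of each matching remain.\<close>

lemma wedge_cube_hermitian:
  fixes F :: "3 \<Rightarrow> 3 \<Rightarrow> complex"
  assumes F: "\<And>j k. F k j = cnj (F j k)"
  shows "wedge_cube (\<lambda>u v. Re (\<i> * (\<Sum>j\<in>UNIV. \<Sum>k\<in>UNIV. F j k * (u$j * cnj (v$k) - v$j * cnj (u$k))))) real_frame
    = 48 * Re (det (\<chi> j k. F j k))"
proof -
  define \<omega> where "\<omega> u v = Re (\<i> * (\<Sum>j\<in>UNIV. \<Sum>k\<in>UNIV. F j k * (u$j * cnj (v$k) - v$j * cnj (u$k))))" for u v :: "complex^3"
  define B where "B m n = \<omega> (real_frame m) (real_frame n)" for m n
  have skew: "B n m = - B m n" for m n
  proof -
    have "(\<Sum>j\<in>UNIV. \<Sum>k\<in>UNIV. F j k * (v$j * cnj (u$k) - u$j * cnj (v$k)))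
        = - (\<Sum>j\<in>UNIV. \<Sum>k\<in>UNIV. F j k * (u$j * cnj (v$k) - v$j * cnj (u$k)))" for u v :: "complex^3"
      unfolding sum_negf[symmetric] by (intro sum.cong refl) (simp add: algebra_simps)
    moreover have "Re (\<i> * X) = - Re (\<i> * Y)" if "X = - Y" for X Y
      using that by simp
    ultimately have sk: "\<omega> v u = - \<omega> u v" for u v
      unfolding \<omega>_def by blast
    show ?thesis
      unfolding B_def by (rule sk)
  qed
  have diag: "Im (F 1 1) = 0" "Im (F 2 2) = 0" "Im (F 3 3) = 0"
    using F[of 1 1] F[of 2 2] F[of 3 3] by (auto simp: complex_eq_iff)
  have off: "F 2 1 = cnj (F 1 2)" "F 3 1 = cnj (F 1 3)" "F 3 2 = cnj (F 2 3)"
    by (rule F)+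
  have pick: "(\<Sum>j\<in>UNIV. \<Sum>k\<in>UNIV. F j k * (axis j0 c $ j * cnj (axis k0 e $ k))) = F j0 k0 * (c * cnj e)" for j0 k0 c e
  proof -
    have "(\<Sum>k\<in>UNIV. F j k * (x * cnj (axis k0 e $ k))) = F j k0 * (x * cnj e)" for j x
      by (subst sum.remove[of _ k0]) (auto simp: axis_def intro!: sum.neutral)
    then have "(\<Sum>j\<in>UNIV. \<Sum>k\<in>UNIV. F j k * (axis j0 c $ j * cnj (axis k0 e $ k)))
        = (\<Sum>j\<in>UNIV. F j k0 * (axis j0 c $ j * cnj e))"
      by simp
    also have "\<dots> = F j0 k0 * (c * cnj e)"
      by (subst sum.remove[of _ j0]) (auto simp: axis_def intro!: sum.neutral)
    finally show ?thesis .
  qed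
  have ax: "\<omega> (axis j c) (axis k e) = - Im (F j k * (c * cnj e) - F k j * (e * cnj c))" for j k c e
  proof -
    have "(\<Sum>j'\<in>UNIV. \<Sum>k'\<in>UNIV. F j' k' * (axis j c $ j' * cnj (axis k e $ k') - axis k e $ j' * cnj (axis j c $ k')))
        = F j k * (c * cnj e) - F k j * (e * cnj c)"
      by (simp only: right_diff_distrib sum_subtractf pick)
    then show ?thesis
      by (simp add: \<omega>_def)
  qed
  have fr: "real_frame 0 = axis 1 1" "real_frame 1 = axis 1 \<i>" "real_frame 2 = axis 2 1"
    "real_frame 3 = axis 2 \<i>" "real_frame 4 = axis 3 1" "real_frame 5 = axis 3 \<i>"
    by (simp_all add: real_frame_def)
  have B: "B 0 1 = 2 * Re (F 1 1)" "B 2 3 = 2 * Re (F 2 2)" "B 4 5 = 2 * Re (F 3 3)"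
    "B 0 2 = - 2 * Im (F 1 2)" "B 0 4 = - 2 * Im (F 1 3)" "B 2 4 = - 2 * Im (F 2 3)"
    "B 0 3 = 2 * Re (F 1 2)" "B 0 5 = 2 * Re (F 1 3)" "B 2 5 = 2 * Re (F 2 3)"
    "B 1 2 = - 2 * Re (F 1 2)" "B 1 4 = - 2 * Re (F 1 3)" "B 3 4 = - 2 * Re (F 2 3)"
    "B 1 3 = - 2 * Im (F 1 2)" "B 1 5 = - 2 * Im (F 1 3)" "B 3 5 = - 2 * Im (F 2 3)"
    unfolding B_def fr ax by (simp_all add: diag off)
  have "wedge_cube \<omega> real_frame = (1 / 8) * (\<Sum>p | p permutes {..<6}. of_int (sign p) * (\<Prod>i<3. B (p (2 * i)) (p (2 * i + 1))))"
    by (simp add: wedge_cube_def B_def)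
  also have "\<dots> = 48 * Re (det (\<chi> j k. F j k))"
    unfolding sum_permutations_pfaffian_6[of B, OF skew] B det_3
    by (simp add: diag off algebra_simps)
  finally show ?thesis
    unfolding \<omega>_def[abs_def] .
qed

text \<open>The formula for the first derivatives of \<kappa> is known only where the squared
  Frobenius norm exceeds 2; differentiating it once more needs only agreement near the
  point.\<close>

lemma frechet_derivative_cong_open:
  assumes "open U" "z \<in> U" "\<And>w. w \<in> U \<Longrightarrow> f w = g w"
  shows "frechet_derivative f (at z) = frechet_derivative g (at z)"
proof -
  have "(f has_derivative D) (at z) \<longleftrightarrow> (g has_derivative D) (at z)" for D
    using has_derivative_transform_within_open[of f D z UNIV U g] has_derivative_transform_within_open[of g D z UNIV U f] assms
    by auto
  then show ?thesis
    by (simp add: frechet_derivative_def)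
qed

text \<open>The points of SU(2) are left out: there the squared norm is 2, where arcosh is not
  differentiable.\<close>

lemma open_regular: "open {z. z$1 \<noteq> 0 \<and> 2 < chart_frob z}"
proof -
  have "continuous_on {z. z$1 \<noteq> 0} chart_frob"
    by (intro continuous_at_imp_continuous_on ballI has_derivative_continuous[OF has_derivative_chart_frob]) simp
  moreover have "open {z::complex^3. z$1 \<noteq> 0}"
    by (intro open_Collect_neq continuous_intros)
  ultimately have "open ({z. z$1 \<noteq> 0} \<inter> chart_frob -` {2<..})"
    by (intro continuous_open_preimage) auto
  then show ?thesis
    by (simp add: Collect_conj_eq vimage_def)
qed

lemma sl2_chart_in_SL2C: "z$1 \<noteq> 0 \<Longrightarrow> sl2_chart z \<in> SL2C"
  using sl2_chart_image by (auto simp: chart_dom_def)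

section \<open>The Liouville density as a function of the Frobenius norm\<close>

definition kappa_deriv :: "real \<Rightarrow> real \<Rightarrow> real" where
  "kappa_deriv \<beta> s = radius s / (2 * \<beta>\<^sup>2 * sqrt ((s / 2)\<^sup>2 - 1))"

lemma sqrt_pos_aux: "s > 2 \<Longrightarrow> (s / 2)\<^sup>2 - 1 > (0::real)"
  using one_less_power[of "s / 2" 2] by simp

lemma DERIV_radius:
  assumes "s > 2"
  shows "(radius has_real_derivative 1 / (4 * sqrt ((s / 2)\<^sup>2 - 1))) (at s)"
proof -
  have "(arcosh has_real_derivative 1 / sqrt ((s / 2)\<^sup>2 - 1)) (at (s / 2))"
    by (rule arcosh_real_has_field_derivative) (use assms in simp)
  from DERIV_chain2[OF this DERIV_cdivide[OF DERIV_ident, of 2]]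
  have "((\<lambda>s. arcosh (s / 2) / 2) has_real_derivative 1 / sqrt ((s / 2)\<^sup>2 - 1) * (1 / 2) / 2) (at s)"
    by (rule DERIV_cdivide)
  then show ?thesis
    unfolding radius_def[abs_def] by simp
qed

lemma DERIV_kappa:
  assumes "s > 2" "\<beta> > 0"
  shows "((\<lambda>s. (radius s)\<^sup>2 / \<beta>\<^sup>2) has_real_derivative kappa_deriv \<beta> s) (at s)"
proof -
  define R where "R = sqrt ((s / 2)\<^sup>2 - 1)"
  have R: "R > 0"
    using sqrt_pos_aux[OF assms(1)] by (simp add: R_def)
  have "(radius has_real_derivative 1 / (4 * R)) (at s)"
    using DERIV_radius[OF assms(1)] by (simp add: R_def)
  note d = DERIV_cdivide[OF DERIV_power[OF this, of 2], of "\<beta>\<^sup>2"]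
  show ?thesis
    unfolding kappa_deriv_def R_def[symmetric]
    by (rule DERIV_cong[OF d]) (use R assms(2) in \<open>simp add: field_simps\<close>)
qed

text \<open>The second derivative of \<kappa> enters the Hessian determinant only in this
  combination. It is constant because sqrt (s^2 - 4) times \<open>kappa_deriv\<close> is a multiple
  of \<open>radius\<close>, whose derivative is a multiple of 1 / sqrt (s^2 - 4).\<close>

lemma DERIV_kappa_deriv:
  assumes s: "s > 2" and \<beta>: "\<beta> > 0"
  obtains \<psi> where "(kappa_deriv \<beta> has_real_derivative \<psi>) (at s)"
    "s * kappa_deriv \<beta> s + \<psi> * (s\<^sup>2 - 4) = 1 / (2 * \<beta>\<^sup>2)"
proof
  define R where "R = sqrt ((s / 2)\<^sup>2 - 1)"
  have R: "R > 0" and R2: "R\<^sup>2 = (s / 2)\<^sup>2 - 1"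
    using sqrt_pos_aux[OF s] by (simp_all add: R_def)
  have dR: "((\<lambda>s. sqrt ((s / 2)\<^sup>2 - 1)) has_real_derivative s / (4 * R)) (at s)"
  proof -
    have "((\<lambda>s::real. (s / 2)\<^sup>2 - 1) has_real_derivative s / 2) (at s)"
      by (auto intro!: derivative_eq_intros)
    from DERIV_chain2[OF DERIV_real_sqrt[OF sqrt_pos_aux[OF s]] this] show ?thesis
      unfolding R_def[symmetric] by (rule DERIV_cong) (simp add: field_simps)
  qed
  let ?\<psi> = "(1 / (4 * R) * (2 * \<beta>\<^sup>2 * R) - radius s * (2 * \<beta>\<^sup>2 * (s / (4 * R)))) / ((2 * \<beta>\<^sup>2 * R) * (2 * \<beta>\<^sup>2 * R))"
  have 1: "(radius has_real_derivative 1 / (4 * R)) (at s)"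
    using DERIV_radius[OF s] by (simp add: R_def)
  have 2: "((\<lambda>s. 2 * \<beta>\<^sup>2 * sqrt ((s / 2)\<^sup>2 - 1)) has_real_derivative 2 * \<beta>\<^sup>2 * (s / (4 * R))) (at s)"
    by (rule DERIV_cmult[OF dR])
  have "2 * \<beta>\<^sup>2 * sqrt ((s / 2)\<^sup>2 - 1) \<noteq> 0"
    using R \<beta> by (simp add: R_def[symmetric])
  from DERIV_divide[OF 1 2 this] show "(kappa_deriv \<beta> has_real_derivative ?\<psi>) (at s)"
    unfolding kappa_deriv_def[abs_def] R_def[symmetric] .
  have "s\<^sup>2 - 4 = 4 * R\<^sup>2"
    by (simp add: R2 power_divide)
  then show "s * kappa_deriv \<beta> s + ?\<psi> * (s\<^sup>2 - 4) = 1 / (2 * \<beta>\<^sup>2)"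
    using R \<beta> unfolding kappa_deriv_def R_def[symmetric]
    by (simp add: field_simps power2_eq_square)
qed

lemma liouville_density_eq:
  assumes z: "z$1 \<noteq> 0" and s: "chart_frob z > 2" and \<beta>: "\<beta> > 0"
  shows "liouville_density \<beta> z
    = (radius (chart_frob z))\<^sup>2 / (\<beta> ^ 6 * ((chart_frob z / 2)\<^sup>2 - 1)) / (cmod (z$1))\<^sup>2"
proof -
  define U where "U = {z. z$1 \<noteq> 0 \<and> 2 < chart_frob z}"
  have U: "open U" "z \<in> U"
    using open_regular z s by (auto simp: U_def)
  define k where "k w = kappa \<beta> (sl2_chart w)" for w
  have k: "k w = (radius (chart_frob w))\<^sup>2 / \<beta>\<^sup>2" if "w \<in> U" for w
    using that by (simp add: k_def U_def kappa_eq sl2_chart_in_SL2C frob_chart)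
  have wb: "wirtinger_bar i (\<lambda>w. complex_of_real (k w)) w = of_real (kappa_deriv \<beta> (chart_frob w)) * cnj (chart_q w $ i)"
    if w: "w \<in> U" for w i
  proof (rule wirtinger_bar_of_real)
    have "((\<lambda>w. (radius (chart_frob w))\<^sup>2 / \<beta>\<^sup>2) has_derivative
        (\<lambda>h. kappa_deriv \<beta> (chart_frob w) * (2 * Re (\<Sum>j\<in>UNIV. chart_q w $ j * h $ j)))) (at w)"
      using has_derivative_compose[OF has_derivative_chart_frob, of w "\<lambda>s. (radius s)\<^sup>2 / \<beta>\<^sup>2" "(*) (kappa_deriv \<beta> (chart_frob w))"]
        DERIV_kappa[of "chart_frob w" \<beta>] w \<beta> by (simp add: has_field_derivative_def U_def)
    then have "(k has_derivative (\<lambda>h. kappa_deriv \<beta> (chart_frob w) * (2 * Re (\<Sum>j\<in>UNIV. chart_q w $ j * h $ j)))) (at w)"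
      by (rule has_derivative_transform_within_open[OF _ U(1) w]) (simp add: k)
    then show "(k has_derivative (\<lambda>h. 2 * kappa_deriv \<beta> (chart_frob w) * Re (\<Sum>j\<in>UNIV. chart_q w $ j * h $ j))) (at w)"
      by (simp add: mult_ac)
  qed
  obtain \<psi> where \<psi>: "(kappa_deriv \<beta> has_real_derivative \<psi>) (at (chart_frob z))"
    "chart_frob z * kappa_deriv \<beta> (chart_frob z) + \<psi> * ((chart_frob z)\<^sup>2 - 4) = 1 / (2 * \<beta>\<^sup>2)"
    using DERIV_kappa_deriv[OF s \<beta>] .
  define F where "F i j = of_real \<psi> * (chart_q z $ i * cnj (chart_q z $ j))
      + of_real (kappa_deriv \<beta> (chart_frob z)) * ((if i = j then 1 else 0) + chart_p z $ i * cnj (chart_p z $ j))" for i j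
  have F: "wirtinger i (wirtinger_bar j (\<lambda>w. complex_of_real (k w))) z = F i j" for i j
  proof -
    have "frechet_derivative (wirtinger_bar j (\<lambda>w. complex_of_real (k w))) (at z)
      = frechet_derivative (\<lambda>w. of_real (kappa_deriv \<beta> (chart_frob w)) * cnj (chart_q w $ j)) (at z)"
      by (rule frechet_derivative_cong_open[OF U]) (rule wb)
    then have "wirtinger i (wirtinger_bar j (\<lambda>w. complex_of_real (k w))) z
      = wirtinger i (\<lambda>w. of_real (kappa_deriv \<beta> (chart_frob w)) * cnj (chart_q w $ j)) z"
      by (simp add: wirtinger_def)
    then show ?thesis
      unfolding F_def wirtinger_potential[OF z \<psi>(1)] .
  qed
  have "omega \<beta> z = (\<lambda>u v. Re (\<i> * (\<Sum>j\<in>UNIV. \<Sum>k\<in>UNIV. F j k * (u$j * cnj (v$k) - v$j * cnj (u$k)))))"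
    by (simp add: fun_eq_iff omega_def i_ddbar_def k_def[symmetric] F)
  then have "wedge_cube (omega \<beta> z) real_frame = 48 * Re (det (\<chi> i j. F i j))"
    by (simp only:) (rule wedge_cube_hermitian, simp add: F_def mult_ac)
  also have "det (\<chi> i j. F i j) = of_real ((kappa_deriv \<beta> (chart_frob z))\<^sup>2 * (1 / (2 * \<beta>\<^sup>2)) / (cmod (z$1))\<^sup>2)"
    unfolding F_def det_chart_hessian[OF z] \<psi>(2) ..
  \<comment> \<open>The factor 8 is 48 / 3!.\<close>
  finally have w: "wedge_cube (omega \<beta> z) real_frame / fact 3 = 8 * ((kappa_deriv \<beta> (chart_frob z))\<^sup>2 * (1 / (2 * \<beta>\<^sup>2)) / (cmod (z$1))\<^sup>2)"
    by (simp add: fact_numeral)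
  have "(kappa_deriv \<beta> (chart_frob z))\<^sup>2 = (radius (chart_frob z))\<^sup>2 / (4 * \<beta> ^ 4 * ((chart_frob z / 2)\<^sup>2 - 1))"
    using sqrt_pos_aux[OF s] by (simp add: kappa_deriv_def power_divide power_mult_distrib)
  then have "wedge_cube (omega \<beta> z) real_frame / fact 3 = (radius (chart_frob z))\<^sup>2 / (\<beta> ^ 6 * ((chart_frob z / 2)\<^sup>2 - 1)) / (cmod (z$1))\<^sup>2"
  proof -
    have "8 * (r / (4 * b4 * q) * (1 / (2 * b2)) / n) = r / ((b4 * b2) * q) / n" for r b4 q b2 n :: real
      by simp
    moreover have "\<beta> ^ 6 = \<beta> ^ 4 * \<beta>\<^sup>2"
      by (simp flip: power_add)
    ultimately show ?thesis
      unfolding w \<open>(kappa_deriv \<beta> (chart_frob z))\<^sup>2 = _\<close> by simp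
  qed
  moreover have "0 \<le> (radius (chart_frob z))\<^sup>2 / (\<beta> ^ 6 * ((chart_frob z / 2)\<^sup>2 - 1)) / (cmod (z$1))\<^sup>2"
    using \<beta> sqrt_pos_aux[OF s] by (intro divide_nonneg_nonneg mult_nonneg_nonneg) auto
  ultimately show ?thesis
    unfolding liouville_density_def by (simp only: abs_of_nonneg)
qed

section \<open>Push-forward under the trace\<close>

lemma borel_measurable_matrix:
  fixes f :: "'z \<Rightarrow> complex^2^2"
  assumes "\<And>i j. (\<lambda>x. f x $ i $ j) \<in> borel_measurable M"
  shows "f \<in> borel_measurable M"
proof (subst borel_measurable_euclidean_space, rule ballI)
  fix b :: "complex^2^2" assume "b \<in> Basis"
  then obtain i j c where "b = axis i (axis j c)"
    by (auto simp: Basis_vec_def)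
  then show "(\<lambda>x. f x \<bullet> b) \<in> borel_measurable M"
    using assms[of i j] by (simp add: inner_axis)
qed

lemma borel_measurable_nth [measurable (raw)]:
  fixes f :: "'z \<Rightarrow> 'a::euclidean_space^'n"
  assumes "f \<in> borel_measurable M"
  shows "(\<lambda>x. f x $ i) \<in> borel_measurable M"
proof -
  have "(\<lambda>v::'a^'n. v $ i) \<in> borel_measurable borel"
    by (intro borel_measurable_continuous_onI continuous_intros)
  then show ?thesis
    using assms by (rule measurable_compose_rev)
qed

lemma borel_measurable_sl2_chart [measurable]: "sl2_chart \<in> borel_measurable borel"
proof (rule borel_measurable_matrix)
  fix i j :: 2
  show "(\<lambda>z. sl2_chart z $ i $ j) \<in> borel_measurable borel"
    using exhaust_2[of i] exhaust_2[of j] by (auto simp: sl2_chart_def)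
qed

lemma borel_measurable_trace [measurable]: "trace \<in> borel_measurable (borel :: (complex^2^2) measure)"
  unfolding trace_def by measurable

lemma borel_measurable_frob [measurable]: "frob \<in> borel_measurable borel"
  unfolding frob_def by measurable

lemma borel_measurable_radius [measurable]: "radius \<in> borel_measurable borel"
  unfolding radius_def arcosh_def by measurable

lemma borel_measurable_chart_frob [measurable]: "chart_frob \<in> borel_measurable borel"
  unfolding chart_frob_def chart_d_def by measurable

lemma borel_measurable_min_frob [measurable]: "min_frob \<in> borel_measurable borel"
  unfolding min_frob_def by measurable

text \<open>Expanding the right side gives s - 2 Re (a d - b c). Both squares vanish exactly for
  unitary matrices.\<close>

lemma chart_frob_minus_2:
  assumes "z$1 \<noteq> 0"
  shows "chart_frob z - 2 = (cmod (z$1 - cnj (chart_d z)))\<^sup>2 + (cmod (z$2 + cnj (z$3)))\<^sup>2"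
proof -
  have "z$1 * chart_d z - z$2 * z$3 = 1"
    using assms by (simp add: chart_d_def)
  then have "Re (z$1 * chart_d z - z$2 * z$3) = 1"
    by simp
  then show ?thesis
    unfolding chart_frob_def cmod_power2 by (simp add: power2_eq_square algebra_simps)
qed

lemma hyperplane_null:
  fixes v :: "'a::euclidean_space"
  assumes "v \<noteq> 0"
  shows "AE z in lborel. v \<bullet> z \<noteq> 0"
proof -
  have "negligible {z. v \<bullet> z = 0}"
    using assms by (intro negligible_hyperplane) simp
  then have "{z. v \<bullet> z = 0} \<in> null_sets lebesgue"
    by (simp add: negligible_iff_null_sets)
  moreover have "closed {z. v \<bullet> z = 0}"
    by (intro closed_Collect_eq continuous_intros)
  ultimately have "{z. v \<bullet> z = 0} \<in> null_sets lborel"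
    by (simp add: null_sets_def)
  from AE_not_in[OF this] show ?thesis
    by simp
qed

text \<open>Two real hyperplanes are removed: off Re a = 0 the chart is defined, and off Re b + Re c
  = 0 the entry sum b + cnj c is nonzero, so that the matrix is not unitary.\<close>

lemma AE_regular: "AE z in lborel. z$1 \<noteq> 0 \<and> 2 < chart_frob z"
proof -
  have "axis 1 1 \<bullet> z = Re (z$1)" "(axis 2 1 + axis 3 1) \<bullet> z = Re (z$2) + Re (z$3)" for z :: "complex^3"
    by (simp_all add: inner_add_left inner_axis' inner_complex_def)
  moreover have "axis 1 1 \<noteq> (0 :: complex^3)" "axis 2 1 + axis 3 1 \<noteq> (0 :: complex^3)"
    by (auto simp: vec_eq_iff forall_3 axis_def)
  ultimately have "AE z::complex^3 in lborel. Re (z$1) \<noteq> 0" "AE z::complex^3 in lborel. Re (z$2) + Re (z$3) \<noteq> 0"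
    using hyperplane_null[of "axis 1 1 :: complex^3"] hyperplane_null[of "axis 2 1 + axis 3 1 :: complex^3"] by simp_all
  then show ?thesis
  proof eventually_elim
    case (elim z)
    then have z: "z$1 \<noteq> 0"
      by auto
    have "z$2 + cnj (z$3) \<noteq> 0"
      using elim(2) by (metis complex_cnj(1) plus_complex.sel(1) complex_cnj zero_complex.sel(1) complex_surj cnj.sel(1))
    then have "0 < (cmod (z$2 + cnj (z$3)))\<^sup>2"
      by simp
    then show ?case
      using chart_frob_minus_2[OF z] z zero_le_power2[of "cmod (z$1 - cnj (chart_d z))"] by linarith
  qed
qed

lemma chart_frob_ge_2: "z$1 \<noteq> 0 \<Longrightarrow> 2 \<le> chart_frob z"
  using chart_frob_minus_2[of z] zero_le_power2[of "cmod (z$1 - cnj (chart_d z))"] zero_le_power2[of "cmod (z$2 + cnj (z$3))"]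
  by linarith

section \<open>Integration against the Liouville measure\<close>

definition chart_density :: "real \<Rightarrow> complex^3 \<Rightarrow> real" where
  "chart_density \<beta> z = (radius (chart_frob z))\<^sup>2 / (\<beta> ^ 6 * ((chart_frob z / 2)\<^sup>2 - 1)) / (cmod (z$1))\<^sup>2"

lemma borel_measurable_chart_density [measurable]: "chart_density \<beta> \<in> borel_measurable borel"
  unfolding chart_density_def by measurable

lemma chart_dom_borel [measurable]: "chart_dom \<in> sets borel"
proof -
  have "open chart_dom"
    unfolding chart_dom_def by (intro open_Collect_neq continuous_intros)
  then show ?thesis
    by simp
qed

text \<open>The Lebesgue integral of functions that agree almost everywhere is the same even without
  measurability, so nothing needs to be known about \<open>liouville_density\<close> on the null set where
  the Hessian is not computed.\<close>

lemma density_cong_AE_unmeasurable: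
  assumes "AE x in M. f x = g x"
  shows "density M f = density M g"
  unfolding density_def using assms
  by (auto intro!: measure_of_eq nn_integral_cong_AE sets.space_closed)

lemma sl2_chart_measurable:
  "sl2_chart \<in> restrict_space lborel chart_dom \<rightarrow>\<^sub>M restrict_space borel SL2C"
proof (rule measurable_restrict_space2)
  show "sl2_chart \<in> borel_measurable (restrict_space lborel chart_dom)"
    by (intro measurable_restrict_space1) simp
  show "sl2_chart \<in> space (restrict_space lborel chart_dom) \<rightarrow> SL2C"
    by (auto simp: space_restrict_space chart_dom_def intro: sl2_chart_in_SL2C)
qed

lemma nn_integral_liouville:
  assumes G: "G \<in> borel_measurable (restrict_space borel SL2C)" and \<beta>: "\<beta> > 0"
  shows "(\<integral>\<^sup>+g. G g \<partial>liouville \<beta>)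
    = (\<integral>\<^sup>+z. ennreal (chart_density \<beta> z) * G (sl2_chart z) * indicator chart_dom z \<partial>lborel)"
proof -
  have 1: "density (restrict_space lborel chart_dom) (\<lambda>z. ennreal (liouville_density \<beta> z))
      = density (restrict_space lborel chart_dom) (\<lambda>z. ennreal (chart_density \<beta> z))"
  proof (rule density_cong_AE_unmeasurable)
    have "AE z in lborel. ennreal (liouville_density \<beta> z) = ennreal (chart_density \<beta> z)"
      using AE_regular by eventually_elim (simp add: liouville_density_eq \<beta> chart_density_def)
    then show "AE z in restrict_space lborel chart_dom. ennreal (liouville_density \<beta> z) = ennreal (chart_density \<beta> z)"
      by (subst AE_restrict_space_iff) (auto elim: eventually_mono)
  qed
  have Gc: "(\<lambda>z. G (sl2_chart z)) \<in> borel_measurable (restrict_space lborel chart_dom)"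
    by (rule measurable_compose[OF sl2_chart_measurable G])
  have d: "(\<lambda>z. ennreal (chart_density \<beta> z)) \<in> borel_measurable (restrict_space lborel chart_dom)"
    by (intro measurable_restrict_space1) simp
  have "(\<integral>\<^sup>+g. G g \<partial>liouville \<beta>) = (\<integral>\<^sup>+z. G (sl2_chart z) \<partial>density (restrict_space lborel chart_dom) (\<lambda>z. ennreal (chart_density \<beta> z)))"
    unfolding liouville_def 1 by (rule nn_integral_distr) (use sl2_chart_measurable G in simp_all)
  also have "\<dots> = (\<integral>\<^sup>+z. ennreal (chart_density \<beta> z) * G (sl2_chart z) \<partial>restrict_space lborel chart_dom)"
    by (rule nn_integral_density[OF d Gc])
  also have "\<dots> = (\<integral>\<^sup>+z. ennreal (chart_density \<beta> z) * G (sl2_chart z) * indicator chart_dom z \<partial>lborel)"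
    by (rule nn_integral_restrict_space) simp
  finally show ?thesis .
qed

text \<open>The Liouville density times the weight as a function of the squared Frobenius norm
  \<open>s\<close>, without the Haar factor 1 / |a|^2.\<close>

definition radial_weight :: "real \<Rightarrow> real \<Rightarrow> real \<Rightarrow> real" where
  "radial_weight hbar \<beta> s = (radius s)\<^sup>2 / (\<beta> ^ 6 * ((s / 2)\<^sup>2 - 1))
     * (exp (- (radius s)\<^sup>2 / (hbar * \<beta>\<^sup>2)) * sinhc (2 * radius s))"

lemma borel_measurable_radial_weight [measurable]: "radial_weight hbar \<beta> \<in> borel_measurable borel"
  unfolding radial_weight_def by measurable

lemma radius_pos: "s > 2 \<Longrightarrow> radius s > 0"
  by (simp add: radius_def)

lemma radial_weight_eq:
  assumes "s > 2"
  shows "radial_weight hbar \<beta> s = radius s / (2 * \<beta> ^ 6 * sqrt ((s / 2)\<^sup>2 - 1)) * exp (- (radius s)\<^sup>2 / (hbar * \<beta>\<^sup>2))"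
proof -
  define R where "R = sqrt ((s / 2)\<^sup>2 - 1)"
  have R: "R > 0" and R2: "(s / 2)\<^sup>2 - 1 = R * R"
    using sqrt_pos_aux[OF assms] by (simp_all add: R_def)
  have "sinh (2 * radius s) = R"
    using assms by (simp add: radius_def R_def sinh_arcosh_real)
  then have "sinhc (2 * radius s) = R / (2 * radius s)"
    using radius_pos[OF assms] by (simp add: sinhc_def)
  then show ?thesis
    unfolding radial_weight_def R_def[symmetric] R2 using radius_pos[OF assms] R
    by (simp add: power2_eq_square)
qed

text \<open>With R = sinh (2 r) and dr/ds = 1 / (4 R), the integrand is a multiple of r dr/ds exp (-
  r^2 / (hbar \<beta>^2)), hence an exact derivative.\<close>

lemma nn_integral_radial_weight:
  assumes a: "a > 2" and hbar: "hbar > 0" and \<beta>: "\<beta> > 0"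
  shows "(\<integral>\<^sup>+s. ennreal (radial_weight hbar \<beta> s) * indicator {a<..} s \<partial>lborel)
    = ennreal (hbar / \<beta> ^ 4 * exp (- (radius a)\<^sup>2 / (hbar * \<beta>\<^sup>2)))"
proof -
  let ?F = "\<lambda>s. - (hbar / \<beta> ^ 4) * exp (- (radius s)\<^sup>2 / (hbar * \<beta>\<^sup>2))"
  have "(\<integral>\<^sup>+s. ennreal (radial_weight hbar \<beta> s) * indicator {a<..} s \<partial>lborel)
      = (\<integral>\<^sup>+s. ennreal (radial_weight hbar \<beta> s) * indicator {a..} s \<partial>lborel)"
    using AE_lborel_singleton[of a]
    by (intro nn_integral_cong_AE) (auto simp: indicator_def elim!: eventually_mono)
  also have "\<dots> = ennreal (0 - ?F a)"
  proof (rule nn_integral_FTC_atLeast)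
    fix s assume "a \<le> s"
    then have s: "s > 2"
      using a by simp
    define R where "R = sqrt ((s / 2)\<^sup>2 - 1)"
    have R: "R > 0"
      using sqrt_pos_aux[OF s] by (simp add: R_def)
    have d: "(radius has_real_derivative 1 / (4 * R)) (at s)"
      using DERIV_radius[OF s] by (simp add: R_def)
    have "((\<lambda>s. - (radius s)\<^sup>2 / (hbar * \<beta>\<^sup>2)) has_real_derivative - (2 * (1 / (4 * R) * radius s)) / (hbar * \<beta>\<^sup>2)) (at s)"
      using DERIV_cdivide[OF DERIV_minus[OF DERIV_power[OF d, of 2]], of "hbar * \<beta>\<^sup>2"] by simp
    note e = DERIV_cmult[OF DERIV_chain2[OF DERIV_exp this], of "- (hbar / \<beta> ^ 4)"]
    have b6: "\<beta> ^ 6 = \<beta> ^ 4 * \<beta>\<^sup>2"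
      by (simp flip: power_add)
    show "(?F has_real_derivative radial_weight hbar \<beta> s) (at s)"
      unfolding radial_weight_eq[OF s] R_def[symmetric] b6
      by (rule DERIV_cong[OF e]) (use R hbar \<beta> in \<open>simp add: field_simps\<close>)
    show "0 \<le> radial_weight hbar \<beta> s"
      unfolding radial_weight_eq[OF s] using radius_pos[OF s] \<beta> sqrt_pos_aux[OF s] by simp
  next
    have "filterlim (\<lambda>s::real. s / 2) at_top at_top"
      by real_asymp
    then have 1: "filterlim (\<lambda>s::real. arcosh (s / 2)) at_top at_top"
      by (rule filterlim_compose[OF arcosh_real_at_top])
    have "filterlim (\<lambda>x::real. - (x / 2)\<^sup>2 / (hbar * \<beta>\<^sup>2)) at_bot at_top"
      using hbar \<beta> by real_asymp
    from filterlim_compose[OF this 1] have "filterlim (\<lambda>s. - (radius s)\<^sup>2 / (hbar * \<beta>\<^sup>2)) at_bot at_top"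
      by (simp add: radius_def)
    from filterlim_compose[OF exp_at_bot this] have "((\<lambda>s. exp (- (radius s)\<^sup>2 / (hbar * \<beta>\<^sup>2))) \<longlongrightarrow> 0) at_top" .
    from tendsto_mult_left[OF this, of "- (hbar / \<beta> ^ 4)"] show "(?F \<longlongrightarrow> 0) at_top"
      by simp
  qed simp
  finally show ?thesis
    by simp
qed

text \<open>The difference of the squares of |w^2 - 4| and 4 - |w|^2 is 16 (Im w)^2. The value 2 is
  taken only on the segment from -2 to 2, the traces of SU(2).\<close>

lemma min_frob_gt_2:
  assumes "Im w \<noteq> 0"
  shows "min_frob w > 2"
proof -
  have "cmod (w\<^sup>2 - 4) > 4 - (cmod w)\<^sup>2"
  proof (rule ccontr)
    assume "\<not> cmod (w\<^sup>2 - 4) > 4 - (cmod w)\<^sup>2"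
    then have "(cmod (w\<^sup>2 - 4))\<^sup>2 \<le> (4 - (cmod w)\<^sup>2)\<^sup>2"
      by (intro power_mono) auto
    then have "16 * (Im w)\<^sup>2 \<le> 0"
      unfolding cmod_power2 by (simp add: power2_eq_square algebra_simps)
    with assms show False
      by simp
  qed
  then show ?thesis
    by (simp add: min_frob_def)
qed

definition gauss :: "real \<Rightarrow> complex \<Rightarrow> real" where
  "gauss \<tau> w = exp (- (radius (min_frob w))\<^sup>2 / \<tau>)"

lemma borel_measurable_gauss [measurable]: "gauss \<tau> \<in> borel_measurable borel"
  unfolding gauss_def by measurable

lemma weight_measurable: "weight hbar \<beta> \<in> borel_measurable (restrict_space borel SL2C)"
proof -
  have "(\<lambda>g. exp (- (radius (frob g))\<^sup>2 / (hbar * \<beta>\<^sup>2)) * sinhc (2 * radius (frob g))) \<in> borel_measurable (restrict_space borel SL2C)"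
    by (intro measurable_restrict_space1) measurable
  then show ?thesis
    by (subst measurable_cong[OF weight_eq]) (auto simp: space_restrict_space)
qed

text \<open>The constant is pi^2 from \<open>nn_integral_trace_frob\<close> times hbar / \<beta>^4
  from \<open>nn_integral_radial_weight\<close>.\<close>

lemma nn_integral_trace_liouville:
  assumes [measurable]: "F \<in> borel_measurable borel" and hbar: "hbar > 0" and \<beta>: "\<beta> > 0"
  shows "(\<integral>\<^sup>+g. F (trace g) * ennreal (weight hbar \<beta> g) \<partial>liouville \<beta>)
    = ennreal (pi\<^sup>2 * hbar / \<beta> ^ 4) * (\<integral>\<^sup>+w. F w * ennreal (gauss (hbar * \<beta>\<^sup>2) w) \<partial>lborel)"
proof -
  have "(\<lambda>g. F (trace g)) \<in> borel_measurable (restrict_space borel SL2C)"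
    by (intro measurable_restrict_space1) measurable
  note [measurable] = this weight_measurable
  define I where "I z = ennreal (1 / (cmod (z$1))\<^sup>2) * (F (z$1 + (1 + z$2 * z$3) / z$1) *
      ennreal (radial_weight hbar \<beta> ((cmod (z$1))\<^sup>2 + (cmod (z$2))\<^sup>2 + (cmod (z$3))\<^sup>2 + (cmod ((1 + z$2 * z$3) / z$1))\<^sup>2)))" for z :: "complex^3"
  have [measurable]: "I \<in> borel_measurable borel"
    unfolding I_def by measurable
  have "(\<integral>\<^sup>+g. F (trace g) * ennreal (weight hbar \<beta> g) \<partial>liouville \<beta>)
     = (\<integral>\<^sup>+z. ennreal (chart_density \<beta> z) * (F (trace (sl2_chart z)) * ennreal (weight hbar \<beta> (sl2_chart z))) * indicator chart_dom z \<partial>lborel)"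
    by (rule nn_integral_liouville) (use \<beta> in simp_all)
  also have "\<dots> = (\<integral>\<^sup>+z. I z \<partial>lborel)"
  proof (rule nn_integral_cong)
    fix z :: "complex^3"
    show "ennreal (chart_density \<beta> z) * (F (trace (sl2_chart z)) * ennreal (weight hbar \<beta> (sl2_chart z))) * indicator chart_dom z = I z"
    proof (cases "z$1 = 0")
      case True
      then show ?thesis
        by (simp add: I_def chart_dom_def)
    next
      case False
      have tr: "trace (sl2_chart z) = z$1 + (1 + z$2 * z$3) / z$1"
        by (simp add: trace_def sum_2 sl2_chart_def)
      have fr: "chart_frob z = (cmod (z$1))\<^sup>2 + (cmod (z$2))\<^sup>2 + (cmod (z$3))\<^sup>2 + (cmod ((1 + z$2 * z$3) / z$1))\<^sup>2"
        by (simp add: chart_frob_def chart_d_def)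
      have w: "weight hbar \<beta> (sl2_chart z) = exp (- (radius (chart_frob z))\<^sup>2 / (hbar * \<beta>\<^sup>2)) * sinhc (2 * radius (chart_frob z))"
        using weight_eq[OF sl2_chart_in_SL2C[OF False]] by (simp add: frob_chart)
      have pos: "0 \<le> exp (- (radius (chart_frob z))\<^sup>2 / (hbar * \<beta>\<^sup>2)) * sinhc (2 * radius (chart_frob z))"
        by (simp add: less_imp_le[OF sinhc_pos])
      have "0 \<le> (chart_frob z / 2)\<^sup>2 - 1"
        using chart_frob_ge_2[OF False] one_le_power[of "chart_frob z / 2" 2] by simp
      then have pos2: "0 \<le> chart_density \<beta> z"
        using \<beta> by (simp add: chart_density_def)
      have "ennreal (chart_density \<beta> z) * ennreal (weight hbar \<beta> (sl2_chart z)) = ennreal (1 / (cmod (z$1))\<^sup>2) * ennreal (radial_weight hbar \<beta> (chart_frob z))"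
        unfolding ennreal_mult'[symmetric, OF pos2] w
        by (subst ennreal_mult'[symmetric]) (simp_all add: chart_density_def radial_weight_def mult_ac)
      then have "ennreal (chart_density \<beta> z) * (F x * ennreal (weight hbar \<beta> (sl2_chart z)))
          = ennreal (1 / (cmod (z$1))\<^sup>2) * (F x * ennreal (radial_weight hbar \<beta> (chart_frob z)))" for x
        by (simp only: mult.left_commute[of _ "F x"])
      moreover have "indicator chart_dom z = (1 :: ennreal)"
        using False by (simp add: chart_dom_def)
      ultimately show ?thesis
        unfolding I_def tr fr[symmetric] by (simp only: mult_1_right)
    qed
  qed
  also have "\<dots> = (\<integral>\<^sup>+a. \<integral>\<^sup>+b. \<integral>\<^sup>+c. I (vector [a, b, c]) \<partial>lborel \<partial>lborel \<partial>lborel)"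
    by (rule nn_integral_lborel_vector_3) simp
  also have "\<dots> = ennreal (pi\<^sup>2) * (\<integral>\<^sup>+w. F w * (\<integral>\<^sup>+s. ennreal (radial_weight hbar \<beta> s) * indicator {min_frob w<..} s \<partial>lborel) \<partial>lborel)"
    unfolding I_def vector_3 by (rule nn_integral_trace_frob) measurable
  also have "(\<integral>\<^sup>+w. F w * (\<integral>\<^sup>+s. ennreal (radial_weight hbar \<beta> s) * indicator {min_frob w<..} s \<partial>lborel) \<partial>lborel)
      = (\<integral>\<^sup>+w. ennreal (hbar / \<beta> ^ 4) * (F w * ennreal (gauss (hbar * \<beta>\<^sup>2) w)) \<partial>lborel)"
  proof (rule nn_integral_cong_AE)
    \<comment> \<open>The radial integral is evaluated for \<open>min_frob w\<close> > 2, hence for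
      w off the real axis, which is almost everywhere.\<close>
    have "AE w::complex in lborel. Im w \<noteq> 0"
      using AE_not_in[OF real_line_null] by simp
    then show "AE w in lborel. F w * (\<integral>\<^sup>+s. ennreal (radial_weight hbar \<beta> s) * indicator {min_frob w<..} s \<partial>lborel)
        = ennreal (hbar / \<beta> ^ 4) * (F w * ennreal (gauss (hbar * \<beta>\<^sup>2) w))"
    proof eventually_elim
      case (elim w)
      show ?case
        unfolding nn_integral_radial_weight[OF min_frob_gt_2[OF elim] hbar \<beta>] gauss_def[symmetric]
        by (subst ennreal_mult') (use hbar \<beta> in \<open>simp_all add: mult.left_commute\<close>)
    qed
  qed
  also have "\<dots> = ennreal (hbar / \<beta> ^ 4) * (\<integral>\<^sup>+w. F w * ennreal (gauss (hbar * \<beta>\<^sup>2) w) \<partial>lborel)"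
    by (rule nn_integral_cmult) measurable
  also have "ennreal (pi\<^sup>2) * (ennreal (hbar / \<beta> ^ 4) * (\<integral>\<^sup>+w. F w * ennreal (gauss (hbar * \<beta>\<^sup>2) w) \<partial>lborel))
      = ennreal (pi\<^sup>2 * hbar / \<beta> ^ 4) * (\<integral>\<^sup>+w. F w * ennreal (gauss (hbar * \<beta>\<^sup>2) w) \<partial>lborel)"
    using hbar by (simp add: mult.assoc[symmetric] flip: ennreal_mult')
  finally show ?thesis .
qed

section \<open>Volume of \<open>SU(2)\<close>\<close>

lemma has_derivative_cis:
  assumes "(f has_derivative f') (at x)"
  shows "((\<lambda>x. cis (f x)) has_derivative (\<lambda>h. of_real (f' h) * (\<i> * cis (f x)))) (at x)"
proof -
  have "((\<lambda>x. \<i> * complex_of_real (f x)) has_derivative (\<lambda>h. \<i> * of_real (f' h))) (at x)"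
    by (intro has_derivative_mult_right bounded_linear.has_derivative[OF bounded_linear_of_real] assms)
  from has_derivative_compose[OF this DERIV_exp[unfolded has_field_derivative_def]]
  show ?thesis
    unfolding cis_conv_exp by (rule has_derivative_eq_rhs) (simp add: fun_eq_iff mult_ac)
qed

lemma has_derivative_matrix_2:
  fixes f :: "'z::real_normed_vector \<Rightarrow> complex^2^2"
  assumes "\<And>i j. ((\<lambda>x. f x $ i $ j) has_derivative (\<lambda>h. f' h $ i $ j)) (at x)"
  shows "(f has_derivative f') (at x)"
proof -
  define E where "E i j c = (axis i (axis j c) :: complex^2^2)" for i j c
  have lin: "bounded_linear (E i j)" for i j
    unfolding linear_conv_bounded_linear[symmetric]
    by (rule linearI) (auto simp: E_def vec_eq_iff axis_def)
  have rep: "A = (\<Sum>i\<in>UNIV. \<Sum>j\<in>UNIV. E i j (A $ i $ j))" for A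
    by (simp add: sum_2 E_def vec_eq_iff forall_2 axis_def)
  have "((\<lambda>x. \<Sum>i\<in>UNIV. \<Sum>j\<in>UNIV. E i j (f x $ i $ j)) has_derivative
      (\<lambda>h. \<Sum>i\<in>UNIV. \<Sum>j\<in>UNIV. E i j (f' h $ i $ j))) (at x)"
    by (intro has_derivative_sum bounded_linear.has_derivative[OF lin] assms)
  then show ?thesis
    unfolding rep[symmetric] .
qed

definition hopf_partial :: "real^3 \<Rightarrow> 3 \<Rightarrow> complex^2^2" where
  "hopf_partial t j = frechet_derivative hopf_chart (at t) (axis j 1)"

lemma hopf_partial_eq:
  "hopf_partial t 1 = vector [vector [- of_real (sin (t$1)) * cis (t$2), - of_real (cos (t$1)) * cis (- t$3)],
     vector [of_real (cos (t$1)) * cis (t$3), - of_real (sin (t$1)) * cis (- t$2)]]"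
  "hopf_partial t 2 = vector [vector [of_real (cos (t$1)) * (\<i> * cis (t$2)), 0],
     vector [0, - of_real (cos (t$1)) * (\<i> * cis (- t$2))]]"
  "hopf_partial t 3 = vector [vector [0, of_real (sin (t$1)) * (\<i> * cis (- t$3))],
     vector [of_real (sin (t$1)) * (\<i> * cis (t$3)), 0]]"
proof -
  have n: "((\<lambda>t::real^3. t $ i) has_derivative (\<lambda>h. h $ i)) (at t)" for i
    by (rule bounded_linear.has_derivative[OF bounded_linear_vec_nth has_derivative_ident])
  have n': "((\<lambda>t::real^3. - t $ i) has_derivative (\<lambda>h. - h $ i)) (at t)" for i
    by (intro has_derivative_minus n)
  have c: "((\<lambda>t::real^3. complex_of_real (cos (t$1))) has_derivative (\<lambda>h. of_real (- sin (t$1) * h$1))) (at t)"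
    using has_derivative_compose[OF n[of 1] DERIV_cos[unfolded has_field_derivative_def]]
    by (intro bounded_linear.has_derivative[OF bounded_linear_of_real])
  have s: "((\<lambda>t::real^3. complex_of_real (sin (t$1))) has_derivative (\<lambda>h. of_real (cos (t$1) * h$1))) (at t)"
    using has_derivative_compose[OF n[of 1] DERIV_sin[unfolded has_field_derivative_def]]
    by (intro bounded_linear.has_derivative[OF bounded_linear_of_real])
  define D where "D h = (vector [vector
      [of_real (cos (t$1)) * (of_real (h$2) * (\<i> * cis (t$2))) + of_real (- sin (t$1) * h$1) * cis (t$2),
       - (of_real (sin (t$1)) * (of_real (- h$3) * (\<i> * cis (- t$3))) + of_real (cos (t$1) * h$1) * cis (- t$3))],
      vector [of_real (sin (t$1)) * (of_real (h$3) * (\<i> * cis (t$3))) + of_real (cos (t$1) * h$1) * cis (t$3),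
        of_real (cos (t$1)) * (of_real (- h$2) * (\<i> * cis (- t$2))) + of_real (- sin (t$1) * h$1) * cis (- t$2)]] :: complex^2^2)" for h :: "real^3"
  have "(hopf_chart has_derivative D) (at t)"
  proof (rule has_derivative_matrix_2)
    fix i j :: 2
    have "((\<lambda>t. of_real (cos (t$1)) * cis (t$2)) has_derivative
        (\<lambda>h. of_real (cos (t$1)) * (of_real (h$2) * (\<i> * cis (t$2))) + of_real (- sin (t$1) * h$1) * cis (t$2))) (at t)"
      "((\<lambda>t. - (of_real (sin (t$1)) * cis (- t$3))) has_derivative
        (\<lambda>h. - (of_real (sin (t$1)) * (of_real (- h$3) * (\<i> * cis (- t$3))) + of_real (cos (t$1) * h$1) * cis (- t$3)))) (at t)"
      "((\<lambda>t. of_real (sin (t$1)) * cis (t$3)) has_derivative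
        (\<lambda>h. of_real (sin (t$1)) * (of_real (h$3) * (\<i> * cis (t$3))) + of_real (cos (t$1) * h$1) * cis (t$3))) (at t)"
      "((\<lambda>t. of_real (cos (t$1)) * cis (- t$2)) has_derivative
        (\<lambda>h. of_real (cos (t$1)) * (of_real (- h$2) * (\<i> * cis (- t$2))) + of_real (- sin (t$1) * h$1) * cis (- t$2))) (at t)"
      by (intro has_derivative_minus has_derivative_mult has_derivative_cis n n' c s)+
    then show "((\<lambda>t. hopf_chart t $ i $ j) has_derivative (\<lambda>h. D h $ i $ j)) (at t)"
      using exhaust_2[of i] exhaust_2[of j] unfolding hopf_chart_def D_def by auto
  qed
  then have "hopf_partial t j = D (axis j 1)" for j
    unfolding hopf_partial_def by (simp add: frechet_derivative_at[symmetric])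
  then show "hopf_partial t 1 = vector [vector [- of_real (sin (t$1)) * cis (t$2), - of_real (cos (t$1)) * cis (- t$3)],
     vector [of_real (cos (t$1)) * cis (t$3), - of_real (sin (t$1)) * cis (- t$2)]]"
  "hopf_partial t 2 = vector [vector [of_real (cos (t$1)) * (\<i> * cis (t$2)), 0],
     vector [0, - of_real (cos (t$1)) * (\<i> * cis (- t$2))]]"
  "hopf_partial t 3 = vector [vector [0, of_real (sin (t$1)) * (\<i> * cis (- t$3))],
     vector [of_real (sin (t$1)) * (\<i> * cis (t$3)), 0]]"
    by (simp_all add: D_def axis_def)
qed

lemma vector_matrix_mult_2:
  "(vector [vector [a, b], vector [c, d]] :: complex^2^2) ** (vector [vector [a', b'], vector [c', d']] :: complex^2^2)
    = vector [vector [a * a' + b * c', a * b' + b * d'], vector [c * a' + d * c', c * b' + d * d']]"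
  by (simp add: vec_eq_iff forall_2 matrix_matrix_mult_def sum_2)

text \<open>\<open>matrix_inv\<close> chooses some two-sided inverse, and associativity makes it
  unique.\<close>

lemma matrix_inv_eqI:
  fixes A :: "'a::comm_ring_1^'n^'n"
  assumes "A ** B = mat 1" "B ** A = mat 1"
  shows "matrix_inv A = B"
proof -
  have "A ** matrix_inv A = mat 1"
    unfolding matrix_inv_def by (rule someI2[where a=B]) (use assms in auto)
  then have "(B ** A) ** matrix_inv A = B"
    by (simp flip: matrix_mul_assoc)
  then show ?thesis
    by (simp add: assms)
qed

lemma matrix_inv_hopf:
  "matrix_inv (hopf_chart t) = vector [vector [of_real (cos (t$1)) * cis (- t$2), of_real (sin (t$1)) * cis (- t$3)],
     vector [- of_real (sin (t$1)) * cis (t$3), of_real (cos (t$1)) * cis (t$2)]]"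
proof -
  have e: "cis x * cis (- x) = 1" for x
    by (simp add: cis_mult)
  have sc: "of_real (sin x) * of_real (sin x) = 1 - of_real (cos x) * (of_real (cos x) :: complex)" for x
    using sin_squared_eq[of x] by (simp add: power2_eq_square flip: of_real_mult)
  have mat1: "mat 1 = (vector [vector [1, 0], vector [0, 1]] :: complex^2^2)"
    by (simp add: vec_eq_iff forall_2 mat_def)
  \<comment> \<open>With letters for cosine, sine and the phases, all entries reduce by A A' = 1, G
    G' = 1 and S^2 + C^2 = 1.\<close>
  have alg: "C * A * (C * A') + - (S * G') * (- S * G) = 1" "C * A * (S * G') + - (S * G') * (C * A) = 0"
    "S * G * (C * A') + C * A' * (- S * G) = 0" "S * G * (S * G') + C * A' * (C * A) = 1"
    "C * A' * (C * A) + S * G' * (S * G) = 1" "C * A' * - (S * G') + S * G' * (C * A') = 0"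
    "- S * G * (C * A) + C * A * (S * G) = 0" "- S * G * - (S * G') + C * A * (C * A') = 1"
    if "A * A' = 1" "G * G' = 1" "S * S = 1 - C * C" for A A' G G' C S :: complex
    using that by algebra+
  show ?thesis
    by (rule matrix_inv_eqI)
       (simp_all only: hopf_chart_def vector_matrix_mult_2 mat1 alg[OF e[of "t$2"] e[of "t$3"] sc[of "t$1"]])
qed

text \<open>In Hopf coordinates the metric is diagonal with entries 1, cos^2 and sin^2 of the first
  coordinate, divided by \<beta>^2. The matrices \<open>X j\<close> are the coordinate vectors
  translated to the identity.\<close>

lemma su2_gram_det:
  assumes "\<beta> > 0"
  shows "det (su2_gram \<beta> t) = (cos (t$1) * sin (t$1) / \<beta> ^ 3)\<^sup>2"
proof -
  have e: "cis x * cis (- x) = 1" for x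
    by (simp add: cis_mult)
  have sc: "of_real (sin x) * of_real (sin x) = 1 - of_real (cos x) * (of_real (cos x) :: complex)" for x
    using sin_squared_eq[of x] by (simp add: power2_eq_square flip: of_real_mult)
  define X where "X j = matrix_inv (hopf_chart t) ** hopf_partial t j" for j
  define C S where "C = complex_of_real (cos (t$1))" and "S = complex_of_real (sin (t$1))"
  define A A' G G' where "A = cis (t$2)" and "A' = cis (- t$2)" and "G = cis (t$3)" and "G' = cis (- t$3)"
  have rel: "A * A' = 1" "G * G' = 1" "S * S = 1 - C * C"
    using e sc by (auto simp: A_def A'_def G_def G'_def C_def S_def)
  note X_unfold = X_def matrix_inv_hopf hopf_partial_eq C_def[symmetric] S_def[symmetric] A_def[symmetric] A'_def[symmetric]
    G_def[symmetric] G'_def[symmetric] vector_matrix_mult_2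
  have X1: "X 1 = vector [vector [0, - (A' * G')], vector [A * G, 0]]"
  proof -
    have x: "C * A' * (- S * A) + S * G' * (C * G) = 0" "C * A' * (- C * G') + S * G' * (- S * A') = - (A' * G')"
      "- S * G * (- S * A) + C * A * (C * G) = A * G" "- S * G * (- C * G') + C * A * (- S * A') = 0"
      using rel by algebra+
    show ?thesis
      by (simp only: X_unfold x)
  qed
  \<comment> \<open>A letter for \<i> keeps it an indeterminate in the polynomial identities; J J =
    -1 enters only when the traces are evaluated.\<close>
  define J where "J = \<i>"
  have J: "J * J = - 1"
    by (simp add: J_def)
  note X_unfold = X_unfold J_def[symmetric]
  have X2: "X 2 = vector [vector [J * (C * C), - J * (S * C * A' * G')], vector [- J * (S * C * A * G), - J * (C * C)]]"
  proof -
    have x: "C * A' * (C * (J * A)) + S * G' * 0 = J * (C * C)" "C * A' * 0 + S * G' * (- C * (J * A')) = - J * (S * C * A' * G')"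
      "- S * G * (C * (J * A)) + C * A * 0 = - J * (S * C * A * G)" "- S * G * 0 + C * A * (- C * (J * A')) = - J * (C * C)"
      using rel by algebra+
    show ?thesis
      by (simp only: X_unfold x)
  qed
  have X3: "X 3 = vector [vector [J * (S * S), J * (S * C * A' * G')], vector [J * (S * C * A * G), - J * (S * S)]]"
  proof -
    have x: "C * A' * 0 + S * G' * (S * (J * G)) = J * (S * S)" "C * A' * (S * (J * G')) + S * G' * 0 = J * (S * C * A' * G')"
      "- S * G * 0 + C * A * (S * (J * G)) = J * (S * C * A * G)" "- S * G * (S * (J * G')) + C * A * 0 = - J * (S * S)"
      using rel by algebra+
    show ?thesis
      by (simp only: X_unfold x)
  qed
  have tr: "trace ((vector [vector [a, b], vector [c, d]] :: complex^2^2) ** (vector [vector [a', b'], vector [c', d']] :: complex^2^2))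
      = a * a' + b * c' + (c * b' + d * d')" for a b c d a' b' c' d'
    by (simp add: trace_def matrix_matrix_mult_def sum_2)
  have T: "trace (X 1 ** X 1) = - 2" "trace (X 1 ** X 2) = 0" "trace (X 1 ** X 3) = 0"
    "trace (X 2 ** X 1) = 0" "trace (X 2 ** X 2) = - 2 * (C * C)" "trace (X 2 ** X 3) = 0"
    "trace (X 3 ** X 1) = 0" "trace (X 3 ** X 2) = 0" "trace (X 3 ** X 3) = - 2 * (S * S)"
  proof -
    show "trace (X 1 ** X 1) = - 2" unfolding X1 tr using rel by algebra
    show "trace (X 1 ** X 2) = 0" unfolding X1 X2 tr by algebra
    show "trace (X 1 ** X 3) = 0" unfolding X1 X3 tr by algebra
    show "trace (X 2 ** X 1) = 0" unfolding X1 X2 tr by algebra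
    show "trace (X 3 ** X 1) = 0" unfolding X1 X3 tr by algebra
    have AG: "(A' * G') * (A * G) = 1"
      using rel by algebra
    have X22: "J * (C * C) * (J * (C * C)) + - J * (S * C * A' * G') * (- J * (S * C * A * G))
      + (- J * (S * C * A * G) * (- J * (S * C * A' * G')) + - J * (C * C) * (- J * (C * C))) = 2 * (J * J) * (C * C * C * C + S * S * C * C)"
      using AG by algebra
    have X23: "J * (C * C) * (J * (S * S)) + - J * (S * C * A' * G') * (J * (S * C * A * G))
      + (- J * (S * C * A * G) * (J * (S * C * A' * G')) + - J * (C * C) * (- J * (S * S))) = 0"
      using AG by algebra
    have X32: "J * (S * S) * (J * (C * C)) + J * (S * C * A' * G') * (- J * (S * C * A * G))
      + (J * (S * C * A * G) * (- J * (S * C * A' * G')) + - J * (S * S) * (- J * (C * C))) = 0"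
      using AG by algebra
    have X33: "J * (S * S) * (J * (S * S)) + J * (S * C * A' * G') * (J * (S * C * A * G))
      + (J * (S * C * A * G) * (J * (S * C * A' * G')) + - J * (S * S) * (- J * (S * S))) = 2 * (J * J) * (S * S * S * S + S * S * C * C)"
      using AG by algebra
    show "trace (X 2 ** X 2) = - 2 * (C * C)"
      unfolding X2 tr X22 J using rel(3) by algebra
    show "trace (X 3 ** X 3) = - 2 * (S * S)"
      unfolding X3 tr X33 J using rel(3) by algebra
    show "trace (X 2 ** X 3) = 0" "trace (X 3 ** X 2) = 0"
      unfolding X2 X3 tr X23 X32 by (rule refl)+
  qed
  have "su2_gram \<beta> t = (\<chi> j k. - (1 / (2 * \<beta>\<^sup>2)) * Re (trace (X j ** X k)))"
    by (simp add: su2_gram_def su2_inner_def X_def hopf_partial_def)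
  then have "det (su2_gram \<beta> t) = (1 / \<beta>\<^sup>2) * ((cos (t$1) * cos (t$1)) / \<beta>\<^sup>2) * ((sin (t$1) * sin (t$1)) / \<beta>\<^sup>2)"
    by (simp add: det_3 T C_def S_def)
  then show ?thesis
    using assms by (simp add: field_simps eval_nat_numeral)
qed

lemma hopf_dom_borel [measurable]: "hopf_dom \<in> sets borel"
  unfolding hopf_dom_def by measurable

text \<open>In this metric SU(2) is a three-sphere of radius 1 / \<beta>.\<close>

lemma vol_SU2_eq:
  assumes \<beta>: "\<beta> > 0"
  shows "vol_SU2 \<beta> = 2 * pi\<^sup>2 / \<beta> ^ 3"
proof -
  have pos: "0 \<le> cos (t$1) * sin (t$1)" if "t \<in> hopf_dom" for t :: "real^3"
    using that by (intro mult_nonneg_nonneg cos_ge_zero sin_ge_zero) (auto simp: hopf_dom_def)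
  let ?f = "\<lambda>t::real^3. indicator hopf_dom t * (cos (t$1) * sin (t$1) / \<beta> ^ 3)"
  have "sqrt (det (su2_gram \<beta> t)) = cos (t$1) * sin (t$1) / \<beta> ^ 3" if "t \<in> hopf_dom" for t
    unfolding su2_gram_det[OF \<beta>] using pos[OF that] \<beta> by (intro real_sqrt_unique) (auto intro: divide_nonneg_nonneg)
  then have eq: "indicator hopf_dom t *\<^sub>R sqrt (det (su2_gram \<beta> t)) = ?f t" for t
    by (auto simp: indicator_def)
  have [measurable]: "cos \<in> borel_measurable (borel :: real measure)" "sin \<in> borel_measurable (borel :: real measure)"
    by (intro borel_measurable_continuous_onI continuous_intros)+
  have "vol_SU2 \<beta> = (LINT t|lborel. ?f t)"
    unfolding vol_SU2_def set_lebesgue_integral_def eq ..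
  also have "\<dots> = enn2real (\<integral>\<^sup>+t. ennreal (?f t) \<partial>lborel)"
    by (rule integral_eq_nn_integral) (use pos \<beta> in \<open>auto simp: indicator_def\<close>)
  also have "(\<integral>\<^sup>+t. ennreal (?f t) \<partial>lborel) = (\<integral>\<^sup>+a. \<integral>\<^sup>+b. \<integral>\<^sup>+c. ennreal (?f (vector [a, b, c])) \<partial>lborel \<partial>lborel \<partial>lborel)"
    by (rule nn_integral_lborel_vector_3) measurable
  also have "\<dots> = (\<integral>\<^sup>+a. \<integral>\<^sup>+b. \<integral>\<^sup>+c. (ennreal (cos a * sin a / \<beta> ^ 3) * indicator {0<..<pi / 2} a) * indicator {0<..<2 * pi} b
      * indicator {0<..<2 * pi} c \<partial>lborel \<partial>lborel \<partial>lborel)"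
    by (intro nn_integral_cong) (auto simp: hopf_dom_def indicator_def)
  also have "\<dots> = (\<integral>\<^sup>+a. \<integral>\<^sup>+b. (ennreal (cos a * sin a / \<beta> ^ 3) * indicator {0<..<pi / 2} a) * ennreal (2 * pi) * indicator {0<..<2 * pi} b \<partial>lborel \<partial>lborel)"
    by (subst nn_integral_cmult_indicator) (simp_all add: mult_ac)
  also have "\<dots> = (\<integral>\<^sup>+a. ennreal (cos a * sin a / \<beta> ^ 3) * indicator {0<..<pi / 2} a * ennreal (2 * pi) * ennreal (2 * pi) \<partial>lborel)"
    by (subst nn_integral_cmult_indicator) simp_all
  also have "\<dots> = (\<integral>\<^sup>+a. ennreal (cos a * sin a / \<beta> ^ 3) * indicator {0<..<pi / 2} a \<partial>lborel) * ennreal (2 * pi) * ennreal (2 * pi)"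
    unfolding mult.assoc[of _ "ennreal (2 * pi)" "ennreal (2 * pi)"] by (rule nn_integral_multc) measurable
  also have "(\<integral>\<^sup>+a. ennreal (cos a * sin a / \<beta> ^ 3) * indicator {0<..<pi / 2} a \<partial>lborel)
      = (\<integral>\<^sup>+a. ennreal (cos a * sin a / \<beta> ^ 3) * indicator {0..pi / 2} a \<partial>lborel)"
  proof (rule nn_integral_cong_AE)
    show "AE a in lborel. ennreal (cos a * sin a / \<beta> ^ 3) * indicator {0<..<pi / 2} a
        = ennreal (cos a * sin a / \<beta> ^ 3) * indicator {0..pi / 2} a"
      using AE_lborel_singleton[of "0::real"] AE_lborel_singleton[of "pi / 2"]
      by eventually_elim (auto simp: indicator_def)
  qed
  also have "\<dots> = ennreal ((sin (pi / 2))\<^sup>2 / (2 * \<beta> ^ 3) - (sin 0)\<^sup>2 / (2 * \<beta> ^ 3))"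
  proof (rule nn_integral_FTC_Icc[where F="\<lambda>x. (sin x)\<^sup>2 / (2 * \<beta> ^ 3)"])
    fix x :: real assume "x \<in> {0..pi / 2}"
    then show "0 \<le> cos x * sin x / \<beta> ^ 3"
      using \<beta> by (intro divide_nonneg_nonneg mult_nonneg_nonneg cos_ge_zero sin_ge_zero) auto
    show "((\<lambda>x. (sin x)\<^sup>2 / (2 * \<beta> ^ 3)) has_real_derivative cos x * sin x / \<beta> ^ 3) (at x)"
      using \<beta> by (auto intro!: derivative_eq_intros simp: field_simps)
  qed (use pi_gt_zero in auto)
  also have "\<dots> * ennreal (2 * pi) * ennreal (2 * pi) = ennreal (2 * pi\<^sup>2 / \<beta> ^ 3)"
    using \<beta> by (simp add: power2_eq_square field_simps flip: ennreal_mult')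
  finally show ?thesis
    using \<beta> by simp
qed

section \<open>Characters as Chebyshev polynomials\<close>

text \<open>This is U_n (w / 2) for the Chebyshev polynomial U_n of the second kind.\<close>

fun cheb :: "nat \<Rightarrow> complex \<Rightarrow> complex" where
  "cheb 0 w = 1"
| "cheb (Suc 0) w = w"
| "cheb (Suc (Suc n)) w = w * cheb (Suc n) w - cheb n w"

text \<open>The trace \<open>T n\<close> is coupled to the shifted sum \<open>S n\<close>, in which
  one factor p is exchanged for q. Splitting off one linear factor gives T (n+1) = a T n + c S n +
  d^(n+1) and S (n+1) = b T n + d S n, and S is then eliminated.\<close>

lemma sym_character_rec:
  "sym_character (Suc (Suc n)) g = trace g * sym_character (Suc n) g - det g * sym_character n g"
proof -
  define a b c d where "a = g$1$1" and "b = g$1$2" and "c = g$2$1" and "d = g$2$2"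
  define p q where "p = [:a, c:]" and "q = [:b, d:]"
  define T where "T n = (\<Sum>k\<le>n. coeff (p ^ (n - k) * q ^ k) k)" for n
  define S where "S n = (\<Sum>k<n. coeff (p ^ (n - Suc k) * q ^ Suc k) k)" for n
  have T: "sym_character n g = T n" for n
    by (simp add: sym_character_def T_def p_def q_def a_def b_def c_def d_def)
  have qk: "coeff (q ^ k) k = d ^ k" for k
    by (simp add: q_def coeff_linear_poly_power)
  have cp: "coeff (p * r) 0 = a * coeff r 0" "coeff (p * r) (Suc k) = a * coeff r (Suc k) + c * coeff r k" for r k
    by (simp_all add: p_def)
  have cq: "coeff (q * r) 0 = b * coeff r 0" "coeff (q * r) (Suc k) = b * coeff r (Suc k) + d * coeff r k" for r k
    by (simp_all add: q_def)
  have T_Suc: "T (Suc n) = a * T n + c * S n + d ^ Suc n" for n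
  proof -
    have "T (Suc n) = (\<Sum>k\<le>n. coeff (p * (p ^ (n - k) * q ^ k)) k) + d ^ Suc n"
      by (simp add: T_def Suc_diff_le mult.assoc qk del: power_Suc) (simp add: mult.assoc)
    also have "(\<Sum>k\<le>n. coeff (p * (p ^ (n - k) * q ^ k)) k)
        = a * T n + c * (\<Sum>k<n. coeff (p ^ (n - Suc k) * q ^ Suc k) k)"
      unfolding T_def lessThan_Suc_atMost[symmetric] sum.lessThan_Suc_shift
      by (simp add: cp sum.distrib sum_distrib_left distrib_left)
    finally show ?thesis
      by (simp add: S_def)
  qed
  have S_Suc: "S (Suc n) = b * T n + d * S n" for n
  proof -
    have "S (Suc n) = (\<Sum>k<Suc n. coeff (q * (p ^ (n - k) * q ^ k)) k)"
      by (simp add: S_def mult_ac)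
    also have "\<dots> = b * T n + d * S n"
      unfolding T_def S_def lessThan_Suc_atMost[symmetric] sum.lessThan_Suc_shift
      by (simp add: cq sum.distrib sum_distrib_left distrib_left)
    finally show ?thesis .
  qed
  have "T (Suc (Suc n)) = (a + d) * T (Suc n) - (a * d - b * c) * T n"
    using T_Suc[of "Suc n"] T_Suc[of n] S_Suc[of n] by (simp add: algebra_simps)
  then show ?thesis
    by (simp add: T trace_def sum_2 det_2 a_def b_def c_def d_def)
qed

lemma sym_character_eq_cheb:
  assumes "det g = 1"
  shows "sym_character n g = cheb n (trace g)"
proof (induction n "trace g" rule: cheb.induct)
  case 1
  then show ?case by (simp add: sym_character_def)
next
  case 2
  then show ?case by (simp add: sym_character_def trace_def sum_2 atMost_Suc)
next
  case (3 n)
  then show ?case by (simp add: sym_character_rec assms)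
qed

lemma chi_eq: "chi n g = (if g \<in> SL2C then cheb n (trace g) else 0)"
  by (simp add: chi_def SL2C_def sym_character_eq_cheb)

text \<open>The Weyl character formula with its denominator cleared, so that \<zeta> = 1 and \<zeta>
  = -1 are included.\<close>

lemma cheb_eigenvalue:
  assumes "\<zeta> \<noteq> 0"
  shows "cheb n (\<zeta> + 1 / \<zeta>) * (\<zeta> - 1 / \<zeta>) = \<zeta> ^ Suc n - (1 / \<zeta>) ^ Suc n"
proof (induction n "\<zeta> + 1 / \<zeta>" rule: cheb.induct)
  case (3 n)
  have "cheb (Suc (Suc n)) (\<zeta> + 1 / \<zeta>) * (\<zeta> - 1 / \<zeta>)
      = (\<zeta> + 1 / \<zeta>) * (\<zeta> ^ Suc (Suc n) - (1 / \<zeta>) ^ Suc (Suc n)) - (\<zeta> ^ Suc n - (1 / \<zeta>) ^ Suc n)"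
    using 3 by (simp only: cheb.simps left_diff_distrib mult.assoc)
  also have "\<dots> = \<zeta> ^ Suc (Suc (Suc n)) - (1 / \<zeta>) ^ Suc (Suc (Suc n))"
    using assms by (simp add: field_simps)
  finally show ?case .
qed (use assms in \<open>auto simp: field_simps\<close>)

lemma cheb_2: "cheb n 2 = of_nat (Suc n)"
  by (induction n "2::complex" rule: cheb.induct) (auto simp: algebra_simps)

lemma cheb_minus_2: "cheb n (- 2) = (- 1) ^ n * of_nat (Suc n)"
proof (induction n "- 2::complex" rule: cheb.induct)
  case (3 n)
  show ?case
    unfolding cheb.simps 3 by (simp add: algebra_simps)
qed simp_all

text \<open>A crude geometric bound; the Gaussian decay of the coefficients of the kernel absorbs
  any geometric growth.\<close>

lemma norm_cheb_le: "cmod (cheb n w) \<le> (cmod w + 1) ^ n"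
proof (induction n w rule: cheb.induct)
  case (3 n w)
  have "cmod (cheb (Suc (Suc n)) w) \<le> cmod w * cmod (cheb (Suc n) w) + cmod (cheb n w)"
    by (metis cheb.simps(3) norm_mult norm_triangle_ineq4)
  also have "\<dots> \<le> cmod w * (cmod w + 1) ^ Suc n + (cmod w + 1) ^ n"
    using 3 by (intro add_mono mult_left_mono) auto
  also have "\<dots> \<le> cmod w * (cmod w + 1) ^ Suc n + (cmod w + 1) ^ Suc n"
    by (intro add_left_mono power_increasing) auto
  finally show ?case
    by (simp add: algebra_simps)
qed auto

lemma cheb_holomorphic: "cheb n holomorphic_on A"
proof (induction n "0::complex" rule: cheb.induct)
  case 1
  then show ?case by (simp add: cheb.simps[abs_def])
next
  case 2
  have "cheb (Suc 0) = (\<lambda>w. w)" by auto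
  then show ?case by simp
next
  case (3 n)
  have "cheb (Suc (Suc n)) = (\<lambda>w. w * cheb (Suc n) w - cheb n w)" by auto
  with 3 show ?case by (simp add: holomorphic_intros)
qed

text \<open>The number of walks of length k on the nonnegative integers from 0 to n with steps +1
  and -1, which is the multiplicity of Sym^n in the k-th tensor power of C^2.\<close>

fun ballot :: "nat \<Rightarrow> nat \<Rightarrow> real" where
  "ballot 0 n = (if n = 0 then 1 else 0)"
| "ballot (Suc k) 0 = ballot k 1"
| "ballot (Suc k) (Suc n) = ballot k n + ballot k (Suc (Suc n))"

lemma ballot_nonneg: "ballot k n \<ge> 0"
  by (induction k n rule: ballot.induct) auto

lemma ballot_eq_0: "n > k \<Longrightarrow> ballot k n = 0"
  by (induction k n rule: ballot.induct) auto

text \<open>Multiplication by w sends \<open>cheb n\<close> to cheb (n+1) + cheb (n-1), the second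
  term being absent for n = 0; this is the step of the walk counted by
  \<open>ballot\<close>.\<close>

lemma power_eq_sum_cheb: "w ^ k = (\<Sum>n\<le>k. of_real (ballot k n) * cheb n w)"
proof (induction k)
  case (Suc k)
  define e where "e n = (of_real (ballot k n) :: complex)" for n
  have e0: "e n = 0" if "n > k" for n
    using that by (simp add: e_def ballot_eq_0)
  have "(\<Sum>n\<le>Suc k. of_real (ballot (Suc k) n) * cheb n w)
      = e 1 + (\<Sum>n\<le>k. (e n + e (Suc (Suc n))) * cheb (Suc n) w)"
    by (simp only: sum.atMost_Suc_shift) (simp add: e_def)
  also have "(\<Sum>n\<le>k. (e n + e (Suc (Suc n))) * cheb (Suc n) w)
      = (\<Sum>n\<le>k. e n * cheb (Suc n) w) + (\<Sum>n\<le>k. e (Suc (Suc n)) * cheb (Suc n) w)"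
    by (simp add: algebra_simps sum.distrib)
  \<comment> \<open>The index is shifted by two. The shifted sum contains the additional term e 1 at
    n = 1, which cancels against the leading e 1.\<close>
  also have "(\<Sum>n\<le>k. e (Suc (Suc n)) * cheb (Suc n) w) = (\<Sum>n\<le>Suc (Suc k). e n * (if n = 0 then 0 else cheb (n - 1) w)) - e 1"
    unfolding sum.atMost_Suc_shift by simp
  also have "(\<Sum>n\<le>Suc (Suc k). e n * (if n = 0 then 0 else cheb (n - 1) w)) = (\<Sum>n\<le>k. e n * (if n = 0 then 0 else cheb (n - 1) w))"
    by (simp add: e0)
  also have "e 1 + ((\<Sum>n\<le>k. e n * cheb (Suc n) w) + ((\<Sum>n\<le>k. e n * (if n = 0 then 0 else cheb (n - 1) w)) - e 1))
      = (\<Sum>n\<le>k. e n * (cheb (Suc n) w + (if n = 0 then 0 else cheb (n - 1) w)))"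
    by (simp add: sum.distrib distrib_left)
  also have "\<dots> = (\<Sum>n\<le>k. w * (e n * cheb n w))"
  proof (intro sum.cong refl)
    fix n show "e n * (cheb (Suc n) w + (if n = 0 then 0 else cheb (n - 1) w)) = w * (e n * cheb n w)"
      by (cases n) auto
  qed
  also have "\<dots> = w ^ Suc k"
    by (simp add: Suc.IH e_def sum_distrib_left)
  finally show ?case ..
qed simp

section \<open>Elliptic coordinates w = 2 cosh z\<close>

definition two_cosh :: "complex \<Rightarrow> complex" where
  "two_cosh z = exp z + exp (- z)"

text \<open>Half of a period strip, since \<open>two_cosh\<close> is even and has period 2 pi
  i.\<close>

definition half_strip :: "complex set" where
  "half_strip = {z. 0 < Re z \<and> 0 < Im z \<and> Im z < 2 * pi}"

lemma open_half_strip: "open half_strip"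
  unfolding half_strip_def by (intro open_Collect_conj open_Collect_less continuous_intros)

lemma two_cosh_holomorphic: "two_cosh holomorphic_on A"
  unfolding two_cosh_def[abs_def] by (intro holomorphic_intros)

lemma deriv_two_cosh: "deriv two_cosh z = exp z - exp (- z)"
  unfolding two_cosh_def[abs_def] by (rule DERIV_imp_deriv) (auto intro!: derivative_eq_intros)

text \<open>The difference of two values factors as (exp z - exp w) (1 - exp (- z - w)), and the
  second factor can vanish only if Re z + Re w = 0.\<close>

lemma inj_on_two_cosh: "inj_on two_cosh half_strip"
proof (rule inj_onI)
  fix z w assume z: "z \<in> half_strip" and w: "w \<in> half_strip" and eq: "two_cosh z = two_cosh w"
  have "(exp z - exp w) * (1 - exp (- z) * exp (- w)) = two_cosh z - two_cosh w"
    by (simp add: two_cosh_def algebra_simps exp_minus)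
  then have "exp z = exp w \<or> exp (- z) * exp (- w) = 1"
    by (metis eq eq_iff_diff_eq_0 mult_eq_0_iff)
  moreover have "exp (- z) * exp (- w) \<noteq> 1"
  proof
    assume "exp (- z) * exp (- w) = 1"
    then have "exp (- Re z) * exp (- Re w) = 1"
      by (metis norm_mult norm_exp_eq_Re norm_one uminus_complex.sel(1))
    then have "Re z + Re w = 0"
      by (metis exp_add exp_eq_one_iff add.commute minus_add_distrib neg_equal_0_iff_equal)
    then show False
      using z w by (auto simp: half_strip_def)
  qed
  ultimately have e: "exp z = exp w"
    by blast
  have "\<bar>Im z - Im w\<bar> < 2 * pi"
    using z w by (auto simp: half_strip_def abs_less_iff)
  then show "z = w"
    using e by (rule exp_complex_eqI)
qed

text \<open>Every w off the real axis is attained. One of its eigenvalues \<zeta> and 1/\<zeta> lies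
  outside the unit circle, since |\<zeta>| = 1 would make w = 2 Re \<zeta> real; this eigenvalue is
  not real either, so it has a logarithm in the strip.\<close>

lemma two_cosh_image: "- two_cosh ` half_strip \<in> null_sets lborel"
proof -
  have "w \<in> two_cosh ` half_strip" if w: "Im w \<noteq> 0" for w
  proof -
    obtain \<zeta>' where \<zeta>': "\<zeta>' \<noteq> 0" "w = \<zeta>' + 1 / \<zeta>'"
      using eigenvalue_exists .
    have ne: "cmod \<zeta>' \<noteq> 1"
    proof
      assume "cmod \<zeta>' = 1"
      then have "1 / \<zeta>' = cnj \<zeta>'"
        by (simp add: divide_conv_cnj)
      with w \<zeta>' show False
        by simp
    qed
    obtain \<zeta> where \<zeta>: "\<zeta> \<noteq> 0" "w = \<zeta> + 1 / \<zeta>" "cmod \<zeta> > 1"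
    proof (cases "cmod \<zeta>' > 1")
      case False
      have "cmod (1 / \<zeta>') > 1"
        using False ne \<zeta>' by (simp add: norm_divide)
      then show thesis
        using \<zeta>' by (intro that[of "1 / \<zeta>'"]) (auto simp: add.commute)
    qed (use \<zeta>' that in blast)
    have "Im \<zeta> \<noteq> 0"
    proof
      assume "Im \<zeta> = 0"
      then have "Im w = 0"
        unfolding \<zeta>(2) by (simp add: Im_divide)
      with w show False ..
    qed
    then obtain z where z: "z \<in> period_strip" "exp z = \<zeta>"
      using exp_period_strip by blast
    have "exp (Re z) > 1"
      using \<zeta>(3) z(2) norm_exp_eq_Re[of z] by simp
    then have "z \<in> half_strip"
      using z(1) by (simp add: half_strip_def period_strip_def)
    moreover have "w = two_cosh z"
      using \<zeta>(2) z(2) by (simp add: two_cosh_def exp_minus inverse_eq_divide)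
    ultimately show ?thesis
      by blast
  qed
  then have sub: "- two_cosh ` half_strip \<subseteq> {w. Im w = 0}"
    by blast
  have "open (two_cosh ` half_strip)"
    by (rule open_mapping_thm3[OF two_cosh_holomorphic open_half_strip inj_on_two_cosh])
  then show ?thesis
    by (intro null_sets_subset[OF real_line_null _ sub]) auto
qed

lemma two_cosh_eigenvalue: "two_cosh z = exp z + 1 / exp z"
  by (simp add: two_cosh_def exp_minus inverse_eq_divide)

text \<open>The eigenvalues are exp z and exp (- z), so \<open>radius\<close> of this value is the
  modulus of Re z.\<close>

lemma min_frob_two_cosh: "min_frob (two_cosh z) = 2 * cosh (2 * Re z)"
proof -
  have "min_frob (two_cosh z) = (cmod (exp z))\<^sup>2 + (cmod (exp (- z)))\<^sup>2"
    using min_frob_eigenvalue[of "exp z"] by (simp add: two_cosh_eigenvalue exp_minus inverse_eq_divide)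
  also have "\<dots> = exp (2 * Re z) + exp (- (2 * Re z))"
    by (simp add: power2_eq_square flip: exp_add)
  finally show ?thesis
    by (simp add: cosh_def)
qed

lemma gauss_two_cosh:
  assumes "0 < Re z"
  shows "gauss \<tau> (two_cosh z) = exp (- (Re z)\<^sup>2 / \<tau>)"
  using assms by (simp add: gauss_def min_frob_two_cosh radius_cosh)

lemma cheb_two_cosh:
  "cheb n (two_cosh z) * deriv two_cosh z = exp (of_nat (Suc n) * z) - exp (- (of_nat (Suc n) * z))"
proof -
  have "cheb n (two_cosh z) * deriv two_cosh z = exp z ^ Suc n - exp (- z) ^ Suc n"
    using cheb_eigenvalue[of "exp z" n]
    by (simp add: two_cosh_eigenvalue deriv_two_cosh exp_minus inverse_eq_divide del: power_Suc)
  also have "\<dots> = exp (of_nat (Suc n) * z) - exp (of_nat (Suc n) * (- z))"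
    unfolding exp_of_nat_mult ..
  finally show ?thesis
    by simp
qed

lemma cnj_measurable [measurable]: "cnj \<in> borel_measurable borel"
  by (intro borel_measurable_continuous_onI continuous_intros)

text \<open>For N = n + 1 this is \<open>cheb n (two_cosh z)\<close> times the derivative of
  \<open>two_cosh\<close>. The Jacobian of the substitution is thereby absorbed, and Chebyshev
  orthogonality becomes Fourier orthogonality in Im z.\<close>

definition sinh_mode :: "nat \<Rightarrow> complex \<Rightarrow> complex" where
  "sinh_mode N z = exp (of_nat N * z) - exp (- (of_nat N * z))"

lemma sinh_mode_measurable [measurable]: "sinh_mode N \<in> borel_measurable borel"
  unfolding sinh_mode_def[abs_def] by (intro borel_measurable_continuous_onI continuous_intros)

lemma cheb_measurable [measurable]: "cheb n \<in> borel_measurable borel"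
  by (intro borel_measurable_continuous_onI holomorphic_on_imp_continuous_on cheb_holomorphic)

lemma two_cosh_measurable [measurable]: "two_cosh \<in> borel_measurable borel"
  by (intro borel_measurable_continuous_onI holomorphic_on_imp_continuous_on two_cosh_holomorphic)

lemma deriv_two_cosh_measurable [measurable]: "deriv two_cosh \<in> borel_measurable borel"
  unfolding deriv_two_cosh[abs_def] by (intro borel_measurable_continuous_onI continuous_intros)

lemma half_strip_borel [measurable]: "half_strip \<in> sets borel"
  using open_half_strip by simp

lemma cheb_product_two_cosh:
  "(cmod (deriv two_cosh z))\<^sup>2 *\<^sub>R (cnj (cheb m (two_cosh z)) * cheb n (two_cosh z))
    = cnj (sinh_mode (Suc m) z) * sinh_mode (Suc n) z"
proof -
  have "complex_of_real ((cmod (deriv two_cosh z))\<^sup>2) = deriv two_cosh z * cnj (deriv two_cosh z)"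
    by (rule complex_norm_square)
  then have "(cmod (deriv two_cosh z))\<^sup>2 *\<^sub>R (cnj (cheb m (two_cosh z)) * cheb n (two_cosh z))
      = cnj (cheb m (two_cosh z) * deriv two_cosh z) * (cheb n (two_cosh z) * deriv two_cosh z)"
    by (simp add: scaleR_conv_of_real mult_ac)
  then show ?thesis
    by (simp only: cheb_two_cosh sinh_mode_def)
qed

lemma sinh_mode_product:
  "cnj (sinh_mode M (Complex x y)) * sinh_mode N (Complex x y)
    = of_real (exp ((real M + real N) * x)) * cis ((real N - real M) * y)
      - of_real (exp ((real M - real N) * x)) * cis (- (real M + real N) * y)
      - of_real (exp ((real N - real M) * x)) * cis ((real M + real N) * y)
      + of_real (exp (- (real M + real N) * x)) * cis ((real M - real N) * y)"
proof -
  have e: "exp (of_nat K * Complex x y) = of_real (exp (real K * x)) * cis (real K * y)"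
    "exp (- (of_nat K * Complex x y)) = of_real (exp (- real K * x)) * cis (- real K * y)" for K
    by (simp_all add: exp_eq_polar)
  have c: "cnj (cis a) = cis (- a)" for a
    by (simp add: cis_cnj)
  have p: "of_real (exp a) * cis b * (of_real (exp a') * cis b') = of_real (exp (a + a')) * cis (b + b')" for a a' b b'
    by (simp add: exp_add cis_mult[symmetric])
  show ?thesis
    unfolding sinh_mode_def e complex_cnj_diff complex_cnj_mult complex_cnj_complex_of_real c
      left_diff_distrib right_diff_distrib p
    by (simp add: algebra_simps)
qed

lemma integral_cis_period:
  assumes "k \<noteq> 0"
  shows "(LINT y|lborel. indicator {0<..<2 * pi} y *\<^sub>R cis (of_int k * y)) = 0"
proof -
  let ?F = "\<lambda>y. cis (of_int k * y) / (\<i> * of_int k)"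
  have "(LINT y|lborel. indicator {0<..<2 * pi} y *\<^sub>R cis (of_int k * y))
      = (LINT y|lborel. indicator {0..2 * pi} y *\<^sub>R cis (of_int k * y))"
  proof (rule integral_cong_AE)
    show "AE y in lborel. indicator {0<..<2 * pi} y *\<^sub>R cis (of_int k * y) = indicator {0..2 * pi} y *\<^sub>R cis (of_int k * y)"
      using AE_lborel_singleton[of "0::real"] AE_lborel_singleton[of "2 * pi"]
      by eventually_elim (auto simp: indicator_def)
    have [measurable]: "cis \<in> borel_measurable borel"
      by (intro borel_measurable_continuous_onI continuous_intros)
    show "(\<lambda>y. indicator {0<..<2 * pi} y *\<^sub>R cis (of_int k * y)) \<in> borel_measurable lborel"
      "(\<lambda>y. indicator {0..2 * pi} y *\<^sub>R cis (of_int k * y)) \<in> borel_measurable lborel"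
      by measurable
  qed
  also have "\<dots> = ?F (2 * pi) - ?F 0"
  proof (rule integral_FTC_Icc)
    fix y :: real
    have "((\<lambda>y. exp (\<i> * of_real (of_int k * y))) has_vector_derivative (\<i> * of_int k) * exp (\<i> * of_real (of_int k * y))) (at y within {0..2 * pi})"
    proof -
      have "((\<lambda>z. exp ((\<i> * of_int k) * z)) has_field_derivative (\<i> * of_int k) * exp ((\<i> * of_int k) * of_real y)) (at (of_real y))"
        by (auto intro!: derivative_eq_intros)
      from has_vector_derivative_real_field[OF this] show ?thesis
        by (simp add: mult_ac)
    qed
    then have "((\<lambda>y. exp (\<i> * of_real (of_int k * y)) / (\<i> * of_int k)) has_vector_derivative (\<i> * of_int k) * exp (\<i> * of_real (of_int k * y)) / (\<i> * of_int k)) (at y within {0..2 * pi})"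
      by (rule has_vector_derivative_divide)
    then show "(?F has_vector_derivative cis (of_int k * y)) (at y within {0..2 * pi})"
      using assms by (simp add: cis_conv_exp)
  next
    show "continuous_on {0..2 * pi} (\<lambda>y. cis (of_int k * y))"
      by (intro continuous_intros)
  qed simp
  also have "?F (2 * pi) = ?F 0"
    by (metis Ints_of_int cis_2pi cis_multiple_2pi cis_zero mult.commute mult_zero_right)
  finally show ?thesis
    by simp
qed

text \<open>The square of the integral is an integral over the plane, which
  \<open>nn_integral_norm_sq\<close> evaluates in polar coordinates.\<close>

lemma nn_integral_exp_neg_square: "(\<integral>\<^sup>+x. ennreal (exp (- x\<^sup>2)) \<partial>lborel) = ennreal (sqrt pi)"
proof -
  define I where "I = (\<integral>\<^sup>+x. ennreal (exp (- x\<^sup>2)) \<partial>lborel)"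
  have "ennreal pi * (\<integral>\<^sup>+m. ennreal (exp (- m)) * indicator {0<..} m \<partial>lborel)
      = (\<integral>\<^sup>+z. ennreal (exp (- (cmod z)\<^sup>2)) \<partial>lborel)"
    by (rule nn_integral_norm_sq[symmetric]) measurable
  also have "\<dots> = (\<integral>\<^sup>+x. \<integral>\<^sup>+y. ennreal (exp (- (cmod (Complex x y))\<^sup>2)) \<partial>lborel \<partial>lborel)"
    by (rule nn_integral_lborel_complex) measurable
  also have "\<dots> = (\<integral>\<^sup>+x. \<integral>\<^sup>+y. ennreal (exp (- x\<^sup>2)) * ennreal (exp (- y\<^sup>2)) \<partial>lborel \<partial>lborel)"
    unfolding ennreal_mult'[symmetric, OF exp_ge_zero] exp_add[symmetric] by (simp add: cmod_power2)
  also have "\<dots> = (\<integral>\<^sup>+x. ennreal (exp (- x\<^sup>2)) * I \<partial>lborel)"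
    unfolding I_def by (intro nn_integral_cong nn_integral_cmult) measurable
  also have "\<dots> = I * I"
    unfolding I_def by (rule nn_integral_multc) measurable
  also have "(\<integral>\<^sup>+m. ennreal (exp (- m)) * indicator {0<..} m \<partial>lborel) = (\<integral>\<^sup>+m. ennreal (exp (- m)) * indicator {0..} m \<partial>lborel)"
    using AE_lborel_singleton[of "0::real"]
    by (intro nn_integral_cong_AE) (auto simp: indicator_def elim!: eventually_mono)
  also have "\<dots> = ennreal (0 - (- exp (- 0)))"
  proof (rule nn_integral_FTC_atLeast)
    show "((\<lambda>m::real. - exp (- m)) \<longlongrightarrow> 0) at_top"
      by real_asymp
    show "((\<lambda>m. - exp (- m)) has_real_derivative exp (- x)) (at x)" for x :: real
      by (auto intro!: derivative_eq_intros)
  qed simp_all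
  finally have II: "I * I = ennreal pi"
    by simp
  then have "I \<noteq> \<infinity>"
    by (auto simp: ennreal_mult_top)
  then obtain r where r: "0 \<le> r" "I = ennreal r"
    by (cases I) auto
  with II have "r * r = pi"
    by (simp flip: ennreal_mult)
  then have "r = sqrt pi"
    using r by (metis real_sqrt_abs2 abs_of_nonneg)
  with r show ?thesis
    by (simp add: I_def)
qed

text \<open>Complete the square with x = \<tau> c + sqrt \<tau> u.\<close>

lemma nn_integral_gaussian_exp:
  assumes "\<tau> > 0"
  shows "(\<integral>\<^sup>+x. ennreal (exp (2 * c * x - x\<^sup>2 / \<tau>)) \<partial>lborel) = ennreal (sqrt (pi * \<tau>) * exp (\<tau> * c\<^sup>2))"
proof -
  define r where "r = sqrt \<tau>"
  have r: "r > 0" "\<tau> = r * r"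
    using assms by (simp_all add: r_def)
  have "(\<integral>\<^sup>+x. ennreal (exp (2 * c * x - x\<^sup>2 / \<tau>)) \<partial>lborel)
      = ennreal \<bar>r\<bar> * (\<integral>\<^sup>+u. ennreal (exp (2 * c * (\<tau> * c + r * u) - (\<tau> * c + r * u)\<^sup>2 / \<tau>)) \<partial>lborel)"
    by (rule nn_integral_real_affine) (use r in auto)
  also have "2 * c * (\<tau> * c + r * u) - (\<tau> * c + r * u)\<^sup>2 / \<tau> = \<tau> * c\<^sup>2 + - u\<^sup>2" for u
    using r(1) unfolding r(2) by (simp add: power2_eq_square field_simps)
  then have "(\<integral>\<^sup>+u. ennreal (exp (2 * c * (\<tau> * c + r * u) - (\<tau> * c + r * u)\<^sup>2 / \<tau>)) \<partial>lborel)
      = (\<integral>\<^sup>+u. ennreal (exp (\<tau> * c\<^sup>2)) * ennreal (exp (- u\<^sup>2)) \<partial>lborel)"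
    by (simp only: exp_add) (simp add: ennreal_mult)
  also have "\<dots> = ennreal (exp (\<tau> * c\<^sup>2)) * ennreal (sqrt pi)"
    by (subst nn_integral_cmult, measurable) (simp only: nn_integral_exp_neg_square)
  also have "ennreal \<bar>r\<bar> * \<dots> = ennreal (sqrt pi * r * exp (\<tau> * c\<^sup>2))"
    using r(1) by (simp add: mult_ac flip: ennreal_mult)
  also have "sqrt pi * r = sqrt (pi * \<tau>)"
    unfolding r_def by (simp only: real_sqrt_mult)
  finally show ?thesis .
qed

text \<open>The squared norm of \<open>cheb n\<close>. For \<tau> = hbar \<beta>^2, multiplication
  by the factor hbar / (2 \<beta>) of \<open>hinner_lift\<close> turns it into
  \<open>C_norm\<close>.\<close>

definition nu :: "real \<Rightarrow> nat \<Rightarrow> real" where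
  "nu \<tau> n = 2 * pi * sqrt (pi * \<tau>) * exp (\<tau> * (real (Suc n))\<^sup>2)"

lemma nu_pos: "\<tau> > 0 \<Longrightarrow> nu \<tau> n > 0"
  by (simp add: nu_def)

section \<open>Norms and orthogonality of the Chebyshev polynomials\<close>

lemma cmod_sinh_mode: "(cmod (sinh_mode N (Complex x y)))\<^sup>2 = exp (2 * real N * x) + exp (- 2 * real N * x) - 2 * cos (2 * real N * y)"
proof -
  have "complex_of_real ((cmod (sinh_mode N (Complex x y)))\<^sup>2) = cnj (sinh_mode N (Complex x y)) * sinh_mode N (Complex x y)"
    by (simp only: complex_norm_square mult.commute)
  then have "(cmod (sinh_mode N (Complex x y)))\<^sup>2 = Re (cnj (sinh_mode N (Complex x y)) * sinh_mode N (Complex x y))"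
    by (metis Re_complex_of_real)
  also have "\<dots> = exp (2 * real N * x) + exp (- 2 * real N * x) - 2 * cos (2 * real N * y)"
    unfolding sinh_mode_product by simp
  finally show ?thesis .
qed

text \<open>For z = x + i y, the integral over a period in y removes the cosine in
  \<open>cmod_sinh_mode\<close>. Reflecting x in the term exp (- 2 N x) joins the two half-line
  integrals into one Gaussian integral over the line, which produces exp (\<tau> N^2).\<close>

lemma nn_integral_cheb_sq:
  assumes \<tau>: "\<tau> > 0"
  shows "(\<integral>\<^sup>+w. ennreal ((cmod (cheb n w))\<^sup>2 * gauss \<tau> w) \<partial>lborel) = ennreal (nu \<tau> n)"
proof -
  define N where "N = Suc n"
  have N0: "real N \<noteq> 0"
    by (simp add: N_def)
  define E where "E x = exp (- x\<^sup>2 / \<tau>)" for x :: real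
  define A where "A x = exp (2 * real N * x) + exp (- 2 * real N * x)" for x
  have [measurable]: "E \<in> borel_measurable borel" "A \<in> borel_measurable borel"
    unfolding E_def A_def by measurable
  have "(\<integral>\<^sup>+w. ennreal ((cmod (cheb n w))\<^sup>2 * gauss \<tau> w) \<partial>lborel)
      = (\<integral>\<^sup>+z. ennreal ((cmod (deriv two_cosh z))\<^sup>2 * indicator half_strip z) * ennreal ((cmod (cheb n (two_cosh z)))\<^sup>2 * gauss \<tau> (two_cosh z)) \<partial>lborel)"
    by (rule nn_integral_holomorphic[OF two_cosh_holomorphic open_half_strip inj_on_two_cosh two_cosh_image]) measurable
  also have "\<dots> = (\<integral>\<^sup>+z. ennreal ((cmod (sinh_mode N z))\<^sup>2 * E (Re z)) * indicator half_strip z \<partial>lborel)"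
  proof (intro nn_integral_cong)
    fix z
    show "ennreal ((cmod (deriv two_cosh z))\<^sup>2 * indicator half_strip z) * ennreal ((cmod (cheb n (two_cosh z)))\<^sup>2 * gauss \<tau> (two_cosh z))
        = ennreal ((cmod (sinh_mode N z))\<^sup>2 * E (Re z)) * indicator half_strip z"
    proof (cases "z \<in> half_strip")
      case True
      then have "gauss \<tau> (two_cosh z) = E (Re z)"
        by (simp add: gauss_two_cosh E_def half_strip_def)
      moreover have "cmod (deriv two_cosh z) * cmod (cheb n (two_cosh z)) = cmod (sinh_mode N z)"
        unfolding sinh_mode_def N_def cheb_two_cosh[symmetric] norm_mult by (rule mult.commute)
      ultimately show ?thesis
        using True by (simp add: power_mult_distrib[symmetric] mult.assoc[symmetric] flip: ennreal_mult')
    qed simp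
  qed
  also have "\<dots> = (\<integral>\<^sup>+x. \<integral>\<^sup>+y. ennreal ((cmod (sinh_mode N (Complex x y)))\<^sup>2 * E x) * indicator half_strip (Complex x y) \<partial>lborel \<partial>lborel)"
    by (subst nn_integral_lborel_complex) simp_all
  also have "\<dots> = (\<integral>\<^sup>+x. ennreal (2 * pi * (A x * E x)) * indicator {0<..} x \<partial>lborel)"
  proof (rule nn_integral_cong)
    fix x :: real
    have "(\<integral>\<^sup>+y. ennreal ((cmod (sinh_mode N (Complex x y)))\<^sup>2 * E x) * indicator half_strip (Complex x y) \<partial>lborel)
        = (\<integral>\<^sup>+y. indicator {0<..} x * (ennreal ((cmod (sinh_mode N (Complex x y)))\<^sup>2 * E x) * indicator {0..2 * pi} y) \<partial>lborel)"
    proof (rule nn_integral_cong_AE)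
      show "AE y in lborel. ennreal ((cmod (sinh_mode N (Complex x y)))\<^sup>2 * E x) * indicator half_strip (Complex x y)
          = indicator {0<..} x * (ennreal ((cmod (sinh_mode N (Complex x y)))\<^sup>2 * E x) * indicator {0..2 * pi} y)"
        using AE_lborel_singleton[of "0::real"] AE_lborel_singleton[of "2 * pi"]
        by eventually_elim (auto simp: indicator_def half_strip_def)
    qed
    also have "\<dots> = indicator {0<..} x * (\<integral>\<^sup>+y. ennreal ((cmod (sinh_mode N (Complex x y)))\<^sup>2 * E x) * indicator {0..2 * pi} y \<partial>lborel)"
      by (rule nn_integral_cmult) measurable
    also have "(\<integral>\<^sup>+y. ennreal ((cmod (sinh_mode N (Complex x y)))\<^sup>2 * E x) * indicator {0..2 * pi} y \<partial>lborel)
        = ennreal ((A x * (2 * pi) - sin (2 * real N * (2 * pi)) / real N) * E x - (A x * 0 - sin (2 * real N * 0) / real N) * E x)"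
    proof (rule nn_integral_FTC_Icc)
      fix y :: real
      show "((\<lambda>y. (A x * y - sin (2 * real N * y) / real N) * E x) has_real_derivative (cmod (sinh_mode N (Complex x y)))\<^sup>2 * E x) (at y)"
        unfolding cmod_sinh_mode A_def
        using N0 by (auto intro!: derivative_eq_intros simp: field_simps)
      show "0 \<le> (cmod (sinh_mode N (Complex x y)))\<^sup>2 * E x"
        by (simp add: E_def)
    qed auto
    also have "sin (2 * real N * (2 * pi)) = 0"
      by (metis mult.assoc mult.commute sin_npi of_nat_mult of_nat_numeral)
    finally show "(\<integral>\<^sup>+y. ennreal ((cmod (sinh_mode N (Complex x y)))\<^sup>2 * E x) * indicator half_strip (Complex x y) \<partial>lborel)
        = ennreal (2 * pi * (A x * E x)) * indicator {0<..} x"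
      by (simp add: mult_ac)
  qed
  also have "\<dots> = (\<integral>\<^sup>+x. ennreal (2 * pi) * (ennreal (exp (2 * real N * x - x\<^sup>2 / \<tau>)) * indicator {0<..} x
      + ennreal (exp (2 * real N * (- x) - x\<^sup>2 / \<tau>)) * indicator {0<..} x) \<partial>lborel)"
  proof (rule nn_integral_cong)
    fix x :: real
    have "A x * E x = exp (2 * real N * x - x\<^sup>2 / \<tau>) + exp (2 * real N * (- x) - x\<^sup>2 / \<tau>)"
      by (simp add: A_def E_def distrib_right flip: exp_add)
    then show "ennreal (2 * pi * (A x * E x)) * indicator {0<..} x = ennreal (2 * pi) * (ennreal (exp (2 * real N * x - x\<^sup>2 / \<tau>)) * indicator {0<..} x
      + ennreal (exp (2 * real N * (- x) - x\<^sup>2 / \<tau>)) * indicator {0<..} x)"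
      by (simp add: indicator_def ennreal_mult')
  qed
  also have "\<dots> = ennreal (2 * pi) * (\<integral>\<^sup>+x. ennreal (exp (2 * real N * x - x\<^sup>2 / \<tau>)) * indicator {0<..} x
      + ennreal (exp (2 * real N * (- x) - x\<^sup>2 / \<tau>)) * indicator {0<..} x \<partial>lborel)"
    by (rule nn_integral_cmult) measurable
  also have "(\<integral>\<^sup>+x. ennreal (exp (2 * real N * x - x\<^sup>2 / \<tau>)) * indicator {0<..} x
      + ennreal (exp (2 * real N * (- x) - x\<^sup>2 / \<tau>)) * indicator {0<..} x \<partial>lborel)
      = (\<integral>\<^sup>+x. ennreal (exp (2 * real N * x - x\<^sup>2 / \<tau>)) * indicator {0<..} x \<partial>lborel)
      + (\<integral>\<^sup>+x. ennreal (exp (2 * real N * (- x) - x\<^sup>2 / \<tau>)) * indicator {0<..} x \<partial>lborel)"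
    by (rule nn_integral_add) measurable
  also have "(\<integral>\<^sup>+x. ennreal (exp (2 * real N * (- x) - x\<^sup>2 / \<tau>)) * indicator {0<..} x \<partial>lborel)
      = (\<integral>\<^sup>+x. ennreal (exp (2 * real N * x - x\<^sup>2 / \<tau>)) * indicator {..<0} x \<partial>lborel)"
  proof -
    have "(\<integral>\<^sup>+x. ennreal (exp (2 * real N * x - x\<^sup>2 / \<tau>)) * indicator {..<0} x \<partial>lborel)
        = ennreal \<bar>- 1\<bar> * (\<integral>\<^sup>+x. ennreal (exp (2 * real N * (0 + - 1 * x) - (0 + - 1 * x)\<^sup>2 / \<tau>)) * indicator {..<0} (0 + - 1 * x) \<partial>lborel)"
      by (rule nn_integral_real_affine) auto
    also have "\<dots> = (\<integral>\<^sup>+x. ennreal (exp (2 * real N * (- x) - x\<^sup>2 / \<tau>)) * indicator {0<..} x \<partial>lborel)"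
      by (simp add: indicator_def)
    finally show ?thesis ..
  qed
  also have "(\<integral>\<^sup>+x. ennreal (exp (2 * real N * x - x\<^sup>2 / \<tau>)) * indicator {0<..} x \<partial>lborel) + \<dots>
      = (\<integral>\<^sup>+x. ennreal (exp (2 * real N * x - x\<^sup>2 / \<tau>)) * indicator {0<..} x + ennreal (exp (2 * real N * x - x\<^sup>2 / \<tau>)) * indicator {..<0} x \<partial>lborel)"
    by (rule nn_integral_add[symmetric]) measurable
  also have "\<dots> = (\<integral>\<^sup>+x. ennreal (exp (2 * real N * x - x\<^sup>2 / \<tau>)) \<partial>lborel)"
    using AE_lborel_singleton[of "0::real"]
    by (intro nn_integral_cong_AE) (auto simp: indicator_def elim!: eventually_mono)
  also have "\<dots> = ennreal (sqrt (pi * \<tau>) * exp (\<tau> * (real N)\<^sup>2))"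
    by (rule nn_integral_gaussian_exp[OF \<tau>])
  also have "ennreal (2 * pi) * \<dots> = ennreal (nu \<tau> n)"
    using \<tau> by (simp add: nu_def N_def mult_ac flip: ennreal_mult')
  finally show ?thesis .
qed

lemma integral_two_cosh:
  fixes H :: "complex \<Rightarrow> complex"
  assumes [measurable]: "H \<in> borel_measurable borel"
  shows "(LINT w|lborel. H w) = (LINT z|lborel. ((cmod (deriv two_cosh z))\<^sup>2 * indicator half_strip z) *\<^sub>R H (two_cosh z))"
proof -
  have "open (two_cosh ` half_strip)"
    by (rule open_mapping_thm3[OF two_cosh_holomorphic open_half_strip inj_on_two_cosh])
  then have [measurable]: "two_cosh ` half_strip \<in> sets borel"
    by simp
  have "(LINT w|lborel. H w) = (LINT w|lborel. indicator (two_cosh ` half_strip) w *\<^sub>R H w)"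
    using AE_not_in[OF two_cosh_image]
    by (intro integral_cong_AE) (auto elim!: eventually_mono)
  also have "\<dots> = (LINT w|density lborel (\<lambda>w. ennreal (indicator (two_cosh ` half_strip) w)). H w)"
    by (rule integral_density[symmetric]) auto
  also have "density lborel (\<lambda>w. ennreal (indicator (two_cosh ` half_strip) w))
      = distr (density lborel (\<lambda>z. ennreal ((cmod (deriv two_cosh z))\<^sup>2 * indicator half_strip z))) borel two_cosh"
    by (simp add: distr_holomorphic[OF two_cosh_holomorphic open_half_strip inj_on_two_cosh] ennreal_indicator)
  also have "(LINT w|\<dots>. H w) = (LINT z|density lborel (\<lambda>z. ennreal ((cmod (deriv two_cosh z))\<^sup>2 * indicator half_strip z)). H (two_cosh z))"
    by (rule integral_distr) auto
  also have "\<dots> = (LINT z|lborel. ((cmod (deriv two_cosh z))\<^sup>2 * indicator half_strip z) *\<^sub>R H (two_cosh z))"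
    by (rule integral_density) auto
  finally show ?thesis .
qed

text \<open>The interior of an ellipse with foci 2 and -2.\<close>

definition shell :: "real \<Rightarrow> complex set" where
  "shell T = {w. min_frob w < 2 * cosh (2 * T)}"

lemma shell_borel [measurable]: "shell T \<in> sets borel"
  unfolding shell_def by measurable

text \<open>At fixed x the integrand combines four exponentials in y with frequencies N - M, - (M +
  N), M + N and M - N. All are nonzero because M = m + 1 and N = n + 1 are positive and distinct.
  Boundedness of the region gives the integrability for Fubini's theorem.\<close>

lemma cheb_orthogonal_shell:
  assumes \<tau>: "\<tau> > 0" and T: "T > 0" and mn: "m \<noteq> n"
  shows "(LINT w|lborel. indicator (shell T) w *\<^sub>R (cnj (cheb m w) * cheb n w * of_real (gauss \<tau> w))) = 0"
proof -
  define M N where "M = Suc m" and "N = Suc n"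
  define h where "h z = cnj (sinh_mode M z) * sinh_mode N z * of_real (exp (- (Re z)\<^sup>2 / \<tau>))" for z
  define D where "D = {z. 0 < Re z \<and> Re z < T \<and> 0 < Im z \<and> Im z < 2 * pi}"
  have "open D"
    unfolding D_def by (intro open_Collect_conj open_Collect_less continuous_intros)
  then have [measurable]: "D \<in> sets borel"
    by simp
  have ch: "continuous_on UNIV h"
    unfolding h_def sinh_mode_def by (intro continuous_intros) (use \<tau> in auto)
  then have [measurable]: "h \<in> borel_measurable borel"
    by (rule borel_measurable_continuous_onI)
  have sh: "two_cosh z \<in> shell T \<longleftrightarrow> Re z < T" if "z \<in> half_strip" for z
    using that T by (simp add: shell_def min_frob_two_cosh half_strip_def cosh_real_nonneg_less_iff)
  have "(LINT w|lborel. indicator (shell T) w *\<^sub>R (cnj (cheb m w) * cheb n w * of_real (gauss \<tau> w)))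
      = (LINT z|lborel. ((cmod (deriv two_cosh z))\<^sup>2 * indicator half_strip z) *\<^sub>R (indicator (shell T) (two_cosh z)
          *\<^sub>R (cnj (cheb m (two_cosh z)) * cheb n (two_cosh z) * of_real (gauss \<tau> (two_cosh z)))))"
    by (rule integral_two_cosh) measurable
  also have "\<dots> = (LINT z|lborel. indicator D z *\<^sub>R h z)"
  proof (rule Bochner_Integration.integral_cong[OF refl])
    fix z
    show "((cmod (deriv two_cosh z))\<^sup>2 * indicator half_strip z) *\<^sub>R (indicator (shell T) (two_cosh z)
          *\<^sub>R (cnj (cheb m (two_cosh z)) * cheb n (two_cosh z) * of_real (gauss \<tau> (two_cosh z)))) = indicator D z *\<^sub>R h z"
    proof (cases "z \<in> half_strip")
      case True
      have g: "gauss \<tau> (two_cosh z) = exp (- (Re z)\<^sup>2 / \<tau>)"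
        using True by (simp add: gauss_two_cosh half_strip_def)
      have "h z = (cmod (deriv two_cosh z))\<^sup>2 *\<^sub>R (cnj (cheb m (two_cosh z)) * cheb n (two_cosh z)) * of_real (exp (- (Re z)\<^sup>2 / \<tau>))"
        unfolding h_def M_def N_def cheb_product_two_cosh ..
      moreover have "indicator D z = (indicator (shell T) (two_cosh z) :: real)"
        using True sh[OF True] by (auto simp: indicator_def D_def half_strip_def)
      ultimately show ?thesis
        using True by (simp add: g)
    qed (auto simp: D_def half_strip_def)
  qed
  also have "\<dots> = (LINT p|(lborel \<Otimes>\<^sub>M lborel). indicator D (Complex (fst p) (snd p)) *\<^sub>R h (Complex (fst p) (snd p)))"
    by (subst lborel_complex, subst integral_distr) (simp_all add: case_prod_unfold)
  also have "\<dots> = (LINT x|lborel. LINT y|lborel. indicator D (Complex x y) *\<^sub>R h (Complex x y))"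
  proof -
    have "compact (cbox 0 (Complex T (2 * pi)))"
      by (rule compact_cbox)
    then have "integrable lborel (\<lambda>z. indicator (cbox 0 (Complex T (2 * pi))) z *\<^sub>R h z)"
      using ch by (intro borel_integrable_compact) (auto intro: continuous_on_subset)
    then have "integrable lborel (\<lambda>z. indicator D z *\<^sub>R h z)"
    proof (rule Bochner_Integration.integrable_bound)
      show "AE z in lborel. norm (indicator D z *\<^sub>R h z) \<le> norm (indicator (cbox 0 (Complex T (2 * pi))) z *\<^sub>R h z)"
        by (intro AE_I2) (auto simp: indicator_def D_def in_cbox_complex_iff)
    qed measurable
    then have "integrable (lborel \<Otimes>\<^sub>M lborel) (\<lambda>p. indicator D (Complex (fst p) (snd p)) *\<^sub>R h (Complex (fst p) (snd p)))"
      by (subst (asm) lborel_complex, subst (asm) integrable_distr_eq) (simp_all add: case_prod_unfold)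
    from lborel_pair.integral_fst'[OF this] show ?thesis
      by simp
  qed
  also have "\<dots> = (LINT x|(lborel :: real measure). 0)"
  proof (rule Bochner_Integration.integral_cong[OF refl])
    fix x :: real
    let ?i = "\<lambda>y. indicator {0<..<2 * pi} y :: real"
    have cm [measurable]: "cis \<in> borel_measurable borel"
      by (intro borel_measurable_continuous_onI continuous_intros)
    have int: "integrable lborel (\<lambda>y. ?i y *\<^sub>R cis (of_int k * y))" for k
    proof (rule Bochner_Integration.integrable_bound)
      show "integrable lborel ?i"
        by simp
    qed (auto simp: indicator_def)
    have z: "(LINT y|lborel. of_real c * (?i y *\<^sub>R cis (of_int k * y))) = 0" if "k \<noteq> 0" for c k
      unfolding integral_mult_right_zero integral_cis_period[OF that] by simp
    have ks: "int N - int M \<noteq> 0" "- (int M + int N) \<noteq> 0" "int M + int N \<noteq> 0" "int M - int N \<noteq> 0"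
      using mn by (auto simp: M_def N_def)
    define e where "e = (if 0 < x \<and> x < T then exp (- x\<^sup>2 / \<tau>) else 0)"
    have "indicator D (Complex x y) *\<^sub>R h (Complex x y)
        = of_real e * (of_real (exp ((real M + real N) * x)) * (?i y *\<^sub>R cis (of_int (int N - int M) * y))
          - of_real (exp ((real M - real N) * x)) * (?i y *\<^sub>R cis (of_int (- (int M + int N)) * y))
          - of_real (exp ((real N - real M) * x)) * (?i y *\<^sub>R cis (of_int (int M + int N) * y))
          + of_real (exp (- (real M + real N) * x)) * (?i y *\<^sub>R cis (of_int (int M - int N) * y)))" for y
    proof (cases "0 < x \<and> x < T")
      case True
      then have "indicator D (Complex x y) = ?i y"
        by (simp add: indicator_def D_def)
      then show ?thesis
        using True unfolding h_def sinh_mode_product e_def by (simp add: indicator_def mult.commute)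
    next
      case False
      then have "indicator D (Complex x y) = (0 :: real)" "e = 0"
        by (auto simp: D_def e_def)
      then show ?thesis
        by simp
    qed
    then have "(LINT y|lborel. indicator D (Complex x y) *\<^sub>R h (Complex x y))
      = of_real e * ((LINT y|lborel. of_real (exp ((real M + real N) * x)) * (?i y *\<^sub>R cis (of_int (int N - int M) * y)))
          - (LINT y|lborel. of_real (exp ((real M - real N) * x)) * (?i y *\<^sub>R cis (of_int (- (int M + int N)) * y)))
          - (LINT y|lborel. of_real (exp ((real N - real M) * x)) * (?i y *\<^sub>R cis (of_int (int M + int N) * y)))
          + (LINT y|lborel. of_real (exp (- (real M + real N) * x)) * (?i y *\<^sub>R cis (of_int (int M - int N) * y))))"
      by (simp only: integral_mult_right_zero Bochner_Integration.integral_add Bochner_Integration.integral_diff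
          Bochner_Integration.integrable_diff integrable_mult_right int)
    then show "(LINT y|lborel. indicator D (Complex x y) *\<^sub>R h (Complex x y)) = 0"
      unfolding z[OF ks(1)] z[OF ks(2)] z[OF ks(3)] z[OF ks(4)] by simp
  qed
  finally show ?thesis
    by simp
qed

section \<open>The weighted Bergman space\<close>

definition ip :: "real \<Rightarrow> (complex \<Rightarrow> complex) \<Rightarrow> (complex \<Rightarrow> complex) \<Rightarrow> complex" where
  "ip \<tau> f g = (LINT w|lborel. cnj (f w) * g w * of_real (gauss \<tau> w))"

definition fock :: "real \<Rightarrow> (complex \<Rightarrow> complex) set" where
  "fock \<tau> = {f. f holomorphic_on UNIV \<and> integrable lborel (\<lambda>w. (cmod (f w))\<^sup>2 * gauss \<tau> w)}"

definition nsq :: "real \<Rightarrow> (complex \<Rightarrow> complex) \<Rightarrow> real" where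
  "nsq \<tau> f = (LINT w|lborel. (cmod (f w))\<^sup>2 * gauss \<tau> w)"

lemma gauss_pos: "gauss \<tau> w > 0"
  by (simp add: gauss_def)

lemma gauss_le_1: "\<tau> > 0 \<Longrightarrow> gauss \<tau> w \<le> 1"
  by (simp add: gauss_def)

lemma entire_measurable: "f holomorphic_on UNIV \<Longrightarrow> f \<in> borel_measurable borel"
  by (intro borel_measurable_continuous_onI holomorphic_on_imp_continuous_on)

lemma fock_measurable: "f \<in> fock \<tau> \<Longrightarrow> f \<in> borel_measurable borel"
  by (simp add: fock_def entire_measurable)

text \<open>The free parameter \<epsilon> replaces the Cauchy-Schwarz inequality:
  \<open>theta_reproducing\<close> chooses it so that both terms of the integrated bound become
  small.\<close>

lemma cmod_product_le: "cmod (a * b) \<le> (\<epsilon> * (cmod a)\<^sup>2 + (cmod b)\<^sup>2 / \<epsilon>) / 2" if "\<epsilon> > 0"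
proof -
  have "0 \<le> (\<epsilon> * cmod a - cmod b)\<^sup>2 / \<epsilon>"
    using that by simp
  also have "(\<epsilon> * cmod a - cmod b)\<^sup>2 / \<epsilon> = \<epsilon> * (cmod a)\<^sup>2 + (cmod b)\<^sup>2 / \<epsilon> - 2 * cmod (a * b)"
    using that by (simp add: power2_eq_square norm_mult field_simps)
  finally show ?thesis
    by simp
qed

lemma fock_product_integrable:
  assumes f: "f \<in> fock \<tau>" and g: "g \<in> fock \<tau>"
  shows "integrable lborel (\<lambda>w. cnj (f w) * g w * of_real (gauss \<tau> w))"
proof (rule Bochner_Integration.integrable_bound)
  note [measurable] = fock_measurable[OF f] fock_measurable[OF g]
  show "integrable lborel (\<lambda>w. (cmod (f w))\<^sup>2 * gauss \<tau> w + (cmod (g w))\<^sup>2 * gauss \<tau> w)"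
    using f g by (simp add: fock_def)
  show "(\<lambda>w. cnj (f w) * g w * of_real (gauss \<tau> w)) \<in> borel_measurable lborel"
    by measurable
  show "AE w in lborel. norm (cnj (f w) * g w * of_real (gauss \<tau> w)) \<le> norm ((cmod (f w))\<^sup>2 * gauss \<tau> w + (cmod (g w))\<^sup>2 * gauss \<tau> w)"
  proof (intro AE_I2)
    fix w
    have "cmod (cnj (f w) * g w) \<le> (cmod (f w))\<^sup>2 + (cmod (g w))\<^sup>2"
      using cmod_product_le[of 1 "cnj (f w)" "g w"] by simp (smt (verit) zero_le_power2)
    from mult_right_mono[OF this less_imp_le[OF gauss_pos[of \<tau> w]]]
    show "norm (cnj (f w) * g w * of_real (gauss \<tau> w)) \<le> norm ((cmod (f w))\<^sup>2 * gauss \<tau> w + (cmod (g w))\<^sup>2 * gauss \<tau> w)"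
      using gauss_pos[of \<tau> w] by (simp add: norm_mult distrib_right abs_of_nonneg)
  qed
qed

lemma fock_add:
  assumes f: "f \<in> fock \<tau>" and g: "g \<in> fock \<tau>"
  shows "(\<lambda>w. f w + g w) \<in> fock \<tau>"
proof -
  note [measurable] = fock_measurable[OF f] fock_measurable[OF g]
  have "integrable lborel (\<lambda>w. (cmod (f w + g w))\<^sup>2 * gauss \<tau> w)"
  proof (rule Bochner_Integration.integrable_bound)
    show "integrable lborel (\<lambda>w. 2 * ((cmod (f w))\<^sup>2 * gauss \<tau> w + (cmod (g w))\<^sup>2 * gauss \<tau> w))"
      using f g by (simp add: fock_def)
    show "AE w in lborel. norm ((cmod (f w + g w))\<^sup>2 * gauss \<tau> w) \<le> norm (2 * ((cmod (f w))\<^sup>2 * gauss \<tau> w + (cmod (g w))\<^sup>2 * gauss \<tau> w))"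
    proof (intro AE_I2)
      fix w
      have "(cmod (f w + g w))\<^sup>2 \<le> (cmod (f w) + cmod (g w))\<^sup>2"
        by (intro power_mono norm_triangle_ineq) simp
      also have "\<dots> \<le> 2 * ((cmod (f w))\<^sup>2 + (cmod (g w))\<^sup>2)"
        using sum_squares_bound[of "cmod (f w)" "cmod (g w)"] by (simp add: power2_sum)
      finally have "(cmod (f w + g w))\<^sup>2 * gauss \<tau> w \<le> 2 * ((cmod (f w))\<^sup>2 + (cmod (g w))\<^sup>2) * gauss \<tau> w"
        by (rule mult_right_mono) (simp add: less_imp_le[OF gauss_pos])
      then show "norm ((cmod (f w + g w))\<^sup>2 * gauss \<tau> w) \<le> norm (2 * ((cmod (f w))\<^sup>2 * gauss \<tau> w + (cmod (g w))\<^sup>2 * gauss \<tau> w))"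
        using gauss_pos[of \<tau> w] by (simp add: algebra_simps abs_of_nonneg)
    qed
  qed measurable
  then show ?thesis
    using f g by (auto simp: fock_def intro!: holomorphic_intros)
qed

lemma fock_scale:
  assumes f: "f \<in> fock \<tau>"
  shows "(\<lambda>w. c * f w) \<in> fock \<tau>"
  using f by (auto simp: fock_def norm_mult power_mult_distrib mult.assoc intro!: holomorphic_intros)

lemma fock_zero: "(\<lambda>w. 0) \<in> fock \<tau>"
  by (simp add: fock_def)

lemma fock_diff: "f \<in> fock \<tau> \<Longrightarrow> g \<in> fock \<tau> \<Longrightarrow> (\<lambda>w. f w - g w) \<in> fock \<tau>"
  using fock_add[of f \<tau> "\<lambda>w. (-1) * g w"] fock_scale[of g \<tau> "-1"] by simp

lemma fock_sum: "(\<And>i. i \<in> I \<Longrightarrow> f i \<in> fock \<tau>) \<Longrightarrow> (\<lambda>w. \<Sum>i\<in>I. f i w) \<in> fock \<tau>"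
  by (induction I rule: infinite_finite_induct) (auto simp: fock_zero fock_add)

lemma ip_scale_right: "ip \<tau> f (\<lambda>w. c * g w) = c * ip \<tau> f g"
  unfolding ip_def by (subst integral_mult_right_zero[symmetric]) (simp add: mult_ac)

lemma ip_scale_left: "ip \<tau> (\<lambda>w. c * f w) g = cnj c * ip \<tau> f g"
  unfolding ip_def by (subst integral_mult_right_zero[symmetric]) (simp add: mult_ac)

lemma ip_add_right: "f \<in> fock \<tau> \<Longrightarrow> g \<in> fock \<tau> \<Longrightarrow> h \<in> fock \<tau> \<Longrightarrow> ip \<tau> f (\<lambda>w. g w + h w) = ip \<tau> f g + ip \<tau> f h"
  unfolding ip_def by (simp add: distrib_left distrib_right fock_product_integrable)

lemma ip_add_left: "f \<in> fock \<tau> \<Longrightarrow> g \<in> fock \<tau> \<Longrightarrow> h \<in> fock \<tau> \<Longrightarrow> ip \<tau> (\<lambda>w. f w + g w) h = ip \<tau> f h + ip \<tau> g h"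
  unfolding ip_def by (simp add: distrib_left distrib_right fock_product_integrable)

lemma ip_diff_left: "f \<in> fock \<tau> \<Longrightarrow> g \<in> fock \<tau> \<Longrightarrow> h \<in> fock \<tau> \<Longrightarrow> ip \<tau> (\<lambda>w. f w - g w) h = ip \<tau> f h - ip \<tau> g h"
  unfolding ip_def by (simp add: left_diff_distrib right_diff_distrib fock_product_integrable)

lemma ip_sum_right:
  assumes "\<And>i. i \<in> I \<Longrightarrow> g i \<in> fock \<tau>" "f \<in> fock \<tau>"
  shows "ip \<tau> f (\<lambda>w. \<Sum>i\<in>I. g i w) = (\<Sum>i\<in>I. ip \<tau> f (g i))"
  using assms
proof (induction I rule: infinite_finite_induct)
  case (insert i I)
  then show ?case
    by (simp add: ip_add_right fock_sum)
qed (simp_all add: ip_def)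

lemma ip_sum_left:
  assumes "\<And>i. i \<in> I \<Longrightarrow> g i \<in> fock \<tau>" "f \<in> fock \<tau>"
  shows "ip \<tau> (\<lambda>w. \<Sum>i\<in>I. g i w) f = (\<Sum>i\<in>I. ip \<tau> (g i) f)"
  using assms
proof (induction I rule: infinite_finite_induct)
  case (insert i I)
  then show ?case
    by (simp add: ip_add_left fock_sum)
qed (simp_all add: ip_def)

lemma ip_self: "ip \<tau> f f = of_real (nsq \<tau> f)"
proof -
  have "cnj (f w) * f w * of_real (gauss \<tau> w) = of_real ((cmod (f w))\<^sup>2 * gauss \<tau> w)" for w
    by (simp only: of_real_mult complex_norm_square) (simp add: mult_ac)
  then show ?thesis
    unfolding ip_def nsq_def by (simp only: integral_complex_of_real)
qed

lemma nsq_nonneg: "nsq \<tau> f \<ge> 0"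
  unfolding nsq_def by (intro integral_nonneg_AE AE_I2) (simp add: less_imp_le[OF gauss_pos])

lemma norm_ip_le:
  assumes f: "f \<in> fock \<tau>" and g: "g \<in> fock \<tau>" and \<epsilon>: "\<epsilon> > 0"
  shows "cmod (ip \<tau> f g) \<le> (\<epsilon> * nsq \<tau> f + nsq \<tau> g / \<epsilon>) / 2"
proof -
  have int: "integrable lborel (\<lambda>w. (cmod (f w))\<^sup>2 * gauss \<tau> w)" "integrable lborel (\<lambda>w. (cmod (g w))\<^sup>2 * gauss \<tau> w)"
    using f g by (auto simp: fock_def)
  have "cmod (ip \<tau> f g) \<le> (LINT w|lborel. (\<epsilon> * ((cmod (f w))\<^sup>2 * gauss \<tau> w) + (cmod (g w))\<^sup>2 * gauss \<tau> w / \<epsilon>) / 2)"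
    unfolding ip_def
  proof (rule Bochner_Integration.integral_norm_bound_integral)
    fix w
    have "cmod (cnj (f w) * g w) * gauss \<tau> w \<le> (\<epsilon> * (cmod (cnj (f w)))\<^sup>2 + (cmod (g w))\<^sup>2 / \<epsilon>) / 2 * gauss \<tau> w"
      by (intro mult_right_mono cmod_product_le \<epsilon> less_imp_le[OF gauss_pos])
    then show "norm (cnj (f w) * g w * of_real (gauss \<tau> w)) \<le> (\<epsilon> * ((cmod (f w))\<^sup>2 * gauss \<tau> w) + (cmod (g w))\<^sup>2 * gauss \<tau> w / \<epsilon>) / 2"
      using gauss_pos[of \<tau> w] by (simp add: norm_mult algebra_simps add_divide_distrib)
  qed (use int fock_product_integrable[OF f g] in auto)
  also have "\<dots> = (\<epsilon> * nsq \<tau> f + nsq \<tau> g / \<epsilon>) / 2"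
    using int by (simp add: nsq_def)
  finally show ?thesis .
qed

lemma cheb_fock:
  assumes "\<tau> > 0"
  shows "cheb n \<in> fock \<tau>" "nsq \<tau> (cheb n) = nu \<tau> n"
proof -
  have nn: "0 \<le> (cmod (cheb n w))\<^sup>2 * gauss \<tau> w" for w
    by (simp add: less_imp_le[OF gauss_pos])
  have m: "(\<lambda>w. (cmod (cheb n w))\<^sup>2 * gauss \<tau> w) \<in> borel_measurable lborel"
    by measurable
  show "cheb n \<in> fock \<tau>"
    unfolding fock_def using m nn nn_integral_cheb_sq[OF assms, of n]
    by (auto simp: cheb_holomorphic intro!: integrableI_nonneg)
  show "nsq \<tau> (cheb n) = nu \<tau> n"
    unfolding nsq_def using integral_eq_nn_integral[OF m] nn nn_integral_cheb_sq[OF assms, of n] nu_pos[OF assms, of n]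
    by (simp add: less_imp_le)
qed

lemma cmod_le_shell: "w \<in> shell T \<Longrightarrow> cmod w \<le> sqrt (4 * cosh (2 * T))"
proof -
  assume "w \<in> shell T"
  then have "(cmod w)\<^sup>2 \<le> 4 * cosh (2 * T)"
    using norm_ge_zero[of "w\<^sup>2 - 4"] by (simp add: shell_def min_frob_def del: norm_ge_zero)
  then show ?thesis
    using real_le_rsqrt by blast
qed

section \<open>Chebyshev coefficients of entire functions\<close>

definition taylor :: "(complex \<Rightarrow> complex) \<Rightarrow> nat \<Rightarrow> complex" where
  "taylor f k = (deriv ^^ k) f 0 / fact k"

lemma taylor_sums:
  assumes "f holomorphic_on UNIV"
  shows "(\<lambda>k. taylor f k * w ^ k) sums f w"
proof -
  have "(\<lambda>n. (deriv ^^ n) f 0 / fact n * (w - 0) ^ n) sums f w"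
    by (rule holomorphic_power_series[of _ _ "cmod w + 1"]) (use assms in \<open>auto intro: holomorphic_on_subset\<close>)
  then show ?thesis
    by (simp add: taylor_def)
qed

lemma taylor_abs_summable:
  assumes "f holomorphic_on UNIV" "R \<ge> 0"
  shows "summable (\<lambda>k. cmod (taylor f k) * R ^ k)"
proof -
  have "summable (\<lambda>k. taylor f k * of_real (R + 1) ^ k)"
    using taylor_sums[OF assms(1)] sums_summable by blast
  then have "summable (\<lambda>k. norm (taylor f k * of_real R ^ k))"
    by (rule powser_insidea) (use assms(2) in auto)
  then show ?thesis
    using assms(2) by (simp add: norm_mult norm_power)
qed

text \<open>Evaluate \<open>power_eq_sum_cheb\<close> at w = 2; this counts the dimension of the
  k-th tensor power of C^2.\<close>

lemma sum_ballot: "(\<Sum>n\<le>k. ballot k n * real (Suc n)) = 2 ^ k"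
proof -
  have "complex_of_real (\<Sum>n\<le>k. ballot k n * real (Suc n)) = (\<Sum>n\<le>k. of_real (ballot k n) * cheb n 2)"
    by (simp only: cheb_2 of_real_sum of_real_mult of_real_of_nat_eq)
  also have "\<dots> = of_real (2 ^ k)"
    by (simp only: power_eq_sum_cheb[symmetric] of_real_power of_real_numeral)
  finally show ?thesis
    by (simp only: of_real_eq_iff)
qed

lemma ballot_le: "ballot k n \<le> 2 ^ k"
proof (cases "n \<le> k")
  case True
  have "ballot k n * 1 \<le> ballot k n * real (Suc n)"
    by (intro mult_left_mono ballot_nonneg) simp
  also have "\<dots> \<le> (\<Sum>n\<le>k. ballot k n * real (Suc n))"
    using True by (intro member_le_sum mult_nonneg_nonneg ballot_nonneg) auto
  finally show ?thesis
    by (simp only: sum_ballot mult_1_right)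
qed (simp add: ballot_eq_0)

text \<open>Obtained by expanding each power in the Taylor series and collecting the coefficient of
  \<open>cheb n\<close>.\<close>

definition cheb_coeff :: "(complex \<Rightarrow> complex) \<Rightarrow> nat \<Rightarrow> complex" where
  "cheb_coeff f n = (\<Sum>k. taylor f k * of_real (ballot k n))"

text \<open>The walk counts are at most 2^k, and the Taylor series of an entire function converges
  absolutely at 2.\<close>

lemma cheb_coeff_sums:
  assumes "f holomorphic_on UNIV"
  shows "(\<lambda>k. taylor f k * of_real (ballot k n)) sums cheb_coeff f n"
  unfolding cheb_coeff_def
proof (intro summable_sums summable_comparison_test'[OF taylor_abs_summable[OF assms, of 2]])
  show "norm (taylor f k * of_real (ballot k n)) \<le> cmod (taylor f k) * 2 ^ k" for k
    using ballot_nonneg[of k n] by (auto simp: norm_mult intro!: mult_left_mono ballot_le)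
qed simp

lemma shell_integrable:
  assumes \<tau>: "\<tau> > 0" and f: "f holomorphic_on UNIV" and g: "g holomorphic_on UNIV"
  shows "integrable lborel (\<lambda>w. indicator (shell T) w *\<^sub>R (cnj (f w) * g w * of_real (gauss \<tau> w)))"
proof (rule Bochner_Integration.integrable_bound)
  note [measurable] = entire_measurable[OF f] entire_measurable[OF g]
  let ?K = "cball (0::complex) (sqrt (4 * cosh (2 * T)))"
  have "continuous_on ?K (\<lambda>w. cnj (f w) * g w)"
    by (intro continuous_intros holomorphic_on_imp_continuous_on holomorphic_on_subset[OF f] holomorphic_on_subset[OF g]) auto
  then show "integrable lborel (\<lambda>w. indicator ?K w *\<^sub>R (cnj (f w) * g w))"
    by (intro borel_integrable_compact) auto
  show "AE w in lborel. norm (indicator (shell T) w *\<^sub>R (cnj (f w) * g w * of_real (gauss \<tau> w)))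
      \<le> norm (indicator ?K w *\<^sub>R (cnj (f w) * g w))"
    using cmod_le_shell[of _ T] gauss_le_1[OF \<tau>] gauss_pos[of \<tau>]
    by (intro AE_I2) (auto simp: indicator_def norm_mult less_imp_le intro!: mult_right_le_one_le mult_nonneg_nonneg)
  show "(\<lambda>w. indicator (shell T) w *\<^sub>R (cnj (f w) * g w * of_real (gauss \<tau> w))) \<in> borel_measurable lborel"
    by measurable
qed

lemma shell_integral_power:
  assumes \<tau>: "\<tau> > 0" and T: "T > 0"
  shows "(LINT w|lborel. indicator (shell T) w *\<^sub>R (cnj (cheb n w) * w ^ k * of_real (gauss \<tau> w)))
    = of_real (ballot k n) * (LINT w|lborel. indicator (shell T) w *\<^sub>R (cnj (cheb n w) * cheb n w * of_real (gauss \<tau> w)))"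
proof -
  have e: "indicator (shell T) w *\<^sub>R (cnj (cheb n w) * w ^ k * of_real (gauss \<tau> w))
      = (\<Sum>m\<le>k. of_real (ballot k m) * (indicator (shell T) w *\<^sub>R (cnj (cheb n w) * cheb m w * of_real (gauss \<tau> w))))" for w
    unfolding power_eq_sum_cheb by (simp add: sum_distrib_left sum_distrib_right scaleR_sum_right mult_ac)
  have "(LINT w|lborel. indicator (shell T) w *\<^sub>R (cnj (cheb n w) * w ^ k * of_real (gauss \<tau> w)))
      = (\<Sum>m\<le>k. of_real (ballot k m) * (LINT w|lborel. indicator (shell T) w *\<^sub>R (cnj (cheb n w) * cheb m w * of_real (gauss \<tau> w))))"
    unfolding e
    by (subst Bochner_Integration.integral_sum)
       (simp_all only: integral_mult_right_zero integrable_mult_right shell_integrable[OF \<tau> cheb_holomorphic cheb_holomorphic])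
  also have "\<dots> = (\<Sum>m\<le>k. if m = n then of_real (ballot k n) * (LINT w|lborel. indicator (shell T) w *\<^sub>R (cnj (cheb n w) * cheb n w * of_real (gauss \<tau> w))) else 0)"
    by (intro sum.cong refl) (auto simp: cheb_orthogonal_shell[OF \<tau> T])
  also have "\<dots> = of_real (ballot k n) * (LINT w|lborel. indicator (shell T) w *\<^sub>R (cnj (cheb n w) * cheb n w * of_real (gauss \<tau> w)))"
    by (simp add: sum.delta ballot_eq_0)
  finally show ?thesis .
qed

text \<open>Integrate the Taylor series term by term; orthogonality keeps only the component along
  \<open>cheb n\<close>. The majorant is constant because the shell is bounded, which is why the
  expansion is made on shells before passing to the plane.\<close>

lemma shell_integral_cheb:
  assumes \<tau>: "\<tau> > 0" and T: "T > 0" and f: "f holomorphic_on UNIV"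
  shows "(LINT w|lborel. indicator (shell T) w *\<^sub>R (cnj (cheb n w) * f w * of_real (gauss \<tau> w)))
    = cheb_coeff f n * (LINT w|lborel. indicator (shell T) w *\<^sub>R (cnj (cheb n w) * cheb n w * of_real (gauss \<tau> w)))"
proof (rule LIMSEQ_unique)
  define R where "R = sqrt (4 * cosh (2 * T))"
  define K where "K = (\<Sum>k. cmod (taylor f k) * R ^ k)"
  note [measurable] = entire_measurable[OF f]
  have R: "R \<ge> 0"
    by (simp add: R_def)
  let ?nu = "LINT w|lborel. indicator (shell T) w *\<^sub>R (cnj (cheb n w) * cheb n w * of_real (gauss \<tau> w))"
  let ?p = "\<lambda>i w. \<Sum>k<i. taylor f k * w ^ k"
  let ?s = "\<lambda>i w. indicator (shell T) w *\<^sub>R (cnj (cheb n w) * ?p i w * of_real (gauss \<tau> w))"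
  have hol: "(\<lambda>w. w ^ k) holomorphic_on UNIV" for k
    by (intro holomorphic_intros)
  show "(\<lambda>i. LINT w|lborel. ?s i w) \<longlonglongrightarrow> (LINT w|lborel. indicator (shell T) w *\<^sub>R (cnj (cheb n w) * f w * of_real (gauss \<tau> w)))"
  proof (rule integral_dominated_convergence)
    show "integrable lborel (\<lambda>w::complex. (indicator (cball 0 R) w * ((R + 1) ^ n * K)))"
      by (intro integrable_mult_left integrable_real_indicator) (use emeasure_lborel_cball_finite[of "0::complex" R] in auto)
    show "AE w in lborel. (\<lambda>i. ?s i w) \<longlonglongrightarrow> indicator (shell T) w *\<^sub>R (cnj (cheb n w) * f w * of_real (gauss \<tau> w))"
      using taylor_sums[OF f] by (intro AE_I2 tendsto_intros) (simp add: sums_def)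
    show "AE w in lborel. norm (?s i w) \<le> indicator (cball 0 R) w * ((R + 1) ^ n * K)" for i
    proof (intro AE_I2)
      fix w
      show "norm (?s i w) \<le> indicator (cball 0 R) w * ((R + 1) ^ n * K)"
      proof (cases "w \<in> shell T")
        case True
        then have w: "cmod w \<le> R"
          by (simp add: R_def cmod_le_shell)
        have "cmod (cheb n w) \<le> (R + 1) ^ n"
          by (rule order_trans[OF norm_cheb_le]) (use w in \<open>auto intro!: power_mono\<close>)
        moreover have "cmod (?p i w) \<le> K"
        proof -
          have "cmod (?p i w) \<le> (\<Sum>k<i. cmod (taylor f k) * R ^ k)"
            by (rule order_trans[OF norm_sum], intro sum_mono) (use w in \<open>auto simp: norm_mult norm_power intro!: mult_left_mono power_mono\<close>)
          also have "\<dots> \<le> K"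
            unfolding K_def by (rule sum_le_suminf[OF taylor_abs_summable[OF f R]]) (use R in auto)
          finally show ?thesis .
        qed
        ultimately have "cmod (cheb n w) * cmod (?p i w) * gauss \<tau> w \<le> (R + 1) ^ n * K * 1"
          using gauss_le_1[OF \<tau>, of w] gauss_pos[of \<tau> w] R
          by (intro mult_mono mult_nonneg_nonneg) (auto intro: order_trans[OF norm_ge_zero])
        then show ?thesis
          using True w gauss_pos[of \<tau> w] by (simp add: norm_mult)
      qed (use R order_trans[OF norm_ge_zero, of "?p 0 0" K] in \<open>auto simp: K_def indicator_def intro!: mult_nonneg_nonneg suminf_nonneg taylor_abs_summable f\<close>)
    qed
  qed measurable
  have "(LINT w|lborel. ?s i w) = (\<Sum>k<i. taylor f k * of_real (ballot k n)) * ?nu" for i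
  proof -
    have e: "?s i w = (\<Sum>k<i. taylor f k * (indicator (shell T) w *\<^sub>R (cnj (cheb n w) * w ^ k * of_real (gauss \<tau> w))))" for w
      by (simp add: sum_distrib_left sum_distrib_right scaleR_sum_right mult_ac)
    have "(LINT w|lborel. ?s i w) = (\<Sum>k<i. taylor f k * (LINT w|lborel. indicator (shell T) w *\<^sub>R (cnj (cheb n w) * w ^ k * of_real (gauss \<tau> w))))"
      unfolding e
      by (subst Bochner_Integration.integral_sum)
         (simp_all only: integral_mult_right_zero integrable_mult_right shell_integrable[OF \<tau> cheb_holomorphic hol])
    then show ?thesis
      by (simp only: shell_integral_power[OF \<tau> T] sum_distrib_right) (simp only: mult.assoc)
  qed
  then show "(\<lambda>i. LINT w|lborel. ?s i w) \<longlonglongrightarrow> cheb_coeff f n * ?nu"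
    using cheb_coeff_sums[OF f, of n] by (simp only: sums_def) (intro tendsto_intros)
qed

text \<open>The parameter is i + 1 and not i because orthogonality on a shell is stated for T >
  0.\<close>

lemma ip_shell_limit:
  assumes f: "f \<in> fock \<tau>" and g: "g \<in> fock \<tau>"
  shows "(\<lambda>i. LINT w|lborel. indicator (shell (real (Suc i))) w *\<^sub>R (cnj (f w) * g w * of_real (gauss \<tau> w))) \<longlonglongrightarrow> ip \<tau> f g"
  unfolding ip_def
proof (rule integral_dominated_convergence)
  note [measurable] = fock_measurable[OF f] fock_measurable[OF g]
  show "integrable lborel (\<lambda>w. norm (cnj (f w) * g w * of_real (gauss \<tau> w)))"
    by (intro integrable_norm fock_product_integrable f g)
  show "AE w in lborel. (\<lambda>i. indicator (shell (real (Suc i))) w *\<^sub>R (cnj (f w) * g w * of_real (gauss \<tau> w)))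
      \<longlonglongrightarrow> cnj (f w) * g w * of_real (gauss \<tau> w)"
  proof (intro AE_I2 tendsto_eventually)
    fix w
    obtain n where n: "min_frob w < real n"
      using reals_Archimedean2 by blast
    have "w \<in> shell (real (Suc i))" if "i \<ge> n" for i
    proof -
      have "min_frob w < 1 + 2 * real (Suc i)"
        using n that by simp
      also have "\<dots> \<le> exp (2 * real (Suc i))"
        by (rule exp_ge_add_one_self)
      also have "\<dots> \<le> 2 * cosh (2 * real (Suc i))"
        by (simp add: cosh_def)
      finally show ?thesis
        by (simp add: shell_def)
    qed
    then show "\<forall>\<^sub>F i in sequentially. indicator (shell (real (Suc i))) w *\<^sub>R (cnj (f w) * g w * of_real (gauss \<tau> w))
        = cnj (f w) * g w * of_real (gauss \<tau> w)"
      unfolding eventually_sequentially by (intro exI[of _ n]) simp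
  qed
  show "AE w in lborel. norm (indicator (shell (real (Suc i))) w *\<^sub>R (cnj (f w) * g w * of_real (gauss \<tau> w)))
      \<le> norm (cnj (f w) * g w * of_real (gauss \<tau> w))" for i
    by (intro AE_I2) (simp add: indicator_def)
  show "(\<lambda>w. cnj (f w) * g w * of_real (gauss \<tau> w)) \<in> borel_measurable lborel"
    by measurable
  show "(\<lambda>w. indicator (shell (real (Suc i))) w *\<^sub>R (cnj (f w) * g w * of_real (gauss \<tau> w))) \<in> borel_measurable lborel" for i
    by measurable
qed

text \<open>The relation of \<open>shell_integral_cheb\<close> has the same coefficient for every T,
  so it survives the limit.\<close>

lemma ip_cheb:
  assumes \<tau>: "\<tau> > 0" and f: "f \<in> fock \<tau>"
  shows "ip \<tau> (cheb n) f = cheb_coeff f n * of_real (nu \<tau> n)"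
proof (rule LIMSEQ_unique)
  have hol: "f holomorphic_on UNIV"
    using f by (simp add: fock_def)
  note c = cheb_fock[OF \<tau>, of n]
  show "(\<lambda>i. LINT w|lborel. indicator (shell (real (Suc i))) w *\<^sub>R (cnj (cheb n w) * f w * of_real (gauss \<tau> w))) \<longlonglongrightarrow> ip \<tau> (cheb n) f"
    by (rule ip_shell_limit[OF c(1) f])
  have "(\<lambda>i. cheb_coeff f n * (LINT w|lborel. indicator (shell (real (Suc i))) w *\<^sub>R (cnj (cheb n w) * cheb n w * of_real (gauss \<tau> w))))
      \<longlonglongrightarrow> cheb_coeff f n * ip \<tau> (cheb n) (cheb n)"
    by (intro tendsto_mult_left ip_shell_limit c)
  then show "(\<lambda>i. LINT w|lborel. indicator (shell (real (Suc i))) w *\<^sub>R (cnj (cheb n w) * f w * of_real (gauss \<tau> w)))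
      \<longlonglongrightarrow> cheb_coeff f n * of_real (nu \<tau> n)"
    by (simp add: shell_integral_cheb[OF \<tau> _ hol] ip_self c)
qed

lemma ip_cheb_cheb:
  assumes \<tau>: "\<tau> > 0"
  shows "ip \<tau> (cheb m) (cheb n) = (if m = n then of_real (nu \<tau> n) else 0)"
proof (cases "m = n")
  case True
  then show ?thesis
    by (simp add: ip_self cheb_fock[OF \<tau>])
next
  case False
  note c = cheb_fock(1)[OF \<tau>]
  have "(\<lambda>i. LINT w|lborel. indicator (shell (real (Suc i))) w *\<^sub>R (cnj (cheb m w) * cheb n w * of_real (gauss \<tau> w))) \<longlonglongrightarrow> ip \<tau> (cheb m) (cheb n)"
    by (rule ip_shell_limit[OF c c])
  then have "(\<lambda>i::nat. 0) \<longlonglongrightarrow> ip \<tau> (cheb m) (cheb n)"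
    by (simp add: cheb_orthogonal_shell[OF \<tau> _ False])
  then show ?thesis
    using False by (simp add: LIMSEQ_const_iff)
qed

section \<open>The reproducing kernel at \<open>\<plusminus>2\<close>\<close>

text \<open>Up to the factor 2 pi sqrt (pi \<tau>) this is the value of \<open>cheb n\<close> at 2 s
  divided by \<open>nu \<tau> n\<close>, for s = 1 and s = -1: the coefficient of the reproducing
  kernel at 2 s.\<close>

definition pole :: "real \<Rightarrow> real \<Rightarrow> nat \<Rightarrow> real" where
  "pole \<tau> s n = s ^ n * (real (Suc n) * exp (- \<tau> * (real (Suc n))\<^sup>2))"

definition theta :: "real \<Rightarrow> real \<Rightarrow> complex \<Rightarrow> complex" where
  "theta \<tau> s w = (\<Sum>n. of_real (pole \<tau> s n) * cheb n w)"

text \<open>The Gaussian beats every geometric growth. The additional factor R ^ n is needed for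
  locally uniform convergence of the kernel series.\<close>

lemma gaussian_summable:
  assumes "\<tau> > 0" "R > 0"
  shows "summable (\<lambda>n. (real (Suc n))\<^sup>2 * exp (- \<tau> * (real (Suc n))\<^sup>2) * R ^ n)"
proof (rule summable_comparison_test_ev)
  show "\<forall>\<^sub>F n in sequentially. norm ((real (Suc n))\<^sup>2 * exp (- \<tau> * (real (Suc n))\<^sup>2) * R ^ n) \<le> (1 / 2) ^ n"
  proof -
    \<comment> \<open>In the threshold |L| + 3 below, |L| pays for R^n, two units pay for m^2 <= exp
      (2 m), and one unit leaves exp (- n).\<close>
    define L where "L = ln R"
    have "\<forall>\<^sub>F n in sequentially. (\<bar>L\<bar> + 3) / \<tau> \<le> real n"
      using filterlim_real_sequentially by (simp add: filterlim_at_top)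
    then have "\<forall>\<^sub>F n in sequentially. (real n + 1)\<^sup>2 * exp (- \<tau> * (real n + 1)\<^sup>2) * exp (ln R * real n) \<le> exp (- real n)"
    proof eventually_elim
      case (elim n)
      define m where "m = real n + 1"
      have m: "m > 0" "\<bar>L\<bar> + 3 \<le> \<tau> * m"
        using elim assms(1) by (auto simp: m_def field_simps)
      have "m \<le> exp m"
        using exp_ge_add_one_self[of m] by linarith
      then have "m\<^sup>2 \<le> (exp m)\<^sup>2"
        using m by (intro power_mono) auto
      then have "m\<^sup>2 * (exp (- \<tau> * m\<^sup>2) * exp (L * real n)) \<le> (exp m)\<^sup>2 * (exp (- \<tau> * m\<^sup>2) * exp (L * real n))"
        by (rule mult_right_mono) simp
      also have "\<dots> = exp (m + m + (- \<tau> * m\<^sup>2 + L * real n))"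
        by (simp only: power2_eq_square exp_add)
      also have "\<dots> \<le> exp (- real n)"
      proof -
        have "(\<bar>L\<bar> + 3) * m \<le> \<tau> * m * m"
          using m by (intro mult_right_mono) auto
        moreover have "L * real n \<le> \<bar>L\<bar> * m"
          by (intro mult_mono) (auto simp: m_def)
        ultimately show ?thesis
          unfolding exp_le_cancel_iff by (simp add: power2_eq_square m_def algebra_simps)
      qed
      finally show ?case
        by (simp add: m_def L_def mult.assoc)
    qed
    then show ?thesis
    proof eventually_elim
      case (elim n)
      have "exp (ln R * real n) = R ^ n"
        using assms(2) by (simp add: mult.commute exp_of_nat_mult)
      moreover have "exp (- real n) \<le> (1 / 2) ^ n"
      proof -
        have "exp (- real n) = exp (- 1) ^ n"
          by (simp flip: exp_of_nat_mult)
        also have "\<dots> \<le> (1 / 2) ^ n"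
          using exp_ge_add_one_self[of 1] by (intro power_mono) (auto simp: exp_minus divide_simps)
        finally show ?thesis .
      qed
      ultimately show ?case
        using elim assms(2) by (simp add: abs_mult add.commute)
    qed
  qed
qed simp

context
  fixes \<tau> s :: real
  assumes \<tau>: "\<tau> > 0" and s: "\<bar>s\<bar> = 1"
begin

lemma abs_pole: "\<bar>pole \<tau> s n\<bar> = real (Suc n) * exp (- \<tau> * (real (Suc n))\<^sup>2)"
  by (simp add: pole_def abs_mult power_abs s)

lemma pole_sq_nu: "(pole \<tau> s n)\<^sup>2 * nu \<tau> n = 2 * pi * sqrt (pi * \<tau>) * ((real (Suc n))\<^sup>2 * exp (- \<tau> * (real (Suc n))\<^sup>2))"
proof -
  have "(pole \<tau> s n)\<^sup>2 = (real (Suc n))\<^sup>2 * (exp (- \<tau> * (real (Suc n))\<^sup>2) * exp (- \<tau> * (real (Suc n))\<^sup>2))"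
    unfolding power2_abs[of "pole \<tau> s n", symmetric] abs_pole by (simp only: power2_eq_square mult_ac)
  moreover have "exp (- \<tau> * (real (Suc n))\<^sup>2) * exp (\<tau> * (real (Suc n))\<^sup>2) = 1"
    by (simp flip: exp_add)
  ultimately show ?thesis
    unfolding nu_def by (simp only: mult_ac mult_1_right)
qed

lemma pole_nu: "pole \<tau> s n * nu \<tau> n = 2 * pi * sqrt (pi * \<tau>) * (s ^ n * real (Suc n))"
proof -
  have "exp (- \<tau> * (real (Suc n))\<^sup>2) * exp (\<tau> * (real (Suc n))\<^sup>2) = 1"
    by (simp flip: exp_add)
  moreover have "a * (b * e) * (c * e') = c * (a * b) * (e * e')" for a b c e e' :: real
    by (simp only: mult_ac)
  ultimately show ?thesis
    unfolding nu_def pole_def by (simp only: mult_1_right)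
qed

lemma pole_summable:
  assumes "R \<ge> 0"
  shows "summable (\<lambda>n. \<bar>pole \<tau> s n\<bar> * (R + 1) ^ n)"
proof (rule summable_comparison_test')
  show "summable (\<lambda>n. (real (Suc n))\<^sup>2 * exp (- \<tau> * (real (Suc n))\<^sup>2) * (R + 1) ^ n)"
    using assms by (intro gaussian_summable \<tau>) simp
  show "norm (\<bar>pole \<tau> s n\<bar> * (R + 1) ^ n) \<le> (real (Suc n))\<^sup>2 * exp (- \<tau> * (real (Suc n))\<^sup>2) * (R + 1) ^ n" for n
  proof -
    have "real (Suc n) \<le> (real (Suc n))\<^sup>2"
      by (simp add: power2_eq_square)
    then show ?thesis
      unfolding abs_pole using assms by (auto simp: abs_mult intro!: mult_right_mono)
  qed
qed

lemma theta_uniform_limit: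
  "uniform_limit (cball 0 R) (\<lambda>m w. \<Sum>n<m. of_real (pole \<tau> s n) * cheb n w) (theta \<tau> s) sequentially"
  unfolding theta_def[abs_def]
proof (rule Weierstrass_m_test)
  show "summable (\<lambda>n. \<bar>pole \<tau> s n\<bar> * (\<bar>R\<bar> + 1) ^ n)"
    by (rule pole_summable) simp
  show "norm (of_real (pole \<tau> s n) * cheb n w) \<le> \<bar>pole \<tau> s n\<bar> * (\<bar>R\<bar> + 1) ^ n" if "w \<in> cball 0 R" for n w
    unfolding norm_mult norm_of_real
    by (intro mult_left_mono order_trans[OF norm_cheb_le] power_mono) (use that in auto)
qed

lemma theta_holomorphic: "theta \<tau> s holomorphic_on UNIV"
proof (rule holomorphic_uniform_sequence)
  show "(\<lambda>w. \<Sum>n<m. of_real (pole \<tau> s n) * cheb n w) holomorphic_on UNIV" for m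
    by (intro holomorphic_intros cheb_holomorphic)
  show "\<exists>d>0. cball w d \<subseteq> UNIV \<and> uniform_limit (cball w d) (\<lambda>m w. \<Sum>n<m. of_real (pole \<tau> s n) * cheb n w) (theta \<tau> s) sequentially" for w
  proof (intro exI[of _ 1] conjI)
    have "cball w 1 \<subseteq> cball 0 (cmod w + 1)"
      by (simp add: cball_subset_cball_iff)
    then show "uniform_limit (cball w 1) (\<lambda>m w. \<Sum>n<m. of_real (pole \<tau> s n) * cheb n w) (theta \<tau> s) sequentially"
      by (rule uniform_limit_on_subset[OF theta_uniform_limit])
  qed auto
qed simp

lemma theta_limit: "(\<lambda>m. \<Sum>n<m. of_real (pole \<tau> s n) * cheb n w) \<longlonglongrightarrow> theta \<tau> s w"
  using tendsto_uniform_limitI[OF theta_uniform_limit[of "cmod w"], of w] by simp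

text \<open>What Pythagoras predicts for the squared norm of the remainder of the kernel series; it
  serves as an upper bound.\<close>

definition theta_tail :: "nat \<Rightarrow> real" where
  "theta_tail m = (\<Sum>n. (pole \<tau> s (n + m))\<^sup>2 * nu \<tau> (n + m))"

lemma summable_pole_sq: "summable (\<lambda>n. (pole \<tau> s n)\<^sup>2 * nu \<tau> n)"
  unfolding pole_sq_nu using gaussian_summable[OF \<tau>, of 1] by (intro summable_mult) simp

lemma theta_tail_tendsto: "theta_tail \<longlonglongrightarrow> 0"
  unfolding theta_tail_def[abs_def] by (rule suminf_exist_split2[OF summable_pole_sq])

text \<open>Strict positivity allows the reciprocal of sqrt (\<open>theta_tail m\<close>) as the
  parameter \<epsilon> of \<open>norm_ip_le\<close>.\<close>

lemma theta_tail_pos: "theta_tail m > 0"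
  unfolding theta_tail_def
proof (rule suminf_pos)
  show "summable (\<lambda>n. (pole \<tau> s (n + m))\<^sup>2 * nu \<tau> (n + m))"
    using summable_pole_sq by (rule summable_ignore_initial_segment)
  show "0 < (pole \<tau> s (n + m))\<^sup>2 * nu \<tau> (n + m)" for n
    unfolding pole_sq_nu using \<tau> by simp
qed

lemma theta_partial_fock: "(\<lambda>w. \<Sum>n\<in>I. of_real (pole \<tau> s n) * cheb n w) \<in> fock \<tau>"
  by (intro fock_sum fock_scale cheb_fock \<tau>)

lemma nsq_partial:
  assumes "finite I"
  shows "nsq \<tau> (\<lambda>w. \<Sum>n\<in>I. of_real (pole \<tau> s n) * cheb n w) = (\<Sum>n\<in>I. (pole \<tau> s n)\<^sup>2 * nu \<tau> n)"
proof -
  note c = cheb_fock(1)[OF \<tau>]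
  have "complex_of_real (nsq \<tau> (\<lambda>w. \<Sum>n\<in>I. of_real (pole \<tau> s n) * cheb n w))
      = (\<Sum>m\<in>I. \<Sum>n\<in>I. of_real (pole \<tau> s m) * (of_real (pole \<tau> s n) * ip \<tau> (cheb m) (cheb n)))"
    unfolding ip_self[symmetric]
    by (simp add: ip_sum_left ip_sum_right fock_scale fock_sum c ip_scale_left ip_scale_right sum_distrib_left)
  also have "\<dots> = (\<Sum>m\<in>I. of_real ((pole \<tau> s m)\<^sup>2 * nu \<tau> m))"
    using assms by (intro sum.cong refl)
      (simp add: ip_cheb_cheb[OF \<tau>] if_distrib[where f="\<lambda>x. _ * x"] sum.delta power2_eq_square mult.assoc cong: if_cong)
  finally show ?thesis
    unfolding of_real_sum[symmetric] of_real_eq_iff .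
qed

text \<open>Fatou's lemma: the blocks from m to M - 1 converge pointwise to the remainder, and by
  orthogonality their squared norms stay below \<open>theta_tail m\<close>. Square integrability of
  the remainder comes along.\<close>

lemma nn_integral_theta_tail:
  "(\<integral>\<^sup>+w. ennreal ((cmod (theta \<tau> s w - (\<Sum>n<m. of_real (pole \<tau> s n) * cheb n w)))\<^sup>2 * gauss \<tau> w) \<partial>lborel) \<le> ennreal (theta_tail m)"
proof -
  note [measurable] = entire_measurable[OF theta_holomorphic]
  define u where "u M w = ennreal ((cmod (\<Sum>n\<in>{m..<M}. of_real (pole \<tau> s n) * cheb n w))\<^sup>2 * gauss \<tau> w)" for M w
  have [measurable]: "u M \<in> borel_measurable borel" for M
    unfolding u_def by measurable
  have "(\<integral>\<^sup>+w. ennreal ((cmod (theta \<tau> s w - (\<Sum>n<m. of_real (pole \<tau> s n) * cheb n w)))\<^sup>2 * gauss \<tau> w) \<partial>lborel)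
      = (\<integral>\<^sup>+w. liminf (\<lambda>M. u M w) \<partial>lborel)"
  proof (rule nn_integral_cong)
    fix w
    have "(\<lambda>M. (\<Sum>n<M. of_real (pole \<tau> s n) * cheb n w) - (\<Sum>n<m. of_real (pole \<tau> s n) * cheb n w))
        \<longlonglongrightarrow> theta \<tau> s w - (\<Sum>n<m. of_real (pole \<tau> s n) * cheb n w)"
      by (intro tendsto_intros theta_limit)
    moreover have "\<forall>\<^sub>F M in sequentially. (\<Sum>n<M. of_real (pole \<tau> s n) * cheb n w) - (\<Sum>n<m. of_real (pole \<tau> s n) * cheb n w)
        = (\<Sum>n\<in>{m..<M}. of_real (pole \<tau> s n) * cheb n w)"
      using eventually_ge_at_top[of m] by eventually_elim (simp add: lessThan_atLeast0 sum_diff_nat_ivl)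
    ultimately have "(\<lambda>M. \<Sum>n\<in>{m..<M}. of_real (pole \<tau> s n) * cheb n w)
        \<longlonglongrightarrow> theta \<tau> s w - (\<Sum>n<m. of_real (pole \<tau> s n) * cheb n w)"
      by (rule Lim_transform_eventually)
    then have "(\<lambda>M. u M w) \<longlonglongrightarrow> ennreal ((cmod (theta \<tau> s w - (\<Sum>n<m. of_real (pole \<tau> s n) * cheb n w)))\<^sup>2 * gauss \<tau> w)"
      unfolding u_def by (intro tendsto_intros tendsto_ennrealI)
    then show "ennreal ((cmod (theta \<tau> s w - (\<Sum>n<m. of_real (pole \<tau> s n) * cheb n w)))\<^sup>2 * gauss \<tau> w) = liminf (\<lambda>M. u M w)"
      by (simp add: lim_imp_Liminf)
  qed
  also have "\<dots> \<le> liminf (\<lambda>M. \<integral>\<^sup>+w. u M w \<partial>lborel)"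
    by (rule nn_integral_liminf) simp
  also have "\<dots> \<le> liminf (\<lambda>M::nat. ennreal (theta_tail m))"
  proof (intro Liminf_mono always_eventually allI)
    fix M
    have "(\<integral>\<^sup>+w. u M w \<partial>lborel) = ennreal (nsq \<tau> (\<lambda>w. \<Sum>n\<in>{m..<M}. of_real (pole \<tau> s n) * cheb n w))"
      unfolding u_def nsq_def using theta_partial_fock[of "{m..<M}"]
      by (intro nn_integral_eq_integral) (auto simp: fock_def less_imp_le[OF gauss_pos])
    also have "nsq \<tau> (\<lambda>w. \<Sum>n\<in>{m..<M}. of_real (pole \<tau> s n) * cheb n w) = (\<Sum>n\<in>{m..<M}. (pole \<tau> s n)\<^sup>2 * nu \<tau> n)"
      by (rule nsq_partial) simp
    also have "\<dots> = (\<Sum>n<M - m. (pole \<tau> s (n + m))\<^sup>2 * nu \<tau> (n + m))"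
      by (rule sum.reindex_bij_witness[where i="\<lambda>n. n + m" and j="\<lambda>n. n - m"]) auto
    also have "\<dots> \<le> theta_tail m"
      unfolding theta_tail_def
      by (rule sum_le_suminf[OF summable_ignore_initial_segment[OF summable_pole_sq]])
         (use nu_pos[OF \<tau>] in \<open>auto intro!: mult_nonneg_nonneg simp: less_imp_le\<close>)
    finally show "(\<integral>\<^sup>+w. u M w \<partial>lborel) \<le> ennreal (theta_tail m)"
      by (simp add: ennreal_leI)
  qed
  finally show ?thesis
    by (simp add: Liminf_const)
qed

lemma theta_diff_fock:
  "(\<lambda>w. theta \<tau> s w - (\<Sum>n<m. of_real (pole \<tau> s n) * cheb n w)) \<in> fock \<tau>"
  "nsq \<tau> (\<lambda>w. theta \<tau> s w - (\<Sum>n<m. of_real (pole \<tau> s n) * cheb n w)) \<le> theta_tail m"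
proof -
  note [measurable] = entire_measurable[OF theta_holomorphic]
  let ?h = "\<lambda>w. (cmod (theta \<tau> s w - (\<Sum>n<m. of_real (pole \<tau> s n) * cheb n w)))\<^sup>2 * gauss \<tau> w"
  have m: "?h \<in> borel_measurable lborel"
    by measurable
  have nn: "0 \<le> ?h w" for w
    by (simp add: less_imp_le[OF gauss_pos])
  have int: "integrable lborel ?h"
    using nn_integral_theta_tail[of m] m nn by (intro integrableI_nonneg) (auto intro: le_less_trans)
  then show "(\<lambda>w. theta \<tau> s w - (\<Sum>n<m. of_real (pole \<tau> s n) * cheb n w)) \<in> fock \<tau>"
    by (auto simp: fock_def intro!: holomorphic_intros theta_holomorphic cheb_holomorphic)
  have "ennreal (nsq \<tau> (\<lambda>w. theta \<tau> s w - (\<Sum>n<m. of_real (pole \<tau> s n) * cheb n w))) \<le> ennreal (theta_tail m)"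
    unfolding nsq_def using nn_integral_theta_tail[of m] nn by (subst nn_integral_eq_integral[OF int, symmetric]) auto
  then show "nsq \<tau> (\<lambda>w. theta \<tau> s w - (\<Sum>n<m. of_real (pole \<tau> s n) * cheb n w)) \<le> theta_tail m"
    using theta_tail_pos[of m] by (simp add: ennreal_le_iff)
qed

lemma theta_fock: "theta \<tau> s \<in> fock \<tau>"
  using theta_diff_fock(1)[of 0] by simp

text \<open>One double series summed in two orders. For fixed k the sum over n is the k-th Taylor
  term at 2 s; for fixed n the sum over k is a Chebyshev coefficient times \<open>cheb n\<close> at
  2 s. It converges absolutely because row k has absolute sum |taylor f k| 2^k by
  \<open>sum_ballot\<close>.\<close>

lemma cheb_coeff_value:
  assumes f: "f holomorphic_on UNIV"
  shows "(\<lambda>n. of_real (s ^ n * real (Suc n)) * cheb_coeff f n) sums f (2 * of_real s)"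
proof -
  define F where "F = (\<lambda>(k, n). taylor f k * of_real (ballot k n) * of_real (s ^ n * real (Suc n)))"
  have s2: "s = 1 \<or> s = - 1"
    using s by auto
  have ch: "cheb n (2 * of_real s) = of_real (s ^ n * real (Suc n))" for n
    using s2 cheb_2[of n] cheb_minus_2[of n] by auto
  have row: "((\<lambda>n. F (k, n)) has_sum taylor f k * (2 * of_real s) ^ k) UNIV" for k
  proof -
    have "((\<lambda>n. F (k, n)) has_sum (\<Sum>n\<le>k. F (k, n))) {..k}"
      by (rule has_sum_finite) simp
    moreover have "((\<lambda>n. F (k, n)) has_sum (\<Sum>n\<le>k. F (k, n))) UNIV \<longleftrightarrow> ((\<lambda>n. F (k, n)) has_sum (\<Sum>n\<le>k. F (k, n))) {..k}"
      by (rule has_sum_cong_neutral) (auto simp: F_def ballot_eq_0)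
    ultimately have "((\<lambda>n. F (k, n)) has_sum (\<Sum>n\<le>k. F (k, n))) UNIV"
      by simp
    also have "(\<Sum>n\<le>k. F (k, n)) = taylor f k * (2 * of_real s) ^ k"
      unfolding power_eq_sum_cheb ch F_def by (simp only: prod.case sum_distrib_left mult.assoc)
    finally show ?thesis .
  qed
  have nrow: "((\<lambda>n. norm (F (k, n))) has_sum cmod (taylor f k) * 2 ^ k) UNIV" for k
  proof -
    have "((\<lambda>n. norm (F (k, n))) has_sum (\<Sum>n\<le>k. norm (F (k, n)))) {..k}"
      by (rule has_sum_finite) simp
    moreover have "((\<lambda>n. norm (F (k, n))) has_sum (\<Sum>n\<le>k. norm (F (k, n)))) UNIV
        \<longleftrightarrow> ((\<lambda>n. norm (F (k, n))) has_sum (\<Sum>n\<le>k. norm (F (k, n)))) {..k}"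
      by (rule has_sum_cong_neutral) (auto simp: F_def ballot_eq_0)
    ultimately have "((\<lambda>n. norm (F (k, n))) has_sum (\<Sum>n\<le>k. norm (F (k, n)))) UNIV"
      by simp
    also have "(\<Sum>n\<le>k. norm (F (k, n))) = (\<Sum>n\<le>k. cmod (taylor f k) * (ballot k n * real (Suc n)))"
    proof (intro sum.cong refl)
      fix n
      have "\<bar>s ^ n\<bar> = 1"
        by (simp add: power_abs s)
      then show "norm (F (k, n)) = cmod (taylor f k) * (ballot k n * real (Suc n))"
        unfolding F_def prod.case norm_mult norm_of_real abs_mult using ballot_nonneg[of k n] by simp
    qed
    also have "\<dots> = cmod (taylor f k) * 2 ^ k"
      by (simp only: sum_distrib_left[symmetric] sum_ballot)
    finally show ?thesis .
  qed
  have "((\<lambda>k. cmod (taylor f k) * 2 ^ k) has_sum (\<Sum>k. cmod (taylor f k) * 2 ^ k)) UNIV"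
    using taylor_abs_summable[OF f, of 2] by (intro sums_nonneg_imp_has_sum) auto
  then have summ: "(\<lambda>k. cmod (taylor f k) * 2 ^ k) summable_on UNIV"
    by (rule has_sum_imp_summable)
  have abs: "(\<lambda>p. norm (F p)) summable_on UNIV \<times> UNIV"
  proof (rule Infinite_Sum.abs_summable_on_Sigma_iff[THEN iffD2], intro conjI ballI)
    show "(\<lambda>n. norm (F (k, n))) summable_on UNIV" for k
      using nrow[of k] has_sum_imp_summable by blast
    show "(\<lambda>k. norm (infsum (\<lambda>n. norm (F (k, n))) UNIV)) summable_on UNIV"
      using summ by (simp add: infsumI[OF nrow])
  qed
  then have summF: "F summable_on UNIV \<times> UNIV"
    by (rule Infinite_Sum.abs_summable_summable)
  have tot: "(F has_sum f (2 * of_real s)) (UNIV \<times> UNIV)"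
  proof -
    have "((\<lambda>k. taylor f k * (2 * of_real s) ^ k) has_sum f (2 * of_real s)) UNIV"
    proof (rule norm_summable_imp_has_sum)
      show "summable (\<lambda>k. norm (taylor f k * (2 * of_real s) ^ k))"
        using taylor_abs_summable[OF f, of 2] by (simp add: norm_mult norm_power s)
      show "(\<lambda>k. taylor f k * (2 * of_real s) ^ k) sums f (2 * of_real s)"
        by (rule taylor_sums[OF f])
    qed
    from has_sum_unique[OF this has_sum_SigmaD[OF has_sum_infsum[OF summF] row]]
    show ?thesis
      using has_sum_infsum[OF summF] by simp
  qed
  have col: "((\<lambda>k. F (k, n)) has_sum of_real (s ^ n * real (Suc n)) * cheb_coeff f n) UNIV" for n
  proof (rule norm_summable_imp_has_sum)
    show "(\<lambda>k. F (k, n)) sums (of_real (s ^ n * real (Suc n)) * cheb_coeff f n)"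
      using sums_mult2[OF cheb_coeff_sums[OF f, of n], of "of_real (s ^ n * real (Suc n))"]
      by (simp add: F_def mult_ac)
    have "summable (\<lambda>k. cmod (taylor f k) * 2 ^ k * real (Suc n))"
      using taylor_abs_summable[OF f, of 2] by (intro summable_mult2) simp
    then show "summable (\<lambda>k. norm (F (k, n)))"
    proof (rule summable_comparison_test'[where N=0])
      show "norm (norm (F (k, n))) \<le> cmod (taylor f k) * 2 ^ k * real (Suc n)" for k
        using ballot_nonneg[of k n] ballot_le[of k n] unfolding F_def prod.case norm_mult norm_of_real abs_mult
        by (simp add: power_abs s) (intro mult_mono mult_left_mono mult_nonneg_nonneg, auto)
    qed
  qed
  have "((\<lambda>(n, k). F (k, n)) has_sum f (2 * of_real s)) (UNIV \<times> UNIV)"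
    using tot by (subst (asm) has_sum_swap) (simp add: case_prod_unfold)
  from has_sum_SigmaD[OF this, of "\<lambda>n. of_real (s ^ n * real (Suc n)) * cheb_coeff f n"] col
  have "((\<lambda>n. of_real (s ^ n * real (Suc n)) * cheb_coeff f n) has_sum f (2 * of_real s)) UNIV"
    by simp
  then show ?thesis
    by (rule has_sum_imp_sums)
qed

text \<open>For partial sums of the kernel the inner products are partial sums of
  \<open>cheb_coeff_value\<close>, since \<open>pole\<close> times \<open>nu\<close> is a constant
  multiple of the value of \<open>cheb n\<close> at 2 s. For the remainder, \<epsilon> = 1 / sqrt
  (\<open>theta_tail m\<close>) makes both terms of \<open>norm_ip_le\<close> of order sqrt
  (\<open>theta_tail m\<close>).\<close>

lemma theta_reproducing:
  assumes f: "f \<in> fock \<tau>"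
  shows "ip \<tau> (theta \<tau> s) f = of_real (2 * pi * sqrt (pi * \<tau>)) * f (2 * of_real s)"
proof (rule LIMSEQ_unique)
  have hol: "f holomorphic_on UNIV"
    using f by (simp add: fock_def)
  let ?S = "\<lambda>m w. \<Sum>n<m. of_real (pole \<tau> s n) * cheb n w"
  have S: "?S m \<in> fock \<tau>" for m
    by (rule theta_partial_fock)
  have "ip \<tau> (?S m) f = of_real (2 * pi * sqrt (pi * \<tau>)) * (\<Sum>n<m. of_real (s ^ n * real (Suc n)) * cheb_coeff f n)" for m
  proof -
    have "ip \<tau> (?S m) f = (\<Sum>n<m. ip \<tau> (\<lambda>w. of_real (pole \<tau> s n) * cheb n w) f)"
      by (rule ip_sum_left) (intro fock_scale cheb_fock[OF \<tau>] f)+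
    also have "\<dots> = (\<Sum>n<m. of_real (pole \<tau> s n * nu \<tau> n) * cheb_coeff f n)"
      by (simp only: ip_scale_left ip_cheb[OF \<tau> f]) (simp add: mult_ac)
    finally show ?thesis
      unfolding pole_nu sum_distrib_left by (simp only: of_real_mult mult.assoc)
  qed
  then show "(\<lambda>m. ip \<tau> (?S m) f) \<longlonglongrightarrow> of_real (2 * pi * sqrt (pi * \<tau>)) * f (2 * of_real s)"
    using cheb_coeff_value[OF hol] by (simp only: sums_def) (intro tendsto_intros)
  have "(\<lambda>m. ip \<tau> (theta \<tau> s) f - ip \<tau> (?S m) f) \<longlonglongrightarrow> 0"
  proof (rule Lim_null_comparison)
    show "\<forall>\<^sub>F m in sequentially. norm (ip \<tau> (theta \<tau> s) f - ip \<tau> (?S m) f) \<le> sqrt (theta_tail m) * (1 + nsq \<tau> f) / 2"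
    proof (intro always_eventually allI)
      fix m
      define t where "t = sqrt (theta_tail m)"
      have t: "t > 0" "theta_tail m = t * t"
        using theta_tail_pos[of m] by (simp_all add: t_def)
      have "norm (ip \<tau> (theta \<tau> s) f - ip \<tau> (?S m) f) = cmod (ip \<tau> (\<lambda>w. theta \<tau> s w - ?S m w) f)"
        by (simp add: ip_diff_left theta_fock S f)
      also have "\<dots> \<le> (1 / t * nsq \<tau> (\<lambda>w. theta \<tau> s w - ?S m w) + nsq \<tau> f / (1 / t)) / 2"
        by (rule norm_ip_le[OF theta_diff_fock(1) f]) (use t in simp)
      also have "\<dots> \<le> (1 / t * theta_tail m + nsq \<tau> f / (1 / t)) / 2"
        using t theta_diff_fock(2)[of m] by (intro divide_right_mono add_right_mono mult_left_mono) auto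
      also have "\<dots> = t * (1 + nsq \<tau> f) / 2"
        using t by (simp add: field_simps)
      finally show "norm (ip \<tau> (theta \<tau> s) f - ip \<tau> (?S m) f) \<le> sqrt (theta_tail m) * (1 + nsq \<tau> f) / 2"
        by (simp add: t_def)
    qed
    have "(\<lambda>m. sqrt (theta_tail m) * (1 + nsq \<tau> f) / 2) \<longlonglongrightarrow> sqrt 0 * (1 + nsq \<tau> f) / 2"
      by (intro tendsto_intros theta_tail_tendsto) simp
    then show "(\<lambda>m. sqrt (theta_tail m) * (1 + nsq \<tau> f) / 2) \<longlonglongrightarrow> 0"
      by simp
  qed
  from tendsto_diff[OF tendsto_const[of "ip \<tau> (theta \<tau> s) f"] this]
  show "(\<lambda>m. ip \<tau> (?S m) f) \<longlonglongrightarrow> ip \<tau> (theta \<tau> s) f"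
    by simp
qed

text \<open>For \<tau> = hbar \<beta>^2 this is N^2. It yields both the norm of the kernel and its
  nonvanishing at the point.\<close>

lemma theta_value: "theta \<tau> s (2 * of_real s) = of_real (\<Sum>n. (real (Suc n))\<^sup>2 * exp (- \<tau> * (real (Suc n))\<^sup>2))"
proof -
  have s2: "s = 1 \<or> s = - 1"
    using s by auto
  have "of_real (pole \<tau> s n) * cheb n (2 * of_real s) = complex_of_real ((real (Suc n))\<^sup>2 * exp (- \<tau> * (real (Suc n))\<^sup>2))" for n
  proof -
    have "cheb n (2 * of_real s) = of_real (s ^ n * real (Suc n))"
      using s2 cheb_2[of n] cheb_minus_2[of n] by auto
    moreover have "s ^ n * s ^ n = 1"
      using s2 by (metis power_mult_distrib mult_1 power_one mult_minus1 minus_minus)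
    moreover have "a * (b * e) * (a * b) = (a * a) * (b\<^sup>2 * e)" for a b e :: real
      by (simp only: power2_eq_square mult_ac)
    ultimately show ?thesis
      unfolding pole_def by (simp only: of_real_mult[symmetric] mult_1)
  qed
  moreover have "summable (\<lambda>n. (real (Suc n))\<^sup>2 * exp (- \<tau> * (real (Suc n))\<^sup>2))"
    using gaussian_summable[OF \<tau>, of 1] by simp
  ultimately show ?thesis
    unfolding theta_def by (simp only: suminf_of_real)
qed

end

section \<open>Class functions as functions of the trace\<close>

definition lift :: "(complex \<Rightarrow> complex) \<Rightarrow> complex^2^2 \<Rightarrow> complex" where
  "lift f = (\<lambda>g. if g \<in> SL2C then f (trace g) else 0)"

text \<open>A holomorphic section of the trace: the companion matrix of the characteristic
  polynomial \<zeta>^2 - w \<zeta> + 1.\<close>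

definition companion :: "complex \<Rightarrow> complex^2^2" where
  "companion w = vector [vector [0, - 1], vector [1, w]]"

lemma companion_SL2C: "companion w \<in> SL2C"
  by (simp add: companion_def SL2C_def det_2)

lemma trace_companion: "trace (companion w) = w"
  by (simp add: companion_def trace_def sum_2)

lemma lift_companion: "lift f (companion w) = f w"
  by (simp add: lift_def companion_SL2C trace_companion)

lemma SU2_inverse:
  assumes "k \<in> SU2"
  shows "matrix_inv k = cadjoint k" "k ** cadjoint k = mat 1" "cadjoint k ** k = mat 1"
proof -
  show 1: "cadjoint k ** k = mat 1"
    using assms by (simp add: SU2_def)
  then show 2: "k ** cadjoint k = mat 1"
    by (simp add: matrix_left_right_inverse)
  from 2 1 show "matrix_inv k = cadjoint k"
    by (rule matrix_inv_eqI)
qed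

lemma SU2_conjugate:
  assumes k: "k \<in> SU2" and g: "g \<in> SL2C"
  shows "k ** g ** matrix_inv k \<in> SL2C" "trace (k ** g ** matrix_inv k) = trace g"
proof -
  have "det k * det (cadjoint k) = 1"
    using SU2_inverse(2)[OF k] by (metis det_I det_mul)
  then show "k ** g ** matrix_inv k \<in> SL2C"
    using g by (simp add: SL2C_def det_mul SU2_inverse[OF k])
  have "trace (k ** g ** cadjoint k) = trace (cadjoint k ** (k ** g))"
    by (rule trace_mul_sym)
  then show "trace (k ** g ** matrix_inv k) = trace g"
    by (simp add: SU2_inverse[OF k] matrix_mul_assoc)
qed

lemma bounded_linear_trace: "bounded_linear (trace :: complex^2^2 \<Rightarrow> complex)"
  unfolding linear_conv_bounded_linear[symmetric]
  by (rule linearI) (auto simp: trace_def sum_2 algebra_simps)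

lemma lift_holomorphic:
  assumes "f holomorphic_on UNIV"
  shows "holomorphic_on_SL2C (lift f)"
  unfolding holomorphic_on_SL2C_def
proof (intro ballI exI conjI allI impI)
  fix A :: "complex^2^2"
  show "open (UNIV :: (complex^2^2) set)"
    by simp
  have "(f has_derivative (*) (deriv f (trace A))) (at (trace A))"
    using holomorphic_derivI[OF assms, of "trace A"] by (simp add: has_field_derivative_def)
  from has_derivative_compose[OF bounded_linear_imp_has_derivative[OF bounded_linear_trace] this]
  show "((\<lambda>A. f (trace A)) has_derivative (\<lambda>X. deriv f (trace A) * trace X)) (at A)" .
  show "deriv f (trace A) * trace (mat c ** X) = c * (deriv f (trace A) * trace X)" for c and X :: "complex^2^2"
    unfolding mat_mult_mat_left by (simp add: trace_def sum_2 algebra_simps)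
qed (auto simp: lift_def)

section \<open>Transfer of integrals from the group to the trace plane\<close>

lemma sets_liouville: "sets (liouville \<beta>) = sets (restrict_space borel SL2C)"
  and space_liouville: "space (liouville \<beta>) = SL2C"
  by (simp_all add: liouville_def space_restrict_space)

lemma measurable_liouville: "measurable (liouville \<beta>) M = measurable (restrict_space borel SL2C) M"
  by (rule measurable_cong_sets) (simp_all add: sets_liouville)

lemma trace_measurable_liouville: "trace \<in> borel_measurable (liouville \<beta>)"
  unfolding measurable_liouville by (intro measurable_restrict_space1 borel_measurable_trace)

lemma weight_measurable_liouville: "weight hbar \<beta> \<in> borel_measurable (liouville \<beta>)"
  unfolding measurable_liouville by (rule weight_measurable)

lemma weight_nonneg: "g \<in> SL2C \<Longrightarrow> 0 \<le> weight hbar \<beta> g"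
  by (simp add: weight_eq less_imp_le[OF sinhc_pos])

text \<open>An equality of measures, so that integrability and Bochner integrals of real and complex
  functions transfer together.\<close>

lemma distr_trace_liouville:
  assumes hbar: "hbar > 0" and \<beta>: "\<beta> > 0"
  shows "distr (density (liouville \<beta>) (\<lambda>g. ennreal (weight hbar \<beta> g))) borel trace
    = density lborel (\<lambda>w. ennreal (pi\<^sup>2 * hbar / \<beta> ^ 4 * gauss (hbar * \<beta>\<^sup>2) w))" (is "?L = ?R")
proof (rule measure_eqI)
  note [measurable] = trace_measurable_liouville weight_measurable_liouville
  fix A assume "A \<in> sets ?L"
  then have [measurable]: "A \<in> sets borel"
    by simp
  have "emeasure ?L A = (\<integral>\<^sup>+x. indicator A x \<partial>?L)"
    by (rule nn_integral_indicator[symmetric]) simp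
  also have "\<dots> = (\<integral>\<^sup>+g. indicator A (trace g) \<partial>density (liouville \<beta>) (\<lambda>g. ennreal (weight hbar \<beta> g)))"
    by (rule nn_integral_distr) (simp_all add: trace_measurable_liouville)
  also have "\<dots> = (\<integral>\<^sup>+g. ennreal (weight hbar \<beta> g) * indicator A (trace g) \<partial>liouville \<beta>)"
    by (rule nn_integral_density) measurable
  also have "\<dots> = (\<integral>\<^sup>+g. indicator A (trace g) * ennreal (weight hbar \<beta> g) \<partial>liouville \<beta>)"
    by (simp only: mult.commute)
  also have "\<dots> = ennreal (pi\<^sup>2 * hbar / \<beta> ^ 4) * (\<integral>\<^sup>+w. indicator A w * ennreal (gauss (hbar * \<beta>\<^sup>2) w) \<partial>lborel)"
    by (rule nn_integral_trace_liouville[OF _ hbar \<beta>]) measurable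
  also have "\<dots> = (\<integral>\<^sup>+w. ennreal (pi\<^sup>2 * hbar / \<beta> ^ 4) * (indicator A w * ennreal (gauss (hbar * \<beta>\<^sup>2) w)) \<partial>lborel)"
    by (rule nn_integral_cmult[symmetric]) measurable
  also have "\<dots> = (\<integral>\<^sup>+w. ennreal (pi\<^sup>2 * hbar / \<beta> ^ 4 * gauss (hbar * \<beta>\<^sup>2) w) * indicator A w \<partial>lborel)"
  proof (rule nn_integral_cong)
    fix w
    have "ennreal (pi\<^sup>2 * hbar / \<beta> ^ 4 * gauss (hbar * \<beta>\<^sup>2) w) = ennreal (pi\<^sup>2 * hbar / \<beta> ^ 4) * ennreal (gauss (hbar * \<beta>\<^sup>2) w)"
      by (rule ennreal_mult') (use hbar in simp)
    then show "ennreal (pi\<^sup>2 * hbar / \<beta> ^ 4) * (indicator A w * ennreal (gauss (hbar * \<beta>\<^sup>2) w))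
        = ennreal (pi\<^sup>2 * hbar / \<beta> ^ 4 * gauss (hbar * \<beta>\<^sup>2) w) * indicator A w"
      by (simp only: mult_ac)
  qed
  also have "\<dots> = emeasure ?R A"
    by (rule emeasure_density[symmetric]) measurable
  finally show "emeasure ?L A = emeasure ?R A" .
qed simp

lemma liouville_trace_integral:
  fixes H :: "complex \<Rightarrow> 'b::{banach, second_countable_topology}"
  assumes [measurable]: "H \<in> borel_measurable borel" and hbar: "hbar > 0" and \<beta>: "\<beta> > 0"
  shows "integrable (liouville \<beta>) (\<lambda>g. weight hbar \<beta> g *\<^sub>R H (trace g))
      \<longleftrightarrow> integrable lborel (\<lambda>w. gauss (hbar * \<beta>\<^sup>2) w *\<^sub>R H w)"
    and "(LINT g|liouville \<beta>. weight hbar \<beta> g *\<^sub>R H (trace g))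
      = (pi\<^sup>2 * hbar / \<beta> ^ 4) *\<^sub>R (LINT w|lborel. gauss (hbar * \<beta>\<^sup>2) w *\<^sub>R H w)"
proof -
  define c where "c = pi\<^sup>2 * hbar / \<beta> ^ 4"
  have c: "c > 0"
    using hbar \<beta> by (simp add: c_def)
  note D = distr_trace_liouville[OF hbar \<beta>, folded c_def]
  note [measurable] = trace_measurable_liouville weight_measurable_liouville
  have w0: "AE g in liouville \<beta>. 0 \<le> weight hbar \<beta> g"
    by (intro AE_I2) (simp add: space_liouville weight_nonneg)
  have g0: "AE w in lborel. 0 \<le> c * gauss (hbar * \<beta>\<^sup>2) w"
    using c by (intro AE_I2) (simp add: less_imp_le[OF gauss_pos])
  have Ht: "(\<lambda>g. H (trace g)) \<in> borel_measurable (liouville \<beta>)"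
    by measurable
  have "integrable (liouville \<beta>) (\<lambda>g. weight hbar \<beta> g *\<^sub>R H (trace g))
      \<longleftrightarrow> integrable (density (liouville \<beta>) (\<lambda>g. ennreal (weight hbar \<beta> g))) (\<lambda>g. H (trace g))"
    by (rule integrable_density[OF Ht _ w0, symmetric]) measurable
  also have "\<dots> \<longleftrightarrow> integrable (density lborel (\<lambda>w. ennreal (c * gauss (hbar * \<beta>\<^sup>2) w))) H"
    unfolding D[symmetric] by (rule integrable_distr_eq[symmetric]) (simp_all add: trace_measurable_liouville)
  also have "\<dots> \<longleftrightarrow> integrable lborel (\<lambda>w. (c * gauss (hbar * \<beta>\<^sup>2) w) *\<^sub>R H w)"
    by (rule integrable_density[OF _ _ g0]) measurable
  also have "\<dots> \<longleftrightarrow> integrable lborel (\<lambda>w. gauss (hbar * \<beta>\<^sup>2) w *\<^sub>R H w)" (is "?L \<longleftrightarrow> ?R")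
  proof
    show "?R" if "?L"
      using integrable_scaleR_right[OF that, of "1 / c"] c by simp
    show "?L" if "?R"
      using integrable_scaleR_right[OF that, of c] by simp
  qed
  finally show "integrable (liouville \<beta>) (\<lambda>g. weight hbar \<beta> g *\<^sub>R H (trace g))
      \<longleftrightarrow> integrable lborel (\<lambda>w. gauss (hbar * \<beta>\<^sup>2) w *\<^sub>R H w)" .
  have "(LINT g|liouville \<beta>. weight hbar \<beta> g *\<^sub>R H (trace g))
      = (LINT g|density (liouville \<beta>) (\<lambda>g. ennreal (weight hbar \<beta> g)). H (trace g))"
    by (rule integral_density[OF Ht _ w0, symmetric]) measurable
  also have "\<dots> = (LINT w|density lborel (\<lambda>w. ennreal (c * gauss (hbar * \<beta>\<^sup>2) w)). H w)"
    unfolding D[symmetric] by (rule integral_distr[symmetric]) (simp_all add: trace_measurable_liouville)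
  also have "\<dots> = (LINT w|lborel. (c * gauss (hbar * \<beta>\<^sup>2) w) *\<^sub>R H w)"
    by (rule integral_density[OF _ _ g0]) measurable
  also have "\<dots> = c *\<^sub>R (LINT w|lborel. gauss (hbar * \<beta>\<^sup>2) w *\<^sub>R H w)"
    by (simp flip: scaleR_scaleR)
  finally show "(LINT g|liouville \<beta>. weight hbar \<beta> g *\<^sub>R H (trace g))
      = (pi\<^sup>2 * hbar / \<beta> ^ 4) *\<^sub>R (LINT w|lborel. gauss (hbar * \<beta>\<^sup>2) w *\<^sub>R H w)"
    unfolding c_def .
qed

lemma lift_integrable_iff:
  assumes f: "f holomorphic_on UNIV" and hbar: "hbar > 0" and \<beta>: "\<beta> > 0"
  shows "integrable (liouville \<beta>) (\<lambda>g. (cmod (lift f g))\<^sup>2 * weight hbar \<beta> g) \<longleftrightarrow> f \<in> fock (hbar * \<beta>\<^sup>2)"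
proof -
  note [measurable] = entire_measurable[OF f]
  have "integrable (liouville \<beta>) (\<lambda>g. (cmod (lift f g))\<^sup>2 * weight hbar \<beta> g)
      \<longleftrightarrow> integrable (liouville \<beta>) (\<lambda>g. weight hbar \<beta> g *\<^sub>R (cmod (f (trace g)))\<^sup>2)"
    by (rule Bochner_Integration.integrable_cong) (simp_all add: space_liouville lift_def mult.commute)
  also have "\<dots> \<longleftrightarrow> integrable lborel (\<lambda>w. gauss (hbar * \<beta>\<^sup>2) w *\<^sub>R (cmod (f w))\<^sup>2)"
    by (rule liouville_trace_integral(1)[OF _ hbar \<beta>]) measurable
  finally show ?thesis
    using f by (simp add: fock_def mult.commute)
qed

lemma lift_HL2:
  assumes f: "f \<in> fock (hbar * \<beta>\<^sup>2)" and hbar: "hbar > 0" and \<beta>: "\<beta> > 0"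
  shows "lift f \<in> HL2 hbar \<beta>"
proof -
  have hol: "f holomorphic_on UNIV"
    using f by (simp add: fock_def)
  show ?thesis
    unfolding HL2_def using lift_holomorphic[OF hol] lift_integrable_iff[OF hol hbar \<beta>] f SU2_conjugate
    by (auto simp: lift_def)
qed

text \<open>The constant is pi^2 hbar / \<beta>^4 from the push-forward divided by the volume 2 pi^2
  / \<beta>^3.\<close>

lemma hinner_lift:
  assumes f: "f \<in> fock (hbar * \<beta>\<^sup>2)" and g: "g \<in> fock (hbar * \<beta>\<^sup>2)" and hbar: "hbar > 0" and \<beta>: "\<beta> > 0"
  shows "hinner hbar \<beta> (lift f) (lift g) = of_real (hbar / (2 * \<beta>)) * ip (hbar * \<beta>\<^sup>2) f g"
proof -
  note [measurable] = fock_measurable[OF f] fock_measurable[OF g]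
  have "(LINT x|liouville \<beta>. cnj (lift f x) * lift g x * of_real (weight hbar \<beta> x))
      = (LINT x|liouville \<beta>. weight hbar \<beta> x *\<^sub>R (cnj (f (trace x)) * g (trace x)))"
    by (rule Bochner_Integration.integral_cong) (simp_all add: space_liouville lift_def scaleR_conv_of_real mult.commute)
  also have "\<dots> = (pi\<^sup>2 * hbar / \<beta> ^ 4) *\<^sub>R (LINT w|lborel. gauss (hbar * \<beta>\<^sup>2) w *\<^sub>R (cnj (f w) * g w))"
    by (rule liouville_trace_integral(2)[OF _ hbar \<beta>]) measurable
  also have "(LINT w|lborel. gauss (hbar * \<beta>\<^sup>2) w *\<^sub>R (cnj (f w) * g w)) = ip (hbar * \<beta>\<^sup>2) f g"
    unfolding ip_def by (simp add: scaleR_conv_of_real mult.commute)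
  finally have "hinner hbar \<beta> (lift f) (lift g) = of_real (1 / (2 * pi\<^sup>2 / \<beta> ^ 3) * (pi\<^sup>2 * hbar / \<beta> ^ 4)) * ip (hbar * \<beta>\<^sup>2) f g"
    by (simp add: hinner_def vol_SU2_eq[OF \<beta>] scaleR_conv_of_real)
  also have "1 / (2 * pi\<^sup>2 / \<beta> ^ 3) * (pi\<^sup>2 * hbar / \<beta> ^ 4) = hbar / (2 * \<beta>)"
    using \<beta> by (simp add: field_simps eval_nat_numeral)
  finally show ?thesis .
qed

text \<open>A conjugation-invariant holomorphic function has vanishing derivative in the directions \<open>[X, g]\<close>
  with \<open>X\<close> in \<open>su2\<close>, hence, by complex linearity, with \<open>X\<close> in the complexification. So it
  is invariant under the complex one-parameter groups that bring \<open>g\<close> to companion form.\<close>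

lemma SU2_derivative_zero:
  assumes e: "e ** e = - mat 1" "e \<in> su2"
    and \<psi>: "\<And>k. k \<in> SU2 \<Longrightarrow> \<psi> (k ** g ** matrix_inv k) = \<psi> g" and g: "g \<in> SL2C"
    and V: "open V" "g \<in> V" "\<And>A. A \<in> V \<inter> SL2C \<Longrightarrow> \<psi> A = F A"
    and F: "(F has_derivative D) (at g)"
  shows "D (e ** g - g ** e) = 0"
proof -
  \<comment> \<open>This is exp (t e), because e^2 = -1.\<close>
  define k where "k t = cos t *\<^sub>R mat 1 + sin t *\<^sub>R e" for t
  have ce: "cadjoint e = - e"
    using e(2) by (simp add: su2_def)
  have H: "e ** e = mat (of_real (- 1))"
    using e(1) by (simp add: vec_eq_iff mat_def)
  have ck: "cadjoint (k t) = cos t *\<^sub>R mat 1 + (- sin t) *\<^sub>R e" for t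
    unfolding k_def cadjoint_linear ce by simp
  have "cos t * cos t + - sin t * sin t * (- 1) = 1" for t :: real
    by (metis mult.commute mult_minus1 mult_minus_left minus_minus power2_eq_square sin_cos_squared_add2)
  then have kk: "cadjoint (k t) ** k t = mat 1" for t
    unfolding ck unfolding k_def mat_linear_mult[OF H] by (simp add: algebra_simps)
  have det_k: "det (k t) = 1" for t
  proof -
    have "e$2$2 = - e$1$1"
      using e(2) by (simp add: su2_def trace_def sum_2 add_eq_0_iff)
    moreover have "e$1$1 * e$1$1 + e$1$2 * e$2$1 = - 1"
      using e(1) by (auto simp: vec_eq_iff forall_2 matrix_matrix_mult_def sum_2 mat_def)
    ultimately have de: "e$1$1 * e$2$2 - e$1$2 * e$2$1 = 1" "e$1$1 + e$2$2 = 0"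
      by algebra+
    have "det (k t) = (of_real (cos t))\<^sup>2 + of_real (cos t) * of_real (sin t) * (e$1$1 + e$2$2)
        + (of_real (sin t))\<^sup>2 * (e$1$1 * e$2$2 - e$1$2 * e$2$1)"
      by (simp add: k_def det_2 mat_def scaleR_conv_of_real[where 'a=complex] power2_eq_square algebra_simps)
    also have "\<dots> = of_real ((cos t)\<^sup>2 + (sin t)\<^sup>2)"
      unfolding de by (simp only: mult_zero_right mult_1_right add_0_right of_real_add of_real_power)
    also have "\<dots> = 1"
      by (simp only: sin_cos_squared_add2 of_real_1)
    finally show ?thesis .
  qed
  have kS: "k t \<in> SU2" for t
    using kk det_k by (simp add: SU2_def)
  define \<gamma> where "\<gamma> t = k t ** g ** cadjoint (k t)" for t
  have \<gamma>S: "\<gamma> t \<in> SL2C" and \<gamma>\<psi>: "\<psi> (\<gamma> t) = \<psi> g" for t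
    using SU2_conjugate(1)[OF kS g, of t] \<psi>[OF kS, of t] SU2_inverse(1)[OF kS, of t] by (simp_all add: \<gamma>_def)
  have \<gamma>0: "\<gamma> 0 = g"
    unfolding \<gamma>_def ck unfolding k_def by simp
  \<comment> \<open>The adjoint of k t is cos t - sin t e, so the derivative at 0 is the commutator
    of e and g.\<close>
  have \<gamma>_eq: "\<gamma> t = (cos t)\<^sup>2 *\<^sub>R g + (cos t * sin t) *\<^sub>R (e ** g - g ** e) - (sin t)\<^sup>2 *\<^sub>R (e ** g ** e)" for t
    unfolding \<gamma>_def ck unfolding k_def
    by (simp add: vec_eq_iff forall_2 matrix_matrix_mult_def sum_2 mat_def scaleR_conv_of_real[where 'a=complex]
        power2_eq_square algebra_simps)
  have "(\<gamma> has_vector_derivative (2 * cos 0 * - sin 0) *\<^sub>R g + (cos 0 * cos 0 + - sin 0 * sin 0) *\<^sub>R (e ** g - g ** e) - (2 * sin 0 * cos 0) *\<^sub>R (e ** g ** e)) (at (0::real))"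
    unfolding \<gamma>_eq[abs_def]
    by (auto intro!: derivative_eq_intros simp: has_real_derivative_iff_has_vector_derivative[symmetric])
  then have "(\<gamma> has_derivative (\<lambda>t. t *\<^sub>R (e ** g - g ** e))) (at 0)"
    by (simp add: has_vector_derivative_def)
  moreover have "(F has_derivative D) (at (\<gamma> 0))"
    using F by (simp add: \<gamma>0)
  ultimately have d: "((\<lambda>t. F (\<gamma> t)) has_derivative (\<lambda>t. D (t *\<^sub>R (e ** g - g ** e)))) (at 0)"
    by (rule has_derivative_compose)
  have "continuous (at 0) \<gamma>"
    using \<open>(\<gamma> has_derivative _) (at 0)\<close> by (rule has_derivative_continuous)
  then have "\<forall>\<^sub>F t in at 0. \<gamma> t \<in> V"
    using V(1,2) \<gamma>0 unfolding isCont_def by (auto elim: topological_tendstoD)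
  then have "\<forall>\<^sub>F t in at 0. F (\<gamma> t) = \<psi> g"
  proof eventually_elim
    case (elim t)
    then show ?case
      using V(3)[of "\<gamma> t"] \<gamma>S[of t] \<gamma>\<psi>[of t] by simp
  qed
  moreover have "F (\<gamma> 0) = \<psi> g"
    using V(2,3) \<gamma>0 g by auto
  ultimately have "((\<lambda>t. \<psi> g) has_derivative (\<lambda>t. D (t *\<^sub>R (e ** g - g ** e)))) (at 0)"
    using has_derivative_transform_eventually[OF d, of "\<lambda>t. \<psi> g"] by simp
  from has_derivative_unique[OF this has_derivative_const] have "(\<lambda>t. D (t *\<^sub>R (e ** g - g ** e))) = (\<lambda>t. 0)" .
  from fun_cong[OF this, of 1] show ?thesis
    by simp
qed

definition sl2_E :: "complex^2^2" where
  "sl2_E = vector [vector [0, 1], vector [0, 0]]"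

definition sl2_H :: "complex^2^2" where
  "sl2_H = vector [vector [1, 0], vector [0, - 1]]"

definition conj_invariant :: "(complex^2^2 \<Rightarrow> complex) \<Rightarrow> bool" where
  "conj_invariant \<psi> \<longleftrightarrow> holomorphic_on_SL2C \<psi> \<and> (\<forall>k\<in>SU2. \<forall>g\<in>SL2C. \<psi> (k ** g ** matrix_inv k) = \<psi> g)"

text \<open>Both directions lie in the complex span of \<open>su2\<close>: sl2_E = (e2 - i e3) / 2
  and sl2_H = - i e1. Complex linearity of D does the rest.\<close>

lemma SL2C_derivative_zero:
  assumes \<psi>: "conj_invariant \<psi>" and g: "g \<in> SL2C"
    and V: "open V" "g \<in> V" "\<And>A. A \<in> V \<inter> SL2C \<Longrightarrow> \<psi> A = F A"
    and F: "(F has_derivative D) (at g)" and lin: "\<And>c X. D (mat c ** X) = c * D X"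
  shows "D (sl2_E ** g - g ** sl2_E) = 0" "D (sl2_H ** g - g ** sl2_H) = 0"
proof -
  define e1 e2 e3 :: "complex^2^2" where "e1 = vector [vector [\<i>, 0], vector [0, - \<i>]]"
    and "e2 = vector [vector [0, 1], vector [- 1, 0]]" and "e3 = vector [vector [0, \<i>], vector [\<i>, 0]]"
  note defs = e1_def e2_def e3_def sl2_E_def sl2_H_def
  have sq: "e1 ** e1 = - mat 1" "e2 ** e2 = - mat 1" "e3 ** e3 = - mat 1"
    by (simp_all add: defs vec_eq_iff forall_2 matrix_matrix_mult_def sum_2 mat_def)
  have su: "e1 \<in> su2" "e2 \<in> su2" "e3 \<in> su2"
    by (simp_all add: defs su2_def vec_eq_iff forall_2 cadjoint_def trace_def sum_2)
  have inv: "\<And>k. k \<in> SU2 \<Longrightarrow> \<psi> (k ** g ** matrix_inv k) = \<psi> g"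
    using \<psi> g by (simp add: conj_invariant_def)
  note z = SU2_derivative_zero[OF _ _ inv g V F]
  have "linear D"
    using F by (rule has_derivative_linear)
  have "sl2_E ** g - g ** sl2_E = mat (1 / 2) ** ((e2 ** g - g ** e2) + mat (- \<i>) ** (e3 ** g - g ** e3))"
    unfolding mat_mult_mat_left by (simp add: defs vec_eq_iff forall_2 matrix_matrix_mult_def sum_2 algebra_simps)
  then show "D (sl2_E ** g - g ** sl2_E) = 0"
    by (simp only: lin linear_add[OF \<open>linear D\<close>] z[OF sq(2) su(2)] z[OF sq(3) su(3)]) simp
  have "sl2_H ** g - g ** sl2_H = mat (- \<i>) ** (e1 ** g - g ** e1)"
    unfolding mat_mult_mat_left by (simp add: defs vec_eq_iff forall_2 matrix_matrix_mult_def sum_2 algebra_simps)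
  then show "D (sl2_H ** g - g ** sl2_H) = 0"
    by (simp only: lin z[OF sq(1) su(1)]) simp
qed

text \<open>The curve moves by conjugation with exp (z X) for complex z. The chain rule gives \<psi>
  along the curve the complex derivative D [X, \<gamma> z] = 0, and the plane is connected.\<close>

lemma conj_invariant_flow:
  assumes \<psi>: "conj_invariant \<psi>" and \<gamma>: "\<And>z. \<gamma> z \<in> SL2C"
    and d: "\<And>z i j. ((\<lambda>z. \<gamma> z $ i $ j) has_field_derivative (X ** \<gamma> z - \<gamma> z ** X) $ i $ j) (at z)"
    and X: "X = sl2_E \<or> X = sl2_H"
  shows "\<psi> (\<gamma> z) = \<psi> (\<gamma> 0)"
proof -
  have g: "(\<gamma> has_derivative (\<lambda>h. mat h ** (X ** \<gamma> z - \<gamma> z ** X))) (at z)" for z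
  proof (rule has_derivative_matrix_2)
    fix i j
    have "(mat h ** (X ** \<gamma> z - \<gamma> z ** X)) $ i $ j = (X ** \<gamma> z - \<gamma> z ** X) $ i $ j * h" for h
      unfolding mat_mult_mat_left by simp
    then show "((\<lambda>z. \<gamma> z $ i $ j) has_derivative (\<lambda>h. (mat h ** (X ** \<gamma> z - \<gamma> z ** X)) $ i $ j)) (at z)"
      using d[of i j z] unfolding has_field_derivative_def by presburger
  qed
  have "((\<lambda>z. \<psi> (\<gamma> z)) has_field_derivative 0) (at z)" for z
  proof -
    obtain V F where V: "open V" "\<gamma> z \<in> V" "\<And>A. A \<in> V \<inter> SL2C \<Longrightarrow> \<psi> A = F A"
      and F: "\<And>A. A \<in> V \<Longrightarrow> \<exists>D. (F has_derivative D) (at A) \<and> (\<forall>c X. D (mat c ** X) = c * D X)"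
      using \<psi> \<gamma>[of z] unfolding conj_invariant_def holomorphic_on_SL2C_def by (metis (no_types, lifting))
    obtain D where D: "(F has_derivative D) (at (\<gamma> z))" "\<And>c X. D (mat c ** X) = c * D X"
      using F[OF V(2)] by blast
    have "D (X ** \<gamma> z - \<gamma> z ** X) = 0"
      using X SL2C_derivative_zero[OF \<psi> \<gamma> V D] by auto
    then have "((\<lambda>z. F (\<gamma> z)) has_derivative (\<lambda>h. 0)) (at z)"
      using has_derivative_compose[OF g D(1)] by (simp add: D(2))
    moreover have "open (\<gamma> -` V)"
    proof (rule open_vimage[OF V(1)])
      have "isCont \<gamma> z" for z
        using g by (rule has_derivative_continuous)
      then show "continuous_on UNIV \<gamma>"
        by (simp add: continuous_at_imp_continuous_on)
    qed
    ultimately have "((\<lambda>z. \<psi> (\<gamma> z)) has_derivative (\<lambda>h. 0)) (at z)"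
      by (rule has_derivative_transform_within_open[of _ _ _ _ "\<gamma> -` V"]) (use V \<gamma> in auto)
    then show ?thesis
      by (simp add: has_field_derivative_def fun_eq_iff[of "(*) 0"] mult_zero_left[abs_def])
  qed
  then have "\<exists>c. \<forall>z\<in>UNIV. \<psi> (\<gamma> z) = c"
    by (intro has_field_derivative_zero_constant) auto
  then show ?thesis
    by auto
qed

text \<open>Conjugation by exp (z E) adds z c to the upper left entry, so z = - a / c clears it.
  Conjugation by exp (z H) then multiplies c by exp (- 2 z), so z = Ln c / 2 makes it 1.\<close>

lemma conj_invariant_companion:
  assumes \<psi>: "conj_invariant \<psi>" and g: "g \<in> SL2C" and c: "g$2$1 \<noteq> 0"
  shows "\<psi> g = \<psi> (companion (trace g))"
proof -
  define a b c d where "a = g$1$1" and "b = g$1$2" and "c = g$2$1" and "d = g$2$2"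
  have c0: "c \<noteq> 0" and det: "a * d - b * c = 1"
    using c g by (simp_all add: a_def b_def c_def d_def SL2C_def det_2)
  have gv: "g = vector [vector [a, b], vector [c, d]]"
    by (simp add: a_def b_def c_def d_def vec_eq_iff forall_2)
  define U :: "complex \<Rightarrow> complex^2^2" where "U z = vector [vector [a + z * c, b + z * d - z * (a + z * c)], vector [c, d - z * c]]" for z
  have US: "U z \<in> SL2C" for z
  proof -
    have "(a + z * c) * (d - z * c) - (b + z * d - z * (a + z * c)) * c = a * d - b * c"
      by (simp add: algebra_simps)
    then show ?thesis
      using det by (simp add: U_def SL2C_def det_2)
  qed
  have 1: "\<psi> (U z) = \<psi> (U 0)" for z
  proof (rule conj_invariant_flow[where X=sl2_E, OF \<psi> US])
    fix z :: complex and i j :: 2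
    have comm: "sl2_E ** U z - U z ** sl2_E = vector [vector [c, d - a - 2 * z * c], vector [0, - c]]"
      by (simp add: sl2_E_def U_def vec_eq_iff forall_2 matrix_matrix_mult_def sum_2 algebra_simps)
    have "((\<lambda>z. a + z * c) has_field_derivative c) (at z)"
      "((\<lambda>z. b + z * d - z * (a + z * c)) has_field_derivative d - a - 2 * z * c) (at z)"
      "((\<lambda>z. d - z * c) has_field_derivative - c) (at z)"
      by (auto intro!: derivative_eq_intros simp: algebra_simps)
    then show "((\<lambda>z. U z $ i $ j) has_field_derivative (sl2_E ** U z - U z ** sl2_E) $ i $ j) (at z)"
      unfolding comm using exhaust_2[of i] exhaust_2[of j] by (auto simp: U_def)
  qed simp
  \<comment> \<open>Determinant 1 with vanishing upper left entry forces this upper right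
    entry.\<close>
  define b' where "b' = - 1 / c"
  define T :: "complex \<Rightarrow> complex^2^2" where "T z = vector [vector [0, exp (2 * z) * b'], vector [exp (- (2 * z)) * c, a + d]]" for z
  have TS: "T z \<in> SL2C" for z
    using c0 by (simp add: T_def SL2C_def det_2 b'_def exp_minus)
  have 2: "\<psi> (T z) = \<psi> (T 0)" for z
  proof (rule conj_invariant_flow[where X=sl2_H, OF \<psi> TS])
    fix z :: complex and i j :: 2
    have comm: "sl2_H ** T z - T z ** sl2_H = vector [vector [0, 2 * (exp (2 * z) * b')], vector [- 2 * (exp (- (2 * z)) * c), 0]]"
      by (simp add: sl2_H_def T_def vec_eq_iff forall_2 matrix_matrix_mult_def sum_2 algebra_simps)
    have "((\<lambda>z. exp (2 * z) * b') has_field_derivative 2 * (exp (2 * z) * b')) (at z)"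
      "((\<lambda>z. exp (- (2 * z)) * c) has_field_derivative - 2 * (exp (- (2 * z)) * c)) (at z)"
      by (auto intro!: derivative_eq_intros simp: algebra_simps)
    then show "((\<lambda>z. T z $ i $ j) has_field_derivative (sl2_H ** T z - T z ** sl2_H) $ i $ j) (at z)"
      unfolding comm using exhaust_2[of i] exhaust_2[of j] by (auto simp: T_def)
  qed simp
  have "U 0 = g"
    by (simp add: U_def gv)
  moreover have "U (- a / c) = T 0"
  proof -
    have "b + (- a / c) * d = b'"
      using c0 det by (simp add: b'_def field_simps)
    moreover have "a + (- a / c) * c = 0" "d - (- a / c) * c = a + d"
      using c0 by (simp_all add: field_simps)
    ultimately show ?thesis
      unfolding U_def T_def by (simp only: mult_zero_right minus_zero diff_zero exp_zero mult_1)
  qed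
  moreover have "T (Ln c / 2) = companion (trace g)"
    using c0 by (simp add: T_def companion_def b'_def exp_minus exp_Ln trace_def sum_2 a_def d_def)
  ultimately show ?thesis
    using 1[of "- a / c"] 2[of "Ln c / 2"] by simp
qed

text \<open>The candidate is \<psi> along \<open>companion\<close>, entire because the section is
  complex affine. It gives \<psi> wherever the lower left entry is nonzero, and the upper triangular
  matrices are limits of such matrices.\<close>

lemma HL2_imp_lift:
  assumes \<psi>: "\<psi> \<in> HL2 hbar \<beta>" and hbar: "hbar > 0" and \<beta>: "\<beta> > 0"
  obtains f where "f \<in> fock (hbar * \<beta>\<^sup>2)" "\<psi> = lift f"
proof -
  have inv: "conj_invariant \<psi>"
    using \<psi> by (simp add: HL2_def conj_invariant_def)
  define f where "f w = \<psi> (companion w)" for w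
  have loc: "\<exists>V F. open V \<and> g \<in> V \<and> (\<forall>A\<in>V \<inter> SL2C. \<psi> A = F A) \<and>
      (\<forall>A\<in>V. \<exists>D. (F has_derivative D) (at A) \<and> (\<forall>c X. D (mat c ** X) = c * D X))" if "g \<in> SL2C" for g
    using \<psi> that by (simp add: HL2_def holomorphic_on_SL2C_def)
  define N :: "complex^2^2" where "N = vector [vector [0, 0], vector [0, 1]]"
  have dc: "(companion has_derivative (\<lambda>h. mat h ** N)) (at w)" for w
  proof (rule has_derivative_matrix_2)
    fix i j :: 2
    show "((\<lambda>w. companion w $ i $ j) has_derivative (\<lambda>h. (mat h ** N) $ i $ j)) (at w)"
      using exhaust_2[of i] exhaust_2[of j] by (auto simp: companion_def N_def mat_mult_mat_left)
  qed
  then have cc: "continuous_on UNIV companion"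
    by (intro continuous_at_imp_continuous_on ballI has_derivative_continuous)
  have "f field_differentiable at w" for w
  proof -
    obtain V F where V: "open V" "companion w \<in> V" "\<And>A. A \<in> V \<inter> SL2C \<Longrightarrow> \<psi> A = F A"
      and F: "\<And>A. A \<in> V \<Longrightarrow> \<exists>D. (F has_derivative D) (at A) \<and> (\<forall>c X. D (mat c ** X) = c * D X)"
      using loc[OF companion_SL2C[of w]] by blast
    obtain D where D: "(F has_derivative D) (at (companion w))" "\<And>c X. D (mat c ** X) = c * D X"
      using F[OF V(2)] by blast
    have "((\<lambda>w. F (companion w)) has_derivative (\<lambda>h. D (mat h ** N))) (at w)"
      by (rule has_derivative_compose[OF dc D(1)])
    then have "(f has_derivative (\<lambda>h. D (mat h ** N))) (at w)"
    proof (rule has_derivative_transform_within_open)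
      show "open (companion -` V)"
        by (rule open_vimage[OF V(1) cc])
    qed (use V companion_SL2C in \<open>auto simp: f_def\<close>)
    then have "(f has_field_derivative D N) (at w)"
      by (simp add: has_field_derivative_def D(2) mult.commute[of _ "D N"])
    then show ?thesis
      by (auto simp: field_differentiable_def)
  qed
  then have hol: "f holomorphic_on UNIV"
    by (simp add: holomorphic_on_def)
  have eq: "\<psi> g = f (trace g)" if g: "g \<in> SL2C" for g
  proof (cases "g$2$1 = 0")
    case False
    then show ?thesis
      by (simp add: f_def conj_invariant_companion[OF inv g])
  next
    case True
    define a b d where "a = g$1$1" and "b = g$1$2" and "d = g$2$2"
    have gv: "g = vector [vector [a, b], vector [0, d]]"
      using True by (simp add: a_def b_def d_def vec_eq_iff forall_2)
    have det: "a * d = 1"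
      using g True by (simp add: SL2C_def det_2 a_def d_def)
    then have d0: "d \<noteq> 0"
      by auto
    \<comment> \<open>The product of g with the lower unipotent matrix with entry t; its lower left
      entry t d is nonzero for t \<noteq> 0.\<close>
    define G :: "real \<Rightarrow> complex^2^2" where "G t = vector [vector [a + of_real t * b, b], vector [of_real t * d, d]]" for t
    have GS: "G t \<in> SL2C" for t
      using det by (simp add: G_def SL2C_def det_2 algebra_simps)
    have "(G has_derivative (\<lambda>h. h *\<^sub>R vector [vector [b, 0], vector [d, 0]])) (at 0)"
    proof (rule has_derivative_matrix_2)
      fix i j :: 2
      have "((\<lambda>t. a + of_real t * b) has_derivative (\<lambda>h. h *\<^sub>R b)) (at 0)" "((\<lambda>t. of_real t * d) has_derivative (\<lambda>h. h *\<^sub>R d)) (at 0)"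
        by (auto intro!: derivative_eq_intros simp: scaleR_conv_of_real)
      then show "((\<lambda>t. G t $ i $ j) has_derivative (\<lambda>h. (h *\<^sub>R (vector [vector [b, 0], vector [d, 0]] :: complex^2^2)) $ i $ j)) (at 0)"
        using exhaust_2[of i] exhaust_2[of j] by (auto simp: G_def)
    qed
    then have "isCont G 0"
      by (rule has_derivative_continuous)
    moreover have G0: "G 0 = g"
      by (simp add: G_def gv)
    ultimately have Gt: "(G \<longlongrightarrow> g) (at 0)"
      by (simp add: isCont_def)
    obtain V F where V: "open V" "g \<in> V" "\<And>A. A \<in> V \<inter> SL2C \<Longrightarrow> \<psi> A = F A"
      and F: "\<And>A. A \<in> V \<Longrightarrow> \<exists>D. (F has_derivative D) (at A) \<and> (\<forall>c X. D (mat c ** X) = c * D X)"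
      using loc[OF g] by blast
    have "isCont F g"
      using F[OF V(2)] has_derivative_continuous by blast
    then have "((\<lambda>t. F (G t)) \<longlongrightarrow> F g) (at 0)"
      using Gt by (rule isCont_tendsto_compose)
    moreover have "\<forall>\<^sub>F t in at 0. F (G t) = f (trace (G t))"
    proof -
      have "\<forall>\<^sub>F t in at 0. G t \<in> V"
        using Gt V(1,2) by (rule topological_tendstoD)
      moreover have "\<forall>\<^sub>F t in at (0::real). t \<noteq> 0"
        by (rule eventually_neq_at_within)
      ultimately show ?thesis
      proof eventually_elim
        case (elim t)
        have "\<psi> (G t) = f (trace (G t))"
          unfolding f_def by (rule conj_invariant_companion[OF inv GS]) (use elim d0 in \<open>simp add: G_def\<close>)
        then show ?case
          using V(3)[of "G t"] elim GS by simp
      qed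
    qed
    ultimately have "((\<lambda>t. f (trace (G t))) \<longlongrightarrow> F g) (at 0)"
      by (rule Lim_transform_eventually)
    moreover have "((\<lambda>t. f (trace (G t))) \<longlongrightarrow> f (trace g)) (at 0)"
    proof (rule isCont_tendsto_compose[of "trace g" f])
      show "isCont f (trace g)"
        by (rule DERIV_isCont[OF holomorphic_derivI[OF hol open_UNIV UNIV_I]])
      show "((\<lambda>t. trace (G t)) \<longlongrightarrow> trace g) (at 0)"
        by (rule bounded_linear.tendsto[OF bounded_linear_trace Gt])
    qed
    ultimately have "F g = f (trace g)"
      by (rule tendsto_unique[rotated]) simp
    then show ?thesis
      using V g by auto
  qed
  have \<psi>f: "\<psi> = lift f"
    using eq \<psi> by (auto simp: lift_def HL2_def fun_eq_iff)
  have "integrable (liouville \<beta>) (\<lambda>g. (cmod (\<psi> g))\<^sup>2 * weight hbar \<beta> g)"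
    using \<psi> by (simp add: HL2_def)
  then have "f \<in> fock (hbar * \<beta>\<^sup>2)"
    unfolding \<psi>f lift_integrable_iff[OF hol hbar \<beta>] .
  then show ?thesis
    using \<psi>f by (rule that)
qed

section \<open>Norms and uniqueness of limits\<close>

lemma lift_add: "lift f + lift g = lift (\<lambda>w. f w + g w)"
  and lift_diff: "lift f - lift g = lift (\<lambda>w. f w - g w)"
  and lift_scale: "fscale c (lift f) = lift (\<lambda>w. c * f w)"
  by (simp_all add: lift_def fscale_def fun_eq_iff)

lemma lift_sum: "(\<Sum>n\<in>I. lift (f n)) = lift (\<lambda>w. \<Sum>n\<in>I. f n w)"
  by (induct I rule: infinite_finite_induct) (simp_all add: lift_add, simp_all add: lift_def fun_eq_iff)

lemma lift_center: "\<bar>s\<bar> = 1 \<Longrightarrow> lift f (s *\<^sub>R mat 1) = f (2 * of_real s)"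
  using abs_eq_iff'[of s 1]
  by (auto simp: lift_def SL2C_def det_2 trace_def sum_2 mat_def scaleR_conv_of_real[where 'a=complex])

lemma hnorm_lift:
  assumes f: "f \<in> fock (hbar * \<beta>\<^sup>2)" and hbar: "hbar > 0" and \<beta>: "\<beta> > 0"
  shows "hnorm hbar \<beta> (lift f) = sqrt (hbar / (2 * \<beta>) * nsq (hbar * \<beta>\<^sup>2) f)"
  unfolding hnorm_def hinner_lift[OF f f hbar \<beta>] ip_self of_real_mult[symmetric] Re_complex_of_real ..

lemma cnj_ip: "cnj (ip \<tau> f g) = ip \<tau> g f"
  unfolding ip_def by (subst Bochner_Integration.integral_cnj[symmetric]) (simp add: mult.commute mult.left_commute)

text \<open>The set where f does not vanish is open and null, hence empty.\<close>

lemma nsq_eq_0: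
  assumes f: "f \<in> fock \<tau>" and "nsq \<tau> f = 0"
  shows "f = (\<lambda>w. 0)"
proof (rule ccontr)
  assume "f \<noteq> (\<lambda>w. 0)"
  then obtain w where w: "f w \<noteq> 0"
    by (auto simp: fun_eq_iff)
  have hol: "f holomorphic_on UNIV" and int: "integrable lborel (\<lambda>w. (cmod (f w))\<^sup>2 * gauss \<tau> w)"
    using f by (simp_all add: fock_def)
  have "AE w in lborel. (cmod (f w))\<^sup>2 * gauss \<tau> w = 0"
    using assms(2) integral_nonneg_eq_0_iff_AE[OF int] gauss_pos[of \<tau>, THEN less_imp_le] by (simp add: nsq_def)
  then have ae: "AE w in lborel. w \<notin> f -` (- {0})"
  proof eventually_elim
    case (elim w)
    then show ?case
      using gauss_pos[of \<tau> w] by simp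
  qed
  have op: "open (f -` (- {0}))"
    by (rule open_vimage[OF _ holomorphic_on_imp_continuous_on[OF hol]]) (simp add: open_Compl)
  then have "f -` (- {0}) \<in> null_sets lborel"
    using ae op AE_iff_null_sets[of "f -` (- {0})" lborel] by simp
  then have "negligible (f -` (- {0}))"
    by (simp add: negligible_iff_null_sets null_sets_completionI)
  then show False
    using open_not_negligible[OF op] w by auto
qed

text \<open>A triangle inequality up to a factor, enough for the uniqueness of limits.\<close>

lemma nsq_diff_le:
  assumes f: "f \<in> fock \<tau>" and g: "g \<in> fock \<tau>"
  shows "nsq \<tau> (\<lambda>w. f w - g w) \<le> 2 * (nsq \<tau> f + nsq \<tau> g)"
proof -
  have i: "integrable lborel (\<lambda>w. (cmod (f w))\<^sup>2 * gauss \<tau> w)" "integrable lborel (\<lambda>w. (cmod (g w))\<^sup>2 * gauss \<tau> w)"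
    "integrable lborel (\<lambda>w. (cmod (f w - g w))\<^sup>2 * gauss \<tau> w)"
    using f g fock_diff[OF f g] by (simp_all add: fock_def)
  have le: "(cmod (f w - g w))\<^sup>2 * gauss \<tau> w \<le> 2 * ((cmod (f w))\<^sup>2 * gauss \<tau> w + (cmod (g w))\<^sup>2 * gauss \<tau> w)" for w
  proof -
    have "(cmod (f w - g w))\<^sup>2 \<le> (cmod (f w) + cmod (g w))\<^sup>2"
      by (intro power_mono norm_triangle_ineq4) simp
    also have "\<dots> \<le> 2 * ((cmod (f w))\<^sup>2 + (cmod (g w))\<^sup>2)"
      using zero_le_power2[of "cmod (f w) - cmod (g w)"] by (simp add: power2_eq_square algebra_simps)
    finally have "(cmod (f w - g w))\<^sup>2 * gauss \<tau> w \<le> (2 * ((cmod (f w))\<^sup>2 + (cmod (g w))\<^sup>2)) * gauss \<tau> w"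
      by (rule mult_right_mono) (simp add: less_imp_le[OF gauss_pos])
    then show ?thesis
      by (simp add: algebra_simps)
  qed
  have "nsq \<tau> (\<lambda>w. f w - g w) \<le> (LINT w|lborel. 2 * ((cmod (f w))\<^sup>2 * gauss \<tau> w + (cmod (g w))\<^sup>2 * gauss \<tau> w))"
    unfolding nsq_def by (rule integral_mono) (use i le in auto)
  also have "\<dots> = 2 * (nsq \<tau> f + nsq \<tau> g)"
    using i by (simp add: nsq_def)
  finally show ?thesis .
qed

text \<open>The sign s = 1 or s = -1 stands for the central element s 1, so that both strata are
  treated together.\<close>

definition signed_term :: "real \<Rightarrow> real \<Rightarrow> real \<Rightarrow> nat \<Rightarrow> complex^2^2 \<Rightarrow> complex" where
  "signed_term hbar \<beta> s n =
     fscale (complex_of_real (s ^ n * (real n + 1) * exp (- hbar * \<beta>\<^sup>2 * (real n + 1)\<^sup>2 / 2)))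
       (ket hbar \<beta> n)"

definition V_at :: "real \<Rightarrow> real \<Rightarrow> real \<Rightarrow> (complex^2^2 \<Rightarrow> complex) set" where
  "V_at hbar \<beta> s = {\<psi> \<in> HL2 hbar \<beta>. \<psi> (s *\<^sub>R mat 1) = 0}"

context
  fixes hbar \<beta> s N \<tau> :: real
  assumes hbar: "hbar > 0" and \<beta>: "\<beta> > 0" and s: "\<bar>s\<bar> = 1" and \<tau>_def: "\<tau> = hbar * \<beta>\<^sup>2"
begin

lemma tau_pos: "\<tau> > 0"
  using hbar \<beta> by (simp add: \<tau>_def)

text \<open>The factor of C_n^(-1/2) that does not depend on n.\<close>

definition ket_scale :: real where "ket_scale = (hbar * pi) powr (- 3 / 4)"

lemma ket_scale_pos: "ket_scale > 0"
  using hbar by (simp add: ket_scale_def)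

text \<open>Half of the exponent in \<open>pole\<close> comes from the coefficient of the series and
  half from the normalization of \<open>ket\<close>.\<close>

lemma signed_term_eq: "signed_term hbar \<beta> s n = lift (\<lambda>w. of_real ket_scale * (of_real (pole \<tau> s n) * cheb n w))"
proof -
  define x where "x = \<tau> * (real n + 1)\<^sup>2"
  have "C_norm hbar \<beta> n powr (- 1 / 2) = ((hbar * pi) powr (3 / 2)) powr (- 1 / 2) * exp x powr (- 1 / 2)"
    unfolding C_norm_def \<tau>_def x_def by (rule powr_mult)
  also have "\<dots> = ket_scale * exp (- x / 2)"
    by (simp add: ket_scale_def powr_powr powr_def)
  finally have C: "C_norm hbar \<beta> n powr (- 1 / 2) = ket_scale * exp (- x / 2)" .
  have "s ^ n * (real n + 1) * exp (- x / 2) * (ket_scale * exp (- x / 2)) = ket_scale * (s ^ n * (real n + 1) * (exp (- x / 2) * exp (- x / 2)))"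
    by simp
  also have "exp (- x / 2) * exp (- x / 2) = exp (- x)"
    by (simp flip: exp_add)
  also have "ket_scale * (s ^ n * (real n + 1) * exp (- x)) = ket_scale * pole \<tau> s n"
    by (simp add: pole_def x_def add.commute)
  finally have M: "s ^ n * (real n + 1) * exp (- x / 2) * (ket_scale * exp (- x / 2)) = ket_scale * pole \<tau> s n" .
  have "- hbar * \<beta>\<^sup>2 * (real n + 1)\<^sup>2 / 2 = - x / 2"
    by (simp add: x_def \<tau>_def)
  then have "s ^ n * (real n + 1) * exp (- hbar * \<beta>\<^sup>2 * (real n + 1)\<^sup>2 / 2) * C_norm hbar \<beta> n powr (- 1 / 2) = ket_scale * pole \<tau> s n"
    by (simp only: C M)
  then have "complex_of_real (s ^ n * (real n + 1) * exp (- hbar * \<beta>\<^sup>2 * (real n + 1)\<^sup>2 / 2)) * complex_of_real (C_norm hbar \<beta> n powr (- 1 / 2))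
      = of_real ket_scale * of_real (pole \<tau> s n)"
    by (metis of_real_mult)
  then show ?thesis
    unfolding signed_term_def ket_def by (simp only: fscale_def chi_eq lift_def fun_eq_iff mult.assoc[symmetric] if_distrib[where f="\<lambda>x. _ * x"] mult_zero_right) simp
qed

lemma scaled_theta_fock: "(\<lambda>w. c * theta \<tau> s w) \<in> fock \<tau>"
  by (rule fock_scale[OF theta_fock[OF tau_pos s]])

lemma signed_partial:
  "(\<Sum>n<m. signed_term hbar \<beta> s n) = lift (\<lambda>w. of_real ket_scale * (\<Sum>n<m. of_real (pole \<tau> s n) * cheb n w))"
  unfolding signed_term_eq lift_sum by (simp add: sum_distrib_left)

lemma nsq_scale: "nsq \<tau> (\<lambda>w. c * f w) = (cmod c)\<^sup>2 * nsq \<tau> f"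
  by (simp add: nsq_def norm_mult power_mult_distrib mult.assoc)

lemma signed_term_hsums: "hsums hbar \<beta> (signed_term hbar \<beta> s) (lift (\<lambda>w. of_real ket_scale * theta \<tau> s w))"
  unfolding hsums_def
proof (intro conjI allI)
  show "signed_term hbar \<beta> s n \<in> HL2 hbar \<beta>" for n
    unfolding signed_term_eq by (rule lift_HL2[OF _ hbar \<beta>], fold \<tau>_def) (intro fock_scale cheb_fock tau_pos)
  show "lift (\<lambda>w. of_real ket_scale * theta \<tau> s w) \<in> HL2 hbar \<beta>"
    by (rule lift_HL2[OF _ hbar \<beta>], fold \<tau>_def) (rule scaled_theta_fock)
  define d where "d m w = theta \<tau> s w - (\<Sum>n<m. of_real (pole \<tau> s n) * cheb n w)" for m w
  note D = theta_diff_fock[OF tau_pos s, folded d_def]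
  have "hnorm hbar \<beta> ((\<Sum>n<m. signed_term hbar \<beta> s n) - lift (\<lambda>w. of_real ket_scale * theta \<tau> s w))
      = sqrt (hbar / (2 * \<beta>) * (ket_scale\<^sup>2 * nsq \<tau> (d m)))" for m
  proof -
    have "(\<Sum>n<m. signed_term hbar \<beta> s n) - lift (\<lambda>w. of_real ket_scale * theta \<tau> s w) = lift (\<lambda>w. - of_real ket_scale * d m w)"
      unfolding signed_partial lift_diff by (simp add: d_def algebra_simps)
    moreover have "(\<lambda>w. - of_real ket_scale * d m w) \<in> fock (hbar * \<beta>\<^sup>2)"
      unfolding \<tau>_def[symmetric] by (rule fock_scale[OF D(1)])
    ultimately show ?thesis
      using hnorm_lift[OF _ hbar \<beta>] nsq_scale[of "- of_real ket_scale" "d m"] ket_scale_pos by (simp add: \<tau>_def)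
  qed
  moreover have "(\<lambda>m. nsq \<tau> (d m)) \<longlonglongrightarrow> 0"
    by (rule tendsto_sandwich[OF _ _ tendsto_const theta_tail_tendsto[OF tau_pos s]])
      (auto intro!: always_eventually nsq_nonneg D(2))
  then have "(\<lambda>m. sqrt (hbar / (2 * \<beta>) * (ket_scale\<^sup>2 * nsq \<tau> (d m)))) \<longlonglongrightarrow> sqrt (hbar / (2 * \<beta>) * (ket_scale\<^sup>2 * 0))"
    by (intro tendsto_intros)
  ultimately show "(\<lambda>m. hnorm hbar \<beta> ((\<Sum>n<m. signed_term hbar \<beta> s n) - lift (\<lambda>w. of_real ket_scale * theta \<tau> s w))) \<longlonglongrightarrow> 0"
    by simp
qed

lemma hsums_nsq_tendsto:
  assumes f: "f \<in> fock \<tau>" and sf: "hsums hbar \<beta> (signed_term hbar \<beta> s) (lift f)"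
  shows "(\<lambda>m. nsq \<tau> (\<lambda>w. of_real ket_scale * (\<Sum>n<m. of_real (pole \<tau> s n) * cheb n w) - f w)) \<longlonglongrightarrow> 0"
proof -
  define p where "p m w = of_real ket_scale * (\<Sum>n<m. of_real (pole \<tau> s n) * cheb n w)" for m w
  have pf: "(\<lambda>w. p m w - f w) \<in> fock \<tau>" for m
    unfolding p_def by (intro fock_diff fock_scale theta_partial_fock tau_pos s f)
  have "hnorm hbar \<beta> ((\<Sum>n<m. signed_term hbar \<beta> s n) - lift f) = sqrt (hbar / (2 * \<beta>) * nsq \<tau> (\<lambda>w. p m w - f w))" for m
    unfolding signed_partial lift_diff p_def[symmetric] using hnorm_lift[OF _ hbar \<beta>] pf by (simp add: \<tau>_def)
  then have "(\<lambda>m. sqrt (hbar / (2 * \<beta>) * nsq \<tau> (\<lambda>w. p m w - f w))) \<longlonglongrightarrow> 0"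
    using sf by (simp add: hsums_def)
  then have "(\<lambda>m. (2 * \<beta> / hbar) * (sqrt (hbar / (2 * \<beta>) * nsq \<tau> (\<lambda>w. p m w - f w)))\<^sup>2) \<longlonglongrightarrow> (2 * \<beta> / hbar) * 0\<^sup>2"
    by (intro tendsto_intros)
  moreover have "(2 * \<beta> / hbar) * (sqrt (hbar / (2 * \<beta>) * nsq \<tau> (\<lambda>w. p m w - f w)))\<^sup>2 = nsq \<tau> (\<lambda>w. p m w - f w)" for m
    using hbar \<beta> nsq_nonneg[of \<tau> "\<lambda>w. p m w - f w"] by simp
  ultimately show ?thesis
    by (simp add: p_def)
qed

text \<open>This makes the description in \<open>hsuminf\<close> denote. A competing limit is again
  a lift by \<open>HL2_imp_lift\<close>; two limits of the same partial sums are at distance zero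
  and agree by \<open>nsq_eq_0\<close>.\<close>

lemma signed_term_hsums_unique:
  assumes "hsums hbar \<beta> (signed_term hbar \<beta> s) \<psi>"
  shows "\<psi> = lift (\<lambda>w. of_real ket_scale * theta \<tau> s w)"
proof -
  obtain f where f: "f \<in> fock \<tau>" and \<psi>: "\<psi> = lift f"
    using HL2_imp_lift[OF _ hbar \<beta>] assms by (auto simp: hsums_def \<tau>_def)
  define g where "g w = of_real ket_scale * theta \<tau> s w" for w
  have g: "g \<in> fock \<tau>"
    unfolding g_def[abs_def] by (rule scaled_theta_fock)
  define p where "p m w = of_real ket_scale * (\<Sum>n<m. of_real (pole \<tau> s n) * cheb n w)" for m w
  have p: "p m \<in> fock \<tau>" for m
    unfolding p_def[abs_def] by (intro fock_scale theta_partial_fock tau_pos s)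
  have "nsq \<tau> (\<lambda>w. g w - f w) \<le> 2 * (nsq \<tau> (\<lambda>w. p m w - f w) + nsq \<tau> (\<lambda>w. p m w - g w))" for m
    using nsq_diff_le[OF fock_diff[OF p f] fock_diff[OF p g], of m m] by simp
  moreover have "(\<lambda>m. 2 * (nsq \<tau> (\<lambda>w. p m w - f w) + nsq \<tau> (\<lambda>w. p m w - g w))) \<longlonglongrightarrow> 2 * (0 + 0)"
    unfolding p_def by (intro tendsto_intros hsums_nsq_tendsto f g) (use assms \<psi> signed_term_hsums g_def in auto)
  ultimately have "nsq \<tau> (\<lambda>w. g w - f w) \<le> 2 * (0 + 0)"
    by (intro LIMSEQ_le_const) auto
  then have "nsq \<tau> (\<lambda>w. g w - f w) = 0"
    using nsq_nonneg[of \<tau> "\<lambda>w. g w - f w"] by simp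
  from nsq_eq_0[OF fock_diff[OF g f] this] have "f = g"
    by (simp add: fun_eq_iff)
  then show ?thesis
    using \<psi> by (simp only: g_def[abs_def])
qed

lemma hsuminf_signed_term: "hsuminf hbar \<beta> (signed_term hbar \<beta> s) = lift (\<lambda>w. of_real ket_scale * theta \<tau> s w)"
  unfolding hsuminf_def using signed_term_hsums signed_term_hsums_unique by (rule the_equality)

lemma orth_compl_V_at:
  assumes a: "a \<noteq> 0"
  shows "orth_compl hbar \<beta> (V_at hbar \<beta> s) = cfun.span {lift (\<lambda>w. a * theta \<tau> s w)}"
proof -
  note \<theta> = theta_fock[OF tau_pos s]
  define K where "K = 2 * pi * sqrt (pi * \<tau>)"
  have K: "K > 0"
    using tau_pos by (simp add: K_def)
  have repr: "ip \<tau> (theta \<tau> s) f = of_real K * f (2 * of_real s)" if "f \<in> fock \<tau>" for f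
    unfolding K_def by (rule theta_reproducing[OF tau_pos s that])
  have hi: "hinner hbar \<beta> (lift f) (lift g) = 0 \<longleftrightarrow> ip \<tau> f g = 0" if "f \<in> fock \<tau>" "g \<in> fock \<tau>" for f g
    using hinner_lift[OF _ _ hbar \<beta>, of f g] that hbar \<beta> by (simp add: \<tau>_def)
  have V: "V_at hbar \<beta> s = lift ` {f \<in> fock \<tau>. f (2 * of_real s) = 0}"
  proof (intro equalityI subsetI)
    fix \<psi> assume "\<psi> \<in> V_at hbar \<beta> s"
    then have "\<psi> \<in> HL2 hbar \<beta>" "\<psi> (s *\<^sub>R mat 1) = 0"
      by (simp_all add: V_at_def)
    moreover from this(1) obtain f where "f \<in> fock \<tau>" "\<psi> = lift f"
      using HL2_imp_lift[OF _ hbar \<beta>] by (auto simp: \<tau>_def)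
    ultimately show "\<psi> \<in> lift ` {f \<in> fock \<tau>. f (2 * of_real s) = 0}"
      by (auto simp: lift_center[OF s])
  qed (use lift_HL2[OF _ hbar \<beta>] in \<open>auto simp: V_at_def lift_center[OF s] \<tau>_def\<close>)
  have pos: "0 < (\<Sum>n. (real (Suc n))\<^sup>2 * exp (- \<tau> * (real (Suc n))\<^sup>2))"
    using gaussian_summable[OF tau_pos, of 1] by (intro suminf_pos) auto
  then have \<theta>0: "theta \<tau> s (2 * of_real s) \<noteq> 0"
    unfolding theta_value[OF tau_pos s] by (metis less_irrefl of_real_eq_0_iff)
  show ?thesis
  proof (intro equalityI subsetI)
    fix \<psi> assume "\<psi> \<in> orth_compl hbar \<beta> (V_at hbar \<beta> s)"
    then have H: "\<psi> \<in> HL2 hbar \<beta>" and orth: "\<And>\<phi>. \<phi> \<in> V_at hbar \<beta> s \<Longrightarrow> hinner hbar \<beta> \<phi> \<psi> = 0"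
      by (auto simp: orth_compl_def)
    obtain g where g: "g \<in> fock \<tau>" "\<psi> = lift g"
      using HL2_imp_lift[OF H hbar \<beta>] by (auto simp: \<tau>_def)
    \<comment> \<open>Chosen so that h vanishes at 2 s. Then h is orthogonal to g by assumption and
      to the kernel by the reproducing property, hence to itself.\<close>
    define c where "c = g (2 * of_real s) / theta \<tau> s (2 * of_real s)"
    define h where "h w = g w - c * theta \<tau> s w" for w
    have h: "h \<in> fock \<tau>" "h (2 * of_real s) = 0"
      unfolding h_def[abs_def] by (intro fock_diff fock_scale g \<theta>) (use \<theta>0 in \<open>simp add: c_def\<close>)
    have "ip \<tau> h g = 0"
      using orth[of "lift h"] h g by (auto simp: V hi)
    moreover have "ip \<tau> h (theta \<tau> s) = 0"
      using repr[OF h(1)] h(2) by (simp flip: cnj_ip[of \<tau> "theta \<tau> s"])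
    moreover have "ip \<tau> h g = ip \<tau> h h + c * ip \<tau> h (theta \<tau> s)"
    proof -
      have "ip \<tau> h (\<lambda>w. h w + c * theta \<tau> s w) = ip \<tau> h h + ip \<tau> h (\<lambda>w. c * theta \<tau> s w)"
        by (rule ip_add_right[OF h(1) h(1) fock_scale[OF \<theta>]])
      then show ?thesis
        by (simp add: ip_scale_right h_def[abs_def])
    qed
    ultimately have "nsq \<tau> h = 0"
      by (simp add: ip_self)
    from nsq_eq_0[OF h(1) this] have "h w = 0" for w
      by simp
    then have "g w = c * theta \<tau> s w" for w
      by (simp add: h_def)
    then have "g = (\<lambda>w. (c / a) * (a * theta \<tau> s w))"
      using a by (simp add: fun_eq_iff)
    then have "\<psi> = fscale (c / a) (lift (\<lambda>w. a * theta \<tau> s w))"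
      by (simp only: g lift_scale)
    then show "\<psi> \<in> cfun.span {lift (\<lambda>w. a * theta \<tau> s w)}"
      unfolding cfun.span_singleton by (rule range_eqI)
  next
    fix \<psi> assume "\<psi> \<in> cfun.span {lift (\<lambda>w. a * theta \<tau> s w)}"
    then obtain b where "\<psi> = fscale b (lift (\<lambda>w. a * theta \<tau> s w))"
      by (auto simp: cfun.span_singleton)
    then have \<psi>: "\<psi> = lift (\<lambda>w. (b * a) * theta \<tau> s w)"
      by (simp add: lift_scale mult.assoc)
    have "ip \<tau> f (\<lambda>w. (b * a) * theta \<tau> s w) = 0" if "f \<in> fock \<tau>" "f (2 * of_real s) = 0" for f
      unfolding ip_scale_right using repr[OF that(1)] that(2) by (simp flip: cnj_ip[of \<tau> "theta \<tau> s"])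
    then show "\<psi> \<in> orth_compl hbar \<beta> (V_at hbar \<beta> s)"
      unfolding orth_compl_def V \<psi> using hi scaled_theta_fock lift_HL2[OF _ hbar \<beta>] by (auto simp: \<tau>_def)
  qed
qed

lemma point_evaluation_complement:
  assumes N: "N\<^sup>2 = (\<Sum>n. (real (Suc n))\<^sup>2 * exp (- hbar * \<beta>\<^sup>2 * (real (Suc n))\<^sup>2))"
  defines "\<psi> \<equiv> fscale (complex_of_real (1 / N)) (hsuminf hbar \<beta> (signed_term hbar \<beta> s))"
  shows "summable (\<lambda>n. (real (Suc n))\<^sup>2 * exp (- hbar * \<beta>\<^sup>2 * (real (Suc n))\<^sup>2))" "N \<noteq> 0"
    "\<exists>!\<psi>. hsums hbar \<beta> (signed_term hbar \<beta> s) \<psi>"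
    "cfun.dim (orth_compl hbar \<beta> (V_at hbar \<beta> s)) = 1"
    "hnorm hbar \<beta> \<psi> = 1"
    "orth_compl hbar \<beta> (V_at hbar \<beta> s) = cfun.span {\<psi>}"
proof -
  have \<tau>': "- hbar * \<beta>\<^sup>2 = - \<tau>"
    by (simp add: \<tau>_def)
  show sm: "summable (\<lambda>n. (real (Suc n))\<^sup>2 * exp (- hbar * \<beta>\<^sup>2 * (real (Suc n))\<^sup>2))"
    unfolding \<tau>' using gaussian_summable[OF tau_pos, of 1] by simp
  have "0 < N\<^sup>2"
    unfolding N by (rule suminf_pos[OF sm]) simp
  then show N0: "N \<noteq> 0"
    by auto
  show "\<exists>!\<psi>. hsums hbar \<beta> (signed_term hbar \<beta> s) \<psi>"
    using signed_term_hsums signed_term_hsums_unique by blast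
  define a where "a = ket_scale / N"
  have a0: "complex_of_real a \<noteq> 0"
    using N0 ket_scale_pos by (simp add: a_def)
  have \<psi>: "\<psi> = lift (\<lambda>w. of_real a * theta \<tau> s w)"
    unfolding \<psi>_def hsuminf_signed_term lift_scale a_def by (simp)
  show span: "orth_compl hbar \<beta> (V_at hbar \<beta> s) = cfun.span {\<psi>}"
    unfolding \<psi> by (rule orth_compl_V_at[OF a0])
  \<comment> \<open>The reproducing property applied to the kernel itself: its squared norm is a
    constant times its value N^2 at the point.\<close>
  have "ip \<tau> (theta \<tau> s) (theta \<tau> s) = of_real (2 * pi * sqrt (pi * \<tau>) * N\<^sup>2)"
    unfolding theta_reproducing[OF tau_pos s theta_fock[OF tau_pos s]] theta_value[OF tau_pos s] N \<tau>' by simp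
  then have "nsq \<tau> (theta \<tau> s) = 2 * pi * sqrt (pi * \<tau>) * N\<^sup>2"
    unfolding ip_self of_real_eq_iff .
  then have "nsq \<tau> (\<lambda>w. of_real a * theta \<tau> s w) = ket_scale\<^sup>2 * (2 * pi * sqrt (pi * \<tau>))"
    unfolding nsq_scale norm_of_real using N0 by (simp add: a_def power_divide)
  \<comment> \<open>With x = hbar pi, \<open>ket_scale\<close> squared is x^(-3/2) and the other
    factors multiply to x^(3/2).\<close>
  moreover have "hbar / (2 * \<beta>) * (ket_scale\<^sup>2 * (2 * pi * sqrt (pi * \<tau>))) = 1"
  proof -
    define x where "x = hbar * pi"
    have x: "x > 0"
      using hbar by (simp add: x_def)
    have "sqrt (pi * \<tau>) = sqrt (x * \<beta>\<^sup>2)"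
      by (simp add: x_def \<tau>_def mult_ac)
    also have "\<dots> = \<beta> * x powr (1 / 2)"
      using \<beta> x by (simp add: real_sqrt_mult powr_half_sqrt)
    finally have "sqrt (pi * \<tau>) = \<beta> * x powr (1 / 2)" .
    moreover have "ket_scale\<^sup>2 = x powr (- 3 / 2)"
      by (simp add: ket_scale_def x_def power2_eq_square flip: powr_add)
    ultimately have "hbar / (2 * \<beta>) * (ket_scale\<^sup>2 * (2 * pi * sqrt (pi * \<tau>))) = x * (x powr (- 3 / 2) * x powr (1 / 2))"
      using \<beta> by (simp add: x_def)
    also have "x powr (- 3 / 2) * x powr (1 / 2) = x powr (- 1)"
      by (simp flip: powr_add)
    also have "x * \<dots> = 1"
      using x by (simp add: powr_minus_divide)
    finally show ?thesis .
  qed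
  ultimately show norm: "hnorm hbar \<beta> \<psi> = 1"
    unfolding \<psi> using hnorm_lift[OF _ hbar \<beta>, of "\<lambda>w. of_real a * theta \<tau> s w"] scaled_theta_fock by (simp add: \<tau>_def)
  have "\<psi> \<noteq> 0"
  proof
    assume "\<psi> = 0"
    then have "hnorm hbar \<beta> \<psi> = 0"
      by (simp add: hnorm_def hinner_def)
    then show False
      using norm by simp
  qed
  then have "cfun.independent {\<psi>}"
    by (simp add: cfun.dependent_single)
  then show "cfun.dim (orth_compl hbar \<beta> (V_at hbar \<beta> s)) = 1"
    unfolding span using cfun.dim_span_eq_card_independent[of "{\<psi>}"] by simp
qed

end

theorem theorem13p1:
  fixes hbar \<beta> N :: real
  assumes "hbar > 0" and "\<beta> > 0"
    and "N\<^sup>2 = (\<Sum>n. (real (Suc n))\<^sup>2 * exp (- hbar * \<beta>\<^sup>2 * (real (Suc n))\<^sup>2))"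
  shows "summable (\<lambda>n. (real (Suc n))\<^sup>2 * exp (- hbar * \<beta>\<^sup>2 * (real (Suc n))\<^sup>2)) \<and> N \<noteq> 0 \<and>
    (\<exists>!\<psi>. hsums hbar \<beta> (plus_term hbar \<beta>) \<psi>) \<and>
    (\<exists>!\<psi>. hsums hbar \<beta> (minus_term hbar \<beta>) \<psi>) \<and>
    cfun.dim (H_plus hbar \<beta>) = 1 \<and>
    cfun.dim (H_minus hbar \<beta>) = 1 \<and>
    hnorm hbar \<beta> (psi_plus hbar \<beta> N) = 1 \<and>
    hnorm hbar \<beta> (psi_minus hbar \<beta> N) = 1 \<and>
    H_plus hbar \<beta> = cfun.span {psi_plus hbar \<beta> N} \<and>
    H_minus hbar \<beta> = cfun.span {psi_minus hbar \<beta> N}"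
proof -
  have "plus_term hbar \<beta> = signed_term hbar \<beta> 1" "minus_term hbar \<beta> = signed_term hbar \<beta> (- 1)"
    by (simp_all add: fun_eq_iff plus_term_def minus_term_def signed_term_def)
  moreover have "V_plus hbar \<beta> = V_at hbar \<beta> 1" "V_minus hbar \<beta> = V_at hbar \<beta> (- 1)"
    by (simp_all add: V_plus_def V_minus_def V_at_def)
  ultimately show ?thesis
    unfolding H_plus_def H_minus_def psi_plus_def psi_minus_def
    using point_evaluation_complement[OF assms(1,2) _ refl assms(3), of 1] point_evaluation_complement[OF assms(1,2) _ refl assms(3), of "- 1"]
    by simp
qed

end
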